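(* (Explicit barrier) Assume that $f^y=0$ and $f^z\ne0$. There is no explicit four-stage method in the Runge--Kutta class defined in the context (i.e. $q=4$, $a_{jj}=0$ for $1\le j\le 4$, $b_5=0$) which is of order $4$, provided that $(\mathbf{Hr})_4$ and $(\mathbf{Ho})_4$ hold and that the $H$-coefficients are given by $H^i_j:=H^{\psi_j}_{t_{i,j},c_jh_i}$ and $H^i_{j,k}:=H^{\phi_j}_{t_{i,j},(c_j-c_k)h_i}$ with $\psi_j\in\mathcal B^3_{[0,1]}$, $\phi_j\in\mathcal B^2_{[0,1]}$, $2\le j\le5$.
   Context: Setting. Fix $T>0$, $d\ge1$, and a filtered probability space with a $d$-dimensional Brownian motion $W$; $\mathbb E_t[\cdot]=\mathbb E[\cdot\mid\mathcal F_t]$. $X_t=X_0+\int_0^tb(X_s)ds+\int_0^t\sigma(X_s)dW_s$ with $b:\mathbb R^d\to\mathbb R^d$, $\sigma:\mathbb R^d\to\mathbb R^{d\times d}$ Lipschitz; $g\in C^1_b(\mathbb R^d)$; $f=f(y,z):\mathbb R\times\mathbb R^d\to\mathbb R$ Lipschitz; $(Y,Z)$ ($Z$ a row vector) solves $Y_t=g(X_T)+\int_t^Tf(Y_s,Z_s)ds-\int_t^TZ_sdW_s$. $Y_t=u(t,X_t)$, $Z_t=\nabla u^\top(t,X_t)\sigma(X_t)$, where $u$ solves (P): $L^{(0)}u=-f(u,\nabla u^\top\sigma)$ on $[0,T)\times\mathbb R^d$, $u(T,\cdot)=g$. $f^y$, $f^{z^\ell}$, $f^z=(f^{z^\ell})_\ell$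 denote partial derivatives; $f^y=0$ means $f$ does not depend on $y$, $f^z\ne0$ means $f^z$ does not vanish identically. Partition $\pi=\{0=t_0<\dots<t_n=T\}$, $h_i=t_{i+1}-t_i$, $|\pi|=\max_ih_i$. Runge--Kutta class with $q$ stages. Terminal condition $(Y_n,Z_n)=(g(X_T),\nabla g^\top(X_T)\sigma(X_T))$. Given $0=c_1<c_2\le\dots\le c_q\le c_{q+1}=1$, set $t_{i,j}=t_{i+1}-c_jh_i$, $(Y_{i,1},Z_{i,1})=(Y_{i+1},Z_{i+1})$, $(Y_{i,q+1},Z_{i,q+1})=(Y_i,Z_i)$. For $1<j\le q$, $Y_{i,j}=\mathbb E_{t_{i,j}}[Y_{i+1}+h_i\sum_{k=1}^ja_{jk}f(Y_{i,k},Z_{i,k})]$, $Z_{i,j}=\mathbb E_{t_{i,j}}[H^i_jY_{i+1}+h_i\sum_{k=1}^{j-1}\alpha_{jk}H^i_{j,k}f(Y_{i,k},Z_{i,k})]$, and $Y_i=\mathbb E_{t_i}[Y_{i+1}+h_i\sum_{j=1}^{q+1}b_jf(Y_{i,j},Z_{i,j})]$, $Z_i=\mathbb E_{t_i}[H^i_{q+1}Y_{i+1}+h_i\sum_{j=1}^q\beta_jH^i_{q+1,j}f(Y_{i,j},Z_{i,j})]$. Coefficients are real, $a_{1j}=\alpha_{1j}=0$, $a_{jk}=\alpha_{jk}=0$ for $j<k$, and $\sum_{k=1}^ja_{jk}=\sum_{k=1}^{j-1}\alpha_{jk}\mathbf 1_{\{c_k<c_j\}}=c_j$ for $j\le q$.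 H-coefficients. $\mathcal B^m_{[0,1]}$ is the set of bounded measurable $\psi:[0,1]\to\mathbb R$ with $\int_0^1\psi(r)dr=1$ and, if $m\ge1$, $\int_0^1\psi(r)r^kdr=0$ for $1\le k\le m$. For $\psi=(\psi^\ell)_{1\le\ell\le d}$ with components in $\mathcal B^m_{[0,1]}$ (written $\psi\in\mathcal B^m_{[0,1]}$), $H^\psi_{t,h}=\big(\frac1h\int_t^{t+h}\psi^\ell(\frac{r-t}{h})dW^\ell_r\big)_{1\le\ell\le d}$ (row vector), and $H^\psi_{t,0}=0$. Operators and smoothness. $L^{(0)}=\partial_t+\sum_ib_i\partial_{x_i}+\frac12\sum_{i,j}(\sigma\sigma^\top)_{ij}\partial_{x_i}\partial_{x_j}$; $L^{(j)}=\sum_{k=1}^d\sigma^{kj}\partial_{x_k}$, $1\le j\le d$. For a multi-index $\alpha=(\alpha_1,\dots,\alpha_p)\in\{0,\dots,d\}^p$, of length $\ell(\alpha)=p$, $L^\alpha=L^{(\alpha_1)}\circ\dots\circ L^{(\alpha_p)}$ and $v^\alpha=L^\alpha v$. $\mathcal G^\alpha_b$ is the set of $v:[0,T]\times\mathbb R^d\to\mathbb R$ for which $L^\alpha v$ is well defined, continuous and bounded; $\mathcal G^n_b$ is the set of $v$ with $v\in\mathcal G^\alpha_b$ for all $\alpha$ with $1\le\ell(\alpha)\le n$ (functions of $x$ only are viewed as constant in time). $C^k_b$: $k$ times continuously differentiable functions with all partial derivatives bounded. $(\mathbf{Hr})_4$: $u\in\mathcal G^5_b$ and $f\in C^5_b$.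 $(\mathbf{Ho})_4$: there exists a function $g\in\mathcal G^4_b$ such that $\mathbb P(g^\alpha(X_T)\ne0)\ne0$ for $\alpha=(0)$, $(0,0)$, $(j_1,0)$, $(j_2,0,0)$ for some $(j_1,j_2)\in\{1,\dots,d\}^2$ ($g$ may be different for each $\alpha$). Moreover (with such a $g$, possibly depending on the $\nu$'s), for pairs $(\nu_1,\nu_3)\ne(0,0)$, $(\nu_2,\nu_4)\ne(0,0)$, $$\mathbb P\Big(\Big(\nu_1g^{(0,0,0)}+\nu_3\sum_{j=1}^d{}^jv_g\Big)(X_T)\ne0\Big)\ne0,\qquad \mathbb P\Big(\Big(\nu_2g^{(\ell,0,0,0)}+\nu_4f^{z^\ell}\sum_{j=1}^dg^{(j,0,0)}\Big)(X_T)\ne0\Big)\ne0\ \ (1\le\ell\le d),$$ and for any $(\nu_1,\nu_2,\nu_3,\nu_4)\ne(0,0,0,0)$, $$\mathbb P\Big(\Big(\nu_1g^{(0,0,0,0)}+\nu_2\sum_{j=1}^d{}^jv_g^{(0)}+\nu_3\sum_{j=1}^d{}^jw_g+\nu_4\sum_{\ell=1}^d\sum_{j=1}^df^{z^\ell}\,{}^jv_g^{(\ell)}\Big)(X_T)\ne0\Big)\ne0,$$ where ${}^jv_g=f^{z^j}g^{(j,0,0)}$, ${}^jw_g=f^{z^j}g^{(j,0,0,0)}$, and $f^{z^j}$ is evaluated at $(g,\nabla g^\top\sigma)$. Order. Let $(\hat Y_{t_i},\hat Z_{t_i})$ be the output of one transition of the scheme (including its intermediate stages) on $[t_i,t_{i+1}]$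 when $(Y_{i+1},Z_{i+1})$ is replaced by the exact values $(Y_{t_{i+1}},Z_{t_{i+1}})$, and $\mathcal T(\pi)=\sum_{i=0}^{n-1}h_i\big(h_i^{-2}\mathbb E[|Y_{t_i}-\hat Y_{t_i}|^2]+\mathbb E[|Z_{t_i}-\hat Z_{t_i}|^2]\big)$. A scheme is of order $m$ if $\mathcal T(\pi)\le C|\pi|^{2m}$ ($C$ independent of $\pi$) for all sufficiently smooth solutions $u$ to (P) and all partitions $\pi$ with sufficiently small mesh size; "sufficiently smooth" means that the regularity assumption $(\mathbf{Hr})_4$ holds. Being of order $m$ is thus a requirement over all problems (P) meeting that assumption and the restrictions on $f$ in the claim. *)

theory Defs
  imports "HOL-Probability.Probability"
begin

section \<open>Partial derivatives and the classes \<open>C\<^sup>k\<^sub>b\<close>\<close>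

definition has_partial :: "'a::real_normed_vector \<Rightarrow> ('a \<Rightarrow> real) \<Rightarrow> 'a \<Rightarrow> bool" where
  "has_partial e \<phi> x \<longleftrightarrow> (\<lambda>s. \<phi> (x + s *\<^sub>R e)) field_differentiable at 0"

definition partial_deriv :: "'a::real_normed_vector \<Rightarrow> ('a \<Rightarrow> real) \<Rightarrow> 'a \<Rightarrow> real" where
  "partial_deriv e \<phi> x = deriv (\<lambda>s. \<phi> (x + s *\<^sub>R e)) 0"

primrec partials :: "'a::real_normed_vector list \<Rightarrow> ('a \<Rightarrow> real) \<Rightarrow> 'a \<Rightarrow> real" where
  "partials [] \<phi> = \<phi>"
| "partials (e # es) \<phi> = partial_deriv e (partials es \<phi>)"

text \<open>The derivatives of orders 1 to \<open>k\<close> are bounded; the function itself need not be.\<close>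

definition Cb :: "nat \<Rightarrow> ('a::euclidean_space \<Rightarrow> real) \<Rightarrow> bool" where
  "Cb k \<phi> \<longleftrightarrow>
     (\<forall>es. set es \<subseteq> Basis \<and> length es \<le> k \<longrightarrow>
        continuous_on UNIV (partials es \<phi>) \<and>
        (length es < k \<longrightarrow> (\<forall>e\<in>Basis. \<forall>x. has_partial e (partials es \<phi>) x)) \<and>
        (es \<noteq> [] \<longrightarrow> bounded (range (partials es \<phi>))))"

definition grad :: "(real^'d \<Rightarrow> real) \<Rightarrow> real^'d \<Rightarrow> real^'d" where
  "grad \<phi> x = (\<chi> i. partial_deriv (axis i 1) \<phi> x)"

text \<open>\<open>f\<^sup>z\<close> component \<open>j\<close>, for a driver \<open>f (y, z)\<close>.\<close>

definition fz :: "'d \<Rightarrow> (real \<times> (real^'d) \<Rightarrow> real) \<Rightarrow> real \<times> (real^'d) \<Rightarrow> real" where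
  "fz j f = partial_deriv (0, axis j 1) f"

definition indep_of_y :: "(real \<times> (real^'d) \<Rightarrow> real) \<Rightarrow> bool" where
  "indep_of_y f \<longleftrightarrow> (\<forall>y y' z. f (y, z) = f (y', z))"

definition fz_nonzero :: "(real \<times> (real^'d) \<Rightarrow> real) \<Rightarrow> bool" where
  "fz_nonzero f \<longleftrightarrow> (\<exists>j p. fz j f p \<noteq> 0)"


section \<open>The operators \<open>L\<^sup>\<alpha>\<close> and the classes \<open>\<G>\<^sup>n\<^sub>b\<close>\<close>

text \<open>A multi-index over \<open>{0, \<dots>, d}\<close> is a list over \<open>'d option\<close>, where \<open>None\<close> stands for \<open>0\<close>.
  Time derivatives at \<open>0\<close> and \<open>T\<close> are one-sided.\<close>

definition dt :: "real \<Rightarrow> (real \<Rightarrow> 'a \<Rightarrow> real) \<Rightarrow> real \<Rightarrow> 'a \<Rightarrow> real" where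
  "dt T v t x = vector_derivative (\<lambda>s. v s x) (at t within {0..T})"

definition Lop :: "real \<Rightarrow> (real^'d \<Rightarrow> real^'d) \<Rightarrow> (real^'d \<Rightarrow> real^'d^'d) \<Rightarrow> 'd option
    \<Rightarrow> (real \<Rightarrow> real^'d \<Rightarrow> real) \<Rightarrow> real \<Rightarrow> real^'d \<Rightarrow> real" where
  "Lop T b \<sigma> m v t x = (case m of
      None \<Rightarrow> dt T v t x
        + (\<Sum>i\<in>UNIV. b x $ i * partial_deriv (axis i 1) (v t) x)
        + 1/2 * (\<Sum>i\<in>UNIV. \<Sum>j\<in>UNIV. (\<sigma> x ** transpose (\<sigma> x)) $ i $ j
                   * partial_deriv (axis i 1) (partial_deriv (axis j 1) (v t)) x)
    | Some j \<Rightarrow> (\<Sum>k\<in>UNIV. \<sigma> x $ k $ j * partial_deriv (axis k 1) (v t) x))"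

definition Lop_defined_at :: "real \<Rightarrow> 'd option \<Rightarrow> (real \<Rightarrow> real^'d \<Rightarrow> real) \<Rightarrow> real \<Rightarrow> real^'d \<Rightarrow> bool" where
  "Lop_defined_at T m v t x \<longleftrightarrow>
     (\<forall>i. has_partial (axis i 1) (v t) x) \<and>
     (m = None \<longrightarrow> (\<lambda>s. v s x) differentiable (at t within {0..T}) \<and>
        (\<forall>i j. has_partial (axis i 1) (partial_deriv (axis j 1) (v t)) x))"

primrec Lmulti :: "real \<Rightarrow> (real^'d \<Rightarrow> real^'d) \<Rightarrow> (real^'d \<Rightarrow> real^'d^'d) \<Rightarrow> 'd option list
    \<Rightarrow> (real \<Rightarrow> real^'d \<Rightarrow> real) \<Rightarrow> real \<Rightarrow> real^'d \<Rightarrow> real" where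
  "Lmulti T b \<sigma> [] v = v"
| "Lmulti T b \<sigma> (m # \<alpha>) v = Lop T b \<sigma> m (Lmulti T b \<sigma> \<alpha> v)"

primrec Lmulti_defined :: "real \<Rightarrow> (real^'d \<Rightarrow> real^'d) \<Rightarrow> (real^'d \<Rightarrow> real^'d^'d) \<Rightarrow> 'd option list
    \<Rightarrow> (real \<Rightarrow> real^'d \<Rightarrow> real) \<Rightarrow> bool" where
  "Lmulti_defined T b \<sigma> [] v \<longleftrightarrow> True"
| "Lmulti_defined T b \<sigma> (m # \<alpha>) v \<longleftrightarrow> Lmulti_defined T b \<sigma> \<alpha> v \<and>
     (\<forall>t\<in>{0..T}. \<forall>x. Lop_defined_at T m (Lmulti T b \<sigma> \<alpha> v) t x)"

definition Gb_index :: "real \<Rightarrow> (real^'d \<Rightarrow> real^'d) \<Rightarrow> (real^'d \<Rightarrow> real^'d^'d) \<Rightarrow> 'd option list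
    \<Rightarrow> (real \<Rightarrow> real^'d \<Rightarrow> real) set" where
  "Gb_index T b \<sigma> \<alpha> = {v. Lmulti_defined T b \<sigma> \<alpha> v \<and>
     continuous_on ({0..T} \<times> UNIV) (\<lambda>(t, x). Lmulti T b \<sigma> \<alpha> v t x) \<and>
     bounded ((\<lambda>(t, x). Lmulti T b \<sigma> \<alpha> v t x) ` ({0..T} \<times> UNIV))}"

definition Gb :: "real \<Rightarrow> (real^'d \<Rightarrow> real^'d) \<Rightarrow> (real^'d \<Rightarrow> real^'d^'d) \<Rightarrow> nat
    \<Rightarrow> (real \<Rightarrow> real^'d \<Rightarrow> real) set" where
  "Gb T b \<sigma> n = {v. \<forall>\<alpha>. 1 \<le> length \<alpha> \<and> length \<alpha> \<le> n \<longrightarrow> v \<in> Gb_index T b \<sigma> \<alpha>}"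


section \<open>Brownian motion and the Ito integral\<close>

definition brownian_motion :: "'w measure \<Rightarrow> (real \<Rightarrow> 'w measure) \<Rightarrow> real
    \<Rightarrow> (real \<Rightarrow> 'w \<Rightarrow> real^'d) \<Rightarrow> bool" where
  "brownian_motion M F T W \<longleftrightarrow>
     (\<forall>\<omega>\<in>space M. W 0 \<omega> = 0 \<and> continuous_on {0..T} (\<lambda>t. W t \<omega>)) \<and>
     (\<forall>t\<in>{0..T}. W t \<in> borel_measurable (F t)) \<and>
     (\<forall>s t. 0 \<le> s \<and> s < t \<and> t \<le> T \<longrightarrow>
        prob_space.indep_set M (sets (F s))
          {(\<lambda>\<omega>. W t \<omega> - W s \<omega>) -` A \<inter> space M | A. A \<in> sets borel} \<and>
        prob_space.indep_vars M (\<lambda>_. borel) (\<lambda>l \<omega>. (W t \<omega> - W s \<omega>) $ l) UNIV \<and>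
        (\<forall>l. distributed M lborel (\<lambda>\<omega>. (W t \<omega> - W s \<omega>) $ l) (normal_density 0 (sqrt (t - s)))))"

definition L2sq :: "'w measure \<Rightarrow> ('w \<Rightarrow> 'a::real_normed_vector) \<Rightarrow> ennreal" where
  "L2sq M V = (\<integral>\<^sup>+\<omega>. ennreal ((norm (V \<omega>))\<^sup>2) \<partial>M)"

definition simple_integrand :: "'w measure \<Rightarrow> (real \<Rightarrow> 'w measure) \<Rightarrow> real \<Rightarrow> real
    \<Rightarrow> nat \<Rightarrow> (nat \<Rightarrow> real) \<Rightarrow> (nat \<Rightarrow> 'w \<Rightarrow> real^'d) \<Rightarrow> bool" where
  "simple_integrand M F r1 r2 n s \<xi> \<longleftrightarrow>
     (\<forall>k\<le>n. r1 \<le> s k \<and> s k \<le> r2) \<and> (\<forall>k<n. s k \<le> s (Suc k)) \<and>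
     (\<forall>k<n. \<xi> k \<in> borel_measurable (F (s k)) \<and> bounded (\<xi> k ` space M))"

definition simple_process :: "nat \<Rightarrow> (nat \<Rightarrow> real) \<Rightarrow> (nat \<Rightarrow> 'w \<Rightarrow> real^'d)
    \<Rightarrow> real \<Rightarrow> 'w \<Rightarrow> real^'d" where
  "simple_process n s \<xi> r \<omega> = (\<Sum>k<n. indicator {s k<..s (Suc k)} r *\<^sub>R \<xi> k \<omega>)"

definition simple_ito :: "(real \<Rightarrow> 'w \<Rightarrow> real^'d) \<Rightarrow> nat \<Rightarrow> (nat \<Rightarrow> real)
    \<Rightarrow> (nat \<Rightarrow> 'w \<Rightarrow> real^'d) \<Rightarrow> 'w \<Rightarrow> real" where
  "simple_ito W n s \<xi> \<omega> = (\<Sum>k<n. \<xi> k \<omega> \<bullet> (W (s (Suc k)) \<omega> - W (s k) \<omega>))"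

text \<open>\<open>I\<close> is a version of \<open>\<integral> \<Phi>\<^sub>r dW\<^sub>r\<close> over \<open>[r1, r2]\<close>, for a row-vector integrand \<open>\<Phi>\<close>:
  the usual \<open>L\<^sup>2\<close> limit along simple adapted processes that converge to \<open>\<Phi>\<close> in \<open>L\<^sup>2(dr \<otimes> dP)\<close>.
  Square integrability of \<open>\<Phi>\<close> is part of the definition.\<close>

definition has_ito_integral :: "'w measure \<Rightarrow> (real \<Rightarrow> 'w measure) \<Rightarrow> (real \<Rightarrow> 'w \<Rightarrow> real^'d)
    \<Rightarrow> (real \<Rightarrow> 'w \<Rightarrow> real^'d) \<Rightarrow> real \<Rightarrow> real \<Rightarrow> ('w \<Rightarrow> real) \<Rightarrow> bool" where
  "has_ito_integral M F W \<Phi> r1 r2 I \<longleftrightarrow>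
     I \<in> borel_measurable M \<and>
     (\<lambda>(r, \<omega>). \<Phi> r \<omega>) \<in> borel_measurable (restrict_space borel {r1..r2} \<Otimes>\<^sub>M M) \<and>
     (\<exists>n s \<xi>. (\<forall>p::nat. simple_integrand M F r1 r2 (n p) (s p) (\<xi> p)) \<and>
        (\<lambda>p. \<integral>\<^sup>+\<omega>. (\<integral>\<^sup>+r\<in>{r1..r2}.
            ennreal ((norm (\<Phi> r \<omega> - simple_process (n p) (s p) (\<xi> p) r \<omega>))\<^sup>2) \<partial>lborel) \<partial>M)
          \<longlonglongrightarrow> 0 \<and>
        (\<lambda>p. L2sq M (\<lambda>\<omega>. I \<omega> - simple_ito W (n p) (s p) (\<xi> p) \<omega>)) \<longlonglongrightarrow> 0)"

definition ito_integral :: "'w measure \<Rightarrow> (real \<Rightarrow> 'w measure) \<Rightarrow> (real \<Rightarrow> 'w \<Rightarrow> real^'d)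
    \<Rightarrow> (real \<Rightarrow> 'w \<Rightarrow> real^'d) \<Rightarrow> real \<Rightarrow> real \<Rightarrow> 'w \<Rightarrow> real" where
  "ito_integral M F W \<Phi> r1 r2 = (SOME I. has_ito_integral M F W \<Phi> r1 r2 I)"


section \<open>The forward-backward system and the PDE\<close>

definition sde_solution :: "'w measure \<Rightarrow> (real \<Rightarrow> 'w measure) \<Rightarrow> (real \<Rightarrow> 'w \<Rightarrow> real^'d) \<Rightarrow> real
    \<Rightarrow> ('w \<Rightarrow> real^'d) \<Rightarrow> (real^'d \<Rightarrow> real^'d) \<Rightarrow> (real^'d \<Rightarrow> real^'d^'d)
    \<Rightarrow> (real \<Rightarrow> 'w \<Rightarrow> real^'d) \<Rightarrow> bool" where
  "sde_solution M F W T X0 b \<sigma> X \<longleftrightarrow>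
     (\<forall>\<omega>\<in>space M. continuous_on {0..T} (\<lambda>t. X t \<omega>)) \<and>
     (\<forall>t\<in>{0..T}. X t \<in> borel_measurable (F t)) \<and>
     (\<forall>t\<in>{0..T}. \<forall>k. has_ito_integral M F W (\<lambda>s \<omega>. row k (\<sigma> (X s \<omega>))) 0 t
        (\<lambda>\<omega>. X t \<omega> $ k - X0 \<omega> $ k - (LINT s:{0..t}|lborel. b (X s \<omega>) $ k)))"

definition bsde_solution :: "'w measure \<Rightarrow> (real \<Rightarrow> 'w measure) \<Rightarrow> (real \<Rightarrow> 'w \<Rightarrow> real^'d) \<Rightarrow> real
    \<Rightarrow> (real \<times> (real^'d) \<Rightarrow> real) \<Rightarrow> (real^'d \<Rightarrow> real) \<Rightarrow> (real \<Rightarrow> 'w \<Rightarrow> real^'d)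
    \<Rightarrow> (real \<Rightarrow> 'w \<Rightarrow> real) \<Rightarrow> (real \<Rightarrow> 'w \<Rightarrow> real^'d) \<Rightarrow> bool" where
  "bsde_solution M F W T f g X Y Z \<longleftrightarrow>
     (\<forall>\<omega>\<in>space M. continuous_on {0..T} (\<lambda>t. Y t \<omega>)) \<and>
     (\<forall>t\<in>{0..T}. Y t \<in> borel_measurable (F t) \<and> Z t \<in> borel_measurable (F t)) \<and>
     (AE \<omega> in M. set_integrable lborel {0..T} (\<lambda>s. f (Y s \<omega>, Z s \<omega>))) \<and>
     (\<forall>t\<in>{0..T}. has_ito_integral M F W Z t T
        (\<lambda>\<omega>. g (X T \<omega>) + (LINT s:{t..T}|lborel. f (Y s \<omega>, Z s \<omega>)) - Y t \<omega>))"

text \<open>Classical solutions of (P).\<close>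

definition solves_P :: "real \<Rightarrow> (real^'d \<Rightarrow> real^'d) \<Rightarrow> (real^'d \<Rightarrow> real^'d^'d)
    \<Rightarrow> (real \<times> (real^'d) \<Rightarrow> real) \<Rightarrow> (real^'d \<Rightarrow> real) \<Rightarrow> (real \<Rightarrow> real^'d \<Rightarrow> real) \<Rightarrow> bool" where
  "solves_P T b \<sigma> f g u \<longleftrightarrow>
     continuous_on ({0..T} \<times> UNIV) (\<lambda>(t, x). u t x) \<and>
     (\<forall>t\<in>{0..<T}. \<forall>x. Lop_defined_at T None u t x) \<and>
     continuous_on ({0..<T} \<times> UNIV) (\<lambda>(t, x). dt T u t x) \<and>
     (\<forall>i. continuous_on ({0..<T} \<times> UNIV) (\<lambda>(t, x). partial_deriv (axis i 1) (u t) x)) \<and>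
     (\<forall>i j. continuous_on ({0..<T} \<times> UNIV)
        (\<lambda>(t, x). partial_deriv (axis i 1) (partial_deriv (axis j 1) (u t)) x)) \<and>
     (\<forall>t\<in>{0..<T}. \<forall>x. Lop T b \<sigma> None u t x = - f (u t x, grad (u t) x v* \<sigma> x)) \<and>
     (\<forall>x. u T x = g x)"

definition fbsde_problem :: "'w measure \<Rightarrow> (real \<Rightarrow> 'w measure) \<Rightarrow> (real \<Rightarrow> 'w \<Rightarrow> real^'d) \<Rightarrow> real
    \<Rightarrow> ('w \<Rightarrow> real^'d) \<Rightarrow> (real^'d \<Rightarrow> real^'d) \<Rightarrow> (real^'d \<Rightarrow> real^'d^'d)
    \<Rightarrow> (real \<times> (real^'d) \<Rightarrow> real) \<Rightarrow> (real^'d \<Rightarrow> real) \<Rightarrow> (real \<Rightarrow> 'w \<Rightarrow> real^'d)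
    \<Rightarrow> (real \<Rightarrow> 'w \<Rightarrow> real) \<Rightarrow> (real \<Rightarrow> 'w \<Rightarrow> real^'d) \<Rightarrow> (real \<Rightarrow> real^'d \<Rightarrow> real) \<Rightarrow> bool" where
  "fbsde_problem M F W T X0 b \<sigma> f g X Y Z u \<longleftrightarrow>
     (\<exists>K. K-lipschitz_on UNIV b) \<and> (\<exists>K. K-lipschitz_on UNIV \<sigma>) \<and> (\<exists>K. K-lipschitz_on UNIV f) \<and>
     Cb 1 g \<and>
     sde_solution M F W T X0 b \<sigma> X \<and> bsde_solution M F W T f g X Y Z \<and> solves_P T b \<sigma> f g u \<and>
     (AE \<omega> in M. \<forall>t\<in>{0..T}. Y t \<omega> = u t (X t \<omega>) \<and>
                             Z t \<omega> = grad (u t) (X t \<omega>) v* \<sigma> (X t \<omega>))"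


section \<open>The assumptions \<open>(Hr)\<^sub>4\<close> and \<open>(Ho)\<^sub>4\<close>\<close>

definition Hr4 :: "real \<Rightarrow> (real^'d \<Rightarrow> real^'d) \<Rightarrow> (real^'d \<Rightarrow> real^'d^'d)
    \<Rightarrow> (real \<times> (real^'d) \<Rightarrow> real) \<Rightarrow> (real \<Rightarrow> real^'d \<Rightarrow> real) \<Rightarrow> bool" where
  "Hr4 T b \<sigma> f u \<longleftrightarrow> u \<in> Gb T b \<sigma> 5 \<and> Cb 5 f"

text \<open>\<open>fz_at\<close> is \<open>f\<^sup>z\<close> (component \<open>j\<close>) at \<open>(g, \<nabla>g\<^sup>T \<sigma>)\<close>; \<open>vg j\<close> and \<open>wg j\<close> are \<open>\<^sup>jv\<^sub>g\<close>
  and \<open>\<^sup>jw\<^sub>g\<close>. All are functions of \<open>(t, x)\<close> that are constant in time.\<close>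

definition fz_at :: "(real^'d \<Rightarrow> real^'d^'d) \<Rightarrow> (real \<times> (real^'d) \<Rightarrow> real) \<Rightarrow> (real^'d \<Rightarrow> real)
    \<Rightarrow> 'd \<Rightarrow> real^'d \<Rightarrow> real" where
  "fz_at \<sigma> f g j x = fz j f (g x, grad g x v* \<sigma> x)"

definition vg :: "real \<Rightarrow> (real^'d \<Rightarrow> real^'d) \<Rightarrow> (real^'d \<Rightarrow> real^'d^'d)
    \<Rightarrow> (real \<times> (real^'d) \<Rightarrow> real) \<Rightarrow> (real^'d \<Rightarrow> real) \<Rightarrow> 'd \<Rightarrow> real \<Rightarrow> real^'d \<Rightarrow> real" where
  "vg T b \<sigma> f g j t x = fz_at \<sigma> f g j x * Lmulti T b \<sigma> [Some j, None, None] (\<lambda>_. g) t x"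

definition wg :: "real \<Rightarrow> (real^'d \<Rightarrow> real^'d) \<Rightarrow> (real^'d \<Rightarrow> real^'d^'d)
    \<Rightarrow> (real \<times> (real^'d) \<Rightarrow> real) \<Rightarrow> (real^'d \<Rightarrow> real) \<Rightarrow> 'd \<Rightarrow> real \<Rightarrow> real^'d \<Rightarrow> real" where
  "wg T b \<sigma> f g j t x = fz_at \<sigma> f g j x * Lmulti T b \<sigma> [Some j, None, None, None] (\<lambda>_. g) t x"

definition nonvanishing :: "'w measure \<Rightarrow> ('w \<Rightarrow> real^'d) \<Rightarrow> (real^'d \<Rightarrow> real) \<Rightarrow> bool" where
  "nonvanishing M \<zeta> \<phi> \<longleftrightarrow> measure M {\<omega> \<in> space M. \<phi> (\<zeta> \<omega>) \<noteq> 0} \<noteq> 0"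

definition Ho4 :: "'w measure \<Rightarrow> real \<Rightarrow> (real^'d \<Rightarrow> real^'d) \<Rightarrow> (real^'d \<Rightarrow> real^'d^'d)
    \<Rightarrow> (real \<times> (real^'d) \<Rightarrow> real) \<Rightarrow> (real \<Rightarrow> 'w \<Rightarrow> real^'d) \<Rightarrow> bool" where
  "Ho4 M T b \<sigma> f X \<longleftrightarrow>
    (let G = {g. (\<lambda>_. g) \<in> Gb T b \<sigma> 4};
         D = (\<lambda>g \<alpha> x. Lmulti T b \<sigma> \<alpha> (\<lambda>_. g) T x)
     in
      (\<exists>g\<in>G. nonvanishing M (X T) (D g [None])) \<and>
      (\<exists>g\<in>G. nonvanishing M (X T) (D g [None, None])) \<and>
      (\<exists>j1 j2. (\<exists>g\<in>G. nonvanishing M (X T) (D g [Some j1, None])) \<and>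
               (\<exists>g\<in>G. nonvanishing M (X T) (D g [Some j2, None, None]))) \<and>
      (\<forall>\<nu>1 \<nu>3. (\<nu>1, \<nu>3) \<noteq> (0, 0) \<longrightarrow>
         (\<exists>g\<in>G. nonvanishing M (X T) (\<lambda>x.
            \<nu>1 * D g [None, None, None] x + \<nu>3 * (\<Sum>j\<in>UNIV. vg T b \<sigma> f g j T x)))) \<and>
      (\<forall>\<nu>2 \<nu>4. (\<nu>2, \<nu>4) \<noteq> (0, 0) \<longrightarrow>
         (\<exists>g\<in>G. \<forall>l. nonvanishing M (X T) (\<lambda>x.
            \<nu>2 * D g [Some l, None, None, None] x
            + \<nu>4 * fz_at \<sigma> f g l x * (\<Sum>j\<in>UNIV. D g [Some j, None, None] x)))) \<and>
      (\<forall>\<nu>1 \<nu>2 \<nu>3 \<nu>4. (\<nu>1, \<nu>2, \<nu>3, \<nu>4) \<noteq> (0, 0, 0, 0) \<longrightarrow>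
         (\<exists>g\<in>G. nonvanishing M (X T) (\<lambda>x.
            \<nu>1 * D g [None, None, None, None] x
            + \<nu>2 * (\<Sum>j\<in>UNIV. Lop T b \<sigma> None (vg T b \<sigma> f g j) T x)
            + \<nu>3 * (\<Sum>j\<in>UNIV. wg T b \<sigma> f g j T x)
            + \<nu>4 * (\<Sum>l\<in>UNIV. \<Sum>j\<in>UNIV. fz_at \<sigma> f g l x
                                * Lop T b \<sigma> (Some l) (vg T b \<sigma> f g j) T x)))))"


section \<open>The Runge--Kutta class\<close>

text \<open>\<open>moment_class m\<close> is \<open>\<B>\<^sup>m\<close> on \<open>[0, 1]\<close>; only values on \<open>[0, 1]\<close> matter.\<close>

definition moment_class :: "nat \<Rightarrow> (real \<Rightarrow> real) set" where
  "moment_class m = {\<psi>. \<psi> \<in> borel_measurable (restrict_space borel {0..1}) \<and>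
     bounded (\<psi> ` {0..1}) \<and>
     (LINT r:{0..1}|lborel. \<psi> r) = 1 \<and>
     (\<forall>k\<in>{1..m}. (LINT r:{0..1}|lborel. \<psi> r * r ^ k) = 0)}"

definition H_coeff :: "'w measure \<Rightarrow> (real \<Rightarrow> 'w measure) \<Rightarrow> (real \<Rightarrow> 'w \<Rightarrow> real^'d)
    \<Rightarrow> ('d \<Rightarrow> real \<Rightarrow> real) \<Rightarrow> real \<Rightarrow> real \<Rightarrow> 'w \<Rightarrow> real^'d" where
  "H_coeff M F W \<psi> t h \<omega> = (if h = 0 then 0 else
     (\<chi> l. 1 / h * ito_integral M F W (\<lambda>r _. axis l (\<psi> l ((r - t) / h))) t (t + h) \<omega>))"

record rk_coeffs =
  rk_c :: "nat \<Rightarrow> real"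
  rk_a :: "nat \<Rightarrow> nat \<Rightarrow> real"
  rk_alpha :: "nat \<Rightarrow> nat \<Rightarrow> real"
  rk_b :: "nat \<Rightarrow> real"
  rk_beta :: "nat \<Rightarrow> real"

definition rk_class :: "nat \<Rightarrow> rk_coeffs \<Rightarrow> bool" where
  "rk_class q S \<longleftrightarrow>
     rk_c S 1 = 0 \<and> rk_c S 1 < rk_c S 2 \<and> (\<forall>j\<in>{2..q}. rk_c S j \<le> rk_c S (j + 1)) \<and>
     rk_c S (q + 1) = 1 \<and>
     (\<forall>j\<in>{1..q}. rk_a S 1 j = 0 \<and> rk_alpha S 1 j = 0) \<and>
     (\<forall>j\<in>{1..q}. \<forall>k\<in>{1..q}. j < k \<longrightarrow> rk_a S j k = 0 \<and> rk_alpha S j k = 0) \<and>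
     (\<forall>j\<in>{1..q}. (\<Sum>k=1..j. rk_a S j k) = rk_c S j \<and>
        (\<Sum>k=1..<j. rk_alpha S j k * (if rk_c S k < rk_c S j then 1 else 0)) = rk_c S j)"

definition rk_explicit :: "nat \<Rightarrow> rk_coeffs \<Rightarrow> bool" where
  "rk_explicit q S \<longleftrightarrow> (\<forall>j\<in>{1..q}. rk_a S j j = 0) \<and> rk_b S (q + 1) = 0"

text \<open>One transition on \<open>[t0, t1]\<close> from \<open>(Y1, Z1)\<close> at time \<open>t1\<close>. The stages are
  \<open>(Ys j, Zs j)\<close> for \<open>1 \<le> j \<le> q + 1\<close>, and stage \<open>q + 1\<close> is the output at time \<open>t0\<close>.
  Stages are determined up to null sets only, and implicitly unless the scheme is explicit,
  hence a relation.\<close>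

definition rk_step :: "'w measure \<Rightarrow> (real \<Rightarrow> 'w measure) \<Rightarrow> (real \<Rightarrow> 'w \<Rightarrow> real^'d) \<Rightarrow> nat
    \<Rightarrow> rk_coeffs \<Rightarrow> (nat \<Rightarrow> 'd \<Rightarrow> real \<Rightarrow> real) \<Rightarrow> (nat \<Rightarrow> 'd \<Rightarrow> real \<Rightarrow> real)
    \<Rightarrow> (real \<times> (real^'d) \<Rightarrow> real) \<Rightarrow> real \<Rightarrow> real \<Rightarrow> ('w \<Rightarrow> real) \<Rightarrow> ('w \<Rightarrow> real^'d)
    \<Rightarrow> (nat \<Rightarrow> 'w \<Rightarrow> real) \<Rightarrow> (nat \<Rightarrow> 'w \<Rightarrow> real^'d) \<Rightarrow> bool" where
  "rk_step M F W q S \<psi> \<phi> f t0 t1 Y1 Z1 Ys Zs \<longleftrightarrow>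
    (let h = t1 - t0;
         \<tau> = (\<lambda>j. t1 - rk_c S j * h);
         H1 = (\<lambda>j. H_coeff M F W (\<psi> j) (\<tau> j) (rk_c S j * h));
         H2 = (\<lambda>j k. H_coeff M F W (\<phi> j) (\<tau> j) ((rk_c S j - rk_c S k) * h));
         fv = (\<lambda>k \<omega>. f (Ys k \<omega>, Zs k \<omega>))
     in
      Ys 1 = Y1 \<and> Zs 1 = Z1 \<and>
      (\<forall>j\<in>{2..q+1}. Ys j \<in> borel_measurable (F (\<tau> j)) \<and> Zs j \<in> borel_measurable (F (\<tau> j))) \<and>
      (\<forall>j\<in>{2..q}.
         (AE \<omega> in M. Ys j \<omega> = real_cond_exp M (F (\<tau> j))
            (\<lambda>\<omega>. Y1 \<omega> + h * (\<Sum>k=1..j. rk_a S j k * fv k \<omega>)) \<omega>) \<and>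
         (\<forall>l. AE \<omega> in M. Zs j \<omega> $ l = real_cond_exp M (F (\<tau> j))
            (\<lambda>\<omega>. H1 j \<omega> $ l * Y1 \<omega>
               + h * (\<Sum>k=1..<j. rk_alpha S j k * H2 j k \<omega> $ l * fv k \<omega>)) \<omega>)) \<and>
      (AE \<omega> in M. Ys (q+1) \<omega> = real_cond_exp M (F t0)
         (\<lambda>\<omega>. Y1 \<omega> + h * (\<Sum>j=1..q+1. rk_b S j * fv j \<omega>)) \<omega>) \<and>
      (\<forall>l. AE \<omega> in M. Zs (q+1) \<omega> $ l = real_cond_exp M (F t0)
         (\<lambda>\<omega>. H1 (q+1) \<omega> $ l * Y1 \<omega>
            + h * (\<Sum>j=1..q. rk_beta S j * H2 (q+1) j \<omega> $ l * fv j \<omega>)) \<omega>))"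


section \<open>Order\<close>

definition partition :: "real \<Rightarrow> nat \<Rightarrow> (nat \<Rightarrow> real) \<Rightarrow> bool" where
  "partition T n t \<longleftrightarrow> 1 \<le> n \<and> t 0 = 0 \<and> t n = T \<and> (\<forall>i<n. t i < t (Suc i))"

definition mesh :: "nat \<Rightarrow> (nat \<Rightarrow> real) \<Rightarrow> real" where
  "mesh n t = Max ((\<lambda>i. t (Suc i) - t i) ` {..<n})"

definition trunc_error :: "'w measure \<Rightarrow> nat \<Rightarrow> (nat \<Rightarrow> real) \<Rightarrow> (real \<Rightarrow> 'w \<Rightarrow> real)
    \<Rightarrow> (real \<Rightarrow> 'w \<Rightarrow> real^'d) \<Rightarrow> (nat \<Rightarrow> 'w \<Rightarrow> real) \<Rightarrow> (nat \<Rightarrow> 'w \<Rightarrow> real^'d) \<Rightarrow> ennreal" where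
  "trunc_error M n t Y Z Yhat Zhat =
     (\<Sum>i<n. ennreal (t (Suc i) - t i) *
        (ennreal (1 / (t (Suc i) - t i)\<^sup>2) * L2sq M (\<lambda>\<omega>. Y (t i) \<omega> - Yhat i \<omega>)
         + L2sq M (\<lambda>\<omega>. Z (t i) \<omega> - Zhat i \<omega>)))"

text \<open>The order of a scheme is relative to a class \<open>P\<close> of problems, which receives the data
  \<open>b\<close>, \<open>\<sigma>\<close>, \<open>f\<close>, the forward process and the solution \<open>u\<close> of (P). The constant and the
  threshold on the mesh may depend on the problem but not on the partition.\<close>

definition rk_order :: "'w measure \<Rightarrow> (real \<Rightarrow> 'w measure) \<Rightarrow> (real \<Rightarrow> 'w \<Rightarrow> real^'d) \<Rightarrow> real
    \<Rightarrow> ('w \<Rightarrow> real^'d)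
    \<Rightarrow> ((real^'d \<Rightarrow> real^'d) \<Rightarrow> (real^'d \<Rightarrow> real^'d^'d) \<Rightarrow> (real \<times> (real^'d) \<Rightarrow> real)
         \<Rightarrow> (real \<Rightarrow> 'w \<Rightarrow> real^'d) \<Rightarrow> (real \<Rightarrow> real^'d \<Rightarrow> real) \<Rightarrow> bool)
    \<Rightarrow> nat \<Rightarrow> nat \<Rightarrow> rk_coeffs \<Rightarrow> (nat \<Rightarrow> 'd \<Rightarrow> real \<Rightarrow> real) \<Rightarrow> (nat \<Rightarrow> 'd \<Rightarrow> real \<Rightarrow> real) \<Rightarrow> bool" where
  "rk_order M F W T X0 P m q S \<psi> \<phi> \<longleftrightarrow>
    (\<forall>b \<sigma> f g X Y Z u. fbsde_problem M F W T X0 b \<sigma> f g X Y Z u \<and> P b \<sigma> f X u \<longrightarrow>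
      (\<exists>C \<delta>. \<delta> > 0 \<and>
        (\<forall>n t Ys Zs. partition T n t \<and> mesh n t \<le> \<delta> \<and>
           (\<forall>i<n. rk_step M F W q S \<psi> \<phi> f (t i) (t (Suc i)) (Y (t (Suc i))) (Z (t (Suc i)))
                     (Ys i) (Zs i)) \<longrightarrow>
           trunc_error M n t Y Z (\<lambda>i. Ys i (q + 1)) (\<lambda>i. Zs i (q + 1))
             \<le> ennreal (C * mesh n t ^ (2 * m)))))"

end

theory Submission
  imports Defs "HOL-Computational_Algebra.Polynomial"
begin

text \<open>
  One problem (P) defeats every scheme: \<open>X = X\<^sub>0 + W\<close>, \<open>f (y, z) = - (\<Sum>l. cos z\<^sub>l) / 2\<close> and
  \<open>u (t, x) = G (\<Sum>l. x\<^sub>l)\<close>, where \<open>G' = gd\<close> is the Gudermannian function, so that \<open>cos (gd x) = sech x\<close>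
  and \<open>sin (gd x) = tanh x\<close>. With \<open>S\<close> the coordinate sum of \<open>X\<close> and \<open>\<eta> = d h\<close>, each conditional
  expectation in the scheme, with or without an \<open>H\<close>-weight, is a Gaussian average in one real variable,
  so the stages are explicit functions of \<open>S\<close> that can be expanded in powers of \<open>\<eta>\<close>.

  If the order were 4, the step that starts at \<open>T/2\<close> in a uniform partition would make the
  coefficient functions of the one-step errors up to \<open>\<eta>\<^sup>4\<close> for \<open>Y\<close> and \<open>\<eta>\<^sup>3\<close> for \<open>Z\<close> vanish, because the
  law of \<open>S\<close> at time \<open>T/2\<close> has full support. These functions have the form \<open>p (sech x) + tanh x * q (sech x)\<close>,
  and linear independence yields the order conditions. Those for \<open>Y\<close> are the conditions of a
  classical explicit four-stage method of order 4, which force \<open>c\<^sub>4 = 1\<close>. Then \<open>H\<close> with step 0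
  removes the fourth stage from \<open>Z\<close>, and three stages cannot satisfy the conditions for \<open>Z\<close>.
\<close>

section \<open>Gaussian averages\<close>

text \<open>The Gudermannian function is chosen because it solves y' = cos y: if every component of
  z is \<open>gd s\<close>, the driver equals -(d/2) G''(s). Hence a time-independent u solves (P),
  the exact Y and Z at the start of a step are G(S) and G'(S), and every coefficient in the
  expansion of a one-step output is directly an error term. The partial derivatives of the driver at
  the solution are tanh / 2; this factor turns derivatives of G into new polynomials in sech,
  independent enough for (Ho)_4 and for separating all order conditions at a given power of eta. The
  scale eta = d h arises since the generator acts on functions of S as (d/2) D^2. The step starts at
  T/2 and not at 0, because X0 may be deterministic. Two obstacles shape the development. The
  H-coefficients and the BSDE refer to Ito integrals defined by approximation and choice, so
  existence, isometry and Ito's formula have to be derived for the integrands at hand. And a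
  weighted average of an O(eta^r) error is only O(eta^(r - 1/2)), so remainders carry half-integer
  exponents; these still lie beyond the last power that matters.\<close>

abbreviation gauss :: "real measure" where "gauss \<equiv> std_normal_distribution"

text \<open>The semigroup generated by D^2 / 2, with \<open>a\<close> as time, which is also the
  variance of the Gaussian shift.\<close>

definition heat :: "real \<Rightarrow> (real \<Rightarrow> real) \<Rightarrow> real \<Rightarrow> real" where
  "heat a v x = (LINT y|gauss. v (x + sqrt a * y))"

text \<open>The derivative of \<open>heat a v\<close>, written so that it needs no derivative of \<open>v\<close>: this is what an
  \<open>H\<close>-coefficient produces. Division by 0 gives \<open>heatd 0 v = 0\<close>, in agreement with \<open>H\<close> at step 0.\<close>

definition heatd :: "real \<Rightarrow> (real \<Rightarrow> real) \<Rightarrow> real \<Rightarrow> real" where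
  "heatd a v x = (LINT y|gauss. y * v (x + sqrt a * y)) / sqrt a"

text \<open>Boundedness would be too narrow, as \<open>gdint\<close> grows linearly. The class is
  closed under \<open>heat\<close> and \<open>heatd\<close>, and integrals against Gaussian moments
  exist on it.\<close>

definition lin_growth :: "(real \<Rightarrow> real) \<Rightarrow> bool" where
  "lin_growth v \<longleftrightarrow> v \<in> borel_measurable borel \<and> (\<exists>C. \<forall>x. \<bar>v x\<bar> \<le> C * (1 + \<bar>x\<bar>))"

interpretation gauss: prob_space gauss
  by (rule prob_space_normal_density) simp

interpretation gauss2: pair_prob_space gauss gauss ..

lemma sets_gauss [measurable_cong, simp]: "sets gauss = sets borel"
  by simp

lemma space_gauss [simp]: "space gauss = UNIV" by simp

lemma lin_growth_measurable [measurable_dest]: "lin_growth v \<Longrightarrow> v \<in> borel_measurable borel"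
  by (simp add: lin_growth_def)

lemma lin_growthE:
  assumes "lin_growth v"
  obtains C where "C \<ge> 0" "\<And>x. \<bar>v x\<bar> \<le> C * (1 + \<bar>x\<bar>)"
proof -
  obtain C where C: "\<And>x. \<bar>v x\<bar> \<le> C * (1 + \<bar>x\<bar>)" using assms by (auto simp: lin_growth_def)
  have "C \<ge> 0" using C[of 0] by auto
  with C that show ?thesis by blast
qed

lemma bounded_lin_growth:
  assumes "v \<in> borel_measurable borel" "\<And>x. \<bar>v x\<bar> \<le> C"
  shows "lin_growth v"
proof -
  have "\<bar>v x\<bar> \<le> C * (1 + \<bar>x\<bar>)" for x
  proof -
    have "0 \<le> C" using assms(2)[of 0] by auto
    then have "C \<le> C * (1 + \<bar>x\<bar>)" by (simp add: distrib_left)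
    then show ?thesis using assms(2)[of x] by linarith
  qed
  with assms(1) show ?thesis unfolding lin_growth_def by blast
qed

lemma gauss_moment_abs: "integrable gauss (\<lambda>y. \<bar>y\<bar> ^ k)"
  using integrable_abs[OF integrable_std_normal_distribution_moment[of k]] by (simp add: power_abs)

lemma growth_integrable:
  assumes "lin_growth v"
  shows "integrable gauss (\<lambda>y. \<bar>y\<bar> ^ k * \<bar>v (x + s * y)\<bar>)"
    and "integrable gauss (\<lambda>y. y ^ k * v (x + s * y))"
proof -
  note [measurable] = lin_growth_measurable[OF assms]
  obtain C where C: "C \<ge> 0" "\<And>x. \<bar>v x\<bar> \<le> C * (1 + \<bar>x\<bar>)" using lin_growthE[OF assms] by blast
  show 1: "integrable gauss (\<lambda>y. \<bar>y\<bar> ^ k * \<bar>v (x + s * y)\<bar>)"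
  proof (rule Bochner_Integration.integrable_bound)
    show "integrable gauss (\<lambda>y. C * (1 + \<bar>x\<bar>) * \<bar>y\<bar> ^ k + C * \<bar>s\<bar> * \<bar>y\<bar> ^ Suc k)"
      by (intro Bochner_Integration.integrable_add integrable_mult_right gauss_moment_abs)
    show "(\<lambda>y. \<bar>y\<bar> ^ k * \<bar>v (x + s * y)\<bar>) \<in> borel_measurable gauss" by measurable
    show "AE y in gauss. norm (\<bar>y\<bar> ^ k * \<bar>v (x + s * y)\<bar>)
        \<le> norm (C * (1 + \<bar>x\<bar>) * \<bar>y\<bar> ^ k + C * \<bar>s\<bar> * \<bar>y\<bar> ^ Suc k)"
    proof (rule AE_I2)
      fix y
      have "\<bar>v (x + s * y)\<bar> \<le> C * (1 + \<bar>x + s * y\<bar>)" by (rule C)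
      also have "\<dots> \<le> C * (1 + (\<bar>x\<bar> + \<bar>s\<bar> * \<bar>y\<bar>))"
        using C(1) abs_triangle_ineq[of x "s * y"] by (intro mult_left_mono) (auto simp: abs_mult)
      finally have "\<bar>y\<bar> ^ k * \<bar>v (x + s * y)\<bar> \<le> \<bar>y\<bar> ^ k * (C * (1 + (\<bar>x\<bar> + \<bar>s\<bar> * \<bar>y\<bar>)))"
        by (intro mult_left_mono) auto
      also have "\<dots> = C * (1 + \<bar>x\<bar>) * \<bar>y\<bar> ^ k + C * \<bar>s\<bar> * \<bar>y\<bar> ^ Suc k" by (simp add: algebra_simps)
      finally show "norm (\<bar>y\<bar> ^ k * \<bar>v (x + s * y)\<bar>)
          \<le> norm (C * (1 + \<bar>x\<bar>) * \<bar>y\<bar> ^ k + C * \<bar>s\<bar> * \<bar>y\<bar> ^ Suc k)"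
        unfolding real_norm_def abs_mult abs_abs power_abs by linarith
    qed
  qed
  have 2: "(\<lambda>y. y ^ k * v (x + s * y)) \<in> borel_measurable gauss" by measurable
  show "integrable gauss (\<lambda>y. y ^ k * v (x + s * y))"
    using integrable_iff_bounded[of gauss "\<lambda>y. y ^ k * v (x + s * y)"] 1 2
    by (simp add: integrable_iff_bounded abs_mult power_abs)
qed

lemmas growth_integrable0 = growth_integrable(2)[where k=0, simplified]
lemmas growth_integrable1 = growth_integrable(2)[where k=1, simplified]

lemma heat_0 [simp]: "heat 0 v = v"
  using gauss.prob_space by (simp add: heat_def fun_eq_iff)

lemma heatd_0 [simp]: "heatd 0 v = (\<lambda>x. 0)"
  by (auto simp: heatd_def)

text \<open>One bound serves both averages, with k = 0 for \<open>heat\<close> and k = 1 for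
  \<open>heatd\<close>. The factor 1 + |x| stands apart so that the averages again have linear
  growth in x.\<close>

lemma gauss_moment_weight:
  assumes v: "lin_growth v"
  obtains C where "C \<ge> 0" "\<And>x s. \<bar>LINT y|gauss. y ^ k * v (x + s * y)\<bar> \<le> C * (1 + \<bar>s\<bar>) * (1 + \<bar>x\<bar>)"
proof -
  obtain C where C: "C \<ge> 0" "\<And>x. \<bar>v x\<bar> \<le> C * (1 + \<bar>x\<bar>)" using lin_growthE[OF v] by blast
  define m0 where "m0 = (LINT y|gauss. \<bar>y\<bar> ^ k)"
  define m1 where "m1 = (LINT y|gauss. \<bar>y\<bar> ^ Suc k)"
  have m: "m0 \<ge> 0" "m1 \<ge> 0" unfolding m0_def m1_def by (auto intro!: Bochner_Integration.integral_nonneg)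
  have "\<bar>LINT y|gauss. y ^ k * v (x + s * y)\<bar> \<le> (C * (m0 + m1)) * (1 + \<bar>s\<bar>) * (1 + \<bar>x\<bar>)" for x s
  proof -
    have "\<bar>LINT y|gauss. y ^ k * v (x + s * y)\<bar> \<le> (LINT y|gauss. \<bar>y ^ k * v (x + s * y)\<bar>)"
      by (rule integral_abs_bound)
    also have "\<dots> \<le> (LINT y|gauss. C * (1 + \<bar>x\<bar>) * \<bar>y\<bar> ^ k + C * \<bar>s\<bar> * \<bar>y\<bar> ^ Suc k)"
    proof (rule integral_mono)
      show "integrable gauss (\<lambda>y. \<bar>y ^ k * v (x + s * y)\<bar>)"
        using growth_integrable(1)[OF v] by (simp add: abs_mult power_abs)
      show "integrable gauss (\<lambda>y. C * (1 + \<bar>x\<bar>) * \<bar>y\<bar> ^ k + C * \<bar>s\<bar> * \<bar>y\<bar> ^ Suc k)"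
        by (intro Bochner_Integration.integrable_add integrable_mult_right gauss_moment_abs)
      fix y
      have "\<bar>v (x + s * y)\<bar> \<le> C * (1 + \<bar>x + s * y\<bar>)" by (rule C)
      also have "\<dots> \<le> C * (1 + (\<bar>x\<bar> + \<bar>s\<bar> * \<bar>y\<bar>))"
        using C(1) abs_triangle_ineq[of x "s * y"] by (intro mult_left_mono) (auto simp: abs_mult)
      finally have "\<bar>y\<bar> ^ k * \<bar>v (x + s * y)\<bar> \<le> \<bar>y\<bar> ^ k * (C * (1 + (\<bar>x\<bar> + \<bar>s\<bar> * \<bar>y\<bar>)))"
        by (intro mult_left_mono) auto
      then show "\<bar>y ^ k * v (x + s * y)\<bar> \<le> C * (1 + \<bar>x\<bar>) * \<bar>y\<bar> ^ k + C * \<bar>s\<bar> * \<bar>y\<bar> ^ Suc k"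
        by (simp add: algebra_simps abs_mult power_abs)
    qed
    also have "\<dots> = C * (1 + \<bar>x\<bar>) * m0 + C * \<bar>s\<bar> * m1"
      unfolding m0_def m1_def
      by (subst Bochner_Integration.integral_add)
        (auto intro!: integrable_mult_right gauss_moment_abs simp del: power_Suc)
    also have "\<dots> \<le> (C * (m0 + m1)) * (1 + \<bar>s\<bar>) * (1 + \<bar>x\<bar>)"
    proof -
      have "0 \<le> C * m0 * \<bar>s\<bar> * (1 + \<bar>x\<bar>) + C * m1 * (1 + \<bar>x\<bar> + \<bar>s\<bar> * \<bar>x\<bar>)"
        using C(1) m by (intro add_nonneg_nonneg mult_nonneg_nonneg) auto
      then show ?thesis by (simp add: algebra_simps)
    qed
    finally show ?thesis .
  qed
  moreover have "C * (m0 + m1) \<ge> 0" using C(1) m by simp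
  ultimately show ?thesis using that by blast
qed

lemma gauss_weight_measurable:
  assumes [measurable]: "v \<in> borel_measurable borel"
  shows "(\<lambda>x. LINT y|gauss. y ^ k * v (x + s * y)) \<in> borel_measurable borel"
  by measurable

lemma lin_growth_heat: assumes v: "lin_growth v" shows "lin_growth (heat a v)"
proof -
  note [measurable] = lin_growth_measurable[OF v]
  obtain C where C: "C \<ge> 0" "\<And>x s. \<bar>LINT y|gauss. y ^ 0 * v (x + s * y)\<bar> \<le> C * (1 + \<bar>s\<bar>) * (1 + \<bar>x\<bar>)"
    using gauss_moment_weight[OF v] by blast
  have "heat a v \<in> borel_measurable borel"
    using gauss_weight_measurable[of v 0 "sqrt a"] unfolding heat_def by simp
  then show ?thesis using C(2)[of _ "sqrt a"] unfolding lin_growth_def heat_def by auto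
qed

lemma lin_growth_heatd: assumes v: "lin_growth v" shows "lin_growth (heatd a v)"
proof -
  note [measurable] = lin_growth_measurable[OF v]
  obtain C where C: "C \<ge> 0" "\<And>x s. \<bar>LINT y|gauss. y ^ 1 * v (x + s * y)\<bar> \<le> C * (1 + \<bar>s\<bar>) * (1 + \<bar>x\<bar>)"
    using gauss_moment_weight[OF v] by blast
  have "heatd a v \<in> borel_measurable borel"
    using gauss_weight_measurable[of v 1 "sqrt a"] unfolding heatd_def by simp
  moreover have "\<bar>heatd a v x\<bar> \<le> (C * (1 + \<bar>sqrt a\<bar>) / \<bar>sqrt a\<bar>) * (1 + \<bar>x\<bar>)" for x
    using C(2)[of x "sqrt a"] unfolding heatd_def
    by (auto simp: abs_divide divide_right_mono)
  ultimately show ?thesis unfolding lin_growth_def by blast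
qed

section \<open>Rotation invariance of the planar Gaussian and the semigroup law\<close>

text \<open>The coordinates are replaced one after the other by affine substitutions on the line,
  whose Jacobians 1/\<alpha> and \<alpha> cancel; this is where \<alpha> > 0 enters.\<close>

lemma nn_integral_lborel_rotate:
  fixes \<alpha> \<beta> :: real and F :: "real \<times> real \<Rightarrow> ennreal"
  assumes [measurable]: "F \<in> borel_measurable (borel \<Otimes>\<^sub>M borel)"
    and \<alpha>: "\<alpha> > 0" and 1: "\<alpha>\<^sup>2 + \<beta>\<^sup>2 = 1"
  shows "(\<integral>\<^sup>+x. \<integral>\<^sup>+y. F (\<alpha> * x + \<beta> * y, - \<beta> * x + \<alpha> * y) \<partial>lborel \<partial>lborel) = (\<integral>\<^sup>+x. \<integral>\<^sup>+y. F (x, y) \<partial>lborel \<partial>lborel)"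
proof -
  have "(\<integral>\<^sup>+x. \<integral>\<^sup>+y. F (\<alpha> * x + \<beta> * y, - \<beta> * x + \<alpha> * y) \<partial>lborel \<partial>lborel)
      = (\<integral>\<^sup>+y. \<integral>\<^sup>+x. F (\<alpha> * x + \<beta> * y, - \<beta> * x + \<alpha> * y) \<partial>lborel \<partial>lborel)"
    by (rule lborel_pair.Fubini') measurable
  also have "\<dots> = (\<integral>\<^sup>+y. ennreal (1 / \<alpha>) * (\<integral>\<^sup>+w. F (w, (y - \<beta> * w) / \<alpha>) \<partial>lborel) \<partial>lborel)"
  proof (rule nn_integral_cong)
    fix y
    have c: "F (\<alpha> * (- \<beta> * y / \<alpha> + 1 / \<alpha> * w) + \<beta> * y, - \<beta> * (- \<beta> * y / \<alpha> + 1 / \<alpha> * w) + \<alpha> * y)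
        = F (w, (y - \<beta> * w) / \<alpha>)" for w
    proof -
      have "\<beta> * (\<beta> * y) + \<alpha> * (\<alpha> * y) = (\<alpha>\<^sup>2 + \<beta>\<^sup>2) * y" by (simp add: power2_eq_square algebra_simps)
      then show ?thesis using \<alpha> 1 by (simp add: field_simps)
    qed
    show "(\<integral>\<^sup>+x. F (\<alpha> * x + \<beta> * y, - \<beta> * x + \<alpha> * y) \<partial>lborel)
        = ennreal (1 / \<alpha>) * (\<integral>\<^sup>+w. F (w, (y - \<beta> * w) / \<alpha>) \<partial>lborel)"
      using \<alpha> by (subst nn_integral_real_affine[where c="1 / \<alpha>" and t="- \<beta> * y / \<alpha>"]) (auto simp only: c, auto)
  qed
  also have "\<dots> = ennreal (1 / \<alpha>) * (\<integral>\<^sup>+y. \<integral>\<^sup>+w. F (w, (y - \<beta> * w) / \<alpha>) \<partial>lborel \<partial>lborel)"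
    by (rule nn_integral_cmult) measurable
  also have "(\<integral>\<^sup>+y. \<integral>\<^sup>+w. F (w, (y - \<beta> * w) / \<alpha>) \<partial>lborel \<partial>lborel)
      = (\<integral>\<^sup>+w. \<integral>\<^sup>+y. F (w, (y - \<beta> * w) / \<alpha>) \<partial>lborel \<partial>lborel)"
    by (rule lborel_pair.Fubini') measurable
  also have "\<dots> = (\<integral>\<^sup>+w. ennreal \<alpha> * (\<integral>\<^sup>+v. F (w, v) \<partial>lborel) \<partial>lborel)"
  proof (rule nn_integral_cong)
    fix w
    show "(\<integral>\<^sup>+y. F (w, (y - \<beta> * w) / \<alpha>) \<partial>lborel) = ennreal \<alpha> * (\<integral>\<^sup>+v. F (w, v) \<partial>lborel)"
      using \<alpha> by (subst nn_integral_real_affine[where c=\<alpha> and t="\<beta> * w"]) auto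
  qed
  also have "\<dots> = ennreal \<alpha> * (\<integral>\<^sup>+w. \<integral>\<^sup>+v. F (w, v) \<partial>lborel \<partial>lborel)"
    by (rule nn_integral_cmult) measurable
  finally show ?thesis
    using \<alpha> by (simp add: mult.assoc[symmetric] ennreal_mult'[symmetric])
qed

text \<open>The product density depends on the point through x^2 + y^2 only, which a rotation
  preserves.\<close>

lemma gauss_rotate:
  fixes \<alpha> \<beta> :: real
  assumes \<alpha>: "\<alpha> > 0" and 1: "\<alpha>\<^sup>2 + \<beta>\<^sup>2 = 1"
  shows "distr (gauss \<Otimes>\<^sub>M gauss) (gauss \<Otimes>\<^sub>M gauss) (\<lambda>(x, y). (\<alpha> * x + \<beta> * y, - \<beta> * x + \<alpha> * y)) = gauss \<Otimes>\<^sub>M gauss"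
proof (rule measure_eqI)
  let ?R = "\<lambda>(x, y). (\<alpha> * x + \<beta> * y, - \<beta> * x + \<alpha> * y)"
  show "sets (distr (gauss \<Otimes>\<^sub>M gauss) (gauss \<Otimes>\<^sub>M gauss) ?R) = sets (gauss \<Otimes>\<^sub>M gauss)" by simp
  have R[measurable]: "?R \<in> measurable (gauss \<Otimes>\<^sub>M gauss) (gauss \<Otimes>\<^sub>M gauss)" by measurable
  have nn: "(\<integral>\<^sup>+p. F p \<partial>(gauss \<Otimes>\<^sub>M gauss))
      = (\<integral>\<^sup>+x. \<integral>\<^sup>+y. ennreal (std_normal_density x * std_normal_density y) * F (x, y) \<partial>lborel \<partial>lborel)"
    if [measurable]: "F \<in> borel_measurable (borel \<Otimes>\<^sub>M borel)" for F
  proof -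
    have "(\<integral>\<^sup>+p. F p \<partial>(gauss \<Otimes>\<^sub>M gauss)) = (\<integral>\<^sup>+x. \<integral>\<^sup>+y. F (x, y) \<partial>gauss \<partial>gauss)"
      by (rule gauss.nn_integral_fst[symmetric]) measurable
    also have "\<dots> = (\<integral>\<^sup>+x. ennreal (std_normal_density x) * (\<integral>\<^sup>+y. ennreal (std_normal_density y) * F (x, y) \<partial>lborel) \<partial>lborel)"
      by (simp add: nn_integral_density)
    also have "\<dots> = (\<integral>\<^sup>+x. \<integral>\<^sup>+y. ennreal (std_normal_density x) * (ennreal (std_normal_density y) * F (x, y)) \<partial>lborel \<partial>lborel)"
      by (subst nn_integral_cmult) auto
    finally show ?thesis by (simp add: ennreal_mult'' mult.assoc normal_density_nonneg)
  qed
  fix A assume "A \<in> sets (distr (gauss \<Otimes>\<^sub>M gauss) (gauss \<Otimes>\<^sub>M gauss) ?R)"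
  then have A: "A \<in> sets (gauss \<Otimes>\<^sub>M gauss)" by simp
  have "sets (gauss \<Otimes>\<^sub>M gauss) = sets (borel \<Otimes>\<^sub>M borel)" by (rule sets_pair_measure_cong) auto
  with A have A'[measurable]: "A \<in> sets (borel \<Otimes>\<^sub>M borel)" by simp
  have "emeasure (distr (gauss \<Otimes>\<^sub>M gauss) (gauss \<Otimes>\<^sub>M gauss) ?R) A
      = (\<integral>\<^sup>+p. indicator A p \<partial>distr (gauss \<Otimes>\<^sub>M gauss) (gauss \<Otimes>\<^sub>M gauss) ?R)"
    using A by simp
  also have "\<dots> = (\<integral>\<^sup>+p. indicator A (?R p) \<partial>(gauss \<Otimes>\<^sub>M gauss))"
    using A by (intro nn_integral_distr) auto
  also have "\<dots> = (\<integral>\<^sup>+x. \<integral>\<^sup>+y. ennreal (std_normal_density x * std_normal_density y) * indicator A (?R (x, y)) \<partial>lborel \<partial>lborel)"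
    by (rule nn) measurable
  also have "\<dots> = (\<integral>\<^sup>+x. \<integral>\<^sup>+y. (\<lambda>(u, v). ennreal (std_normal_density u * std_normal_density v) * indicator A (u, v))
      (\<alpha> * x + \<beta> * y, - \<beta> * x + \<alpha> * y) \<partial>lborel \<partial>lborel)"
  proof (intro nn_integral_cong)
    fix x y :: real
    have "(\<alpha> * x + \<beta> * y)\<^sup>2 + (- \<beta> * x + \<alpha> * y)\<^sup>2 = (\<alpha>\<^sup>2 + \<beta>\<^sup>2) * (x\<^sup>2 + y\<^sup>2)"
      by (simp add: power2_eq_square algebra_simps)
    then have "(\<alpha> * x + \<beta> * y)\<^sup>2 + (- \<beta> * x + \<alpha> * y)\<^sup>2 = x\<^sup>2 + y\<^sup>2" using 1 by simp
    then have "exp (- (\<alpha> * x + \<beta> * y)\<^sup>2 / 2) * exp (- (- \<beta> * x + \<alpha> * y)\<^sup>2 / 2) = exp (- x\<^sup>2 / 2) * exp (- y\<^sup>2 / 2)"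
      unfolding exp_add[symmetric] by (simp add: field_simps)
    then have "std_normal_density (\<alpha> * x + \<beta> * y) * std_normal_density (- \<beta> * x + \<alpha> * y)
        = std_normal_density x * std_normal_density y"
      unfolding std_normal_density_def by (simp add: field_simps)
    then show "ennreal (std_normal_density x * std_normal_density y) * indicator A (?R (x, y))
        = (\<lambda>(u, v). ennreal (std_normal_density u * std_normal_density v) * indicator A (u, v))
      (\<alpha> * x + \<beta> * y, - \<beta> * x + \<alpha> * y)" by simp
  qed
  also have "\<dots> = (\<integral>\<^sup>+x. \<integral>\<^sup>+y. (\<lambda>(u, v). ennreal (std_normal_density u * std_normal_density v) * indicator A (u, v)) (x, y) \<partial>lborel \<partial>lborel)"
    by (rule nn_integral_lborel_rotate[OF _ \<alpha> 1]) measurable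
  also have "\<dots> = (\<integral>\<^sup>+p. indicator A p \<partial>(gauss \<Otimes>\<^sub>M gauss))"
    by (subst nn) auto
  also have "\<dots> = emeasure (gauss \<Otimes>\<^sub>M gauss) A" using A by simp
  finally show "emeasure (distr (gauss \<Otimes>\<^sub>M gauss) (gauss \<Otimes>\<^sub>M gauss) ?R) A = emeasure (gauss \<Otimes>\<^sub>M gauss) A" .
qed

lemma abs_moments_integrable2: "integrable (gauss \<Otimes>\<^sub>M gauss) (\<lambda>p. \<bar>fst p\<bar> ^ i * \<bar>snd p\<bar> ^ j)"
proof (rule gauss2.Fubini_integrable)
  show "(\<lambda>p. \<bar>fst p\<bar> ^ i * \<bar>snd p\<bar> ^ j) \<in> borel_measurable (gauss \<Otimes>\<^sub>M gauss)" by measurable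
  show "integrable gauss (\<lambda>x. LINT y|gauss. norm (\<bar>fst (x, y)\<bar> ^ i * \<bar>snd (x, y)\<bar> ^ j))"
    by (simp add: abs_mult gauss_moment_abs)
  show "AE x in gauss. integrable gauss (\<lambda>y. \<bar>fst (x, y)\<bar> ^ i * \<bar>snd (x, y)\<bar> ^ j)"
    by (simp add: gauss_moment_abs)
qed

lemma growth_integrable2:
  assumes v: "lin_growth v"
  shows "integrable (gauss \<Otimes>\<^sub>M gauss) (\<lambda>p. fst p ^ k * snd p ^ l * v (x + s * fst p + t * snd p))"
proof -
  note [measurable] = lin_growth_measurable[OF v]
  obtain C where C: "C \<ge> 0" "\<And>x. \<bar>v x\<bar> \<le> C * (1 + \<bar>x\<bar>)" using lin_growthE[OF v] by blast
  let ?B = "\<lambda>p. C * (1 + \<bar>x\<bar>) * (\<bar>fst p\<bar> ^ k * \<bar>snd p\<bar> ^ l) + C * \<bar>s\<bar> * (\<bar>fst p\<bar> ^ Suc k * \<bar>snd p\<bar> ^ l)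
      + C * \<bar>t\<bar> * (\<bar>fst p\<bar> ^ k * \<bar>snd p\<bar> ^ Suc l)"
  show ?thesis
  proof (rule Bochner_Integration.integrable_bound)
    show "integrable (gauss \<Otimes>\<^sub>M gauss) ?B"
      by (intro Bochner_Integration.integrable_add integrable_mult_right abs_moments_integrable2)
    show "(\<lambda>p. fst p ^ k * snd p ^ l * v (x + s * fst p + t * snd p)) \<in> borel_measurable (gauss \<Otimes>\<^sub>M gauss)"
      by measurable
    show "AE p in gauss \<Otimes>\<^sub>M gauss. norm (fst p ^ k * snd p ^ l * v (x + s * fst p + t * snd p)) \<le> norm (?B p)"
    proof (rule AE_I2)
      fix p :: "real \<times> real"
      have "\<bar>v (x + s * fst p + t * snd p)\<bar> \<le> C * (1 + \<bar>x + s * fst p + t * snd p\<bar>)" by (rule C)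
      also have "\<dots> \<le> C * (1 + (\<bar>x\<bar> + \<bar>s\<bar> * \<bar>fst p\<bar> + \<bar>t\<bar> * \<bar>snd p\<bar>))"
        using C(1) abs_triangle_ineq[of x "s * fst p"] abs_triangle_ineq[of "x + s * fst p" "t * snd p"]
        by (intro mult_left_mono) (auto simp: abs_mult)
      finally have "\<bar>fst p\<bar> ^ k * \<bar>snd p\<bar> ^ l * \<bar>v (x + s * fst p + t * snd p)\<bar>
          \<le> \<bar>fst p\<bar> ^ k * \<bar>snd p\<bar> ^ l * (C * (1 + (\<bar>x\<bar> + \<bar>s\<bar> * \<bar>fst p\<bar> + \<bar>t\<bar> * \<bar>snd p\<bar>)))"
        by (intro mult_left_mono) auto
      also have "\<dots> = ?B p" by (simp add: algebra_simps)
      finally show "norm (fst p ^ k * snd p ^ l * v (x + s * fst p + t * snd p)) \<le> norm (?B p)"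
        unfolding real_norm_def abs_mult power_abs by linarith
    qed
  qed
qed

text \<open>The angle is the one for which sqrt a x + sqrt b y = sqrt (a + b) (\<alpha> x + \<beta>
  y): two independent shifts of variances a and b become one shift of variance a + b along the first
  axis.\<close>

lemma gauss_rotate_integral:
  fixes K :: "real \<times> real \<Rightarrow> real"
  assumes [measurable]: "K \<in> borel_measurable (borel \<Otimes>\<^sub>M borel)" and ab: "a > 0" "b \<ge> 0"
  defines "\<alpha> \<equiv> sqrt a / sqrt (a + b)" and "\<beta> \<equiv> sqrt b / sqrt (a + b)"
  shows "(LINT p|(gauss \<Otimes>\<^sub>M gauss). K p) = (LINT p|(gauss \<Otimes>\<^sub>M gauss). K (\<alpha> * fst p + \<beta> * snd p, - \<beta> * fst p + \<alpha> * snd p))"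
proof -
  have "\<alpha> > 0" "\<alpha>\<^sup>2 + \<beta>\<^sup>2 = 1"
    using ab unfolding \<alpha>_def \<beta>_def by (auto simp: power_divide add_divide_distrib[symmetric])
  from gauss_rotate[OF this] have "(LINT p|(gauss \<Otimes>\<^sub>M gauss). K p)
      = (LINT p|(distr (gauss \<Otimes>\<^sub>M gauss) (gauss \<Otimes>\<^sub>M gauss) (\<lambda>(x, y). (\<alpha> * x + \<beta> * y, - \<beta> * x + \<alpha> * y))). K p)"
    by simp
  also have "\<dots> = (LINT p|(gauss \<Otimes>\<^sub>M gauss). K (case p of (x, y) \<Rightarrow> (\<alpha> * x + \<beta> * y, - \<beta> * x + \<alpha> * y)))"
    by (rule integral_distr) measurable
  finally show ?thesis by (simp add: case_prod_beta)
qed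

text \<open>Formally both sides are D exp ((a + b) D^2 / 2) v. Since v has no derivative, the
  identity is obtained by rotating the two Gaussian variables until v depends on one of them. For b
  = 0 it would fail, because \<open>heatd 0\<close> is zero.\<close>

lemma heat_heatd:
  assumes v: "lin_growth v" and ab: "a \<ge> 0" "b > 0"
  shows "heat a (heatd b v) = heatd (a + b) v"
proof (cases "a = 0")
  case False
  then have a: "a > 0" using ab by simp
  note [measurable] = lin_growth_measurable[OF v]
  define \<alpha> \<beta> where "\<alpha> = sqrt a / sqrt (a + b)" and "\<beta> = sqrt b / sqrt (a + b)"
  have 1: "\<alpha> * \<alpha> + \<beta> * \<beta> = 1" using a ab unfolding \<alpha>_def \<beta>_def by (simp add: add_divide_distrib[symmetric])
  show ?thesis
  proof
    fix x
    have "heat a (heatd b v) x = (LINT y1|gauss. LINT y2|gauss. y2 * v (x + sqrt a * y1 + sqrt b * y2)) / sqrt b"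
      by (simp add: heat_def heatd_def)
    also have "(LINT y1|gauss. LINT y2|gauss. y2 * v (x + sqrt a * y1 + sqrt b * y2))
        = (LINT p|(gauss \<Otimes>\<^sub>M gauss). snd p * v (x + sqrt a * fst p + sqrt b * snd p))"
      using gauss2.integral_fst'[OF growth_integrable2[OF v, of 0 1 x "sqrt a" "sqrt b"]] by simp
    also have "\<dots> = (LINT p|(gauss \<Otimes>\<^sub>M gauss). (\<beta> * fst p + \<alpha> * snd p) * v (x + sqrt (a + b) * fst p))"
    proof -
      have *: "\<beta> * (\<alpha> * fst p + \<beta> * snd p) + \<alpha> * (- \<beta> * fst p + \<alpha> * snd p) = snd p" for p :: "real \<times> real"
      proof -
        have "\<beta> * (\<alpha> * fst p + \<beta> * snd p) + \<alpha> * (- \<beta> * fst p + \<alpha> * snd p) = (\<alpha> * \<alpha> + \<beta> * \<beta>) * snd p"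
          by (simp add: algebra_simps)
        then show ?thesis using 1 by simp
      qed
      have **: "x + sqrt (a + b) * (\<alpha> * fst p + \<beta> * snd p) = x + sqrt a * fst p + sqrt b * snd p" for p :: "real \<times> real"
        using a ab by (simp add: \<alpha>_def \<beta>_def distrib_left)
      show ?thesis
        using gauss_rotate_integral[of "\<lambda>p. (\<beta> * fst p + \<alpha> * snd p) * v (x + sqrt (a + b) * fst p)" a b, folded \<alpha>_def \<beta>_def]
          a ab(2) by (simp only: fst_conv snd_conv * **) simp
    qed
    also have "\<dots> = (LINT y1|gauss. LINT y2|gauss. (\<beta> * y1 + \<alpha> * y2) * v (x + sqrt (a + b) * y1))"
    proof -
      have "integrable (gauss \<Otimes>\<^sub>M gauss) (\<lambda>p. \<beta> * (fst p ^ 1 * snd p ^ 0 * v (x + sqrt (a + b) * fst p + 0 * snd p))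
          + \<alpha> * (fst p ^ 0 * snd p ^ 1 * v (x + sqrt (a + b) * fst p + 0 * snd p)))"
        by (intro Bochner_Integration.integrable_add integrable_mult_right growth_integrable2[OF v])
      then have "integrable (gauss \<Otimes>\<^sub>M gauss) (\<lambda>p. (\<beta> * fst p + \<alpha> * snd p) * v (x + sqrt (a + b) * fst p))"
        by (simp add: algebra_simps)
      from gauss2.integral_fst'[OF this] show ?thesis by simp
    qed
    \<comment> \<open>The component of the rotated weight along y2 integrates to zero, as v does not
      involve y2. The surviving factor satisfies \<beta> / sqrt b = 1 / sqrt (a + b), the
      normalisation of \<open>heatd (a + b)\<close>.\<close>
    also have "\<dots> = (LINT y1|gauss. \<beta> * (y1 * v (x + sqrt (a + b) * y1)))"
    proof (rule Bochner_Integration.integral_cong[OF refl])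
      fix y1
      have i: "integrable gauss (\<lambda>y. y)" using integrable_std_normal_distribution_moment[of 1] by simp
      have z: "(LINT y|gauss. y) = 0" using integral_std_normal_distribution_moment_odd[of 1] by simp
      have "(LINT y2|gauss. (\<beta> * y1 + \<alpha> * y2)) = \<beta> * y1 + \<alpha> * (LINT y|gauss. y)"
        using i gauss.prob_space by (subst Bochner_Integration.integral_add) auto
      then show "(LINT y2|gauss. (\<beta> * y1 + \<alpha> * y2) * v (x + sqrt (a + b) * y1)) = \<beta> * (y1 * v (x + sqrt (a + b) * y1))"
        by (simp add: z)
    qed
    also have "\<dots> / sqrt b = heatd (a + b) v x"
      using ab a by (simp add: heatd_def \<beta>_def)
    finally show "heat a (heatd b v) x = heatd (a + b) v x" .
  qed
qed simp

text \<open>By Fubini the weight may sit on either of the two averages, which reduces this to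
  \<open>heat_heatd\<close>.\<close>

lemma heatd_heat:
  assumes v: "lin_growth v" and ab: "a \<ge> 0" "b > 0"
  shows "heatd b (heat a v) = heatd (a + b) v"
proof -
  note [measurable] = lin_growth_measurable[OF v]
  have "heatd b (heat a v) x = heat a (heatd b v) x" for x
  proof -
    have "heatd b (heat a v) x = (LINT y1|gauss. LINT y2|gauss. y1 * v (x + sqrt b * y1 + sqrt a * y2)) / sqrt b"
      by (simp add: heat_def heatd_def)
    also have "\<dots> = (LINT y2|gauss. LINT y1|gauss. y1 * v (x + sqrt b * y1 + sqrt a * y2)) / sqrt b"
    proof -
      have "integrable (gauss \<Otimes>\<^sub>M gauss) (\<lambda>(y1, y2). y1 * v (x + sqrt b * y1 + sqrt a * y2))"
        using growth_integrable2[OF v, of 1 0 x "sqrt b" "sqrt a"] by (simp add: case_prod_unfold)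
      from gauss2.Fubini_integral[OF this] show ?thesis by (simp only:)
    qed
    also have "\<dots> = heat a (heatd b v) x" by (simp add: heat_def heatd_def algebra_simps)
    finally show ?thesis .
  qed
  then show ?thesis using heat_heatd[OF v ab] by auto
qed

section \<open>Uniform bounds and Taylor expansion in the variance\<close>

lemma abs_first_moment_le: "(LINT y|gauss. \<bar>y\<bar>) \<le> 1"
proof -
  have "(LINT y|gauss. \<bar>y\<bar>) \<le> (LINT y|gauss. (1 + y\<^sup>2) / 2)"
  proof (rule integral_mono)
    show "integrable gauss (\<lambda>y. \<bar>y\<bar>)" using gauss_moment_abs[of 1] by simp
    show "integrable gauss (\<lambda>y. (1 + y\<^sup>2) / 2)" using integrable_std_normal_distribution_moment[of 2] by auto
    fix y :: real
    have "0 \<le> (\<bar>y\<bar> - 1)\<^sup>2" by simp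
    then show "\<bar>y\<bar> \<le> (1 + y\<^sup>2) / 2" by (simp add: power2_eq_square algebra_simps abs_mult[symmetric])
  qed
  also have "\<dots> = 1"
    using std_normal_distribution_even_moments[of 1] gauss.prob_space
    by (subst integral_divide_zero, subst Bochner_Integration.integral_add) auto
  finally show ?thesis .
qed

lemma heat_bound:
  assumes "v \<in> borel_measurable borel" "\<And>x. \<bar>v x\<bar> \<le> C"
  shows "\<bar>heat a v x\<bar> \<le> C"
proof -
  have v: "lin_growth v" using assms by (rule bounded_lin_growth)
  have "\<bar>heat a v x\<bar> \<le> (LINT y|gauss. \<bar>v (x + sqrt a * y)\<bar>)" unfolding heat_def by (rule integral_abs_bound)
  also have "\<dots> \<le> (LINT y|gauss. C)"
    using growth_integrable(1)[OF v, of 0] assms(2) by (intro integral_mono) auto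
  finally show ?thesis using gauss.prob_space by simp
qed

text \<open>The weight costs a factor 1 / sqrt a, here with the crude bound 1 for the first absolute
  moment. This loss is the origin of the half-integer exponents in the error estimates.\<close>

lemma heatd_bound:
  assumes "v \<in> borel_measurable borel" "\<And>x. \<bar>v x\<bar> \<le> C" "a \<ge> 0"
  shows "\<bar>heatd a v x\<bar> \<le> C / sqrt a"
proof -
  have v: "lin_growth v" using assms(1,2) by (rule bounded_lin_growth)
  have C: "C \<ge> 0" using assms(2)[of 0] by auto
  have "\<bar>LINT y|gauss. y * v (x + sqrt a * y)\<bar> \<le> (LINT y|gauss. \<bar>y * v (x + sqrt a * y)\<bar>)"
    by (rule integral_abs_bound)
  also have "\<dots> \<le> (LINT y|gauss. C * \<bar>y\<bar>)"
  proof (rule integral_mono)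
    show "integrable gauss (\<lambda>y. \<bar>y * v (x + sqrt a * y)\<bar>)"
      using growth_integrable(1)[OF v, of 1 x "sqrt a"] by (simp add: abs_mult)
    show "integrable gauss (\<lambda>y. C * \<bar>y\<bar>)" using gauss_moment_abs[of 1] by simp
    show "\<bar>y * v (x + sqrt a * y)\<bar> \<le> C * \<bar>y\<bar>" for y
      using mult_right_mono[OF assms(2), of "\<bar>y\<bar>" "x + sqrt a * y"] by (simp add: abs_mult mult.commute)
  qed
  also have "\<dots> \<le> C" using mult_left_mono[OF abs_first_moment_le C] by simp
  finally show ?thesis using assms(3) unfolding heatd_def by (auto simp: abs_divide divide_right_mono)
qed

text \<open>Taylor's formula with Lagrange remainder, integrated against y^k. The derivatives are
  given as a sequence \<open>D\<close>, so that explicit formulas for them can be inserted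
  later.\<close>

lemma gauss_taylor:
  fixes D :: "nat \<Rightarrow> real \<Rightarrow> real"
  assumes der: "\<And>m x. (D m has_real_derivative D (Suc m) x) (at x)"
    and K: "\<And>x. \<bar>D N x\<bar> \<le> K" and v: "lin_growth (D 0)"
  shows "\<bar>(LINT y|gauss. y ^ k * D 0 (x + r * y)) - (\<Sum>m<N. D m x / fact m * r ^ m * (LINT y|gauss. y ^ (m + k)))\<bar>
    \<le> K * \<bar>r\<bar> ^ N / fact N * (LINT y|gauss. \<bar>y\<bar> ^ (N + k))"
proof -
  define P where "P y = (\<Sum>m<N. D m x / fact m * (r * y) ^ m)" for y
  have rem: "\<bar>D 0 (x + h) - (\<Sum>m<N. D m x / fact m * h ^ m)\<bar> \<le> K * \<bar>h\<bar> ^ N / fact N" for h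
  proof -
    have der': "((\<lambda>h. D m (x + h)) has_real_derivative D (Suc m) (x + t)) (at t)" for m t
      using der[of m "x + t"] by (simp add: DERIV_shift[symmetric] add.commute)
    obtain t where t: "D 0 (x + h) = (\<Sum>m<N. D m (x + 0) / fact m * h ^ m) + D N (x + t) / fact N * h ^ N"
      using Maclaurin_all_le[of "\<lambda>m h. D m (x + h)" "\<lambda>h. D 0 (x + h)" h N] der' by auto
    have "\<bar>D N (x + t) / fact N * h ^ N\<bar> \<le> K * \<bar>h\<bar> ^ N / fact N"
      using mult_right_mono[OF K[of "x + t"], of "\<bar>h\<bar> ^ N"] by (simp add: abs_mult power_abs divide_right_mono)
    with t show ?thesis by simp
  qed
  have iP: "integrable gauss (\<lambda>y. y ^ k * P y)"
    and eP: "(LINT y|gauss. y ^ k * P y) = (\<Sum>m<N. D m x / fact m * r ^ m * (LINT y|gauss. y ^ (m + k)))"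
  proof -
    have *: "y ^ k * P y = (\<Sum>m<N. D m x / fact m * r ^ m * y ^ (m + k))" for y
      by (simp add: P_def sum_distrib_left power_add power_mult_distrib mult_ac)
    show "integrable gauss (\<lambda>y. y ^ k * P y)" unfolding *
      by (intro Bochner_Integration.integrable_sum integrable_mult_right integrable_std_normal_distribution_moment)
    show "(LINT y|gauss. y ^ k * P y) = (\<Sum>m<N. D m x / fact m * r ^ m * (LINT y|gauss. y ^ (m + k)))" unfolding *
      by (subst Bochner_Integration.integral_sum)
        (auto intro!: integrable_mult_right integrable_std_normal_distribution_moment)
  qed
  have iv: "integrable gauss (\<lambda>y. y ^ k * D 0 (x + r * y))" by (rule growth_integrable(2)[OF v])
  have "\<bar>(LINT y|gauss. y ^ k * D 0 (x + r * y)) - (LINT y|gauss. y ^ k * P y)\<bar>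
      = \<bar>LINT y|gauss. y ^ k * D 0 (x + r * y) - y ^ k * P y\<bar>"
    by (simp only: Bochner_Integration.integral_diff[OF iv iP])
  also have "\<dots> \<le> (LINT y|gauss. \<bar>y ^ k * D 0 (x + r * y) - y ^ k * P y\<bar>)" by (rule integral_abs_bound)
  also have "\<dots> \<le> (LINT y|gauss. K * \<bar>r\<bar> ^ N / fact N * \<bar>y\<bar> ^ (N + k))"
  proof (rule integral_mono)
    show "integrable gauss (\<lambda>y. \<bar>y ^ k * D 0 (x + r * y) - y ^ k * P y\<bar>)" using iv iP by auto
    show "integrable gauss (\<lambda>y. K * \<bar>r\<bar> ^ N / fact N * \<bar>y\<bar> ^ (N + k))"
      by (intro integrable_mult_right gauss_moment_abs)
    fix y
    have "\<bar>y ^ k * D 0 (x + r * y) - y ^ k * P y\<bar> = \<bar>y\<bar> ^ k * \<bar>D 0 (x + r * y) - P y\<bar>"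
      by (simp add: abs_mult power_abs right_diff_distrib[symmetric])
    also have "\<dots> \<le> \<bar>y\<bar> ^ k * (K * \<bar>r * y\<bar> ^ N / fact N)"
      unfolding P_def by (intro mult_left_mono rem) auto
    also have "\<dots> = K * \<bar>r\<bar> ^ N / fact N * \<bar>y\<bar> ^ (N + k)"
      by (simp add: abs_mult power_mult_distrib power_add)
    finally show "\<bar>y ^ k * D 0 (x + r * y) - y ^ k * P y\<bar> \<le> K * \<bar>r\<bar> ^ N / fact N * \<bar>y\<bar> ^ (N + k)" .
  qed
  finally show ?thesis by (simp add: eP)
qed

lemma sum_even_terms:
  fixes g :: "nat \<Rightarrow> real"
  assumes "\<And>m. odd m \<Longrightarrow> g m = 0"
  shows "(\<Sum>m<2*n. g m) = (\<Sum>p<n. g (2 * p))"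
  using assms by (induction n) auto

lemma sum_odd_terms:
  fixes g :: "nat \<Rightarrow> real"
  assumes "\<And>m. even m \<Longrightarrow> g m = 0"
  shows "(\<Sum>m<2*n+1. g m) = (\<Sum>p<n. g (2 * p + 1))"
  using assms by (induction n) auto

text \<open>Odd Gaussian moments vanish, and the even ones, (2p)! / (2^p p!), cancel the Taylor
  factorials; what remains is the series of exp (s D^2 / 2). The remainder factor 1 / (2^n n!) is
  estimated by 1.\<close>

lemma heat_taylor:
  fixes D :: "nat \<Rightarrow> real \<Rightarrow> real"
  assumes der: "\<And>m x. (D m has_real_derivative D (Suc m) x) (at x)"
    and K: "\<And>x. \<bar>D (2 * n) x\<bar> \<le> K" and v: "lin_growth (D 0)" and s: "s \<ge> 0"
  shows "\<bar>heat s (D 0) x - (\<Sum>p<n. s ^ p / (2 ^ p * fact p) * D (2 * p) x)\<bar> \<le> K * s ^ n"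
proof -
  have ev: "sqrt s ^ (2 * p) = s ^ p" for p using s by (simp add: power_mult)
  have K0: "K \<ge> 0" using K[of 0] by auto
  have "(\<Sum>m<2*n. D m x / fact m * sqrt s ^ m * (LINT y|gauss. y ^ (m + 0)))
      = (\<Sum>p<n. D (2*p) x / fact (2*p) * sqrt s ^ (2*p) * (LINT y|gauss. y ^ (2*p + 0)))"
    by (rule sum_even_terms) (simp add: integral_std_normal_distribution_moment_odd)
  also have "\<dots> = (\<Sum>p<n. s ^ p / (2 ^ p * fact p) * D (2 * p) x)"
    unfolding add_0_right std_normal_distribution_even_moments(1) ev by (intro sum.cong) (auto simp: field_simps)
  finally have "\<bar>heat s (D 0) x - (\<Sum>p<n. s ^ p / (2 ^ p * fact p) * D (2 * p) x)\<bar>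
      \<le> K * \<bar>sqrt s\<bar> ^ (2 * n) / fact (2 * n) * (LINT y|gauss. \<bar>y\<bar> ^ (2 * n + 0))"
    using gauss_taylor[OF der K v, of 0 x "sqrt s"] by (simp add: heat_def)
  also have "\<dots> = K * s ^ n / (2 ^ n * fact n)"
    using s unfolding add_0_right std_normal_distribution_even_moments_abs by (simp add: ev)
  also have "\<dots> \<le> K * s ^ n / 1"
  proof (rule divide_left_mono)
    show "1 \<le> 2 ^ n * (fact n :: real)" using mult_mono[of 1 "2 ^ n" 1 "fact n :: real"] by simp
  qed (use K0 s in auto)
  finally show ?thesis by simp
qed

text \<open>The weight raises every moment by one, so the odd derivatives survive and form the
  series of D exp (s D^2 / 2). At s = 0 the expansion would be wrong, since \<open>heatd 0\<close>
  is zero and not the derivative.\<close>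

lemma heatd_taylor:
  fixes D :: "nat \<Rightarrow> real \<Rightarrow> real"
  assumes der: "\<And>m x. (D m has_real_derivative D (Suc m) x) (at x)"
    and K: "\<And>x. \<bar>D (2 * n + 1) x\<bar> \<le> K" and v: "lin_growth (D 0)" and s: "s > 0"
  shows "\<bar>heatd s (D 0) x - (\<Sum>p<n. s ^ p / (2 ^ p * fact p) * D (2 * p + 1) x)\<bar> \<le> K * s ^ n"
proof -
  have ev: "sqrt s ^ (2 * p) = s ^ p" for p using s by (simp add: power_mult)
  have K0: "K \<ge> 0" using K[of 0] by auto
  have two: "2 * p + 1 + 1 = 2 * (p + 1)" for p :: nat by simp
  have fac: "fact (2 * (p + 1)) = (2 * (real p + 1)) * fact (2 * p + 1)" for p
    by (simp add: algebra_simps)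
  \<comment> \<open>The moment of order 2p + 2 equals (2p + 1)! / (2^p p!), which cancels the
    factorial of the Taylor coefficient of order 2p + 1.\<close>
  have mom: "fact (2 * (p + 1)) / (2 ^ (p + 1) * fact (p + 1)) = fact (2 * p + 1) / (2 ^ p * fact p :: real)" for p
    unfolding fac by (simp add: field_simps del: fact_Suc) (simp add: algebra_simps)
  have "(\<Sum>m<2*n+1. D m x / fact m * sqrt s ^ m * (LINT y|gauss. y ^ (m + 1)))
      = (\<Sum>p<n. D (2*p+1) x / fact (2*p+1) * sqrt s ^ (2*p+1) * (LINT y|gauss. y ^ (2*p + 1 + 1)))"
    by (rule sum_odd_terms) (simp add: integral_std_normal_distribution_moment_odd del: power_Suc)
  also have "\<dots> = (\<Sum>p<n. s ^ p / (2 ^ p * fact p) * D (2 * p + 1) x) * sqrt s"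
    unfolding two std_normal_distribution_even_moments(1) mom sum_distrib_right
    by (intro sum.cong) (auto simp: ev)
  finally have sm: "(\<Sum>m<2*n+1. D m x / fact m * sqrt s ^ m * (LINT y|gauss. y ^ (m + 1)))
      = (\<Sum>p<n. s ^ p / (2 ^ p * fact p) * D (2 * p + 1) x) * sqrt s" .
  have "\<bar>heatd s (D 0) x - (\<Sum>p<n. s ^ p / (2 ^ p * fact p) * D (2 * p + 1) x)\<bar>
      = \<bar>(LINT y|gauss. y ^ 1 * D 0 (x + sqrt s * y)) - (\<Sum>p<n. s ^ p / (2 ^ p * fact p) * D (2 * p + 1) x) * sqrt s\<bar> / sqrt s"
  proof -
    have "\<bar>A / sqrt s - B\<bar> = \<bar>A - B * sqrt s\<bar> / sqrt s" for A B
    proof -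
      have "A / sqrt s - B = (A - B * sqrt s) / sqrt s" using s by (simp add: field_simps)
      then show ?thesis using s by (simp add: abs_divide)
    qed
    then show ?thesis by (simp only: heatd_def power_one_right)
  qed
  also have "\<dots> \<le> (K * \<bar>sqrt s\<bar> ^ (2 * n + 1) / fact (2 * n + 1) * (LINT y|gauss. \<bar>y\<bar> ^ (2 * n + 1 + 1))) / sqrt s"
    using gauss_taylor[OF der K v, of 1 x "sqrt s"] s unfolding sm by (intro divide_right_mono) auto
  also have "\<dots> = K * s ^ n / (2 ^ n * fact n)"
  proof -
    have m: "(LINT y|gauss. \<bar>y\<bar> ^ (2 * n + 1 + 1)) = fact (2 * n + 1) / (2 ^ n * fact n)"
      unfolding two std_normal_distribution_even_moments_abs by (rule mom)
    have "K * (s ^ n * sqrt s) / A * (A / B) / sqrt s = K * s ^ n / B" if "A \<noteq> 0" for A B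
      using that s by (simp add: field_simps)
    then show ?thesis using s unfolding m by (simp add: ev del: fact_Suc)
  qed
  also have "\<dots> \<le> K * s ^ n / 1"
  proof (rule divide_left_mono)
    show "1 \<le> 2 ^ n * (fact n :: real)" using mult_mono[of 1 "2 ^ n" 1 "fact n :: real"] by simp
  qed (use K0 s in auto)
  finally show ?thesis by simp
qed

section \<open>Brownian increments\<close>

definition square_integrable :: "'a measure \<Rightarrow> ('a \<Rightarrow> real) \<Rightarrow> bool" where
  "square_integrable M f \<longleftrightarrow> f \<in> borel_measurable M \<and> integrable M (\<lambda>x. (f x)\<^sup>2)"

lemma square_integrable_measurable [measurable_dest]: "square_integrable M f \<Longrightarrow> f \<in> borel_measurable M"
  by (simp add: square_integrable_def)

lemma square_integrable_times:
  assumes "square_integrable M f" "square_integrable M g"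
  shows "integrable M (\<lambda>x. f x * g x)"
proof (rule Bochner_Integration.integrable_bound)
  show "integrable M (\<lambda>x. (f x)\<^sup>2 + (g x)\<^sup>2)" using assms by (auto simp: square_integrable_def)
  show "(\<lambda>x. f x * g x) \<in> borel_measurable M" using assms by (auto simp: square_integrable_def)
  have "\<bar>a * b\<bar> \<le> a\<^sup>2 + b\<^sup>2" for a b :: real
  proof -
    have "0 \<le> (\<bar>a\<bar> - \<bar>b\<bar>)\<^sup>2" by simp
    then have "2 * \<bar>a * b\<bar> \<le> a\<^sup>2 + b\<^sup>2" by (simp add: power2_diff abs_mult)
    then show ?thesis by simp
  qed
  then show "AE x in M. norm (f x * g x) \<le> norm ((f x)\<^sup>2 + (g x)\<^sup>2)" by (intro AE_I2) (simp add: abs_mult)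
qed

lemma square_integrable_add:
  assumes "square_integrable M f" "square_integrable M g"
  shows "square_integrable M (\<lambda>x. f x + g x)"
proof -
  have "integrable M (\<lambda>x. (f x)\<^sup>2 + (g x)\<^sup>2 + 2 * (f x * g x))"
    using assms square_integrable_times[OF assms] by (auto simp: square_integrable_def)
  then show ?thesis using assms by (auto simp: square_integrable_def power2_sum mult.assoc)
qed

lemma square_integrable_mult: "square_integrable M f \<Longrightarrow> square_integrable M (\<lambda>x. c * f x)"
  by (auto simp: square_integrable_def power_mult_distrib)

lemma square_integrable_diff:
  assumes "square_integrable M f" "square_integrable M g"
  shows "square_integrable M (\<lambda>x. f x - g x)"
  using square_integrable_add[OF assms(1) square_integrable_mult[OF assms(2), of "-1"]] by simp

lemma square_integrable_sum:
  assumes "\<And>i. i \<in> I \<Longrightarrow> square_integrable M (f i)"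
  shows "square_integrable M (\<lambda>x. \<Sum>i\<in>I. f i x)"
  using assms
  by (induction I rule: infinite_finite_induct) (auto intro: square_integrable_add, auto simp: square_integrable_def)

lemma square_integrable_bound:
  assumes "square_integrable M g" "f \<in> borel_measurable M" "\<And>x. x \<in> space M \<Longrightarrow> \<bar>f x\<bar> \<le> \<bar>g x\<bar>"
  shows "square_integrable M f"
proof -
  have "integrable M (\<lambda>x. (f x)\<^sup>2)"
  proof (rule Bochner_Integration.integrable_bound)
    show "integrable M (\<lambda>x. (g x)\<^sup>2)" using assms by (simp add: square_integrable_def)
    show "AE x in M. norm ((f x)\<^sup>2) \<le> norm ((g x)\<^sup>2)"
      using assms(3) by (intro AE_I2) (simp add: abs_le_square_iff)
  qed (use assms in measurable)
  with assms show ?thesis by (simp add: square_integrable_def)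
qed

lemma (in finite_measure) square_integrable_const: "square_integrable M (\<lambda>x. c)"
  by (simp add: square_integrable_def)

lemma (in finite_measure) square_integrable_bounded:
  assumes "f \<in> borel_measurable M" "\<And>x. x \<in> space M \<Longrightarrow> \<bar>f x\<bar> \<le> C"
  shows "square_integrable M f"
proof (rule square_integrable_bound[OF square_integrable_const[of C] assms(1)])
  show "\<bar>f x\<bar> \<le> \<bar>C\<bar>" if "x \<in> space M" for x using assms(2)[OF that] by linarith
qed

lemma (in finite_measure) square_integrable_integrable:
  assumes "square_integrable M f" shows "integrable M f"
  using square_integrable_times[OF square_integrable_const[of 1] assms] by simp

lemma square_integrable_bounded_mult:
  assumes "square_integrable M g" "f \<in> borel_measurable M" "\<And>x. x \<in> space M \<Longrightarrow> \<bar>f x\<bar> \<le> C"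
  shows "square_integrable M (\<lambda>x. f x * g x)"
proof (rule square_integrable_bound[OF square_integrable_mult[OF assms(1), of C]])
  fix x assume x: "x \<in> space M"
  have "\<bar>f x\<bar> * \<bar>g x\<bar> \<le> \<bar>C\<bar> * \<bar>g x\<bar>" using assms(3)[OF x] by (intro mult_right_mono) auto
  then show "\<bar>f x * g x\<bar> \<le> \<bar>C * g x\<bar>" by (simp add: abs_mult)
qed (use assms in measurable)

lemma borel_measurable_vec_nth [measurable (raw)]:
  fixes f :: "'a \<Rightarrow> real^'d"
  assumes "f \<in> borel_measurable M"
  shows "(\<lambda>x. f x $ i) \<in> borel_measurable M"
  using measurable_compose[OF assms, of "\<lambda>v. v $ i" borel]
  by (simp add: borel_measurable_continuous_onI continuous_intros)

section \<open>Normal variables as scaled standard normal variables\<close>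

lemma (in prob_space) normal_gauss_distr:
  assumes "distributed M lborel X (normal_density 0 \<sigma>)" "\<sigma> > 0"
  shows "distr M borel (\<lambda>\<omega>. X \<omega> / \<sigma>) = gauss" "X \<in> borel_measurable M"
proof -
  have d: "distributed M lborel (\<lambda>x. X x / \<sigma>) std_normal_density"
    using normal_standard_normal_convert[of \<sigma> X 0] assms by simp
  from distributed_distr_eq_density[OF d] show "distr M borel (\<lambda>\<omega>. X \<omega> / \<sigma>) = gauss"
    by (simp cong: distr_cong)
  show "X \<in> borel_measurable M" using distributed_measurable[OF assms(1)] by simp
qed

lemma (in prob_space) normal_expectation:
  fixes k :: "real \<Rightarrow> real"
  assumes X: "distributed M lborel X (normal_density 0 \<sigma>)" "\<sigma> > 0" and [measurable]: "k \<in> borel_measurable borel"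
  shows "expectation (\<lambda>\<omega>. k (X \<omega>)) = (LINT y|gauss. k (\<sigma> * y))"
    and "integrable M (\<lambda>\<omega>. k (X \<omega>)) \<longleftrightarrow> integrable gauss (\<lambda>y. k (\<sigma> * y))"
proof -
  note g = normal_gauss_distr[OF X]
  have [measurable]: "X \<in> borel_measurable M" by (rule g)
  show "expectation (\<lambda>\<omega>. k (X \<omega>)) = (LINT y|gauss. k (\<sigma> * y))"
    unfolding g(1)[symmetric] using X(2) by (subst integral_distr) auto
  show "integrable M (\<lambda>\<omega>. k (X \<omega>)) \<longleftrightarrow> integrable gauss (\<lambda>y. k (\<sigma> * y))"
    unfolding g(1)[symmetric] using X(2) by (subst integrable_distr_eq) auto
qed

lemma (in prob_space) normal_pair_expectation:
  fixes k :: "real \<Rightarrow> real \<Rightarrow> real"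
  assumes X: "distributed M lborel X (normal_density 0 \<sigma>)" "\<sigma> > 0"
    and Y: "distributed M lborel Y (normal_density 0 \<tau>)" "\<tau> > 0"
    and ind: "indep_var borel X borel Y"
    and [measurable]: "(\<lambda>p. k (fst p) (snd p)) \<in> borel_measurable (borel \<Otimes>\<^sub>M borel)"
  shows "expectation (\<lambda>\<omega>. k (X \<omega>) (Y \<omega>)) = (LINT p|(gauss \<Otimes>\<^sub>M gauss). k (\<sigma> * fst p) (\<tau> * snd p))"
proof -
  note g = normal_gauss_distr[OF X] normal_gauss_distr[OF Y]
  have [measurable]: "X \<in> borel_measurable M" "Y \<in> borel_measurable M" by (rule g)+
  have "indep_var borel ((\<lambda>x. x / \<sigma>) \<circ> X) borel ((\<lambda>x. x / \<tau>) \<circ> Y)"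
    by (rule indep_var_compose[OF ind]) measurable
  then have "distr M (borel \<Otimes>\<^sub>M borel) (\<lambda>\<omega>. (X \<omega> / \<sigma>, Y \<omega> / \<tau>)) = gauss \<Otimes>\<^sub>M gauss"
    unfolding indep_var_distribution_eq comp_def g(1,3) by simp
  then have "(LINT p|(gauss \<Otimes>\<^sub>M gauss). k (\<sigma> * fst p) (\<tau> * snd p))
      = (LINT p|(distr M (borel \<Otimes>\<^sub>M borel) (\<lambda>\<omega>. (X \<omega> / \<sigma>, Y \<omega> / \<tau>))). k (\<sigma> * fst p) (\<tau> * snd p))" by simp
  also have "\<dots> = expectation (\<lambda>\<omega>. k (X \<omega>) (Y \<omega>))"
  proof (subst integral_distr)
    have "(\<lambda>p. (\<sigma> * fst p, \<tau> * snd p)) \<in> measurable (borel \<Otimes>\<^sub>M borel) (borel \<Otimes>\<^sub>M borel)" by measurable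
    from measurable_compose[OF this assms(6)]
    show "(\<lambda>p. k (\<sigma> * fst p) (\<tau> * snd p)) \<in> borel_measurable (borel \<Otimes>\<^sub>M borel)" by simp
  qed (use X(2) Y(2) in auto)
  finally show ?thesis by simp
qed

section \<open>Increments of the driving motion and of the coordinate sum\<close>

locale brownian_setup = prob_space M for M :: "'w measure" +
  fixes F :: "real \<Rightarrow> 'w measure" and T :: real and W :: "real \<Rightarrow> 'w \<Rightarrow> real^'d" and X0 :: "'w \<Rightarrow> real^'d"
  assumes T: "T > 0" and filt: "filtration (space M) F" and sub: "\<And>t. subalgebra M (F t)"
    and bm: "brownian_motion M F T W"
    and X0F: "X0 \<in> borel_measurable (F 0)" and X0i: "integrable M (\<lambda>\<omega>. (norm (X0 \<omega>))\<^sup>2)"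
begin

definition d :: real where "d = real CARD('d)"

definition Dl :: "real \<Rightarrow> real \<Rightarrow> 'd \<Rightarrow> 'w \<Rightarrow> real" where "Dl a b l \<omega> = (W b \<omega> - W a \<omega>) $ l"

definition DS :: "real \<Rightarrow> real \<Rightarrow> 'w \<Rightarrow> real" where "DS a b \<omega> = (\<Sum>l\<in>UNIV. Dl a b l \<omega>)"

text \<open>The coordinate sum of the forward process X0 + W of the test problem. Its increment over
  an interval of length h is centred normal with variance d h.\<close>

definition S :: "real \<Rightarrow> 'w \<Rightarrow> real" where "S t \<omega> = (\<Sum>l\<in>UNIV. (X0 \<omega> + W t \<omega>) $ l)"

lemma d_pos: "d > 0" unfolding d_def by simp

lemma F_mono: "s \<le> t \<Longrightarrow> f \<in> measurable (F s) N \<Longrightarrow> f \<in> measurable (F t) N"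
  using filtration.sets_F_mono[OF filt] filtration.space_F[OF filt]
  by (rule_tac measurable_from_subalg[of "F t" "F s"]) (auto simp: subalgebra_def)

lemma F_M: "f \<in> measurable (F s) N \<Longrightarrow> f \<in> measurable M N"
  by (rule measurable_from_subalg[OF sub])

lemma space_F: "space (F t) = space M" using filtration.space_F[OF filt] by simp

lemma W_F: "t \<in> {0..T} \<Longrightarrow> W t \<in> borel_measurable (F t)"
  using bm by (simp add: brownian_motion_def)

lemma W_M: "t \<in> {0..T} \<Longrightarrow> W t \<in> borel_measurable M"
  using W_F F_M by blast

lemma Dl_F: "a \<in> {0..T} \<Longrightarrow> b \<in> {0..T} \<Longrightarrow> a \<le> c \<Longrightarrow> b \<le> c \<Longrightarrow> Dl a b l \<in> borel_measurable (F c)"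
  unfolding Dl_def using F_mono[OF _ W_F[of a], of c] F_mono[OF _ W_F[of b], of c] by simp measurable

lemma Dl_M: "a \<in> {0..T} \<Longrightarrow> b \<in> {0..T} \<Longrightarrow> Dl a b l \<in> borel_measurable M"
  using Dl_F[of a b "max a b"] F_M by auto

lemma DS_F: "a \<in> {0..T} \<Longrightarrow> b \<in> {0..T} \<Longrightarrow> a \<le> c \<Longrightarrow> b \<le> c \<Longrightarrow> DS a b \<in> borel_measurable (F c)"
  unfolding DS_def using Dl_F[of a b c] by measurable

lemma DS_M: "a \<in> {0..T} \<Longrightarrow> b \<in> {0..T} \<Longrightarrow> DS a b \<in> borel_measurable M"
  using DS_F[of a b "max a b"] F_M by auto

lemma S_F: "t \<in> {0..T} \<Longrightarrow> t \<le> c \<Longrightarrow> S t \<in> borel_measurable (F c)"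
proof -
  assume t: "t \<in> {0..T}" "t \<le> c"
  have [measurable]: "X0 \<in> borel_measurable (F c)" "W t \<in> borel_measurable (F c)"
    using F_mono[OF _ X0F, of c] F_mono[OF t(2) W_F] t by auto
  show ?thesis unfolding S_def by measurable
qed

lemma S_M: "t \<in> {0..T} \<Longrightarrow> S t \<in> borel_measurable M" using S_F[of t t] F_M by auto

lemma S_DS: "S b \<omega> = S a \<omega> + DS a b \<omega>"
  by (simp add: S_def DS_def Dl_def sum.distrib sum_subtractf)

lemma Dl_refl [simp]: "Dl a a l \<omega> = 0" by (simp add: Dl_def)

lemma Dl_normal:
  assumes "0 \<le> a" "a < b" "b \<le> T"
  shows "distributed M lborel (Dl a b l) (normal_density 0 (sqrt (b - a)))"
  using bm assms unfolding brownian_motion_def Dl_def by blast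

lemma Dl_indep:
  assumes "0 \<le> a" "a < b" "b \<le> T"
  shows "indep_vars (\<lambda>_. borel) (\<lambda>l. Dl a b l) UNIV"
  using bm assms unfolding brownian_motion_def Dl_def by blast

lemma sum_Dl_normal:
  assumes "0 \<le> a" "a < b" "b \<le> T" "I \<noteq> {}"
  shows "distributed M lborel (\<lambda>\<omega>. \<Sum>l\<in>I. Dl a b l \<omega>) (normal_density 0 (sqrt (real (card I) * (b - a))))"
proof -
  have "distributed M lborel (\<lambda>\<omega>. \<Sum>l\<in>I. Dl a b l \<omega>) (normal_density (\<Sum>l\<in>I. 0) (sqrt (\<Sum>l\<in>I. (sqrt (b - a))\<^sup>2)))"
  proof (rule sum_indep_normal)
    show "indep_vars (\<lambda>i. borel) (\<lambda>l. Dl a b l) I" by (rule indep_vars_subset[OF Dl_indep[OF assms(1-3)]]) simp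
  qed (use assms Dl_normal in auto)
  then show ?thesis using assms by simp
qed

lemma DS_normal:
  assumes "0 \<le> a" "a < b" "b \<le> T"
  shows "distributed M lborel (DS a b) (normal_density 0 (sqrt (d * (b - a))))"
  using sum_Dl_normal[OF assms, of UNIV] unfolding DS_def d_def by simp

lemma DS_plain:
  assumes "0 \<le> a" "a \<le> b" "b \<le> T" and v: "lin_growth v"
  shows "expectation (\<lambda>\<omega>. v (x + DS a b \<omega>)) = heat (d * (b - a)) v x"
proof (cases "a = b")
  case True then show ?thesis using prob_space by (simp add: DS_def)
next
  case False
  with assms have ab: "a < b" by simp
  note [measurable] = lin_growth_measurable[OF v]
  show ?thesis unfolding heat_def
    by (rule normal_expectation(1)[OF DS_normal, of a b "\<lambda>y. v (x + y)"]) (use assms ab d_pos in auto)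
qed

text \<open>The weight is the increment of one coordinate, while v sees the sum of all. The other d
  - 1 coordinates form an independent normal variable; averaging over it replaces v by a
  \<open>heat\<close> average, and the semigroup law restores the full variance d (b - a).\<close>

lemma DS_weight:
  assumes "0 \<le> a" "a < b" "b \<le> T" and v: "lin_growth v"
  shows "expectation (\<lambda>\<omega>. Dl a b l \<omega> * v (x + DS a b \<omega>)) = (b - a) * heatd (d * (b - a)) v x"
proof -
  note [measurable] = lin_growth_measurable[OF v]
  let ?\<sigma> = "sqrt (b - a)"
  have \<sigma>: "?\<sigma> > 0" using assms by simp
  have \<sigma>2: "?\<sigma> * ?\<sigma> = b - a" using assms by simp
  define R where "R \<omega> = (\<Sum>m\<in>UNIV - {l}. Dl a b m \<omega>)" for \<omega>
  have DSR: "DS a b \<omega> = Dl a b l \<omega> + R \<omega>" for \<omega> unfolding DS_def R_def by (simp add: sum.remove)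
  have basic: "(LINT y|gauss. ?\<sigma> * y * w (x + ?\<sigma> * y)) = (b - a) * heatd (b - a) w x" for w
  proof -
    have "(LINT y|gauss. ?\<sigma> * y * w (x + ?\<sigma> * y)) = ?\<sigma> * (LINT y|gauss. y * w (x + ?\<sigma> * y))"
      by (simp add: mult.assoc)
    also have "\<dots> = ?\<sigma> * ?\<sigma> * ((LINT y|gauss. y * w (x + ?\<sigma> * y)) / ?\<sigma>)"
    proof -
      have "u * A = u * u * (A / u)" if "u > 0" for u A :: real using that by simp
      from this[OF \<sigma>] show ?thesis .
    qed
    finally show ?thesis unfolding \<sigma>2 heatd_def .
  qed
  show ?thesis
  \<comment> \<open>In dimension one the remainder R is zero and has no normal density.\<close>
  proof (cases "UNIV - {l} = {}")
    case True
    then have "R \<omega> = 0" for \<omega> unfolding R_def by (simp only: sum.empty)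
    moreover have "UNIV = {l}" using True by auto
    then have "d = 1" unfolding d_def by (metis card_1_singleton_iff One_nat_def of_nat_1)
    ultimately show ?thesis
      using normal_expectation(1)[OF Dl_normal[OF assms(1-3)] \<sigma>, of "\<lambda>y. y * v (x + y)" l] basic[of v]
      by (simp add: DSR)
  next
    case False
    let ?n = "card (UNIV - {l})"
    have n: "?n > 0" unfolding card_gt_0_iff by (rule conjI[OF False]) simp
    have dn: "real ?n + 1 = d"
    proof -
      have "CARD('d) = Suc ?n" by (rule card.remove) auto
      then show ?thesis unfolding d_def by (simp only: of_nat_Suc add.commute)
    qed
    let ?\<tau> = "sqrt (real ?n * (b - a))"
    have \<tau>: "?\<tau> > 0" using n assms by simp
    have RN: "distributed M lborel R (normal_density 0 ?\<tau>)"
      using sum_Dl_normal[OF assms(1-3) False] unfolding R_def .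
    have ind: "indep_var borel (Dl a b l) borel R"
      unfolding R_def using Dl_indep[OF assms(1-3)] by (intro indep_vars_sum) (auto simp: insert_UNIV)
    have "expectation (\<lambda>\<omega>. Dl a b l \<omega> * v (x + DS a b \<omega>)) = expectation (\<lambda>\<omega>. Dl a b l \<omega> * v (x + Dl a b l \<omega> + R \<omega>))"
      by (simp add: DSR add.assoc)
    also have "\<dots> = (LINT p|(gauss \<Otimes>\<^sub>M gauss). ?\<sigma> * fst p * v (x + ?\<sigma> * fst p + ?\<tau> * snd p))"
      by (rule normal_pair_expectation[OF Dl_normal[OF assms(1-3)] \<sigma> RN \<tau> ind, of "\<lambda>y z. y * v (x + y + z)"]) measurable
    also have "\<dots> = (LINT y1|gauss. LINT y2|gauss. ?\<sigma> * y1 * v (x + ?\<sigma> * y1 + ?\<tau> * y2))"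
    proof -
      have "integrable (gauss \<Otimes>\<^sub>M gauss) (\<lambda>p. ?\<sigma> * (fst p ^ 1 * snd p ^ 0 * v (x + ?\<sigma> * fst p + ?\<tau> * snd p)))"
        by (intro integrable_mult_right growth_integrable2[OF v])
      then have "integrable (gauss \<Otimes>\<^sub>M gauss) (\<lambda>p. ?\<sigma> * fst p * v (x + ?\<sigma> * fst p + ?\<tau> * snd p))"
        by (simp add: mult.assoc)
      from gauss2.integral_fst'[OF this] show ?thesis by simp
    qed
    also have "\<dots> = (LINT y|gauss. ?\<sigma> * y * heat (real ?n * (b - a)) v (x + ?\<sigma> * y))"
      by (simp add: heat_def)
    also have "\<dots> = (b - a) * heatd (b - a) (heat (real ?n * (b - a)) v) x" by (rule basic)
    also have "heatd (b - a) (heat (real ?n * (b - a)) v) = heatd (d * (b - a)) v"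
    proof -
      have nn: "real ?n * (b - a) \<ge> 0" using assms(2) by (intro mult_nonneg_nonneg) auto
      have eq: "real ?n * (b - a) + (b - a) = d * (b - a)" unfolding dn[symmetric] by (simp only: distrib_right mult_1)
      show ?thesis using heatd_heat[OF v nn, of "b - a"] assms(2) unfolding eq by (simp only: diff_gt_0_iff_gt)
    qed
    finally show ?thesis .
  qed
qed

lemma incr_distr:
  assumes ab: "0 \<le> a" "a < b" "b \<le> T" and \<xi>: "\<xi> \<in> measurable (F a) N"
  shows "distr M N \<xi> \<Otimes>\<^sub>M distr M borel (\<lambda>\<omega>. W b \<omega> - W a \<omega>)
    = distr M (N \<Otimes>\<^sub>M borel) (\<lambda>\<omega>. (\<xi> \<omega>, W b \<omega> - W a \<omega>))"
proof -
  let ?D = "\<lambda>\<omega>. W b \<omega> - W a \<omega>"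
  have [measurable]: "\<xi> \<in> measurable M N" "W a \<in> borel_measurable M" "W b \<in> borel_measurable M"
    using F_M[OF \<xi>] W_M[of a] W_M[of b] ab by auto
  interpret N1: prob_space "distr M N \<xi>" by (rule prob_space_distr) measurable
  interpret N2: prob_space "distr M borel ?D" by (rule prob_space_distr) measurable
  have ind: "indep_set (sets (F a)) {?D -` A \<inter> space M | A. A \<in> sets borel}"
    using bm ab unfolding brownian_motion_def by blast
  show ?thesis
  proof (rule pair_measure_eqI)
    fix A B assume A: "A \<in> sets (distr M N \<xi>)" and B: "B \<in> sets (distr M borel ?D)"
    have "\<xi> -` A \<inter> space M \<in> sets (F a)" using measurable_sets[OF \<xi>, of A] A by (simp add: space_F)
    with ind B have "prob ((\<xi> -` A \<inter> space M) \<inter> (?D -` B \<inter> space M)) = prob (\<xi> -` A \<inter> space M) * prob (?D -` B \<inter> space M)"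
      by (intro indep_setD[OF ind]) auto
    moreover have "(\<lambda>\<omega>. (\<xi> \<omega>, ?D \<omega>)) -` (A \<times> B) \<inter> space M = (\<xi> -` A \<inter> space M) \<inter> (?D -` B \<inter> space M)" by auto
    ultimately show "emeasure (distr M N \<xi>) A * emeasure (distr M borel ?D) B
        = emeasure (distr M (N \<Otimes>\<^sub>M borel) (\<lambda>\<omega>. (\<xi> \<omega>, ?D \<omega>))) (A \<times> B)"
      using A B by (simp add: emeasure_distr emeasure_eq_measure ennreal_mult'[symmetric] measure_nonneg)
  qed (auto intro!: sets_pair_measure_cong N1.sigma_finite_measure_axioms N2.sigma_finite_measure_axioms)
qed

text \<open>Fubini on the product law of past and increment: the past variable may be frozen.
  Conditional expectations are treated in this tested form until the final comparison with
  \<open>real_cond_exp\<close>.\<close>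

lemma expectation_indep_incr:
  fixes g :: "'n \<times> (real^'d) \<Rightarrow> real"
  assumes ab: "0 \<le> a" "a < b" "b \<le> T" and \<xi>: "\<xi> \<in> measurable (F a) N"
    and g[measurable]: "g \<in> borel_measurable (N \<Otimes>\<^sub>M borel)"
    and i: "integrable M (\<lambda>\<omega>. g (\<xi> \<omega>, W b \<omega> - W a \<omega>))"
  shows "expectation (\<lambda>\<omega>. g (\<xi> \<omega>, W b \<omega> - W a \<omega>)) = expectation (\<lambda>\<omega>. expectation (\<lambda>\<omega>'. g (\<xi> \<omega>, W b \<omega>' - W a \<omega>')))"
proof -
  let ?D = "\<lambda>\<omega>. W b \<omega> - W a \<omega>"
  have [measurable]: "\<xi> \<in> measurable M N" "W a \<in> borel_measurable M" "W b \<in> borel_measurable M"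
    using F_M[OF \<xi>] W_M[of a] W_M[of b] ab by auto
  note eq = incr_distr[OF ab \<xi>]
  interpret N1: prob_space "distr M N \<xi>" by (rule prob_space_distr) measurable
  interpret N2: prob_space "distr M borel ?D" by (rule prob_space_distr) measurable
  interpret P: pair_prob_space "distr M N \<xi>" "distr M borel ?D" ..
  have i': "integrable (distr M N \<xi> \<Otimes>\<^sub>M distr M borel ?D) g"
    unfolding eq using i by (subst integrable_distr_eq) auto
  have "expectation (\<lambda>\<omega>. g (\<xi> \<omega>, ?D \<omega>)) = integral\<^sup>L (distr M (N \<Otimes>\<^sub>M borel) (\<lambda>\<omega>. (\<xi> \<omega>, ?D \<omega>))) g"
    by (subst integral_distr) auto
  also have "\<dots> = (LINT y|(distr M N \<xi>). LINT z|(distr M borel ?D). g (y, z))"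
    unfolding eq[symmetric] using P.integral_fst'[OF i'] by simp
  also have "\<dots> = (LINT y|(distr M N \<xi>). expectation (\<lambda>\<omega>'. g (y, ?D \<omega>')))"
    by (intro Bochner_Integration.integral_cong refl) (subst integral_distr, auto)
  also have "\<dots> = expectation (\<lambda>\<omega>. expectation (\<lambda>\<omega>'. g (\<xi> \<omega>, ?D \<omega>')))"
    by (subst integral_distr) auto
  finally show ?thesis .
qed

lemma expectation_mult_incr:
  fixes \<xi> :: "'w \<Rightarrow> real" and k :: "real^'d \<Rightarrow> real"
  assumes ab: "0 \<le> a" "a < b" "b \<le> T" and \<xi>: "\<xi> \<in> borel_measurable (F a)"
    and [measurable]: "k \<in> borel_measurable borel"
    and i: "integrable M (\<lambda>\<omega>. \<xi> \<omega> * k (W b \<omega> - W a \<omega>))"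
  shows "expectation (\<lambda>\<omega>. \<xi> \<omega> * k (W b \<omega> - W a \<omega>)) = expectation \<xi> * expectation (\<lambda>\<omega>. k (W b \<omega> - W a \<omega>))"
  using expectation_indep_incr[OF ab \<xi>, of "\<lambda>(y, z). y * k z"] i by simp

lemma Dl_square_integrable:
  assumes "a \<in> {0..T}" "b \<in> {0..T}"
  shows "square_integrable M (Dl a b l)"
proof -
  have *: "square_integrable M (Dl a b l)" if "0 \<le> a" "a < b" "b \<le> T" for a b
    using normal_expectation(2)[OF Dl_normal[OF that], of "\<lambda>y. y\<^sup>2" l] that Dl_M[of a b l]
      integrable_std_normal_distribution_moment[of 2]
    by (simp add: square_integrable_def power_mult_distrib)
  have neg: "Dl a b l = (\<lambda>\<omega>. (-1) * Dl b a l \<omega>)" by (auto simp: Dl_def)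
  consider "a < b" | "a = b" | "b < a" by linarith
  then show ?thesis
  proof cases
    case 1 then show ?thesis using *[of a b] assms by auto
  next
    case 2 then show ?thesis using square_integrable_const[of 0] by (simp add: Dl_def[abs_def])
  next
    case 3 then show ?thesis unfolding neg using assms by (intro square_integrable_mult *) auto
  qed
qed

lemma Dl_moments:
  assumes "0 \<le> a" "a \<le> b" "b \<le> T"
  shows "expectation (Dl a b l) = 0"
    and "expectation (\<lambda>\<omega>. Dl a b l \<omega> * Dl a b m \<omega>) = (if l = m then b - a else 0)"
proof -
  have m0: "(LINT y|gauss. y) = 0" using integral_std_normal_distribution_moment_odd[of 1] by simp
  have m2: "(LINT y|gauss. y * y) = 1" using std_normal_distribution_even_moments(1)[of 1] by (simp add: power2_eq_square)
  show 0: "expectation (Dl a b l) = 0"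
  proof (cases "a = b")
    case False
    then have ab: "a < b" using assms by simp
    from normal_expectation(1)[OF Dl_normal[OF assms(1) ab assms(3)], of "\<lambda>y. y" l] ab m0 show ?thesis by simp
  qed (simp add: Dl_def[abs_def])
  show "expectation (\<lambda>\<omega>. Dl a b l \<omega> * Dl a b m \<omega>) = (if l = m then b - a else 0)"
  proof (cases "a = b")
    case False
    then have ab: "a < b" using assms by simp
    note N = Dl_normal[OF assms(1) ab assms(3)]
    show ?thesis
    proof (cases "l = m")
      case True
      have "(LINT y|gauss. sqrt (b - a) * y * (sqrt (b - a) * y)) = (LINT y|gauss. (b - a) * (y * y))"
        using ab by (intro Bochner_Integration.integral_cong) (auto simp: algebra_simps)
      then show ?thesis
        using normal_expectation(1)[OF N, of "\<lambda>y. y * y" l] ab True m2 by simp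
    next
      case False
      have "indep_var borel (Dl a b l) borel (\<lambda>\<omega>. \<Sum>i\<in>{m}. Dl a b i \<omega>)"
        using False by (intro indep_vars_sum indep_vars_subset[OF Dl_indep[OF assms(1) ab assms(3)]]) auto
      then have ind: "indep_var borel (Dl a b l) borel (Dl a b m)" by simp
      have "expectation (\<lambda>\<omega>. Dl a b l \<omega> * Dl a b m \<omega>) = expectation (Dl a b l) * expectation (Dl a b m)"
        using Dl_square_integrable[of a b] assms
        by (intro indep_var_lebesgue_integral[OF ind] square_integrable_integrable) auto
      then show ?thesis using 0 False by simp
    qed
  qed simp
qed

lemma S0_square_integrable: "square_integrable M (S 0)"
proof -
  have X0M: "X0 \<in> borel_measurable M" using X0F F_M by blast
  have "square_integrable M (\<lambda>\<omega>. X0 \<omega> $ l)" for l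
  proof (rule square_integrable_bound)
    show "square_integrable M (\<lambda>\<omega>. norm (X0 \<omega>))" using X0M X0i by (simp add: square_integrable_def)
    show "\<bar>X0 \<omega> $ l\<bar> \<le> \<bar>norm (X0 \<omega>)\<bar>" for \<omega> using component_le_norm_cart[of "X0 \<omega>" l] by simp
  qed (use X0M in measurable)
  then have 1: "square_integrable M (\<lambda>\<omega>. \<Sum>l\<in>UNIV. X0 \<omega> $ l)" by (rule square_integrable_sum)
  have W0: "W 0 \<omega> = 0" if "\<omega> \<in> space M" for \<omega> using bm that unfolding brownian_motion_def by blast
  have 2: "S 0 \<omega> = (\<Sum>l\<in>UNIV. X0 \<omega> $ l)" if "\<omega> \<in> space M" for \<omega>
    using W0[OF that] by (simp add: S_def)
  show ?thesis
  proof (rule square_integrable_bound[OF 1])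
    show "S 0 \<in> borel_measurable M" using S_M[of 0] T by simp
    show "\<bar>S 0 \<omega>\<bar> \<le> \<bar>\<Sum>l\<in>UNIV. X0 \<omega> $ l\<bar>" if "\<omega> \<in> space M" for \<omega> by (simp only: 2[OF that])
  qed
qed

lemma DS_square_integrable: "a \<in> {0..T} \<Longrightarrow> b \<in> {0..T} \<Longrightarrow> square_integrable M (DS a b)"
  unfolding DS_def[abs_def] by (intro square_integrable_sum Dl_square_integrable)

lemma S_square_integrable:
  assumes "t \<in> {0..T}" shows "square_integrable M (S t)"
proof -
  have "S t = (\<lambda>\<omega>. S 0 \<omega> + DS 0 t \<omega>)" using S_DS by auto
  then show ?thesis using assms T by (auto intro!: square_integrable_add S0_square_integrable DS_square_integrable)
qed

lemma growth_S_square_integrable: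
  assumes v: "lin_growth v" and t: "t \<in> {0..T}"
  shows "square_integrable M (\<lambda>\<omega>. v (S t \<omega>))"
proof -
  note [measurable] = lin_growth_measurable[OF v] S_M[OF t]
  obtain C where C: "C \<ge> 0" "\<And>x. \<bar>v x\<bar> \<le> C * (1 + \<bar>x\<bar>)" using lin_growthE[OF v] by blast
  have "square_integrable M (\<lambda>\<omega>. \<bar>S t \<omega>\<bar>)"
    by (rule square_integrable_bound[OF S_square_integrable[OF t]]) auto
  then have "square_integrable M (\<lambda>\<omega>. C * (1 + \<bar>S t \<omega>\<bar>))"
    by (intro square_integrable_mult square_integrable_add square_integrable_const)
  then show ?thesis
  proof (rule square_integrable_bound)
    show "\<bar>v (S t \<omega>)\<bar> \<le> \<bar>C * (1 + \<bar>S t \<omega>\<bar>)\<bar>" for \<omega> using C(2)[of "S t \<omega>"] by linarith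
  qed measurable
qed

section \<open>The Markov property in weak form\<close>

text \<open>\<xi> and \<open>S a\<close> are frozen together as one past variable. Integrability of
  the product is asked for instead of boundedness of \<xi>, because \<open>cond_heatd\<close> uses a
  factor that contains a Brownian increment.\<close>

lemma cond_heat:
  fixes \<xi> :: "'w \<Rightarrow> real"
  assumes ab: "0 \<le> a" "a \<le> b" "b \<le> T" and \<xi>: "\<xi> \<in> borel_measurable (F a)" and v: "lin_growth v"
    and i: "integrable M (\<lambda>\<omega>. \<xi> \<omega> * v (S b \<omega>))"
  shows "expectation (\<lambda>\<omega>. \<xi> \<omega> * v (S b \<omega>)) = expectation (\<lambda>\<omega>. \<xi> \<omega> * heat (d * (b - a)) v (S a \<omega>))"
proof (cases "a = b")
  case False
  then have lt: "a < b" using ab by simp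
  note [measurable] = lin_growth_measurable[OF v]
  let ?g = "\<lambda>p::(real \<times> real) \<times> (real^'d). fst (fst p) * v (snd (fst p) + (\<Sum>l\<in>UNIV. snd p $ l))"
  have eq: "S b \<omega> = S a \<omega> + (\<Sum>l\<in>UNIV. (W b \<omega> - W a \<omega>) $ l)" for \<omega>
    using S_DS[of b \<omega> a] by (simp add: DS_def Dl_def)
  have "(\<lambda>\<omega>. (\<xi> \<omega>, S a \<omega>)) \<in> measurable (F a) (borel \<Otimes>\<^sub>M borel)"
    using \<xi> S_F[of a a] ab by (intro measurable_Pair) auto
  from expectation_indep_incr[OF ab(1) lt ab(3) this, of ?g] i
  have "expectation (\<lambda>\<omega>. \<xi> \<omega> * v (S b \<omega>))
      = expectation (\<lambda>\<omega>. expectation (\<lambda>\<omega>'. \<xi> \<omega> * v (S a \<omega> + (\<Sum>l\<in>UNIV. (W b \<omega>' - W a \<omega>') $ l))))"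
    by (simp add: eq)
  also have "\<dots> = expectation (\<lambda>\<omega>. \<xi> \<omega> * heat (d * (b - a)) v (S a \<omega>))"
    using DS_plain[OF ab v] by (simp add: DS_def Dl_def)
  finally show ?thesis .
qed simp

lemma cond_heatd_step:
  fixes \<xi> :: "'w \<Rightarrow> real"
  assumes ab: "0 \<le> a" "a < b" "b \<le> T" and \<xi>: "\<xi> \<in> borel_measurable (F a)" and v: "lin_growth v"
    and i: "integrable M (\<lambda>\<omega>. \<xi> \<omega> * (Dl a b l \<omega> * v (S b \<omega>)))"
  shows "expectation (\<lambda>\<omega>. \<xi> \<omega> * (Dl a b l \<omega> * v (S b \<omega>)))
    = (b - a) * expectation (\<lambda>\<omega>. \<xi> \<omega> * heatd (d * (b - a)) v (S a \<omega>))"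
proof -
  note [measurable] = lin_growth_measurable[OF v]
  let ?g = "\<lambda>p::(real \<times> real) \<times> (real^'d). fst (fst p) * (snd p $ l * v (snd (fst p) + (\<Sum>l\<in>UNIV. snd p $ l)))"
  have eq: "S b \<omega> = S a \<omega> + (\<Sum>l\<in>UNIV. (W b \<omega> - W a \<omega>) $ l)" for \<omega>
    using S_DS[of b \<omega> a] by (simp add: DS_def Dl_def)
  have "(\<lambda>\<omega>. (\<xi> \<omega>, S a \<omega>)) \<in> measurable (F a) (borel \<Otimes>\<^sub>M borel)"
    using \<xi> S_F[of a a] ab by (intro measurable_Pair) auto
  from expectation_indep_incr[OF ab this, of ?g] i
  have "expectation (\<lambda>\<omega>. \<xi> \<omega> * (Dl a b l \<omega> * v (S b \<omega>)))
      = expectation (\<lambda>\<omega>. expectation (\<lambda>\<omega>'. \<xi> \<omega> * ((W b \<omega>' - W a \<omega>') $ l * v (S a \<omega> + (\<Sum>l\<in>UNIV. (W b \<omega>' - W a \<omega>') $ l)))))"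
    by (simp add: eq Dl_def)
  also have "\<dots> = expectation (\<lambda>\<omega>. \<xi> \<omega> * ((b - a) * heatd (d * (b - a)) v (S a \<omega>)))"
    using DS_weight[OF ab v, of l] by (simp add: DS_def Dl_def)
  also have "\<dots> = (b - a) * expectation (\<lambda>\<omega>. \<xi> \<omega> * heatd (d * (b - a)) v (S a \<omega>))"
    by (subst integral_mult_right_zero[symmetric]) (simp add: mult_ac)
  finally show ?thesis .
qed

text \<open>The weight may be the increment over any subinterval of [t, b], and the result depends
  on that subinterval only through its length: average from b back to r', apply the weight on
  [r, r'], average back to t, and the semigroup laws merge the three variances. Consequently a
  stochastic integral used as a weight will matter only through the integral of its
  integrand.\<close>

lemma cond_heatd:
  fixes \<xi> :: "'w \<Rightarrow> real"
  assumes t: "0 \<le> t" "t \<le> r" "r \<le> r'" "r' \<le> b" "b \<le> T"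
    and \<xi>: "\<xi> \<in> borel_measurable (F t)" and C: "\<And>\<omega>. \<omega> \<in> space M \<Longrightarrow> \<bar>\<xi> \<omega>\<bar> \<le> C" and v: "lin_growth v"
  shows "expectation (\<lambda>\<omega>. \<xi> \<omega> * (Dl r r' l \<omega> * v (S b \<omega>)))
    = (r' - r) * expectation (\<lambda>\<omega>. \<xi> \<omega> * heatd (d * (b - t)) v (S t \<omega>))"
proof (cases "r = r'")
  case False
  then have rr: "r < r'" using t by simp
  have \<xi>M: "\<xi> \<in> borel_measurable M" using \<xi> F_M by blast
  have sD: "square_integrable M (\<lambda>\<omega>. \<xi> \<omega> * Dl r r' l \<omega>)"
    using \<xi>M C t by (intro square_integrable_bounded_mult Dl_square_integrable) auto
  let ?v1 = "heat (d * (b - r')) v"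
  let ?v2 = "heatd (d * (r' - r)) ?v1"
  have v1: "lin_growth ?v1" by (rule lin_growth_heat[OF v])
  have v2: "lin_growth ?v2" by (rule lin_growth_heatd[OF v1])
  have \<xi>r: "\<xi> \<in> borel_measurable (F r)" "\<xi> \<in> borel_measurable (F r')" using F_mono[OF _ \<xi>] t by auto
  have \<xi>sq: "square_integrable M \<xi>" using \<xi>M C by (rule square_integrable_bounded)
  have "expectation (\<lambda>\<omega>. \<xi> \<omega> * (Dl r r' l \<omega> * v (S b \<omega>))) = expectation (\<lambda>\<omega>. \<xi> \<omega> * Dl r r' l \<omega> * v (S b \<omega>))"
    by (simp add: mult.assoc)
  also have "\<dots> = expectation (\<lambda>\<omega>. \<xi> \<omega> * Dl r r' l \<omega> * ?v1 (S r' \<omega>))"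
  proof (rule cond_heat[OF _ t(4,5) _ v])
    show "(\<lambda>\<omega>. \<xi> \<omega> * Dl r r' l \<omega>) \<in> borel_measurable (F r')"
      using \<xi>r(2) Dl_F[of r r' r' l] t by (intro borel_measurable_times) auto
    show "integrable M (\<lambda>\<omega>. \<xi> \<omega> * Dl r r' l \<omega> * v (S b \<omega>))"
      using t by (intro square_integrable_times[OF sD] growth_S_square_integrable[OF v]) auto
  qed (use t in auto)
  also have "\<dots> = expectation (\<lambda>\<omega>. \<xi> \<omega> * (Dl r r' l \<omega> * ?v1 (S r' \<omega>)))" by (simp add: mult.assoc)
  also have "\<dots> = (r' - r) * expectation (\<lambda>\<omega>. \<xi> \<omega> * ?v2 (S r \<omega>))"
  proof (rule cond_heatd_step[OF _ rr _ \<xi>r(1) v1])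
    have "integrable M (\<lambda>\<omega>. \<xi> \<omega> * Dl r r' l \<omega> * ?v1 (S r' \<omega>))"
      using t by (intro square_integrable_times[OF sD] growth_S_square_integrable[OF v1]) auto
    then show "integrable M (\<lambda>\<omega>. \<xi> \<omega> * (Dl r r' l \<omega> * ?v1 (S r' \<omega>)))" by (simp add: mult.assoc)
  qed (use t in auto)
  also have "expectation (\<lambda>\<omega>. \<xi> \<omega> * ?v2 (S r \<omega>)) = expectation (\<lambda>\<omega>. \<xi> \<omega> * heat (d * (r - t)) ?v2 (S t \<omega>))"
    using t by (intro cond_heat[OF _ _ _ \<xi> v2] square_integrable_times[OF \<xi>sq] growth_S_square_integrable[OF v2]) auto
  also have "heat (d * (r - t)) ?v2 = heatd (d * (b - t)) v"
  proof -
    have "?v2 = heatd (d * (b - r)) v"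
      using t rr d_pos by (subst heatd_heat[OF v]) (auto simp: algebra_simps)
    moreover have "heat (d * (r - t)) (heatd (d * (b - r)) v) = heatd (d * (b - t)) v"
      using t rr d_pos by (subst heat_heatd[OF v]) (auto simp: algebra_simps)
    ultimately show ?thesis by simp
  qed
  finally show ?thesis .
qed simp

section \<open>Covariances of increments with adapted coefficients\<close>

lemma Dl_zero:
  assumes ab: "0 \<le> a" "a \<le> b" "b \<le> T" and \<xi>: "\<xi> \<in> borel_measurable (F a)" "square_integrable M \<xi>"
  shows "expectation (\<lambda>\<omega>. \<xi> \<omega> * Dl a b l \<omega>) = 0"
proof (cases "a = b")
  case False
  then have lt: "a < b" using ab by simp
  have "integrable M (\<lambda>\<omega>. \<xi> \<omega> * Dl a b l \<omega>)"
    using ab by (intro square_integrable_times[OF \<xi>(2)] Dl_square_integrable) auto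
  from expectation_mult_incr[OF ab(1) lt ab(3) \<xi>(1), of "\<lambda>z. z $ l"] this Dl_moments(1)[OF ab, of l]
  show ?thesis by (simp add: Dl_def[abs_def])
qed simp

lemma Dl_square_mult:
  assumes ab: "0 \<le> a" "a \<le> b" "b \<le> T" and \<xi>: "\<xi> \<in> borel_measurable (F a)" "\<And>\<omega>. \<omega> \<in> space M \<Longrightarrow> \<bar>\<xi> \<omega>\<bar> \<le> C"
  shows "expectation (\<lambda>\<omega>. \<xi> \<omega> * Dl a b l \<omega> * Dl a b m \<omega>) = (if l = m then expectation \<xi> * (b - a) else 0)"
proof (cases "a = b")
  case False
  then have lt: "a < b" using ab by simp
  have "integrable M (\<lambda>\<omega>. \<xi> \<omega> * Dl a b l \<omega> * Dl a b m \<omega>)"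
    using ab F_M[OF \<xi>(1)] \<xi>(2)
    by (intro square_integrable_times[OF square_integrable_bounded_mult] Dl_square_integrable) auto
  then have "integrable M (\<lambda>\<omega>. \<xi> \<omega> * (Dl a b l \<omega> * Dl a b m \<omega>))" by (simp add: mult.assoc)
  from expectation_mult_incr[OF ab(1) lt ab(3) \<xi>(1), of "\<lambda>z. z $ l * z $ m"] this Dl_moments(2)[OF ab, of l m]
  show ?thesis by (simp add: Dl_def[abs_def] mult.assoc)
qed simp

text \<open>Both increments are cut at the later left end a' and the earlier right end n. A product
  of increments over consecutive pieces vanishes, because the later one is centred given the past;
  the common piece contributes its length, the overlap of the intervals.\<close>

lemma Dl_product_aux:
  assumes ab: "0 \<le> a" "a \<le> b" "b \<le> T" and ab': "0 \<le> a'" "a' \<le> b'" "b' \<le> T" and aa: "a \<le> a'"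
    and p: "p \<in> borel_measurable (F a)" "\<And>\<omega>. \<omega> \<in> space M \<Longrightarrow> \<bar>p \<omega>\<bar> \<le> C"
    and q: "q \<in> borel_measurable (F a')" "\<And>\<omega>. \<omega> \<in> space M \<Longrightarrow> \<bar>q \<omega>\<bar> \<le> C"
  shows "expectation (\<lambda>\<omega>. (p \<omega> * Dl a b l \<omega>) * (q \<omega> * Dl a' b' m \<omega>))
    = (if l = m then expectation (\<lambda>\<omega>. p \<omega> * q \<omega>) * max 0 (min b b' - max a a') else 0)"
proof -
  let ?\<xi> = "\<lambda>\<omega>. p \<omega> * q \<omega>"
  have \<xi>F: "?\<xi> \<in> borel_measurable (F c)" if "a' \<le> c" for c
    using F_mono[OF _ p(1), of c] F_mono[OF _ q(1), of c] aa that by (intro borel_measurable_times) auto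
  have \<xi>M: "?\<xi> \<in> borel_measurable M" using \<xi>F[of a'] F_M by auto
  have \<xi>C: "\<bar>?\<xi> \<omega>\<bar> \<le> C * C" if "\<omega> \<in> space M" for \<omega>
    unfolding abs_mult using p(2)[OF that] q(2)[OF that] abs_ge_zero[of "p \<omega>"] by (intro mult_mono) linarith+
  have sq: "square_integrable M (\<lambda>\<omega>. ?\<xi> \<omega> * Dl r r' k \<omega>)" if "r \<in> {0..T}" "r' \<in> {0..T}" for r r' k
    using that by (intro square_integrable_bounded_mult[OF Dl_square_integrable \<xi>M \<xi>C])
  have sqF: "(\<lambda>\<omega>. ?\<xi> \<omega> * Dl r r' k \<omega>) \<in> borel_measurable (F c)"
    if "r \<in> {0..T}" "r' \<in> {0..T}" "r \<le> c" "r' \<le> c" "a' \<le> c" for r r' k c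
    using that by (intro borel_measurable_times[OF \<xi>F Dl_F])
  show ?thesis
  proof (cases "b \<le> a'")
    case True
    have "expectation (\<lambda>\<omega>. (?\<xi> \<omega> * Dl a b l \<omega>) * Dl a' b' m \<omega>) = 0"
      using ab ab' aa True by (intro Dl_zero[OF ab'] sqF sq) auto
    moreover have "max 0 (min b b' - max a a') = 0" using True aa by simp
    ultimately show ?thesis by (simp add: mult_ac)
  next
    case False
    define n where "n = min b b'"
    have n: "a' \<le> n" "n \<le> b" "n \<le> b'" "n = b \<or> n = b'" using False ab' unfolding n_def by auto
    have e: "(p \<omega> * Dl a b l \<omega>) * (q \<omega> * Dl a' b' m \<omega>) =
       (?\<xi> \<omega> * Dl a a' l \<omega>) * Dl a' b' m \<omega> + ?\<xi> \<omega> * Dl a' n l \<omega> * Dl a' n m \<omega>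
       + (?\<xi> \<omega> * Dl a' n l \<omega>) * Dl n b' m \<omega> + (?\<xi> \<omega> * Dl a' n m \<omega>) * Dl n b l \<omega>" for \<omega>
    proof -
      have 1: "Dl a b l \<omega> = Dl a a' l \<omega> + (Dl a' n l \<omega> + Dl n b l \<omega>)" by (simp add: Dl_def)
      have 2: "Dl a' b' m \<omega> = Dl a' n m \<omega> + Dl n b' m \<omega>" by (simp add: Dl_def)
      \<comment> \<open>At most one interval extends beyond n, so one of the two right-hand pieces
        is empty.\<close>
      have 3: "Dl n b l \<omega> * Dl n b' m \<omega> = 0" using n(4) by auto
      have "(p \<omega> * Dl a b l \<omega>) * (q \<omega> * Dl a' b' m \<omega>)
        = (?\<xi> \<omega> * Dl a a' l \<omega>) * Dl a' b' m \<omega> + ?\<xi> \<omega> * ((Dl a' n l \<omega> + Dl n b l \<omega>) * (Dl a' n m \<omega> + Dl n b' m \<omega>))"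
        unfolding 1 by (simp add: 2 algebra_simps)
      also have "(Dl a' n l \<omega> + Dl n b l \<omega>) * (Dl a' n m \<omega> + Dl n b' m \<omega>)
        = Dl a' n l \<omega> * Dl a' n m \<omega> + Dl a' n l \<omega> * Dl n b' m \<omega> + Dl n b l \<omega> * Dl a' n m \<omega>"
        using 3 by (simp add: algebra_simps)
      finally show ?thesis by (simp add: algebra_simps)
    qed
    have i: "integrable M (\<lambda>\<omega>. (?\<xi> \<omega> * Dl r r' k \<omega>) * Dl u u' k' \<omega>)"
      if "r \<in> {0..T}" "r' \<in> {0..T}" "u \<in> {0..T}" "u' \<in> {0..T}" for r r' u u' k k'
      using that by (intro square_integrable_times sq Dl_square_integrable)
    have z: "expectation (\<lambda>\<omega>. (?\<xi> \<omega> * Dl a a' l \<omega>) * Dl a' b' m \<omega>) = 0"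
      "expectation (\<lambda>\<omega>. (?\<xi> \<omega> * Dl a' n l \<omega>) * Dl n b' m \<omega>) = 0"
      "expectation (\<lambda>\<omega>. (?\<xi> \<omega> * Dl a' n m \<omega>) * Dl n b l \<omega>) = 0"
      using ab ab' aa n by (auto intro!: Dl_zero sqF sq)
    have "expectation (\<lambda>\<omega>. ?\<xi> \<omega> * Dl a' n l \<omega> * Dl a' n m \<omega>) = (if l = m then expectation ?\<xi> * (n - a') else 0)"
      using ab ab' n by (intro Dl_square_mult[OF _ _ _ \<xi>F \<xi>C]) auto
    moreover have "max 0 (min b b' - max a a') = n - a'" using n aa unfolding n_def by auto
    ultimately show ?thesis
      unfolding e using ab ab' aa n
      by (subst Bochner_Integration.integral_add | simp add: z i)+
  qed
qed

lemma Dl_product: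
  assumes ab: "0 \<le> a" "a \<le> b" "b \<le> T" and ab': "0 \<le> a'" "a' \<le> b'" "b' \<le> T"
    and p: "p \<in> borel_measurable (F a)" "\<And>\<omega>. \<omega> \<in> space M \<Longrightarrow> \<bar>p \<omega>\<bar> \<le> C"
    and q: "q \<in> borel_measurable (F a')" "\<And>\<omega>. \<omega> \<in> space M \<Longrightarrow> \<bar>q \<omega>\<bar> \<le> C"
  shows "expectation (\<lambda>\<omega>. (p \<omega> * Dl a b l \<omega>) * (q \<omega> * Dl a' b' m \<omega>))
    = (if l = m then expectation (\<lambda>\<omega>. p \<omega> * q \<omega>) * max 0 (min b b' - max a a') else 0)"
proof (cases "a \<le> a'")
  case True then show ?thesis using Dl_product_aux[OF ab ab' True p q] by simp
next
  case False
  then have "a' \<le> a" by simp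
  from Dl_product_aux[OF ab' ab this q p, of m l] show ?thesis
    by (simp add: mult_ac min.commute max.commute eq_commute[of l m])
qed

end

section \<open>The Ito integral\<close>

text \<open>The Lebesgue counterpart of \<open>Dl_product\<close>: both produce the overlap length,
  and this agreement is the Ito isometry.\<close>

lemma indicator_overlap:
  fixes a b a' b' :: real
  assumes "a \<le> b" "a' \<le> b'"
  shows "integrable lborel (\<lambda>r. indicator {a<..b} r * indicator {a'<..b'} r :: real)"
    and "(LINT r|lborel. indicator {a<..b} r * indicator {a'<..b'} r) = max 0 (min b b' - max a a')"
proof -
  have e: "(\<lambda>r. indicator {a<..b} r * indicator {a'<..b'} r :: real) = indicator {max a a'<..min b b'}"
    by (auto simp: indicator_def fun_eq_iff)
  show "integrable lborel (\<lambda>r. indicator {a<..b} r * indicator {a'<..b'} r :: real)"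
    unfolding e by (cases "max a a' \<le> min b b'") (auto simp: integrable_indicator_iff)
  show "(LINT r|lborel. indicator {a<..b} r * indicator {a'<..b'} r) = max 0 (min b b' - max a a')"
    unfolding e by (cases "max a a' \<le> min b b'") (auto simp: max_def min_def)
qed

lemma L2sq_eq:
  assumes "square_integrable M f"
  shows "L2sq M f = ennreal (LINT x|M. (f x)\<^sup>2)"
  using assms unfolding L2sq_def square_integrable_def by (subst nn_integral_eq_integral) auto

lemma L2sq_add_le:
  fixes f g :: "'a \<Rightarrow> real"
  assumes [measurable]: "f \<in> borel_measurable M" "g \<in> borel_measurable M"
  shows "L2sq M (\<lambda>x. f x + g x) \<le> 2 * L2sq M f + 2 * L2sq M g"
proof -
  have "L2sq M (\<lambda>x. f x + g x) \<le> (\<integral>\<^sup>+x. 2 * ennreal ((norm (f x))\<^sup>2) + 2 * ennreal ((norm (g x))\<^sup>2) \<partial>M)"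
    unfolding L2sq_def
  proof (rule nn_integral_mono)
    fix x
    have "0 \<le> (f x - g x)\<^sup>2" by simp
    then have "(norm (f x + g x))\<^sup>2 \<le> 2 * (norm (f x))\<^sup>2 + 2 * (norm (g x))\<^sup>2"
      by (simp add: power2_sum power2_diff)
    then have "ennreal ((norm (f x + g x))\<^sup>2) \<le> ennreal (2 * (norm (f x))\<^sup>2 + 2 * (norm (g x))\<^sup>2)"
      by (rule ennreal_leI)
    also have "\<dots> = 2 * ennreal ((norm (f x))\<^sup>2) + 2 * ennreal ((norm (g x))\<^sup>2)"
      by (simp add: ennreal_plus ennreal_mult')
    finally show "ennreal ((norm (f x + g x))\<^sup>2) \<le> 2 * ennreal ((norm (f x))\<^sup>2) + 2 * ennreal ((norm (g x))\<^sup>2)" .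
  qed
  also have "\<dots> = 2 * L2sq M f + 2 * L2sq M g"
    unfolding L2sq_def by (simp add: nn_integral_add nn_integral_cmult)
  finally show ?thesis .
qed

lemma square_integrable_L2sq:
  fixes f :: "'a \<Rightarrow> real"
  assumes "f \<in> borel_measurable M" "L2sq M f < \<infinity>"
  shows "square_integrable M f"
  using assms unfolding square_integrable_def L2sq_def by (auto simp: integrable_iff_bounded)

lemma integral_sum2:
  fixes f :: "'i \<Rightarrow> 'j \<Rightarrow> 'a \<Rightarrow> real"
  assumes "\<And>k k'. k \<in> A \<Longrightarrow> k' \<in> B \<Longrightarrow> integrable M (f k k')"
  shows "(LINT x|M. (\<Sum>k\<in>A. \<Sum>k'\<in>B. f k k' x)) = (\<Sum>k\<in>A. \<Sum>k'\<in>B. LINT x|M. f k k' x)"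
proof -
  have "(LINT x|M. (\<Sum>k\<in>A. \<Sum>k'\<in>B. f k k' x)) = (\<Sum>k\<in>A. LINT x|M. (\<Sum>k'\<in>B. f k k' x))"
    by (rule Bochner_Integration.integral_sum) (auto intro!: Bochner_Integration.integrable_sum assms)
  also have "\<dots> = (\<Sum>k\<in>A. \<Sum>k'\<in>B. LINT x|M. f k k' x)"
    by (intro sum.cong refl Bochner_Integration.integral_sum) (auto intro!: assms)
  finally show ?thesis .
qed

section \<open>Isometry for simple integrands and independence of the approximating sequence\<close>

context brownian_setup
begin

lemma simple_integrandD:
  assumes "simple_integrand M F r1 r2 n s \<xi>" "k < n"
  shows "r1 \<le> s k" "s k \<le> s (Suc k)" "s (Suc k) \<le> r2" "\<xi> k \<in> borel_measurable (F (s k))"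
  using assms unfolding simple_integrand_def by auto

lemma simple_integrand_bound:
  assumes "simple_integrand M F r1 r2 n s \<xi>"
  obtains C where "\<And>k l \<omega>. k < n \<Longrightarrow> \<omega> \<in> space M \<Longrightarrow> \<bar>\<xi> k \<omega> $ l\<bar> \<le> C"
proof -
  have "\<exists>C. \<forall>\<omega>\<in>space M. norm (\<xi> k \<omega>) \<le> C" if "k < n" for k
    using assms that unfolding simple_integrand_def bounded_iff by auto
  then obtain C where C: "\<And>k \<omega>. k < n \<Longrightarrow> \<omega> \<in> space M \<Longrightarrow> norm (\<xi> k \<omega>) \<le> C k" by metis
  have "\<bar>\<xi> k \<omega> $ l\<bar> \<le> (\<Sum>k<n. \<bar>C k\<bar>)" if "k < n" "\<omega> \<in> space M" for k l \<omega>
  proof -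
    have "\<bar>\<xi> k \<omega> $ l\<bar> \<le> norm (\<xi> k \<omega>)" by (rule component_le_norm_cart)
    also have "\<dots> \<le> \<bar>C k\<bar>" using C[OF that] by linarith
    also have "\<dots> \<le> (\<Sum>k<n. \<bar>C k\<bar>)" using that by (intro member_le_sum) auto
    finally show ?thesis .
  qed
  then show ?thesis using that by blast
qed

lemma simple_ito_Dl: "simple_ito W n s \<xi> \<omega> = (\<Sum>k<n. \<Sum>l\<in>UNIV. \<xi> k \<omega> $ l * Dl (s k) (s (Suc k)) l \<omega>)"
  by (simp add: simple_ito_def inner_vec_def Dl_def)

lemma simple_process_inner:
  "simple_process n s \<xi> r \<omega> \<bullet> simple_process n' s' \<xi>' r \<omega>
    = (\<Sum>k<n. \<Sum>k'<n'. (\<xi> k \<omega> \<bullet> \<xi>' k' \<omega>) * (indicator {s k<..s (Suc k)} r * indicator {s' k'<..s' (Suc k')} r))"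
  unfolding simple_process_def inner_sum_left inner_sum_right
  by (subst sum.swap) (simp add: mult_ac)

text \<open>The isometry in polarised form for two integrands on unrelated grids. By bilinearity it
  is enough to compare each pair of cells, so no common refinement has to be formed.\<close>

lemma simple_cross:
  assumes r: "0 \<le> r1" "r2 \<le> T" and s: "simple_integrand M F r1 r2 n s \<xi>" and s': "simple_integrand M F r1 r2 n' s' \<xi>'"
  shows "square_integrable M (simple_ito W n s \<xi>)"
    and "integrable lborel (\<lambda>r. simple_process n s \<xi> r \<omega> \<bullet> simple_process n' s' \<xi>' r \<omega>)" (is ?i1)
    and "integrable M (\<lambda>\<omega>. LINT r|lborel. simple_process n s \<xi> r \<omega> \<bullet> simple_process n' s' \<xi>' r \<omega>)" (is ?i2)
    and "expectation (\<lambda>\<omega>. simple_ito W n s \<xi> \<omega> * simple_ito W n' s' \<xi>' \<omega>)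
      = expectation (\<lambda>\<omega>. LINT r|lborel. simple_process n s \<xi> r \<omega> \<bullet> simple_process n' s' \<xi>' r \<omega>)" (is ?e)
proof -
  note D = simple_integrandD[OF s] and D' = simple_integrandD[OF s']
  obtain C1 where C1: "\<And>k l \<omega>. k < n \<Longrightarrow> \<omega> \<in> space M \<Longrightarrow> \<bar>\<xi> k \<omega> $ l\<bar> \<le> C1" using simple_integrand_bound[OF s] by blast
  obtain C2 where C2: "\<And>k l \<omega>. k < n' \<Longrightarrow> \<omega> \<in> space M \<Longrightarrow> \<bar>\<xi>' k \<omega> $ l\<bar> \<le> C2" using simple_integrand_bound[OF s'] by blast
  define C where "C = max C1 C2"
  have C: "\<And>k l \<omega>. k < n \<Longrightarrow> \<omega> \<in> space M \<Longrightarrow> \<bar>\<xi> k \<omega> $ l\<bar> \<le> C"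
    "\<And>k l \<omega>. k < n' \<Longrightarrow> \<omega> \<in> space M \<Longrightarrow> \<bar>\<xi>' k \<omega> $ l\<bar> \<le> C"
    using C1 C2 unfolding C_def by (auto intro: max.coboundedI1 max.coboundedI2)
  have F\<xi>: "(\<lambda>\<omega>. \<xi> k \<omega> $ l) \<in> borel_measurable (F (s k))" if "k < n" for k l
    using D(4)[OF that] by measurable
  have F\<xi>': "(\<lambda>\<omega>. \<xi>' k \<omega> $ l) \<in> borel_measurable (F (s' k))" if "k < n'" for k l
    using D'(4)[OF that] by measurable
  have sq: "square_integrable M (\<lambda>\<omega>. \<xi> k \<omega> $ l * Dl (s k) (s (Suc k)) l \<omega>)" if "k < n" for k l
    using D[OF that] r F_M[OF F\<xi>[OF that]] C that
    by (intro square_integrable_bounded_mult[where C=C] Dl_square_integrable) auto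
  have sq': "square_integrable M (\<lambda>\<omega>. \<xi>' k \<omega> $ l * Dl (s' k) (s' (Suc k)) l \<omega>)" if "k < n'" for k l
    using D'[OF that] r F_M[OF F\<xi>'[OF that]] C that
    by (intro square_integrable_bounded_mult[where C=C] Dl_square_integrable) auto
  show "square_integrable M (simple_ito W n s \<xi>)"
    unfolding simple_ito_Dl[abs_def] using sq by (intro square_integrable_sum) auto
  let ?ov = "\<lambda>k k'. max 0 (min (s (Suc k)) (s' (Suc k')) - max (s k) (s' k'))"
  show i1: ?i1 for \<omega>
    unfolding simple_process_inner using D D'
    by (intro Bochner_Integration.integrable_sum integrable_mult_right indicator_overlap) auto
  have inn: "(LINT r|lborel. simple_process n s \<xi> r \<omega> \<bullet> simple_process n' s' \<xi>' r \<omega>)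
      = (\<Sum>k<n. \<Sum>k'<n'. (\<xi> k \<omega> \<bullet> \<xi>' k' \<omega>) * ?ov k k')" for \<omega>
  proof -
    have *: "integrable lborel (\<lambda>r. (\<xi> k \<omega> \<bullet> \<xi>' k' \<omega>) * (indicator {s k<..s (Suc k)} r * indicator {s' k'<..s' (Suc k')} r))"
      if "k < n" "k' < n'" for k k'
      using D[OF that(1)] D'[OF that(2)] by (intro integrable_mult_right indicator_overlap) auto
    have "(LINT r|lborel. simple_process n s \<xi> r \<omega> \<bullet> simple_process n' s' \<xi>' r \<omega>)
        = (\<Sum>k<n. \<Sum>k'<n'. LINT r|lborel. (\<xi> k \<omega> \<bullet> \<xi>' k' \<omega>) * (indicator {s k<..s (Suc k)} r * indicator {s' k'<..s' (Suc k')} r))"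
      unfolding simple_process_inner by (rule integral_sum2, rule *) auto
    also have "\<dots> = (\<Sum>k<n. \<Sum>k'<n'. (\<xi> k \<omega> \<bullet> \<xi>' k' \<omega>) * ?ov k k')"
      using D D' by (intro sum.cong refl) (simp add: indicator_overlap)
    finally show ?thesis .
  qed
  have bi: "integrable M (\<lambda>\<omega>. \<xi> k \<omega> $ l * \<xi>' k' \<omega> $ l)" if "k < n" "k' < n'" for k k' l
    using F_M[OF F\<xi>[OF that(1)]] F_M[OF F\<xi>'[OF that(2)]] C that
    by (intro square_integrable_times square_integrable_bounded[where C=C]) auto
  have bi2: "integrable M (\<lambda>\<omega>. \<xi> k \<omega> \<bullet> \<xi>' k' \<omega>)" if "k < n" "k' < n'" for k k'
    unfolding inner_vec_def inner_real_def using bi[OF that] by (intro Bochner_Integration.integrable_sum) auto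
  show ?i2 unfolding inn using bi2 by (intro Bochner_Integration.integrable_sum integrable_mult_left) auto
  have "expectation (\<lambda>\<omega>. simple_ito W n s \<xi> \<omega> * simple_ito W n' s' \<xi>' \<omega>)
      = expectation (\<lambda>\<omega>. \<Sum>k<n. \<Sum>k'<n'. \<Sum>l\<in>UNIV. \<Sum>m\<in>UNIV.
         (\<xi> k \<omega> $ l * Dl (s k) (s (Suc k)) l \<omega>) * (\<xi>' k' \<omega> $ m * Dl (s' k') (s' (Suc k')) m \<omega>))"
  proof -
    have "simple_ito W n s \<xi> \<omega> * simple_ito W n' s' \<xi>' \<omega> = (\<Sum>k<n. \<Sum>k'<n'. \<Sum>l\<in>UNIV. \<Sum>m\<in>UNIV.
         (\<xi> k \<omega> $ l * Dl (s k) (s (Suc k)) l \<omega>) * (\<xi>' k' \<omega> $ m * Dl (s' k') (s' (Suc k')) m \<omega>))" for \<omega>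
      unfolding simple_ito_Dl sum_product by simp
    then show ?thesis by simp
  qed
  also have "\<dots> = (\<Sum>k<n. \<Sum>k'<n'. \<Sum>l\<in>UNIV. \<Sum>m\<in>UNIV. expectation (\<lambda>\<omega>.
         (\<xi> k \<omega> $ l * Dl (s k) (s (Suc k)) l \<omega>) * (\<xi>' k' \<omega> $ m * Dl (s' k') (s' (Suc k')) m \<omega>)))"
  proof -
    let ?f = "\<lambda>k k' l m \<omega>. (\<xi> k \<omega> $ l * Dl (s k) (s (Suc k)) l \<omega>) * (\<xi>' k' \<omega> $ m * Dl (s' k') (s' (Suc k')) m \<omega>)"
    have int: "integrable M (?f k k' l m)" if "k \<in> {..<n}" "k' \<in> {..<n'}" for k k' l m
      using that by (intro square_integrable_times sq sq') auto
    have "expectation (\<lambda>\<omega>. \<Sum>k<n. \<Sum>k'<n'. \<Sum>l\<in>UNIV. \<Sum>m\<in>UNIV. ?f k k' l m \<omega>)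
        = (\<Sum>k<n. \<Sum>k'<n'. expectation (\<lambda>\<omega>. \<Sum>l\<in>UNIV. \<Sum>m\<in>UNIV. ?f k k' l m \<omega>))"
      by (rule integral_sum2) (intro Bochner_Integration.integrable_sum int)
    also have "\<dots> = (\<Sum>k<n. \<Sum>k'<n'. \<Sum>l\<in>UNIV. \<Sum>m\<in>UNIV. expectation (?f k k' l m))"
      by (intro sum.cong refl integral_sum2 int)
    finally show ?thesis .
  qed
  also have "\<dots> = (\<Sum>k<n. \<Sum>k'<n'. \<Sum>l\<in>UNIV. \<Sum>m\<in>UNIV. if l = m then expectation (\<lambda>\<omega>. \<xi> k \<omega> $ l * \<xi>' k' \<omega> $ m) * ?ov k k' else 0)"
  proof (intro sum.cong refl)
    fix k k' l m assume "k \<in> {..<n}" "k' \<in> {..<n'}"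
    then show "expectation (\<lambda>\<omega>. (\<xi> k \<omega> $ l * Dl (s k) (s (Suc k)) l \<omega>) * (\<xi>' k' \<omega> $ m * Dl (s' k') (s' (Suc k')) m \<omega>))
      = (if l = m then expectation (\<lambda>\<omega>. \<xi> k \<omega> $ l * \<xi>' k' \<omega> $ m) * ?ov k k' else 0)"
      using D[of k] D'[of k'] r F\<xi>[of k l] F\<xi>'[of k' m] C
      by (intro Dl_product[where C=C]) auto
  qed
  also have "\<dots> = (\<Sum>k<n. \<Sum>k'<n'. \<Sum>l\<in>UNIV. expectation (\<lambda>\<omega>. \<xi> k \<omega> $ l * \<xi>' k' \<omega> $ l) * ?ov k k')"
    by simp
  also have "\<dots> = (\<Sum>k<n. \<Sum>k'<n'. expectation (\<lambda>\<omega>. \<xi> k \<omega> \<bullet> \<xi>' k' \<omega>) * ?ov k k')"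
    unfolding inner_vec_def inner_real_def using bi
    by (simp add: Bochner_Integration.integral_sum sum_distrib_right)
  also have "\<dots> = expectation (\<lambda>\<omega>. \<Sum>k<n. \<Sum>k'<n'. (\<xi> k \<omega> \<bullet> \<xi>' k' \<omega>) * ?ov k k')"
    by (subst integral_sum2, rule integrable_mult_left, rule bi2) auto
  also have "\<dots> = expectation (\<lambda>\<omega>. LINT r|lborel. simple_process n s \<xi> r \<omega> \<bullet> simple_process n' s' \<xi>' r \<omega>)"
    by (simp add: inn)
  finally show ?e .
qed

lemma simple_process_outside:
  assumes "simple_integrand M F r1 r2 n s \<xi>" "r \<notin> {r1..r2}"
  shows "simple_process n s \<xi> r \<omega> = 0"
  unfolding simple_process_def
proof (rule sum.neutral, rule ballI)
  fix k assume "k \<in> {..<n}"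
  then show "indicator {s k<..s (Suc k)} r *\<^sub>R \<xi> k \<omega> = 0"
    using simple_integrandD(1,3)[OF assms(1), of k] assms(2) by (auto simp: indicator_def)
qed

text \<open>The difference of two simple processes on different grids is not presented as one simple
  process, so the square is expanded and \<open>simple_cross\<close> applied to each of the three
  terms.\<close>

lemma simple_isometry:
  assumes r: "0 \<le> r1" "r2 \<le> T" and s: "simple_integrand M F r1 r2 n s \<xi>" and s': "simple_integrand M F r1 r2 n' s' \<xi>'"
  shows "L2sq M (\<lambda>\<omega>. simple_ito W n s \<xi> \<omega> - simple_ito W n' s' \<xi>' \<omega>)
    = (\<integral>\<^sup>+\<omega>. (\<integral>\<^sup>+r\<in>{r1..r2}. ennreal ((norm (simple_process n s \<xi> r \<omega> - simple_process n' s' \<xi>' r \<omega>))\<^sup>2) \<partial>lborel) \<partial>M)"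
proof -
  let ?A = "simple_ito W n s \<xi>" and ?B = "simple_ito W n' s' \<xi>'"
  let ?P = "simple_process n s \<xi>" and ?Q = "simple_process n' s' \<xi>'"
  note ss = simple_cross[OF r s s] and ss' = simple_cross[OF r s s'] and s's' = simple_cross[OF r s' s']
  have sqd: "square_integrable M (\<lambda>\<omega>. ?A \<omega> - ?B \<omega>)" by (rule square_integrable_diff[OF ss(1) s's'(1)])
  have n2: "(norm (?P r \<omega> - ?Q r \<omega>))\<^sup>2 = ?P r \<omega> \<bullet> ?P r \<omega> - 2 * (?P r \<omega> \<bullet> ?Q r \<omega>) + ?Q r \<omega> \<bullet> ?Q r \<omega>" for r \<omega>
    by (simp add: power2_norm_eq_inner inner_diff_left inner_diff_right inner_commute)
  have inner: "(\<integral>\<^sup>+r\<in>{r1..r2}. ennreal ((norm (?P r \<omega> - ?Q r \<omega>))\<^sup>2) \<partial>lborel)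
      = ennreal ((LINT r|lborel. ?P r \<omega> \<bullet> ?P r \<omega>) - 2 * (LINT r|lborel. ?P r \<omega> \<bullet> ?Q r \<omega>) + (LINT r|lborel. ?Q r \<omega> \<bullet> ?Q r \<omega>))" for \<omega>
  proof -
    have "(\<integral>\<^sup>+r\<in>{r1..r2}. ennreal ((norm (?P r \<omega> - ?Q r \<omega>))\<^sup>2) \<partial>lborel) = (\<integral>\<^sup>+r. ennreal ((norm (?P r \<omega> - ?Q r \<omega>))\<^sup>2) \<partial>lborel)"
      using simple_process_outside[OF s] simple_process_outside[OF s']
      by (intro nn_integral_cong) (auto simp: indicator_def)
    also have "\<dots> = ennreal (LINT r|lborel. (norm (?P r \<omega> - ?Q r \<omega>))\<^sup>2)"
    proof (rule nn_integral_eq_integral)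
      show "integrable lborel (\<lambda>r. (norm (?P r \<omega> - ?Q r \<omega>))\<^sup>2)"
        unfolding n2 using ss(2)[of \<omega>] ss'(2)[of \<omega>] s's'(2)[of \<omega>] by simp
    qed simp
    also have "(LINT r|lborel. (norm (?P r \<omega> - ?Q r \<omega>))\<^sup>2)
        = (LINT r|lborel. ?P r \<omega> \<bullet> ?P r \<omega>) - 2 * (LINT r|lborel. ?P r \<omega> \<bullet> ?Q r \<omega>) + (LINT r|lborel. ?Q r \<omega> \<bullet> ?Q r \<omega>)"
      unfolding n2 using ss(2)[of \<omega>] ss'(2)[of \<omega>] s's'(2)[of \<omega>] by simp
    finally show ?thesis .
  qed
  have nonneg: "0 \<le> (LINT r|lborel. ?P r \<omega> \<bullet> ?P r \<omega>) - 2 * (LINT r|lborel. ?P r \<omega> \<bullet> ?Q r \<omega>) + (LINT r|lborel. ?Q r \<omega> \<bullet> ?Q r \<omega>)" for \<omega>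
  proof -
    have "0 \<le> (LINT r|lborel. (norm (?P r \<omega> - ?Q r \<omega>))\<^sup>2)" by (rule Bochner_Integration.integral_nonneg) simp
    also have "\<dots> = (LINT r|lborel. ?P r \<omega> \<bullet> ?P r \<omega>) - 2 * (LINT r|lborel. ?P r \<omega> \<bullet> ?Q r \<omega>) + (LINT r|lborel. ?Q r \<omega> \<bullet> ?Q r \<omega>)"
      unfolding n2 using ss(2)[of \<omega>] ss'(2)[of \<omega>] s's'(2)[of \<omega>] by simp
    finally show ?thesis .
  qed
  have "expectation (\<lambda>\<omega>. (?A \<omega> - ?B \<omega>)\<^sup>2) = expectation (\<lambda>\<omega>. ?A \<omega> * ?A \<omega> - 2 * (?A \<omega> * ?B \<omega>) + ?B \<omega> * ?B \<omega>)"
    by (intro Bochner_Integration.integral_cong) (auto simp: power2_eq_square algebra_simps)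
  also have "\<dots> = expectation (\<lambda>\<omega>. ?A \<omega> * ?A \<omega>) - 2 * expectation (\<lambda>\<omega>. ?A \<omega> * ?B \<omega>) + expectation (\<lambda>\<omega>. ?B \<omega> * ?B \<omega>)"
    using square_integrable_times[OF ss(1) ss(1)] square_integrable_times[OF ss(1) s's'(1)] square_integrable_times[OF s's'(1) s's'(1)]
    by simp
  also have "\<dots> = expectation (\<lambda>\<omega>. (LINT r|lborel. ?P r \<omega> \<bullet> ?P r \<omega>) - 2 * (LINT r|lborel. ?P r \<omega> \<bullet> ?Q r \<omega>) + (LINT r|lborel. ?Q r \<omega> \<bullet> ?Q r \<omega>))"
    unfolding ss(4) ss'(4) s's'(4) using ss(3) ss'(3) s's'(3) by simp
  finally have e: "expectation (\<lambda>\<omega>. (?A \<omega> - ?B \<omega>)\<^sup>2) = \<dots>" .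
  show ?thesis
    unfolding L2sq_eq[OF sqd] e inner using ss(3) ss'(3) s's'(3) nonneg
    by (subst nn_integral_eq_integral) auto
qed

lemma simple_process_measurable:
  assumes "simple_integrand M F r1 r2 n s \<xi>"
  shows "(\<lambda>(\<omega>, r). simple_process n s \<xi> r \<omega>) \<in> borel_measurable (M \<Otimes>\<^sub>M lborel)"
proof -
  have "(\<lambda>x. indicator {s k<..s (Suc k)} (snd x) *\<^sub>R \<xi> k (fst x)) \<in> borel_measurable (M \<Otimes>\<^sub>M lborel)" if "k < n" for k
  proof -
    have [measurable]: "\<xi> k \<in> borel_measurable M" using simple_integrandD(4)[OF assms that] F_M by blast
    show ?thesis by measurable
  qed
  then show ?thesis
    unfolding simple_process_def case_prod_beta by (intro borel_measurable_sum) auto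
qed

definition sq_dist :: "real \<Rightarrow> real \<Rightarrow> (real \<Rightarrow> real^'d) \<Rightarrow> nat \<Rightarrow> (nat \<Rightarrow> real) \<Rightarrow> (nat \<Rightarrow> 'w \<Rightarrow> real^'d) \<Rightarrow> ennreal" where
  "sq_dist r1 r2 \<phi> n s \<xi> = (\<integral>\<^sup>+\<omega>. (\<integral>\<^sup>+r\<in>{r1..r2}. ennreal ((norm (\<phi> r - simple_process n s \<xi> r \<omega>))\<^sup>2) \<partial>lborel) \<partial>M)"

lemma simple_sq_dist:
  assumes r: "0 \<le> r1" "r2 \<le> T" and s: "simple_integrand M F r1 r2 n s \<xi>" and s': "simple_integrand M F r1 r2 n' s' \<xi>'"
    and [measurable]: "\<phi> \<in> borel_measurable borel"
  shows "L2sq M (\<lambda>\<omega>. simple_ito W n s \<xi> \<omega> - simple_ito W n' s' \<xi>' \<omega>)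
    \<le> 2 * sq_dist r1 r2 \<phi> n s \<xi> + 2 * sq_dist r1 r2 \<phi> n' s' \<xi>'"
proof -
  let ?P = "simple_process n s \<xi>" and ?Q = "simple_process n' s' \<xi>'"
  have [measurable]: "(\<lambda>(\<omega>, r). ?P r \<omega>) \<in> borel_measurable (M \<Otimes>\<^sub>M lborel)"
    "(\<lambda>(\<omega>, r). ?Q r \<omega>) \<in> borel_measurable (M \<Otimes>\<^sub>M lborel)"
    using simple_process_measurable s s' by blast+
  have 1: "(norm (x - y))\<^sup>2 \<le> 2 * (norm (z - x))\<^sup>2 + 2 * (norm (z - y))\<^sup>2" for x y z :: "real^'d"
  proof -
    have "norm (x - y) \<le> norm (z - x) + norm (z - y)" by (metis norm_minus_commute norm_triangle_sub add.commute dist_norm dist_triangle3)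
    then have "(norm (x - y))\<^sup>2 \<le> (norm (z - x) + norm (z - y))\<^sup>2" by (intro power_mono) auto
    moreover have "0 \<le> (norm (z - x) - norm (z - y))\<^sup>2" by simp
    ultimately show ?thesis by (simp add: power2_sum power2_diff)
  qed
  have "L2sq M (\<lambda>\<omega>. simple_ito W n s \<xi> \<omega> - simple_ito W n' s' \<xi>' \<omega>)
      = (\<integral>\<^sup>+\<omega>. (\<integral>\<^sup>+r\<in>{r1..r2}. ennreal ((norm (?P r \<omega> - ?Q r \<omega>))\<^sup>2) \<partial>lborel) \<partial>M)"
    by (rule simple_isometry[OF r s s'])
  also have "\<dots> \<le> (\<integral>\<^sup>+\<omega>. (\<integral>\<^sup>+r. 2 * (ennreal ((norm (\<phi> r - ?P r \<omega>))\<^sup>2) * indicator {r1..r2} r)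
      + 2 * (ennreal ((norm (\<phi> r - ?Q r \<omega>))\<^sup>2) * indicator {r1..r2} r) \<partial>lborel) \<partial>M)"
  proof (intro nn_integral_mono)
    fix \<omega> r
    have "ennreal ((norm (?P r \<omega> - ?Q r \<omega>))\<^sup>2) \<le> ennreal (2 * (norm (\<phi> r - ?P r \<omega>))\<^sup>2 + 2 * (norm (\<phi> r - ?Q r \<omega>))\<^sup>2)"
      by (intro ennreal_leI 1)
    also have "\<dots> = 2 * ennreal ((norm (\<phi> r - ?P r \<omega>))\<^sup>2) + 2 * ennreal ((norm (\<phi> r - ?Q r \<omega>))\<^sup>2)"
      by (simp add: ennreal_plus ennreal_mult')
    finally show "ennreal ((norm (?P r \<omega> - ?Q r \<omega>))\<^sup>2) * indicator {r1..r2} r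
      \<le> 2 * (ennreal ((norm (\<phi> r - ?P r \<omega>))\<^sup>2) * indicator {r1..r2} r)
      + 2 * (ennreal ((norm (\<phi> r - ?Q r \<omega>))\<^sup>2) * indicator {r1..r2} r)"
      by (auto simp: indicator_def)
  qed
  also have "\<dots> = (\<integral>\<^sup>+\<omega>. 2 * (\<integral>\<^sup>+r\<in>{r1..r2}. ennreal ((norm (\<phi> r - ?P r \<omega>))\<^sup>2) \<partial>lborel)
      + 2 * (\<integral>\<^sup>+r\<in>{r1..r2}. ennreal ((norm (\<phi> r - ?Q r \<omega>))\<^sup>2) \<partial>lborel) \<partial>M)"
  proof (rule nn_integral_cong)
    fix \<omega> assume [measurable]: "\<omega> \<in> space M"
    show "(\<integral>\<^sup>+r. 2 * (ennreal ((norm (\<phi> r - ?P r \<omega>))\<^sup>2) * indicator {r1..r2} r)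
      + 2 * (ennreal ((norm (\<phi> r - ?Q r \<omega>))\<^sup>2) * indicator {r1..r2} r) \<partial>lborel)
      = 2 * (\<integral>\<^sup>+r\<in>{r1..r2}. ennreal ((norm (\<phi> r - ?P r \<omega>))\<^sup>2) \<partial>lborel)
      + 2 * (\<integral>\<^sup>+r\<in>{r1..r2}. ennreal ((norm (\<phi> r - ?Q r \<omega>))\<^sup>2) \<partial>lborel)"
      by (subst nn_integral_add, measurable) (simp add: nn_integral_cmult)
  qed
  also have "\<dots> = 2 * sq_dist r1 r2 \<phi> n s \<xi> + 2 * sq_dist r1 r2 \<phi> n' s' \<xi>'"
    unfolding sq_dist_def by (subst nn_integral_add, measurable) (simp add: nn_integral_cmult)
  finally show ?thesis .
qed

text \<open>The definition supplies some approximating sequence, possibly a random one. By the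
  isometry every other sequence that approximates the integrand yields the same integral, so a
  convenient deterministic step sequence may be chosen.\<close>

lemma ito_limit:
  assumes r: "0 \<le> r1" "r2 \<le> T" and I: "has_ito_integral M F W (\<lambda>r _. \<phi> r) r1 r2 I"
    and [measurable]: "\<phi> \<in> borel_measurable borel"
    and s: "\<And>q::nat. simple_integrand M F r1 r2 (n q) (s q) (\<xi> q)"
    and lim: "(\<lambda>q. sq_dist r1 r2 \<phi> (n q) (s q) (\<xi> q)) \<longlonglongrightarrow> 0"
  shows "(\<lambda>q. L2sq M (\<lambda>\<omega>. I \<omega> - simple_ito W (n q) (s q) (\<xi> q) \<omega>)) \<longlonglongrightarrow> 0"
proof -
  obtain n' s' \<xi>' where s': "\<And>p::nat. simple_integrand M F r1 r2 (n' p) (s' p) (\<xi>' p)"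
    and l1: "(\<lambda>p. sq_dist r1 r2 \<phi> (n' p) (s' p) (\<xi>' p)) \<longlonglongrightarrow> 0"
    and l2: "(\<lambda>p. L2sq M (\<lambda>\<omega>. I \<omega> - simple_ito W (n' p) (s' p) (\<xi>' p) \<omega>)) \<longlonglongrightarrow> 0"
    using I unfolding has_ito_integral_def sq_dist_def by blast
  have [measurable]: "I \<in> borel_measurable M" using I unfolding has_ito_integral_def by blast
  have [measurable]: "simple_ito W (n q) (s q) (\<xi> q) \<in> borel_measurable M" for q
    using simple_cross(1)[OF r s s[of q]] by (simp add: square_integrable_def)
  have [measurable]: "simple_ito W (n' q) (s' q) (\<xi>' q) \<in> borel_measurable M" for q
    using simple_cross(1)[OF r s' s'[of q]] by (simp add: square_integrable_def)
  let ?a = "\<lambda>p. L2sq M (\<lambda>\<omega>. I \<omega> - simple_ito W (n' p) (s' p) (\<xi>' p) \<omega>)"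
  let ?E' = "\<lambda>p. sq_dist r1 r2 \<phi> (n' p) (s' p) (\<xi>' p)" and ?E = "\<lambda>q. sq_dist r1 r2 \<phi> (n q) (s q) (\<xi> q)"
  \<comment> \<open>The index p runs along the sequence from the definition and is sent to infinity
    with q fixed. The 4 comes from two uses of (a + b)^2 <= 2 a^2 + 2 b^2.\<close>
  have "L2sq M (\<lambda>\<omega>. I \<omega> - simple_ito W (n q) (s q) (\<xi> q) \<omega>) \<le> 4 * ?E q" for q
  proof (rule LIMSEQ_le_const)
    have "(\<lambda>p. 2 * ?a p + (4 * ?E' p + 4 * ?E q)) \<longlonglongrightarrow> 2 * 0 + (4 * 0 + 4 * ?E q)"
      by (intro tendsto_add ennreal_tendsto_cmult l1 l2 tendsto_const) auto
    then show "(\<lambda>p. 2 * ?a p + (4 * ?E' p + 4 * ?E q)) \<longlonglongrightarrow> 4 * ?E q" by simp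
    have "L2sq M (\<lambda>\<omega>. I \<omega> - simple_ito W (n q) (s q) (\<xi> q) \<omega>) \<le> 2 * ?a p + (4 * ?E' p + 4 * ?E q)" for p
    proof -
      have "L2sq M (\<lambda>\<omega>. I \<omega> - simple_ito W (n q) (s q) (\<xi> q) \<omega>)
        = L2sq M (\<lambda>\<omega>. (I \<omega> - simple_ito W (n' p) (s' p) (\<xi>' p) \<omega>) + (simple_ito W (n' p) (s' p) (\<xi>' p) \<omega> - simple_ito W (n q) (s q) (\<xi> q) \<omega>))"
        by simp
      also have "\<dots> \<le> 2 * ?a p + 2 * L2sq M (\<lambda>\<omega>. simple_ito W (n' p) (s' p) (\<xi>' p) \<omega> - simple_ito W (n q) (s q) (\<xi> q) \<omega>)"
        by (rule L2sq_add_le) measurable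
      also have "\<dots> \<le> 2 * ?a p + 2 * (2 * ?E' p + 2 * ?E q)"
        by (intro add_left_mono mult_left_mono simple_sq_dist[OF r s' s]) auto
      finally show ?thesis by (simp add: distrib_left mult.assoc[symmetric])
    qed
    then show "\<exists>N. \<forall>p\<ge>N. L2sq M (\<lambda>\<omega>. I \<omega> - simple_ito W (n q) (s q) (\<xi> q) \<omega>) \<le> 2 * ?a p + (4 * ?E' p + 4 * ?E q)"
      by blast
  qed
  note le = this
  have lim4: "(\<lambda>q. 4 * ?E q) \<longlonglongrightarrow> 0" using ennreal_tendsto_cmult[OF _ lim, of 4] by simp
  show ?thesis
  proof (rule tendsto_sandwich[OF _ _ tendsto_const lim4])
    show "\<forall>\<^sub>F q in sequentially. 0 \<le> L2sq M (\<lambda>\<omega>. I \<omega> - simple_ito W (n q) (s q) (\<xi> q) \<omega>)" by simp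
    show "\<forall>\<^sub>F q in sequentially. L2sq M (\<lambda>\<omega>. I \<omega> - simple_ito W (n q) (s q) (\<xi> q) \<omega>) \<le> 4 * ?E q"
      by (rule always_eventually, rule allI, rule le)
  qed
qed

end

section \<open>Step functions on uniform grids\<close>

definition grid :: "real \<Rightarrow> real \<Rightarrow> nat \<Rightarrow> nat \<Rightarrow> real" where
  "grid u v N k = u + (v - u) * real k / real N"

definition step_fun :: "(nat \<Rightarrow> real) \<Rightarrow> nat \<Rightarrow> (nat \<Rightarrow> real) \<Rightarrow> real \<Rightarrow> real" where
  "step_fun s N a r = (\<Sum>k<N. a k * indicator {s k<..s (Suc k)} r)"

lemma grid_bounds:
  assumes "u \<le> v" "k \<le> N" "0 < N"
  shows "u \<le> grid u v N k" "grid u v N k \<le> v"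
proof -
  have "0 \<le> (v - u) * real k / real N" using assms by simp
  then show "u \<le> grid u v N k" by (simp add: grid_def)
  have "(v - u) * (real k / real N) \<le> (v - u) * 1" using assms by (intro mult_left_mono) auto
  then show "grid u v N k \<le> v" by (simp add: grid_def)
qed

lemma grid_Suc: "grid u v N (Suc k) - grid u v N k = (v - u) / real N"
  by (simp add: grid_def add_divide_distrib distrib_left)

lemma grid_mono: "u \<le> v \<Longrightarrow> k \<le> k' \<Longrightarrow> grid u v N k \<le> grid u v N k'"
  unfolding grid_def by (intro add_left_mono divide_right_mono mult_left_mono) auto

lemma grid_ends [simp]: "grid u v N 0 = u" "N > 0 \<Longrightarrow> grid u v N N = v"
  by (auto simp: grid_def)

lemma grid_cell:
  assumes "u < r" "r \<le> v" "0 < N"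
  obtains k where "k < N" "grid u v N k < r" "r \<le> grid u v N (Suc k)"
proof -
  define k where "k = (LEAST k. r \<le> grid u v N k)"
  have ex: "r \<le> grid u v N N" using assms by simp
  have k: "r \<le> grid u v N k" unfolding k_def by (rule LeastI[of "\<lambda>k. r \<le> grid u v N k", OF ex])
  have kN: "k \<le> N" unfolding k_def by (rule Least_le[of "\<lambda>k. r \<le> grid u v N k", OF ex])
  have k0: "k \<noteq> 0" using k assms(1) by (intro notI) simp
  then obtain j where j: "k = Suc j" by (cases k) auto
  have "\<not> r \<le> grid u v N j" using not_less_Least[of j "\<lambda>k. r \<le> grid u v N k"] j unfolding k_def by auto
  then show ?thesis using that[of j] k kN j by auto
qed

lemma grid_cell_unique:
  assumes "u \<le> v" "grid u v N k < r" "r \<le> grid u v N (Suc k)" "grid u v N j < r" "r \<le> grid u v N (Suc j)"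
  shows "k = j"
proof (rule ccontr)
  assume "k \<noteq> j"
  then consider "Suc k \<le> j" | "Suc j \<le> k" by linarith
  then show False using grid_mono[OF assms(1), of "Suc k" j N] grid_mono[OF assms(1), of "Suc j" k N] assms by cases auto
qed

lemma step_fun_grid:
  assumes "u \<le> v" "k < N" "grid u v N k < r" "r \<le> grid u v N (Suc k)"
  shows "step_fun (grid u v N) N a r = a k"
proof -
  have "step_fun (grid u v N) N a r = (\<Sum>j<N. if j = k then a k else 0)"
    unfolding step_fun_def
  proof (intro sum.cong refl)
    fix j
    show "a j * indicator {grid u v N j<..grid u v N (Suc j)} r = (if j = k then a k else 0)"
    proof (cases "j = k")
      case True with assms show ?thesis by simp
    next
      case False
      then have "r \<notin> {grid u v N j<..grid u v N (Suc j)}" using grid_cell_unique[OF assms(1,3,4)] by force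
      then show ?thesis using False by simp
    qed
  qed
  then show ?thesis using assms by simp
qed

lemma step_fun_measurable [measurable]: "step_fun s N a \<in> borel_measurable borel"
  unfolding step_fun_def[abs_def] by measurable

lemma step_fun_integral:
  assumes u: "u \<le> w" and N: "0 < N"
  shows "integrable lborel (\<lambda>r. indicator {u..w} r * step_fun (grid u w N) N a r)"
    and "(LINT r|lborel. indicator {u..w} r * step_fun (grid u w N) N a r) = (\<Sum>k<N. a k * (grid u w N (Suc k) - grid u w N k))"
proof -
  let ?s = "grid u w N"
  have e: "indicator {u..w} r * step_fun ?s N a r = (\<Sum>k<N. a k * indicator {?s k<..?s (Suc k)} r)" for r
    unfolding step_fun_def sum_distrib_left
  proof (rule sum.cong[OF refl])
    fix k assume "k \<in> {..<N}"
    then have "{?s k<..?s (Suc k)} \<subseteq> {u..w}"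
      using grid_bounds[of u w k N] grid_bounds[of u w "Suc k" N] u N by auto
    then show "indicator {u..w} r * (a k * indicator {?s k<..?s (Suc k)} r) = a k * indicator {?s k<..?s (Suc k)} r"
      by (auto simp: indicator_def)
  qed
  have i: "integrable lborel (\<lambda>r. a k * indicator {?s k<..?s (Suc k)} r)" for k
    using grid_mono[of u w k "Suc k" N] u by (auto simp: integrable_indicator_iff)
  show "integrable lborel (\<lambda>r. indicator {u..w} r * step_fun ?s N a r)"
    unfolding e by (intro Bochner_Integration.integrable_sum i)
  show "(LINT r|lborel. indicator {u..w} r * step_fun ?s N a r) = (\<Sum>k<N. a k * (?s (Suc k) - ?s k))"
    unfolding e using i grid_mono[of u w _ "Suc _" N] u by (subst Bochner_Integration.integral_sum) auto
qed

lemma step_approx_continuous: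
  assumes uv: "u < v" and g: "continuous_on UNIV (g :: real \<Rightarrow> real)" and e: "e > 0"
  obtains N where "N > 0" "\<And>r. u < r \<Longrightarrow> r \<le> v \<Longrightarrow> \<bar>g r - step_fun (grid u v N) N (\<lambda>k. g (grid u v N k)) r\<bar> < e"
proof -
  have "uniformly_continuous_on {u..v} g"
    by (rule compact_uniformly_continuous) (use g continuous_on_subset in auto)
  then obtain \<delta> where \<delta>: "\<delta> > 0" "\<And>x y. x \<in> {u..v} \<Longrightarrow> y \<in> {u..v} \<Longrightarrow> \<bar>x - y\<bar> < \<delta> \<Longrightarrow> \<bar>g x - g y\<bar> < e"
    using e unfolding uniformly_continuous_on_def dist_real_def by metis
  obtain N :: nat where N: "(v - u) / \<delta> < real N" using reals_Archimedean2 by blast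
  have "(v - u) / \<delta> > 0" using uv \<delta>(1) by simp
  with N have "0 < real N" by linarith
  then have N0: "N > 0" by simp
  have small: "(v - u) / real N < \<delta>" using N N0 \<delta> by (simp add: field_simps)
  show ?thesis
  proof (rule that[OF N0])
    fix r assume r: "u < r" "r \<le> v"
    obtain k where k: "k < N" "grid u v N k < r" "r \<le> grid u v N (Suc k)" using grid_cell[OF r N0] by blast
    have "\<bar>r - grid u v N k\<bar> < \<delta>" using k small grid_Suc[of u v N k] by linarith
    moreover have "grid u v N k \<in> {u..v}" using grid_bounds[of u v k N] uv k by auto
    ultimately show "\<bar>g r - step_fun (grid u v N) N (\<lambda>k. g (grid u v N k)) r\<bar> < e"
      using step_fun_grid[of u v k N r "\<lambda>k. g (grid u v N k)"] k uv r \<delta>(2)[of r "grid u v N k"] by auto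
  qed
qed

lemma integrable_indicator_Icc: "integrable lborel (indicator {u..v} :: real \<Rightarrow> real)"
  by (simp add: integrable_indicator_iff emeasure_lborel_Icc_eq)

text \<open>A measurable function is an almost everywhere limit of continuous functions. Truncation
  at the bound K keeps them continuous and makes dominated convergence available.\<close>

lemma continuous_L2_approx:
  fixes g :: "real \<Rightarrow> real"
  assumes g[measurable]: "g \<in> borel_measurable borel" and K: "\<And>r. \<bar>g r\<bar> \<le> K"
  obtains h :: "nat \<Rightarrow> real \<Rightarrow> real" where "\<And>n. continuous_on UNIV (h n)" "\<And>n r. \<bar>h n r\<bar> \<le> K"
    "(\<lambda>n. LINT r:{u..v}|lborel. (g r - h n r)\<^sup>2) \<longlonglongrightarrow> 0"
proof -
  have K0: "K \<ge> 0" using K[of 0] by auto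
  have "g measurable_on UNIV"
    using g by (intro lebesgue_measurable_imp_measurable_on_real) (auto intro: measurable_completion)
  then obtain N f where N: "negligible N" and f: "\<And>n. continuous_on UNIV (f n)"
    and lim: "\<And>x. x \<notin> N \<Longrightarrow> (\<lambda>n::nat. f n x) \<longlonglongrightarrow> g x"
    unfolding measurable_on_def by auto
  define h where "h n r = max (- K) (min K (f n r))" for n r
  have hc: "continuous_on UNIV (h n)" for n
    unfolding h_def[abs_def] by (intro continuous_intros f)
  have hK: "\<bar>h n r\<bar> \<le> K" for n r using K0 unfolding h_def by (simp add: abs_le_iff)
  have [measurable]: "h n \<in> borel_measurable borel" for n using hc by (rule borel_measurable_continuous_onI)
  have ae: "AE r in lborel. (\<lambda>n. h n r) \<longlonglongrightarrow> g r"
  proof -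
    have "AE r in lebesgue. r \<notin> N" using N by (simp add: negligible_iff_null_sets AE_not_in)
    then have "AE r in lebesgue. (\<lambda>n. h n r) \<longlonglongrightarrow> g r"
    proof eventually_elim
      case (elim r)
      have "(\<lambda>n. h n r) \<longlonglongrightarrow> max (- K) (min K (g r))" unfolding h_def
        by (intro tendsto_max tendsto_min tendsto_const lim elim)
      moreover have "max (- K) (min K (g r)) = g r"
      proof -
        have "g r \<le> K" "- K \<le> g r" using K[of r] by linarith+
        then show ?thesis by (simp add: min_absorb2 max_absorb2)
      qed
      ultimately show ?case by simp
    qed
    then show ?thesis by (simp add: AE_completion_iff)
  qed
  have "(\<lambda>n. LINT r:{u..v}|lborel. (g r - h n r)\<^sup>2) \<longlonglongrightarrow> (LINT r:{u..v}|lborel. 0)"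
    unfolding set_lebesgue_integral_def
  proof (rule integral_dominated_convergence)
    show "integrable lborel (\<lambda>r. indicator {u..v} r * (2 * K)\<^sup>2)"
      by (intro integrable_mult_left integrable_indicator_Icc)
    show "AE r in lborel. (\<lambda>n. indicator {u..v} r *\<^sub>R (g r - h n r)\<^sup>2) \<longlonglongrightarrow> indicator {u..v} r *\<^sub>R 0"
      using ae
    proof eventually_elim
      case (elim r)
      have "(\<lambda>n. indicator {u..v} r *\<^sub>R (g r - h n r)\<^sup>2) \<longlonglongrightarrow> indicator {u..v} r *\<^sub>R (g r - g r)\<^sup>2"
        by (intro tendsto_intros elim)
      then show ?case by simp
    qed
    show "AE r in lborel. norm (indicator {u..v} r *\<^sub>R (g r - h n r)\<^sup>2) \<le> indicator {u..v} r * (2 * K)\<^sup>2" for n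
    proof (rule AE_I2)
      fix r
      have "\<bar>g r - h n r\<bar> \<le> 2 * K" using K[of r] hK[of n r] by linarith
      then have "\<bar>g r - h n r\<bar>\<^sup>2 \<le> (2 * K)\<^sup>2" by (intro power_mono) auto
      then have "(g r - h n r)\<^sup>2 \<le> (2 * K)\<^sup>2" by simp
      then show "norm (indicator {u..v} r *\<^sub>R (g r - h n r)\<^sup>2) \<le> indicator {u..v} r * (2 * K)\<^sup>2"
        by (auto simp: indicator_def)
    qed
  qed measurable
  then show ?thesis using that[of h] hc hK by simp
qed

text \<open>The n-th continuous approximant is sampled on a grid fine enough for a uniform error 1 /
  (n + 1).\<close>

lemma step_L2_approx:
  fixes g :: "real \<Rightarrow> real"
  assumes [measurable]: "g \<in> borel_measurable borel" and K: "\<And>r. \<bar>g r\<bar> \<le> K" and uv: "u < v"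
  obtains N a where "\<And>q::nat. N q > (0::nat)"
    "(\<lambda>q. LINT r:{u..v}|lborel. (g r - step_fun (grid u v (N q)) (N q) (a q) r)\<^sup>2) \<longlonglongrightarrow> 0"
proof -
  obtain h :: "nat \<Rightarrow> real \<Rightarrow> real" where h: "\<And>n. continuous_on UNIV (h n)" "\<And>n r. \<bar>h n r\<bar> \<le> K"
    and lim: "(\<lambda>n. LINT r:{u..v}|lborel. (g r - h n r)\<^sup>2) \<longlonglongrightarrow> 0"
    using continuous_L2_approx[of g K u v] K by auto
  have [measurable]: "h n \<in> borel_measurable borel" for n using h(1) by (rule borel_measurable_continuous_onI)
  have "\<exists>N>0. \<forall>r. u < r \<longrightarrow> r \<le> v \<longrightarrow> \<bar>h n r - step_fun (grid u v N) N (\<lambda>k. h n (grid u v N k)) r\<bar> < 1 / (real n + 1)" for n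
  proof -
    have "1 / (real n + 1) > 0" by simp
    from step_approx_continuous[OF uv h(1) this] show ?thesis by metis
  qed
  then obtain N where N: "\<And>n. N n > 0"
    and st: "\<And>n r. u < r \<Longrightarrow> r \<le> v \<Longrightarrow> \<bar>h n r - step_fun (grid u v (N n)) (N n) (\<lambda>k. h n (grid u v (N n) k)) r\<bar> < 1 / (real n + 1)"
    by metis
  define S where "S n = step_fun (grid u v (N n)) (N n) (\<lambda>k. h n (grid u v (N n) k))" for n
  have [measurable]: "S n \<in> borel_measurable borel" for n unfolding S_def by measurable
  have K0: "K \<ge> 0" using K[of 0] by auto
  have bnd: "integrable lborel (\<lambda>r. indicator {u..v} r * (g r - h n r)\<^sup>2)" for n
  proof (rule Bochner_Integration.integrable_bound)
    show "integrable lborel (\<lambda>r. indicator {u..v} r * (2 * K)\<^sup>2)"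
      by (intro integrable_mult_left integrable_indicator_Icc)
    show "AE r in lborel. norm (indicator {u..v} r * (g r - h n r)\<^sup>2) \<le> norm (indicator {u..v} r * (2 * K)\<^sup>2)"
    proof (rule AE_I2)
      fix r
      have "\<bar>g r - h n r\<bar> \<le> 2 * K" using K[of r] h(2)[of n r] by linarith
      then have "\<bar>g r - h n r\<bar>\<^sup>2 \<le> (2 * K)\<^sup>2" by (intro power_mono) auto
      then have "(g r - h n r)\<^sup>2 \<le> (2 * K)\<^sup>2" by simp
      then show "norm (indicator {u..v} r * (g r - h n r)\<^sup>2) \<le> norm (indicator {u..v} r * (2 * K)\<^sup>2)"
        by (auto simp: indicator_def)
    qed
  qed measurable
  have le: "(LINT r:{u..v}|lborel. (g r - S n r)\<^sup>2) \<le> 2 * (LINT r:{u..v}|lborel. (g r - h n r)\<^sup>2) + 2 * (1 / (real n + 1))\<^sup>2 * (v - u)" for n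
  proof -
    have "(LINT r:{u..v}|lborel. (g r - S n r)\<^sup>2)
        \<le> (LINT r|lborel. 2 * (indicator {u..v} r * (g r - h n r)\<^sup>2) + 2 * (1 / (real n + 1))\<^sup>2 * indicator {u..v} r)"
      unfolding set_lebesgue_integral_def
    proof (rule integral_mono_AE')
      show "integrable lborel (\<lambda>r. 2 * (indicator {u..v} r * (g r - h n r)\<^sup>2) + 2 * (1 / (real n + 1))\<^sup>2 * indicator {u..v} r)"
        using bnd by (intro Bochner_Integration.integrable_add integrable_mult_right integrable_indicator_Icc)
      \<comment> \<open>The cells are open on the left, so the point u lies in none of them.\<close>
      have "AE r in lborel. r \<noteq> u" by (rule AE_lborel_singleton)
      then show "AE r in lborel. indicator {u..v} r *\<^sub>R (g r - S n r)\<^sup>2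
        \<le> 2 * (indicator {u..v} r * (g r - h n r)\<^sup>2) + 2 * (1 / (real n + 1))\<^sup>2 * indicator {u..v} r"
      proof eventually_elim
        case (elim r)
        show ?case
        proof (cases "r \<in> {u..v}")
          case True
          with elim have r: "u < r" "r \<le> v" by auto
          have "\<bar>h n r - S n r\<bar> \<le> 1 / (real n + 1)" using st[OF r, of n] unfolding S_def by simp
          then have a: "(h n r - S n r)\<^sup>2 \<le> (1 / (real n + 1))\<^sup>2"
            by (metis abs_ge_zero power2_abs power_mono)
          have "0 \<le> ((g r - h n r) - (h n r - S n r))\<^sup>2" by simp
          then have "(g r - S n r)\<^sup>2 \<le> 2 * (g r - h n r)\<^sup>2 + 2 * (h n r - S n r)\<^sup>2"
            by (simp add: power2_eq_square algebra_simps)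
          with a True show ?thesis by simp
        qed simp
      qed
      show "AE r in lborel. 0 \<le> 2 * (indicator {u..v} r * (g r - h n r)\<^sup>2) + 2 * (1 / (real n + 1))\<^sup>2 * indicator {u..v} r"
        by simp
    qed
    also have "\<dots> = 2 * (LINT r:{u..v}|lborel. (g r - h n r)\<^sup>2) + 2 * (1 / (real n + 1))\<^sup>2 * (v - u)"
      using bnd uv unfolding set_lebesgue_integral_def
      by (subst Bochner_Integration.integral_add) (auto intro!: integrable_mult_right integrable_indicator_Icc)
    finally show ?thesis .
  qed
  have "(\<lambda>n. 2 * (LINT r:{u..v}|lborel. (g r - h n r)\<^sup>2) + 2 * (1 / (real n + 1))\<^sup>2 * (v - u)) \<longlonglongrightarrow> 2 * 0 + 2 * 0\<^sup>2 * (v - u)"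
    by (intro tendsto_intros lim) (use LIMSEQ_inverse_real_of_nat in \<open>simp add: inverse_eq_divide add.commute\<close>)
  then have lim2: "(\<lambda>n. 2 * (LINT r:{u..v}|lborel. (g r - h n r)\<^sup>2) + 2 * (1 / (real n + 1))\<^sup>2 * (v - u)) \<longlonglongrightarrow> 0" by simp
  have "(\<lambda>n. LINT r:{u..v}|lborel. (g r - S n r)\<^sup>2) \<longlonglongrightarrow> 0"
  proof (rule tendsto_sandwich[OF _ _ tendsto_const lim2])
    show "\<forall>\<^sub>F n in sequentially. 0 \<le> (LINT r:{u..v}|lborel. (g r - S n r)\<^sup>2)"
      unfolding set_lebesgue_integral_def by (intro always_eventually allI Bochner_Integration.integral_nonneg) auto
    show "\<forall>\<^sub>F n in sequentially. (LINT r:{u..v}|lborel. (g r - S n r)\<^sup>2)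
      \<le> 2 * (LINT r:{u..v}|lborel. (g r - h n r)\<^sup>2) + 2 * (1 / (real n + 1))\<^sup>2 * (v - u)"
      by (rule always_eventually, rule allI, rule le)
  qed
  then show ?thesis
    unfolding S_def by (rule that[of N "\<lambda>q k. h q (grid u v (N q) k)", OF N])
qed

text \<open>Young's inequality with a free parameter \<delta> takes the place of Cauchy-Schwarz: |X
  V| <= \<delta> V^2 + X^2 / \<delta>.\<close>

lemma L2_pair_tendsto:
  assumes X: "\<And>q::nat. square_integrable M (X q)" and V: "square_integrable M V"
    and lim: "(\<lambda>q. LINT x|M. (X q x)\<^sup>2) \<longlonglongrightarrow> 0"
  shows "(\<lambda>q. LINT x|M. X q x * V x) \<longlonglongrightarrow> 0"
proof -
  let ?v = "LINT x|M. (V x)\<^sup>2"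
  have v0: "?v \<ge> 0" by (rule Bochner_Integration.integral_nonneg) simp
  have bound: "\<bar>LINT x|M. X q x * V x\<bar> \<le> \<delta> * ?v + (LINT x|M. (X q x)\<^sup>2) / \<delta>" if \<delta>: "\<delta> > 0" for q \<delta>
  proof -
    have "\<bar>LINT x|M. X q x * V x\<bar> \<le> (LINT x|M. \<bar>X q x * V x\<bar>)" by (rule integral_abs_bound)
    also have "\<dots> \<le> (LINT x|M. \<delta> * (V x)\<^sup>2 + (X q x)\<^sup>2 / \<delta>)"
    proof (rule integral_mono)
      show "integrable M (\<lambda>x. \<bar>X q x * V x\<bar>)" using square_integrable_times[OF X V] by simp
      show "integrable M (\<lambda>x. \<delta> * (V x)\<^sup>2 + (X q x)\<^sup>2 / \<delta>)" using X V by (auto simp: square_integrable_def)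
      fix x
      have "0 \<le> (\<delta> * \<bar>V x\<bar> - \<bar>X q x\<bar>)\<^sup>2" by simp
      then have "2 * (\<delta> * \<bar>X q x * V x\<bar>) \<le> \<delta> * (\<delta> * (V x)\<^sup>2) + (X q x)\<^sup>2"
        by (simp add: power2_diff abs_mult power2_eq_square algebra_simps)
      moreover have "0 \<le> \<delta> * \<bar>X q x * V x\<bar>" using \<delta> by simp
      ultimately have "\<delta> * \<bar>X q x * V x\<bar> \<le> \<delta> * (\<delta> * (V x)\<^sup>2) + (X q x)\<^sup>2" by linarith
      also have "\<dots> = \<delta> * (\<delta> * (V x)\<^sup>2 + (X q x)\<^sup>2 / \<delta>)" using \<delta> by (simp add: distrib_left)
      finally show "\<bar>X q x * V x\<bar> \<le> \<delta> * (V x)\<^sup>2 + (X q x)\<^sup>2 / \<delta>" using \<delta> by (simp only: mult_le_cancel_left_pos)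
    qed
    also have "\<dots> = \<delta> * ?v + (LINT x|M. (X q x)\<^sup>2) / \<delta>"
      using X V by (subst Bochner_Integration.integral_add) (auto simp: square_integrable_def)
    finally show ?thesis .
  qed
  show ?thesis
  proof (rule LIMSEQ_I)
    fix e :: real assume e: "e > 0"
    \<comment> \<open>Chosen so that \<delta> times the second moment of V stays below e / 2; the
      summand 1 covers V = 0.\<close>
    define \<delta> where "\<delta> = e / (2 * (?v + 1))"
    have \<delta>: "\<delta> > 0" unfolding \<delta>_def by (intro divide_pos_pos mult_pos_pos) (use e v0 in linarith)+
    have "\<delta> * ?v < e / 2"
    proof -
      have "\<delta> * ?v < \<delta> * (?v + 1)" using \<delta> by simp
      also have "\<dots> = e / 2"
      proof -
        have "e / (2 * c) * c = e / 2" if "c > 0" for c :: real using that by simp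
        from this[of "?v + 1"] v0 show ?thesis unfolding \<delta>_def by linarith
      qed
      finally show ?thesis .
    qed
    note dv = this
    have "\<forall>\<^sub>F q in sequentially. (LINT x|M. (X q x)\<^sup>2) < e * \<delta> / 2"
      using lim e \<delta> by (intro order_tendstoD) auto
    then obtain n where n: "\<And>q. q \<ge> n \<Longrightarrow> (LINT x|M. (X q x)\<^sup>2) < e * \<delta> / 2" by (auto simp: eventually_sequentially)
    have "norm ((LINT x|M. X q x * V x) - 0) < e" if "q \<ge> n" for q
    proof -
      have "(LINT x|M. (X q x)\<^sup>2) / \<delta> < e / 2" using n[OF that] \<delta> by (simp add: field_simps)
      then show ?thesis using bound[OF \<delta>, of q] dv unfolding real_norm_def diff_0_right by linarith
    qed
    then show "\<exists>n. \<forall>q\<ge>n. norm ((LINT x|M. X q x * V x) - 0) < e" by blast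
  qed
qed

lemma axis_diff: "axis l (x - y) = axis l x - (axis l y :: real^'n)"
  by (simp add: vec_eq_iff axis_def)

lemma norm_axis_real: "norm (axis l x :: real^'n) = \<bar>x\<bar>"
proof -
  have "(axis l x :: real^'n) = x *\<^sub>R axis l 1" by (auto simp: vec_eq_iff axis_def)
  then show ?thesis by (simp add: norm_axis_1)
qed

lemma axis_measurable: "g \<in> borel_measurable M \<Longrightarrow> (\<lambda>r. axis l (g r) :: real^'n) \<in> borel_measurable M"
proof -
  assume g: "g \<in> borel_measurable M"
  have "(\<lambda>r. axis l (g r) :: real^'n) = (\<lambda>r. g r *\<^sub>R axis l 1)"
    by (auto simp: vec_eq_iff axis_def)
  then show ?thesis using g by simp
qed

section \<open>Ito integrals of deterministic integrands and the H-coefficients\<close>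

context brownian_setup
begin

lemma step_simple_integrand:
  assumes "0 \<le> u" "u < w" "w \<le> T" "N > 0"
  shows "simple_integrand M F u w N (grid u w N) (\<lambda>k _. axis l (a k) :: real^'d)"
proof -
  have "bounded ((\<lambda>_::'w. axis l (a k) :: real^'d) ` space M)" for k
    by (rule bounded_subset[of "{axis l (a k)}"]) auto
  then show ?thesis
    using assms grid_bounds[of u w _ N] grid_mono[of u w _ _ N]
    by (auto simp: simple_integrand_def)
qed

lemma step_simple_process:
  "simple_process N (grid u w N) (\<lambda>k _. axis l (a k)) r \<omega> = axis l (step_fun (grid u w N) N a r)"
  by (auto simp: simple_process_def step_fun_def vec_eq_iff axis_def sum_distrib_left mult.commute)

lemma step_sq_dist:
  assumes [measurable]: "g \<in> borel_measurable borel" and K: "\<And>r. \<bar>g r\<bar> \<le> K"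
  shows "sq_dist u w (\<lambda>r. axis l (g r)) N (grid u w N) (\<lambda>k _. axis l (a k))
    = ennreal (LINT r:{u..w}|lborel. (g r - step_fun (grid u w N) N a r)\<^sup>2)"
proof -
  let ?s = "step_fun (grid u w N) N a"
  have sb: "\<bar>?s r\<bar> \<le> (\<Sum>k<N. \<bar>a k\<bar>)" for r
    unfolding step_fun_def by (rule order_trans[OF sum_abs]) (rule sum_mono, auto simp: abs_mult indicator_def)
  let ?K = "K + (\<Sum>k<N. \<bar>a k\<bar>)"
  have int: "integrable lborel (\<lambda>r. indicator {u..w} r *\<^sub>R (g r - ?s r)\<^sup>2)"
  proof (rule Bochner_Integration.integrable_bound)
    show "integrable lborel (\<lambda>r. indicator {u..w} r * ?K\<^sup>2)" by (intro integrable_mult_left integrable_indicator_Icc)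
    show "AE r in lborel. norm (indicator {u..w} r *\<^sub>R (g r - ?s r)\<^sup>2) \<le> norm (indicator {u..w} r * ?K\<^sup>2)"
    proof (rule AE_I2)
      fix r
      have "\<bar>g r - ?s r\<bar> \<le> ?K" using K[of r] sb[of r] by linarith
      then have "\<bar>g r - ?s r\<bar>\<^sup>2 \<le> ?K\<^sup>2" by (intro power_mono) auto
      then show "norm (indicator {u..w} r *\<^sub>R (g r - ?s r)\<^sup>2) \<le> norm (indicator {u..w} r * ?K\<^sup>2)"
        by (auto simp: indicator_def)
    qed
  qed measurable
  have "(\<integral>\<^sup>+r\<in>{u..w}. ennreal ((norm (axis l (g r) - (axis l (?s r) :: real^'d)))\<^sup>2) \<partial>lborel)
      = (\<integral>\<^sup>+r. ennreal (indicator {u..w} r *\<^sub>R (g r - ?s r)\<^sup>2) \<partial>lborel)"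
    by (intro nn_integral_cong) (auto simp: indicator_def axis_diff[symmetric] norm_axis_real)
  also have "\<dots> = ennreal (LINT r:{u..w}|lborel. (g r - ?s r)\<^sup>2)"
    unfolding set_lebesgue_integral_def using int by (intro nn_integral_eq_integral) auto
  finally show ?thesis
    unfolding sq_dist_def step_simple_process by (simp add: emeasure_space_1)
qed

lemma abs_expectation_le:
  assumes X: "square_integrable M X" and e: "e > 0" and lt: "expectation (\<lambda>\<omega>. (X \<omega>)\<^sup>2) < e\<^sup>2"
  shows "expectation (\<lambda>\<omega>. \<bar>X \<omega>\<bar>) < e"
proof -
  have iX: "integrable M X" by (rule square_integrable_integrable[OF X])
  have "expectation (\<lambda>\<omega>. \<bar>X \<omega>\<bar>) \<le> expectation (\<lambda>\<omega>. e / 2 + (X \<omega>)\<^sup>2 / (2 * e))"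
  proof (rule integral_mono)
    fix \<omega>
    have "0 \<le> (e - \<bar>X \<omega>\<bar>)\<^sup>2" by simp
    then have "2 * e * \<bar>X \<omega>\<bar> \<le> e\<^sup>2 + (X \<omega>)\<^sup>2" by (simp add: power2_diff)
    then show "\<bar>X \<omega>\<bar> \<le> e / 2 + (X \<omega>)\<^sup>2 / (2 * e)" using e by (simp add: field_simps power2_eq_square)
  qed (use iX X in \<open>auto simp: square_integrable_def\<close>)
  also have "\<dots> = e / 2 + expectation (\<lambda>\<omega>. (X \<omega>)\<^sup>2) / (2 * e)"
    using X prob_space by (subst Bochner_Integration.integral_add) (auto simp: square_integrable_def)
  also have "\<dots> < e / 2 + e\<^sup>2 / (2 * e)" using lt e by (intro add_strict_left_mono divide_strict_right_mono) auto
  also have "\<dots> = e" using e by (simp add: power2_eq_square)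
  finally show ?thesis .
qed

text \<open>\<open>ito_integral\<close> is a choice, so nothing is known about an H-coefficient
  before an integral has been shown to exist. The integrals of step approximations are Cauchy in L^2
  by the isometry, hence in L^1, and a subsequence converges almost everywhere.\<close>

lemma ito_exists:
  assumes u: "0 \<le> u" "u < w" "w \<le> T" and g[measurable]: "g \<in> borel_measurable borel" and K: "\<And>r. \<bar>g r\<bar> \<le> K"
  shows "\<exists>I. has_ito_integral M F W (\<lambda>r _. axis l (g r)) u w I"
proof -
  obtain N a where N: "\<And>q::nat. N q > (0::nat)"
    and lim: "(\<lambda>q. LINT r:{u..w}|lborel. (g r - step_fun (grid u w (N q)) (N q) (a q) r)\<^sup>2) \<longlonglongrightarrow> 0"
    using step_L2_approx[OF g K u(2)] by blast
  let ?\<phi> = "\<lambda>r. axis l (g r) :: real^'d"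
  define \<xi> where "\<xi> q = (\<lambda>k (_::'w). axis l (a q k) :: real^'d)" for q
  define J where "J q = simple_ito W (N q) (grid u w (N q)) (\<xi> q)" for q
  have s: "simple_integrand M F u w (N q) (grid u w (N q)) (\<xi> q)" for q
    unfolding \<xi>_def by (rule step_simple_integrand[OF u N])
  define E where "E q = (LINT r:{u..w}|lborel. (g r - step_fun (grid u w (N q)) (N q) (a q) r)\<^sup>2)" for q
  have E0: "E q \<ge> 0" for q
    unfolding E_def set_lebesgue_integral_def by (rule Bochner_Integration.integral_nonneg) simp
  have Elim: "E \<longlonglongrightarrow> 0" using lim unfolding E_def[abs_def] .
  have sd: "sq_dist u w ?\<phi> (N q) (grid u w (N q)) (\<xi> q) = ennreal (E q)" for q
    unfolding \<xi>_def E_def by (rule step_sq_dist[OF g K])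
  have \<phi>m[measurable]: "?\<phi> \<in> borel_measurable borel" by (rule axis_measurable[OF g])
  have Jsq: "square_integrable M (J q)" for q unfolding J_def by (rule simple_cross(1)[OF u(1,3) s s])
  have [measurable]: "J q \<in> borel_measurable M" for q using Jsq by (simp add: square_integrable_def)
  have JJ: "L2sq M (\<lambda>\<omega>. J i \<omega> - J j \<omega>) \<le> ennreal (2 * E i + 2 * E j)" for i j
    using simple_sq_dist[OF u(1,3) s[of i] s[of j] \<phi>m] E0
    unfolding sd J_def by (simp add: ennreal_plus ennreal_mult')
  have JJ': "expectation (\<lambda>\<omega>. (J i \<omega> - J j \<omega>)\<^sup>2) \<le> 2 * E i + 2 * E j" for i j
    using JJ[of i j] E0[of i] E0[of j] unfolding L2sq_eq[OF square_integrable_diff[OF Jsq Jsq]]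
    by (subst (asm) ennreal_le_iff) auto
  have cau: "\<exists>n. \<forall>i\<ge>n. \<forall>j\<ge>n. expectation (\<lambda>\<omega>. norm (J i \<omega> - J j \<omega>)) < e" if e: "e > 0" for e
  proof -
    have "\<forall>\<^sub>F q in sequentially. E q < e\<^sup>2 / 4" using Elim e by (intro order_tendstoD) auto
    then obtain n where n: "\<And>q. q \<ge> n \<Longrightarrow> E q < e\<^sup>2 / 4" by (auto simp: eventually_sequentially)
    have "expectation (\<lambda>\<omega>. norm (J i \<omega> - J j \<omega>)) < e" if "i \<ge> n" "j \<ge> n" for i j
    proof -
      have "expectation (\<lambda>\<omega>. (J i \<omega> - J j \<omega>)\<^sup>2) < e\<^sup>2" using JJ'[of i j] n[OF that(1)] n[OF that(2)] by linarith
      from abs_expectation_le[OF square_integrable_diff[OF Jsq Jsq] e this] show ?thesis by simp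
    qed
    then show ?thesis by blast
  qed
  obtain r where r: "strict_mono r" and ae: "AE \<omega> in M. Cauchy (\<lambda>i. J (r i) \<omega>)"
    using cauchy_L1_AE_cauchy_subseq[of M J, OF square_integrable_integrable[OF Jsq] cau] by auto
  define I where "I \<omega> = lim (\<lambda>i. J (r i) \<omega>)" for \<omega>
  have [measurable]: "I \<in> borel_measurable M" unfolding I_def by measurable
  have aeI: "AE \<omega> in M. (\<lambda>i. J (r i) \<omega>) \<longlonglongrightarrow> I \<omega>"
    using ae by eventually_elim (simp add: I_def Cauchy_convergent_iff convergent_LIMSEQ_iff)
  have Er: "(\<lambda>i. E (r i)) \<longlonglongrightarrow> 0" using LIMSEQ_subseq_LIMSEQ[OF Elim r] by (simp add: comp_def)
  \<comment> \<open>Fatou's lemma along the subsequence \<open>r\<close> bounds the distance of the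
    limit to every member of the original sequence.\<close>
  have IJ: "L2sq M (\<lambda>\<omega>. I \<omega> - J q \<omega>) \<le> ennreal (2 * E q)" for q
  proof -
    have "L2sq M (\<lambda>\<omega>. I \<omega> - J q \<omega>) = (\<integral>\<^sup>+\<omega>. liminf (\<lambda>i. ennreal ((norm (J (r i) \<omega> - J q \<omega>))\<^sup>2)) \<partial>M)"
      unfolding L2sq_def
    proof (rule nn_integral_cong_AE)
      show "AE \<omega> in M. ennreal ((norm (I \<omega> - J q \<omega>))\<^sup>2) = liminf (\<lambda>i. ennreal ((norm (J (r i) \<omega> - J q \<omega>))\<^sup>2))"
        using aeI
      proof eventually_elim
        case (elim \<omega>)
        have "(\<lambda>i. ennreal ((norm (J (r i) \<omega> - J q \<omega>))\<^sup>2)) \<longlonglongrightarrow> ennreal ((norm (I \<omega> - J q \<omega>))\<^sup>2)"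
          by (intro tendsto_ennrealI tendsto_intros elim)
        from lim_imp_Liminf[OF _ this] show ?case by simp
      qed
    qed
    also have "\<dots> \<le> liminf (\<lambda>i. L2sq M (\<lambda>\<omega>. J (r i) \<omega> - J q \<omega>))"
      unfolding L2sq_def by (rule nn_integral_liminf) measurable
    also have "\<dots> \<le> liminf (\<lambda>i. ennreal (2 * E (r i) + 2 * E q))"
      by (intro Liminf_mono always_eventually allI JJ)
    also have "\<dots> = ennreal (2 * 0 + 2 * E q)"
      by (intro lim_imp_Liminf tendsto_ennrealI tendsto_intros Er) simp
    finally show ?thesis by simp
  qed
  have "has_ito_integral M F W (\<lambda>r _. ?\<phi> r) u w I"
    unfolding has_ito_integral_def
  proof (intro conjI exI allI)
    show "(\<lambda>(r, \<omega>). ?\<phi> r) \<in> borel_measurable (restrict_space borel {u..w} \<Otimes>\<^sub>M M)"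
      using measurable_restrict_space1[OF \<phi>m, of "{u..w}"] by measurable
    show "simple_integrand M F u w (N q) (grid u w (N q)) (\<xi> q)" for q by (rule s)
    show "(\<lambda>p. \<integral>\<^sup>+\<omega>. (\<integral>\<^sup>+r\<in>{u..w}. ennreal ((norm (?\<phi> r - simple_process (N p) (grid u w (N p)) (\<xi> p) r \<omega>))\<^sup>2) \<partial>lborel) \<partial>M) \<longlonglongrightarrow> 0"
      using tendsto_ennrealI[OF Elim] unfolding sd[unfolded sq_dist_def] by simp
    show "(\<lambda>p. L2sq M (\<lambda>\<omega>. I \<omega> - simple_ito W (N p) (grid u w (N p)) (\<xi> p) \<omega>)) \<longlonglongrightarrow> 0"
      unfolding J_def[symmetric]
    proof (rule tendsto_sandwich[OF _ _ tendsto_const])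
      have "(\<lambda>q. 2 * E q) \<longlonglongrightarrow> 0" using tendsto_mult[OF tendsto_const Elim, of 2] by simp
      from tendsto_ennrealI[OF this] show "(\<lambda>q. ennreal (2 * E q)) \<longlonglongrightarrow> 0" by simp
    qed (auto intro!: always_eventually IJ)
  qed simp
  then show ?thesis by blast
qed

text \<open>For a step integrand \<open>cond_heatd\<close> applies cell by cell: every cell
  contributes its value times its length times the same expectation. The general integrand follows
  by passing to the limit on both sides.\<close>

lemma ito_moment:
  assumes u: "0 \<le> u" "u < w" "w \<le> T" and g[measurable]: "g \<in> borel_measurable borel" and K: "\<And>r. \<bar>g r\<bar> \<le> K"
    and I: "has_ito_integral M F W (\<lambda>r _. axis l (g r)) u w I"
    and \<zeta>: "\<zeta> \<in> borel_measurable (F u)" "\<And>\<omega>. \<omega> \<in> space M \<Longrightarrow> \<bar>\<zeta> \<omega>\<bar> \<le> C" and v: "lin_growth v"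
  shows "square_integrable M I"
    and "expectation (\<lambda>\<omega>. \<zeta> \<omega> * (I \<omega> * v (S w \<omega>)))
      = (LINT r:{u..w}|lborel. g r) * expectation (\<lambda>\<omega>. \<zeta> \<omega> * heatd (d * (w - u)) v (S u \<omega>))"
proof -
  obtain N a where N: "\<And>q::nat. N q > (0::nat)"
    and lim: "(\<lambda>q. LINT r:{u..w}|lborel. (g r - step_fun (grid u w (N q)) (N q) (a q) r)\<^sup>2) \<longlonglongrightarrow> 0"
    using step_L2_approx[OF g K u(2)] by blast
  let ?\<phi> = "\<lambda>r. axis l (g r) :: real^'d"
  define \<xi> where "\<xi> q = (\<lambda>k (_::'w). axis l (a q k) :: real^'d)" for q
  define J where "J q = simple_ito W (N q) (grid u w (N q)) (\<xi> q)" for q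
  let ?S = "\<lambda>q. step_fun (grid u w (N q)) (N q) (a q)"
  have s: "simple_integrand M F u w (N q) (grid u w (N q)) (\<xi> q)" for q
    unfolding \<xi>_def by (rule step_simple_integrand[OF u N])
  have sd: "sq_dist u w ?\<phi> (N q) (grid u w (N q)) (\<xi> q) = ennreal (LINT r:{u..w}|lborel. (g r - ?S q r)\<^sup>2)" for q
    unfolding \<xi>_def by (rule step_sq_dist[OF g K])
  have IM[measurable]: "I \<in> borel_measurable M" using I by (simp add: has_ito_integral_def)
  have IJ: "(\<lambda>q. L2sq M (\<lambda>\<omega>. I \<omega> - J q \<omega>)) \<longlonglongrightarrow> 0"
    unfolding J_def
  proof (rule ito_limit[OF u(1,3) I axis_measurable[OF g] s])
    show "(\<lambda>q. sq_dist u w ?\<phi> (N q) (grid u w (N q)) (\<xi> q)) \<longlonglongrightarrow> 0"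
      unfolding sd using tendsto_ennrealI[OF lim] by simp
  qed
  have Jsq: "square_integrable M (J q)" for q unfolding J_def by (rule simple_cross(1)[OF u(1,3) s s])
  have [measurable]: "J q \<in> borel_measurable M" for q using Jsq by (simp add: square_integrable_def)
  show Isq: "square_integrable M I"
  proof -
    have "\<forall>\<^sub>F q in sequentially. L2sq M (\<lambda>\<omega>. I \<omega> - J q \<omega>) < 1" using IJ by (rule order_tendstoD) simp
    then obtain q where q: "L2sq M (\<lambda>\<omega>. I \<omega> - J q \<omega>) < 1" by (auto simp: eventually_sequentially)
    have "square_integrable M (\<lambda>\<omega>. I \<omega> - J q \<omega>)"
      using q by (intro square_integrable_L2sq) (auto intro: order.strict_trans)
    from square_integrable_add[OF this Jsq[of q]] show ?thesis by simp
  qed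
  have dsq: "square_integrable M (\<lambda>\<omega>. I \<omega> - J q \<omega>)" for q by (rule square_integrable_diff[OF Isq Jsq])
  have e2: "(\<lambda>q. expectation (\<lambda>\<omega>. (I \<omega> - J q \<omega>)\<^sup>2)) \<longlonglongrightarrow> 0"
    using IJ unfolding L2sq_eq[OF dsq] ennreal_0[symmetric]
    by (rule tendsto_ennrealD) (auto intro!: always_eventually)
  have \<zeta>M: "\<zeta> \<in> borel_measurable M" using \<zeta>(1) F_M by blast
  let ?V = "\<lambda>\<omega>. \<zeta> \<omega> * v (S w \<omega>)"
  have Vsq: "square_integrable M ?V"
    using u \<zeta>M \<zeta>(2) by (intro square_integrable_bounded_mult growth_S_square_integrable[OF v]) auto
  have lim1: "(\<lambda>q. expectation (\<lambda>\<omega>. J q \<omega> * ?V \<omega>)) \<longlonglongrightarrow> expectation (\<lambda>\<omega>. I \<omega> * ?V \<omega>)"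
  proof -
    have "(\<lambda>q. expectation (\<lambda>\<omega>. I \<omega> * ?V \<omega>) - expectation (\<lambda>\<omega>. (I \<omega> - J q \<omega>) * ?V \<omega>)) \<longlonglongrightarrow> expectation (\<lambda>\<omega>. I \<omega> * ?V \<omega>) - 0"
      by (intro tendsto_diff tendsto_const L2_pair_tendsto[OF dsq Vsq e2])
    moreover have "expectation (\<lambda>\<omega>. I \<omega> * ?V \<omega>) - expectation (\<lambda>\<omega>. (I \<omega> - J q \<omega>) * ?V \<omega>) = expectation (\<lambda>\<omega>. J q \<omega> * ?V \<omega>)" for q
      using square_integrable_times[OF Isq Vsq] square_integrable_times[OF Jsq Vsq]
      by (simp only: left_diff_distrib Bochner_Integration.integral_diff)
    ultimately show ?thesis by simp
  qed
  let ?H = "expectation (\<lambda>\<omega>. \<zeta> \<omega> * heatd (d * (w - u)) v (S u \<omega>))"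
  have Sint: "integrable lborel (\<lambda>r. indicator {u..w} r * ?S q r)"
    and Sval: "(LINT r|lborel. indicator {u..w} r * ?S q r) = (\<Sum>k<N q. a q k * (grid u w (N q) (Suc k) - grid u w (N q) k))" for q
    using step_fun_integral[OF less_imp_le[OF u(2)] N[of q], of "a q"] by blast+
  \<comment> \<open>The common factor \<open>?H\<close> does not depend on the cell, so the cells
    add up to the integral of the step function.\<close>
  have JV: "expectation (\<lambda>\<omega>. J q \<omega> * ?V \<omega>) = (LINT r|lborel. indicator {u..w} r * ?S q r) * ?H" for q
  proof -
    let ?s = "grid u w (N q)"
    have sk: "0 \<le> ?s k" "u \<le> ?s k" "?s k \<le> ?s (Suc k)" "?s (Suc k) \<le> w" if "k < N q" for k
      using grid_bounds[of u w k "N q"] grid_bounds[of u w "Suc k" "N q"] grid_mono[of u w k "Suc k" "N q"] u N[of q] that by auto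
    have Jq: "J q \<omega> = (\<Sum>k<N q. a q k * Dl (?s k) (?s (Suc k)) l \<omega>)" for \<omega>
      unfolding J_def \<xi>_def simple_ito_Dl by (simp add: axis_def if_distrib[of "\<lambda>x. x * _"] cong: if_cong)
    have eq: "J q \<omega> * ?V \<omega> = (\<Sum>k<N q. a q k * (\<zeta> \<omega> * (Dl (?s k) (?s (Suc k)) l \<omega> * v (S w \<omega>))))" for \<omega>
      unfolding Jq sum_distrib_right by (simp add: mult_ac)
    have int: "integrable M (\<lambda>\<omega>. \<zeta> \<omega> * (Dl (?s k) (?s (Suc k)) l \<omega> * v (S w \<omega>)))" if "k < N q" for k
    proof -
      have "integrable M (\<lambda>\<omega>. Dl (?s k) (?s (Suc k)) l \<omega> * ?V \<omega>)"
        using sk[OF that] u by (intro square_integrable_times[OF Dl_square_integrable Vsq]) auto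
      then show ?thesis by (simp add: mult_ac)
    qed
    have "expectation (\<lambda>\<omega>. J q \<omega> * ?V \<omega>) = (\<Sum>k<N q. a q k * expectation (\<lambda>\<omega>. \<zeta> \<omega> * (Dl (?s k) (?s (Suc k)) l \<omega> * v (S w \<omega>))))"
      unfolding eq using int by (subst Bochner_Integration.integral_sum) auto
    also have "\<dots> = (\<Sum>k<N q. a q k * ((?s (Suc k) - ?s k) * ?H))"
    proof (intro sum.cong refl)
      fix k assume "k \<in> {..<N q}"
      then have k: "k < N q" by simp
      show "a q k * expectation (\<lambda>\<omega>. \<zeta> \<omega> * (Dl (?s k) (?s (Suc k)) l \<omega> * v (S w \<omega>))) = a q k * ((?s (Suc k) - ?s k) * ?H)"
        using cond_heatd[OF u(1) sk(2,3,4)[OF k] u(3) \<zeta> v, of l] by simp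
    qed
    also have "\<dots> = (LINT r|lborel. indicator {u..w} r * ?S q r) * ?H"
      unfolding Sval sum_distrib_right by (simp add: mult.assoc)
    finally show ?thesis .
  qed
  have isq: "square_integrable lborel (indicator {u..w} :: real \<Rightarrow> real)"
    using integrable_indicator_Icc[of u w] by (auto simp: square_integrable_def power2_eq_square indicator_inter_arith[symmetric])
  have gsq: "square_integrable lborel (\<lambda>r. indicator {u..w} r * g r)"
  proof (rule square_integrable_bound[OF square_integrable_mult[OF isq, of K]])
    show "\<bar>indicator {u..w} r * g r\<bar> \<le> \<bar>K * indicator {u..w} r\<bar>" for r
      using K[of r] by (auto simp: indicator_def)
  qed simp
  have Ssq: "square_integrable lborel (\<lambda>r. indicator {u..w} r * ?S q r)" for q
  proof (rule square_integrable_bound[OF square_integrable_mult[OF isq, of "\<Sum>k<N q. \<bar>a q k\<bar>"]])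
    show "\<bar>indicator {u..w} r * ?S q r\<bar> \<le> \<bar>(\<Sum>k<N q. \<bar>a q k\<bar>) * indicator {u..w} r\<bar>" for r
    proof -
      have "\<bar>?S q r\<bar> \<le> (\<Sum>k<N q. \<bar>a q k\<bar>)"
        unfolding step_fun_def by (rule order_trans[OF sum_abs]) (rule sum_mono, auto simp: abs_mult indicator_def)
      then show ?thesis by (auto simp: indicator_def)
    qed
  qed simp
  have glim: "(\<lambda>q. LINT r|lborel. indicator {u..w} r * ?S q r) \<longlonglongrightarrow> (LINT r:{u..w}|lborel. g r)"
  proof -
    let ?X = "\<lambda>q r. indicator {u..w} r * g r - indicator {u..w} r * ?S q r"
    have "(\<lambda>q. LINT r|lborel. ?X q r * indicator {u..w} r) \<longlonglongrightarrow> 0"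
    proof (rule L2_pair_tendsto[OF square_integrable_diff[OF gsq Ssq] isq])
      have "(?X q r)\<^sup>2 = indicator {u..w} r *\<^sub>R (g r - ?S q r)\<^sup>2" for q r by (auto simp: indicator_def)
      then show "(\<lambda>q. LINT r|lborel. (?X q r)\<^sup>2) \<longlonglongrightarrow> 0" using lim by (simp add: set_lebesgue_integral_def)
    qed
    moreover have "(LINT r|lborel. ?X q r * indicator {u..w} r) = (LINT r:{u..w}|lborel. g r) - (LINT r|lborel. indicator {u..w} r * ?S q r)" for q
    proof -
      have "integrable lborel (\<lambda>r. indicator {u..w} r * g r)"
        using square_integrable_times[OF gsq isq] by (simp add: mult_ac indicator_inter_arith[symmetric] mult.assoc[symmetric])
      from Bochner_Integration.integral_diff[OF this Sint[of q]]
      have "(LINT r|lborel. ?X q r) = (LINT r:{u..w}|lborel. g r) - (LINT r|lborel. indicator {u..w} r * ?S q r)"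
        by (simp add: set_lebesgue_integral_def)
      moreover have "(LINT r|lborel. ?X q r * indicator {u..w} r) = (LINT r|lborel. ?X q r)"
        by (intro Bochner_Integration.integral_cong) (auto simp: indicator_def)
      ultimately show ?thesis by simp
    qed
    ultimately have "(\<lambda>q. (LINT r:{u..w}|lborel. g r) - (LINT r|lborel. indicator {u..w} r * ?S q r)) \<longlonglongrightarrow> 0" by simp
    from tendsto_diff[OF tendsto_const[of "LINT r:{u..w}|lborel. g r"] this] show ?thesis by simp
  qed
  have "(\<lambda>q. expectation (\<lambda>\<omega>. J q \<omega> * ?V \<omega>)) \<longlonglongrightarrow> (LINT r:{u..w}|lborel. g r) * ?H"
    unfolding JV by (intro tendsto_mult glim tendsto_const)
  with lim1 have "expectation (\<lambda>\<omega>. I \<omega> * ?V \<omega>) = (LINT r:{u..w}|lborel. g r) * ?H" by (rule LIMSEQ_unique)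
  then show "expectation (\<lambda>\<omega>. \<zeta> \<omega> * (I \<omega> * v (S w \<omega>))) = (LINT r:{u..w}|lborel. g r) * ?H"
    by (simp add: mult_ac)
qed

lemma has_ito_integral_cong:
  assumes "\<And>r \<omega>. r \<in> {r1..r2} \<Longrightarrow> \<omega> \<in> space M \<Longrightarrow> \<Phi> r \<omega> = \<Psi> r \<omega>"
  shows "has_ito_integral M F W \<Phi> r1 r2 I \<longleftrightarrow> has_ito_integral M F W \<Psi> r1 r2 I"
proof -
  have 1: "(\<lambda>(r, \<omega>). \<Phi> r \<omega>) \<in> borel_measurable (restrict_space borel {r1..r2} \<Otimes>\<^sub>M M)
      \<longleftrightarrow> (\<lambda>(r, \<omega>). \<Psi> r \<omega>) \<in> borel_measurable (restrict_space borel {r1..r2} \<Otimes>\<^sub>M M)"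
    using assms by (intro measurable_cong) (auto simp: space_pair_measure space_restrict_space)
  have 2: "(\<integral>\<^sup>+\<omega>. (\<integral>\<^sup>+r\<in>{r1..r2}. ennreal ((norm (\<Phi> r \<omega> - P r \<omega>))\<^sup>2) \<partial>lborel) \<partial>M)
      = (\<integral>\<^sup>+\<omega>. (\<integral>\<^sup>+r\<in>{r1..r2}. ennreal ((norm (\<Psi> r \<omega> - P r \<omega>))\<^sup>2) \<partial>lborel) \<partial>M)" for P
    using assms by (intro nn_integral_cong) (auto simp: indicator_def)
  show ?thesis unfolding has_ito_integral_def 1 2 ..
qed

text \<open>Rescaling by (r - t) / h turns the normalisation of \<psi> on [0, 1] into an integral
  equal to h, which cancels the 1 / h in the H-coefficient; in expectation against functions of S
  the coefficient acts as the derivative of the semigroup. At h = 0 both sides vanish by the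
  conventions for step 0.\<close>

lemma H_coeff_moment:
  assumes t: "0 \<le> t" "0 \<le> h" "t + h \<le> T" and \<psi>: "\<psi> l \<in> moment_class m"
    and \<zeta>: "\<zeta> \<in> borel_measurable (F t)" "\<And>\<omega>. \<omega> \<in> space M \<Longrightarrow> \<bar>\<zeta> \<omega>\<bar> \<le> C" and v: "lin_growth v"
  shows "square_integrable M (\<lambda>\<omega>. H_coeff M F W \<psi> t h \<omega> $ l)"
    and "expectation (\<lambda>\<omega>. \<zeta> \<omega> * (H_coeff M F W \<psi> t h \<omega> $ l * v (S (t + h) \<omega>)))
      = expectation (\<lambda>\<omega>. \<zeta> \<omega> * heatd (d * h) v (S t \<omega>))"
proof -
  have "square_integrable M (\<lambda>\<omega>. H_coeff M F W \<psi> t h \<omega> $ l) \<and>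
     expectation (\<lambda>\<omega>. \<zeta> \<omega> * (H_coeff M F W \<psi> t h \<omega> $ l * v (S (t + h) \<omega>)))
      = expectation (\<lambda>\<omega>. \<zeta> \<omega> * heatd (d * h) v (S t \<omega>))"
  proof (cases "h = 0")
    case True
    then show ?thesis using square_integrable_const[of 0] by (simp add: H_coeff_def)
  next
    case False
    then have h: "h > 0" using t by simp
    \<comment> \<open>\<psi> is controlled on [0, 1] only; extension by zero gives a bounded Borel
      function on the line.\<close>
    define p where "p r = indicator {0..1} r * \<psi> l r" for r :: real
    define g where "g r = p ((r - t) / h)" for r
    obtain B where B': "\<forall>r\<in>{0..1}. \<bar>\<psi> l r\<bar> \<le> B"
      using \<psi> unfolding moment_class_def bounded_iff by auto
    then have B: "\<And>r. r \<in> {0..1} \<Longrightarrow> \<bar>\<psi> l r\<bar> \<le> B" by blast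
    have B0: "B \<ge> 0" using B[of 0] by auto
    have pm[measurable]: "p \<in> borel_measurable borel"
      using \<psi> unfolding p_def moment_class_def by (simp add: borel_measurable_restrict_space_iff)
    have pB: "\<bar>p r\<bar> \<le> B" for r using B[of r] B0 unfolding p_def by (auto simp: indicator_def)
    have gm[measurable]: "g \<in> borel_measurable borel" unfolding g_def by measurable
    have gB: "\<bar>g r\<bar> \<le> B" for r unfolding g_def by (rule pB)
    have th: "t < t + h" using h by simp
    \<comment> \<open>The two integrands agree on the interval of integration, so the chosen
      integral of one is an integral of the other.\<close>
    have eq: "has_ito_integral M F W (\<lambda>r _. axis l (\<psi> l ((r - t) / h))) t (t + h) I
        \<longleftrightarrow> has_ito_integral M F W (\<lambda>r _. axis l (g r)) t (t + h) I" for I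
      using h by (intro has_ito_integral_cong) (auto simp: g_def p_def indicator_def field_simps)
    define I where "I = ito_integral M F W (\<lambda>r _. axis l (\<psi> l ((r - t) / h))) t (t + h)"
    have I: "has_ito_integral M F W (\<lambda>r _. axis l (g r)) t (t + h) I"
      unfolding I_def ito_integral_def eq by (rule someI_ex[OF ito_exists[OF t(1) th t(3) gm gB]])
    note mom = ito_moment[OF t(1) th t(3) gm gB I \<zeta> v]
    have H: "H_coeff M F W \<psi> t h \<omega> $ l = 1 / h * I \<omega>" for \<omega>
      using h by (simp add: H_coeff_def I_def)
    have int: "(LINT r:{t..t+h}|lborel. g r) = h"
    proof -
      have "(LINT r:{t..t+h}|lborel. g r) = (LINT r|lborel. g r)"
        unfolding set_lebesgue_integral_def using h
        by (intro Bochner_Integration.integral_cong) (auto simp: g_def p_def indicator_def field_simps)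
      also have "\<dots> = h * (LINT x|lborel. g (t + h * x))"
        using h lborel_integral_real_affine[of h g t] by simp
      also have "(LINT x|lborel. g (t + h * x)) = (LINT r:{0..1}|lborel. \<psi> l r)"
        using h by (simp add: g_def p_def set_lebesgue_integral_def)
      also have "\<dots> = 1" using \<psi> by (simp add: moment_class_def)
      finally show ?thesis by simp
    qed
    have "expectation (\<lambda>\<omega>. \<zeta> \<omega> * (H_coeff M F W \<psi> t h \<omega> $ l * v (S (t + h) \<omega>)))
        = expectation (\<lambda>\<omega>. (1 / h) * (\<zeta> \<omega> * (I \<omega> * v (S (t + h) \<omega>))))"
      unfolding H by (intro Bochner_Integration.integral_cong) (auto simp: mult_ac)
    also have "\<dots> = (1 / h) * (h * expectation (\<lambda>\<omega>. \<zeta> \<omega> * heatd (d * h) v (S t \<omega>)))"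
    proof -
      have "expectation (\<lambda>\<omega>. \<zeta> \<omega> * (I \<omega> * v (S (t + h) \<omega>))) = h * expectation (\<lambda>\<omega>. \<zeta> \<omega> * heatd (d * h) v (S t \<omega>))"
        using mom(2) int by simp
      then show ?thesis by (simp only: integral_mult_right_zero)
    qed
    also have "\<dots> = expectation (\<lambda>\<omega>. \<zeta> \<omega> * heatd (d * h) v (S t \<omega>))" using h by simp
    finally show ?thesis
      by (intro conjI) (unfold H, rule square_integrable_mult[OF mom(1)])
  qed
  then show "square_integrable M (\<lambda>\<omega>. H_coeff M F W \<psi> t h \<omega> $ l)"
    and "expectation (\<lambda>\<omega>. \<zeta> \<omega> * (H_coeff M F W \<psi> t h \<omega> $ l * v (S (t + h) \<omega>)))
      = expectation (\<lambda>\<omega>. \<zeta> \<omega> * heatd (d * h) v (S t \<omega>))" by blast+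
qed

end

section \<open>The Ito formula for functions of the coordinate sum\<close>

text \<open>The difference of the two sides is, up to a positive factor, the integral of the squared
  deviation of f from its mean m.\<close>

lemma square_integral_Icc_le:
  fixes f :: "real \<Rightarrow> real"
  assumes f: "integrable lborel (\<lambda>r. indicator {u..w} r * f r)" and f2: "integrable lborel (\<lambda>r. indicator {u..w} r * (f r)\<^sup>2)"
    and uw: "u < w"
  shows "(LINT r:{u..w}|lborel. f r)\<^sup>2 \<le> (w - u) * (LINT r:{u..w}|lborel. (f r)\<^sup>2)"
proof -
  define m where "m = (LINT r:{u..w}|lborel. f r) / (w - u)"
  have m: "(LINT r|lborel. indicator {u..w} r * f r) = m * (w - u)"
    using uw unfolding m_def set_lebesgue_integral_def by simp
  have "0 \<le> (LINT r|lborel. indicator {u..w} r * (f r - m)\<^sup>2)"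
    by (rule Bochner_Integration.integral_nonneg) simp
  also have "\<dots> = (LINT r|lborel. indicator {u..w} r * (f r)\<^sup>2 - 2 * m * (indicator {u..w} r * f r) + m\<^sup>2 * indicator {u..w} r)"
    by (intro Bochner_Integration.integral_cong) (auto simp: power2_diff indicator_def)
  also have "\<dots> = (LINT r|lborel. indicator {u..w} r * (f r)\<^sup>2) - 2 * m * (m * (w - u)) + m\<^sup>2 * (w - u)"
    unfolding m[symmetric] using f f2 uw integrable_indicator_Icc[of u w]
    by (subst Bochner_Integration.integral_add | subst Bochner_Integration.integral_diff | simp)+
  finally have "m\<^sup>2 * (w - u) \<le> (LINT r|lborel. indicator {u..w} r * (f r)\<^sup>2)"
    by (simp add: power2_eq_square algebra_simps)
  then have "(w - u) * (m\<^sup>2 * (w - u)) \<le> (w - u) * (LINT r|lborel. indicator {u..w} r * (f r)\<^sup>2)"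
    using uw by (intro mult_left_mono) auto
  moreover have "(w - u) * (m\<^sup>2 * (w - u)) = (m * (w - u))\<^sup>2" by (simp add: power2_eq_square)
  ultimately show ?thesis unfolding set_lebesgue_integral_def real_scaleR_def m by simp
qed

lemma taylor3:
  fixes G :: "real \<Rightarrow> real"
  assumes "\<And>x. (G has_real_derivative z x) (at x)" "\<And>x. (z has_real_derivative z1 x) (at x)"
    "\<And>x. (z1 has_real_derivative z2 x) (at x)" and K: "\<And>x. \<bar>z2 x\<bar> \<le> K"
  shows "\<bar>G (x + h) - G x - z x * h - 1/2 * z1 x * h\<^sup>2\<bar> \<le> K * \<bar>h\<bar> ^ 3"
proof -
  define D where "D m = (case m of 0 \<Rightarrow> G | Suc 0 \<Rightarrow> z | Suc (Suc 0) \<Rightarrow> z1 | _ \<Rightarrow> z2)" for m :: nat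
  have D: "((\<lambda>h. D m (x + h)) has_real_derivative D (Suc m) (x + t)) (at t)" if "m < 3" for m t
  proof -
    have "m = 0 \<or> m = 1 \<or> m = 2" using that by auto
    then have "(D m has_real_derivative D (Suc m) (x + t)) (at (x + t))"
      using assms(1-3) by (auto simp: D_def numeral_2_eq_2)
    then show ?thesis by (simp add: DERIV_shift[symmetric] add.commute)
  qed
  have K0: "0 \<le> K" using K[of 0] by linarith
  have "\<exists>t. \<bar>t\<bar> \<le> \<bar>h\<bar> \<and> G (x + h) = (\<Sum>m<3. D m (x + 0) / fact m * h ^ m) + D 3 (x + t) / fact 3 * h ^ 3"
  proof (cases "h = 0")
    case True then show ?thesis by (auto simp: D_def numeral_3_eq_3)
  next
    case False
    consider "h < 0" | "h > 0" using False by linarith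
    then show ?thesis
    proof cases
      case 1
      from Maclaurin_minus[of h 3 "\<lambda>m h. D m (x + h)" "\<lambda>h. G (x + h)"] 1 D
      obtain t where "h < t" "t < 0" "G (x + h) = (\<Sum>m<3. D m (x + 0) / fact m * h ^ m) + D 3 (x + t) / fact 3 * h ^ 3"
        by (auto simp: D_def)
      then show ?thesis by (intro exI[of _ t]) auto
    next
      case 2
      from Maclaurin[of h 3 "\<lambda>m h. D m (x + h)" "\<lambda>h. G (x + h)"] 2 D
      obtain t where "0 < t" "t < h" "G (x + h) = (\<Sum>m<3. D m (x + 0) / fact m * h ^ m) + D 3 (x + t) / fact 3 * h ^ 3"
        by (auto simp: D_def)
      then show ?thesis by (intro exI[of _ t]) auto
    qed
  qed
  then obtain t where t: "G (x + h) = (\<Sum>m<3. D m (x + 0) / fact m * h ^ m) + D 3 (x + t) / fact 3 * h ^ 3" by blast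
  have "(\<Sum>m<3. D m (x + 0) / fact m * h ^ m) = G x + z x * h + 1/2 * z1 x * h\<^sup>2"
    by (simp add: numeral_3_eq_3 D_def power2_eq_square)
  with t have "\<bar>G (x + h) - G x - z x * h - 1/2 * z1 x * h\<^sup>2\<bar> = \<bar>D 3 (x + t) / fact 3 * h ^ 3\<bar>" by simp
  also have "\<dots> = \<bar>z2 (x + t)\<bar> / 6 * \<bar>h\<bar> ^ 3" by (simp add: D_def numeral_3_eq_3 abs_mult power_abs)
  also have "\<dots> \<le> K * \<bar>h\<bar> ^ 3" using K[of "x + t"] K0 by (intro mult_right_mono) auto
  finally show ?thesis .
qed

lemma lipschitz_from_deriv:
  fixes f :: "real \<Rightarrow> real"
  assumes "\<And>x. (f has_real_derivative f' x) (at x)" "\<And>x. \<bar>f' x\<bar> \<le> K"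
  shows "\<bar>f x - f y\<bar> \<le> K * \<bar>x - y\<bar>"
  using field_differentiable_bound[of UNIV f f' K x y] assms by (auto simp: abs_minus_commute)

lemma ennreal_combination:
  assumes "0 \<le> a" "0 \<le> b" "0 \<le> c"
  shows "2 * (2 * ennreal a + 2 * ennreal b) + 2 * ennreal c = ennreal (2 * (2 * a + 2 * b) + 2 * c)"
  using assms by (simp add: ennreal_plus ennreal_mult')

context brownian_setup
begin

lemma S_continuous: "\<omega> \<in> space M \<Longrightarrow> continuous_on {0..T} (\<lambda>t. S t \<omega>)"
proof -
  assume "\<omega> \<in> space M"
  then have "continuous_on {0..T} (\<lambda>t. W t \<omega>)" using bm unfolding brownian_motion_def by blast
  then show ?thesis unfolding S_def by (intro continuous_intros)
qed

text \<open>Paths are continuous, so S is a pointwise limit of its values at dyadic times, which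
  take countably many values. Clamping to [u, w] keeps all times where the paths are continuous and
  measurable.\<close>

lemma S_joint_measurable:
  assumes u: "0 \<le> u" "u \<le> w" "w \<le> T"
  shows "(\<lambda>(\<omega>, r). S (max u (min w r)) \<omega>) \<in> borel_measurable (M \<Otimes>\<^sub>M borel)"
proof (rule borel_measurable_LIMSEQ_real)
  let ?c = "\<lambda>r. max u (min w r)"
  let ?g = "\<lambda>n (r::real). real_of_int \<lfloor>r * 2 ^ n\<rfloor> / 2 ^ n :: real"
  have cT: "?c r \<in> {0..T}" for r using u by auto
  have flo: "(\<lambda>n. ?g n r) \<longlonglongrightarrow> r" for r :: real
  proof (rule LIMSEQ_I)
    fix e :: real assume "e > 0"
    obtain N where N: "(1/2) ^ N < e" using real_arch_pow_inv[OF \<open>e > 0\<close>, of "1/2"] by auto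
    have "norm (?g n r - r) < e" if n: "n \<ge> N" for n
    proof -
      have "\<bar>?g n r - r\<bar> = \<bar>real_of_int \<lfloor>r * 2 ^ n\<rfloor> - r * 2 ^ n\<bar> / 2 ^ n" by (simp add: field_simps abs_divide[symmetric])
      also have "\<dots> \<le> 1 / 2 ^ n" by (intro divide_right_mono) (linarith, simp)
      also have "\<dots> = (1/2) ^ n" by (simp add: power_divide)
      also have "\<dots> \<le> (1/2) ^ N" using n by (intro power_decreasing) auto
      finally show ?thesis using N by simp
    qed
    then show "\<exists>N. \<forall>n\<ge>N. norm (?g n r - r) < e" by blast
  qed
  show "(\<lambda>n. (\<lambda>(\<omega>, r). S (?c (?g n r)) \<omega>) x) \<longlonglongrightarrow> (\<lambda>(\<omega>, r). S (?c r) \<omega>) x" if xs: "x \<in> space (M \<Otimes>\<^sub>M borel)" for x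
  proof -
    obtain \<omega> r where x: "x = (\<omega>, r)" "\<omega> \<in> space M" using xs by (cases x) (auto simp: space_pair_measure)
    have "(\<lambda>n. ?c (?g n r)) \<longlonglongrightarrow> ?c r" by (intro tendsto_max tendsto_min tendsto_const flo)
    then have "(\<lambda>n. S (?c (?g n r)) \<omega>) \<longlonglongrightarrow> S (?c r) \<omega>"
      using S_continuous[OF x(2)] cT by (intro continuous_on_tendsto_compose[where f="\<lambda>t. S t \<omega>" and s="{0..T}"]) auto
    then show ?thesis by (simp add: x)
  qed
  show "(\<lambda>(\<omega>, r). S (?c (?g n r)) \<omega>) \<in> borel_measurable (M \<Otimes>\<^sub>M borel)" for n
  proof -
    have "(\<lambda>x. (\<lambda>k x. S (?c (real_of_int k / 2 ^ n)) (fst x)) \<lfloor>snd x * 2 ^ n\<rfloor> x) \<in> borel_measurable (M \<Otimes>\<^sub>M (borel :: real measure))"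
    proof (rule measurable_compose_countable[where f="\<lambda>k x. S (?c (real_of_int k / 2 ^ n)) (fst x)" and g="\<lambda>x. \<lfloor>snd x * 2 ^ n\<rfloor>"])
      fix k :: int
      have "S (?c (real_of_int k / 2 ^ n)) \<in> borel_measurable M" by (rule S_M[OF cT])
      then show "(\<lambda>x. S (?c (real_of_int k / 2 ^ n)) (fst x)) \<in> borel_measurable (M \<Otimes>\<^sub>M (borel :: real measure))"
        by (rule measurable_compose[OF measurable_fst])
    qed measurable
    then show ?thesis by (simp add: case_prod_unfold)
  qed
qed

text \<open>The fourth moment serves the compensated squares, the sixth the square of a cubic Taylor
  remainder.\<close>

lemma DS_moments:
  assumes ab: "0 \<le> a" "a < b" "b \<le> T"
  shows "integrable M (\<lambda>\<omega>. DS a b \<omega> ^ k)"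
    and "expectation (\<lambda>\<omega>. (DS a b \<omega>)\<^sup>2) = d * (b - a)"
    and "expectation (\<lambda>\<omega>. DS a b \<omega> ^ 4) = 3 * (d * (b - a))\<^sup>2"
    and "expectation (\<lambda>\<omega>. DS a b \<omega> ^ 6) = 15 * (d * (b - a)) ^ 3"
proof -
  note N = DS_normal[OF ab]
  have s: "sqrt (d * (b - a)) > 0" using ab d_pos by simp
  have sq: "sqrt (d * (b - a)) ^ (2 * k) = (d * (b - a)) ^ k" for k using s by (simp add: power_mult)
  show "integrable M (\<lambda>\<omega>. DS a b \<omega> ^ k)"
    using normal_expectation(2)[OF N s, of "\<lambda>y. y ^ k"] integrable_std_normal_distribution_moment[of k]
    by (simp add: power_mult_distrib)
  have e: "expectation (\<lambda>\<omega>. DS a b \<omega> ^ (2 * k)) = (d * (b - a)) ^ k * (fact (2 * k) / (2 ^ k * fact k))" for k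
    using normal_expectation(1)[OF N s, of "\<lambda>y. y ^ (2 * k)"] std_normal_distribution_even_moments(1)[of k]
    by (simp add: power_mult_distrib sq)
  show "expectation (\<lambda>\<omega>. (DS a b \<omega>)\<^sup>2) = d * (b - a)" using e[of 1] by simp
  show "expectation (\<lambda>\<omega>. DS a b \<omega> ^ 4) = 3 * (d * (b - a))\<^sup>2" using e[of 2] by (simp add: fact_numeral)
  show "expectation (\<lambda>\<omega>. DS a b \<omega> ^ 6) = 15 * (d * (b - a)) ^ 3" using e[of 3] by (simp add: fact_numeral)
qed

lemma increment_sq_le:
  assumes ab: "0 \<le> a" "a \<le> b" "b \<le> T" and \<rho>: "\<rho> \<in> borel_measurable borel" "\<And>x y. \<bar>\<rho> x - \<rho> y\<bar> \<le> K * \<bar>x - y\<bar>"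
  shows "(\<integral>\<^sup>+\<omega>. ennreal ((\<rho> (S b \<omega>) - \<rho> (S a \<omega>))\<^sup>2) \<partial>M) \<le> ennreal (K\<^sup>2 * (d * (b - a)))"
proof (cases "a = b")
  case False
  then have lt: "a < b" using ab by simp
  have "(\<integral>\<^sup>+\<omega>. ennreal ((\<rho> (S b \<omega>) - \<rho> (S a \<omega>))\<^sup>2) \<partial>M) \<le> (\<integral>\<^sup>+\<omega>. ennreal (K\<^sup>2 * (DS a b \<omega>)\<^sup>2) \<partial>M)"
  proof (intro nn_integral_mono ennreal_leI)
    fix \<omega>
    have "\<bar>\<rho> (S b \<omega>) - \<rho> (S a \<omega>)\<bar> \<le> K * \<bar>DS a b \<omega>\<bar>" using \<rho>(2)[of "S b \<omega>" "S a \<omega>"] S_DS[of b \<omega> a] by simp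
    then have "\<bar>\<rho> (S b \<omega>) - \<rho> (S a \<omega>)\<bar>\<^sup>2 \<le> (K * \<bar>DS a b \<omega>\<bar>)\<^sup>2" by (intro power_mono) auto
    then show "(\<rho> (S b \<omega>) - \<rho> (S a \<omega>))\<^sup>2 \<le> K\<^sup>2 * (DS a b \<omega>)\<^sup>2" by (simp add: power_mult_distrib)
  qed
  also have "\<dots> = ennreal (K\<^sup>2 * (d * (b - a)))"
    using DS_moments(1)[OF ab(1) lt ab(3), of 2] DS_moments(2)[OF ab(1) lt ab(3)]
    by (subst nn_integral_eq_integral) auto
  finally show ?thesis .
qed simp

text \<open>Sampling at the left end of each cell keeps the approximation adapted.\<close>

definition left_step :: "(real \<Rightarrow> real) \<Rightarrow> real \<Rightarrow> real \<Rightarrow> nat \<Rightarrow> real \<Rightarrow> 'w \<Rightarrow> real" where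
  "left_step \<rho> u w N r \<omega> = step_fun (grid u w N) N (\<lambda>k. \<rho> (S (grid u w N k) \<omega>)) r"

lemma left_step_mult: "left_step (\<lambda>x. c * \<rho> x) u w N r \<omega> = c * left_step \<rho> u w N r \<omega>"
  by (simp only: left_step_def step_fun_def sum_distrib_left mult.assoc)

text \<open>At a time r inside a cell the sampling time is at most (w - u) / N earlier, and the
  Lipschitz bound turns this lag into a variance.\<close>

lemma left_step_dist:
  assumes u: "0 \<le> u" "u < w" "w \<le> T" and N: "N > 0"
    and \<rho>[measurable]: "\<rho> \<in> borel_measurable borel" and lip: "\<And>x y. \<bar>\<rho> x - \<rho> y\<bar> \<le> K * \<bar>x - y\<bar>"
  shows "(\<integral>\<^sup>+\<omega>. (\<integral>\<^sup>+r\<in>{u..w}. ennreal ((\<rho> (S r \<omega>) - left_step \<rho> u w N r \<omega>)\<^sup>2) \<partial>lborel) \<partial>M)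
    \<le> ennreal (K\<^sup>2 * (d * ((w - u) / real N)) * (w - u))"
proof -
  interpret P: pair_sigma_finite M lborel ..
  let ?c = "\<lambda>r. max u (min w r)"
  let ?f = "\<lambda>(\<omega>, r). ennreal ((\<rho> (S (?c r) \<omega>) - left_step \<rho> u w N r \<omega>)\<^sup>2) * indicator {u..w} r"
  have gT: "grid u w N k \<in> {0..T}" if "k \<le> N" for k using grid_bounds[of u w k N] that u N by auto
  have [measurable]: "(\<lambda>x. S (?c (snd x)) (fst x)) \<in> borel_measurable (M \<Otimes>\<^sub>M lborel)"
    using S_joint_measurable[OF u(1) less_imp_le[OF u(2)] u(3)] by (simp add: case_prod_unfold)
  have [measurable]: "(\<lambda>x. left_step \<rho> u w N (snd x) (fst x)) \<in> borel_measurable (M \<Otimes>\<^sub>M lborel)"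
    unfolding left_step_def step_fun_def
  proof (rule borel_measurable_sum)
    fix k assume "k \<in> {..<N}"
    then have [measurable]: "S (grid u w N k) \<in> borel_measurable M" by (intro S_M gT) auto
    show "(\<lambda>x. \<rho> (S (grid u w N k) (fst x)) * indicator {grid u w N k<..grid u w N (Suc k)} (snd x)) \<in> borel_measurable (M \<Otimes>\<^sub>M lborel)"
      by measurable
  qed
  have fm: "?f \<in> borel_measurable (M \<Otimes>\<^sub>M lborel)" unfolding case_prod_unfold by measurable
  have "(\<integral>\<^sup>+\<omega>. (\<integral>\<^sup>+r\<in>{u..w}. ennreal ((\<rho> (S r \<omega>) - left_step \<rho> u w N r \<omega>)\<^sup>2) \<partial>lborel) \<partial>M)
      = (\<integral>\<^sup>+\<omega>. (\<integral>\<^sup>+r. ?f (\<omega>, r) \<partial>lborel) \<partial>M)"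
    by (intro nn_integral_cong) (auto simp: indicator_def)
  also have "\<dots> = (\<integral>\<^sup>+r. (\<integral>\<^sup>+\<omega>. ?f (\<omega>, r) \<partial>M) \<partial>lborel)"
    using P.Fubini[OF fm] by simp
  also have "\<dots> \<le> (\<integral>\<^sup>+r. ennreal (K\<^sup>2 * (d * ((w - u) / real N))) * indicator {u..w} r \<partial>lborel)"
  proof (rule nn_integral_mono_AE)
    have "AE r in lborel. r \<noteq> u" by (rule AE_lborel_singleton)
    then show "AE r in lborel. (\<integral>\<^sup>+\<omega>. ?f (\<omega>, r) \<partial>M) \<le> ennreal (K\<^sup>2 * (d * ((w - u) / real N))) * indicator {u..w} r"
    proof eventually_elim
      case (elim r)
      show ?case
      proof (cases "r \<in> {u..w}")
        case True
        with elim have r: "u < r" "r \<le> w" by auto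
        obtain k where k: "k < N" "grid u w N k < r" "r \<le> grid u w N (Suc k)" using grid_cell[OF r N] by blast
        have ls: "left_step \<rho> u w N r \<omega> = \<rho> (S (grid u w N k) \<omega>)" for \<omega>
          unfolding left_step_def using step_fun_grid[of u w k N r] k u by simp
        have "(\<integral>\<^sup>+\<omega>. ?f (\<omega>, r) \<partial>M) = (\<integral>\<^sup>+\<omega>. ennreal ((\<rho> (S r \<omega>) - \<rho> (S (grid u w N k) \<omega>))\<^sup>2) \<partial>M)"
          using r by (simp add: ls)
        also have "\<dots> \<le> ennreal (K\<^sup>2 * (d * (r - grid u w N k)))"
          using k r u gT[of k] by (intro increment_sq_le[OF _ _ _ \<rho> lip]) auto
        also have "\<dots> \<le> ennreal (K\<^sup>2 * (d * ((w - u) / real N)))"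
          using k grid_Suc[of u w N k] d_pos by (intro ennreal_leI mult_left_mono) auto
        finally show ?thesis using True by simp
      qed simp
    qed
  qed
  also have "\<dots> = ennreal (K\<^sup>2 * (d * ((w - u) / real N)) * (w - u))"
    using u d_pos by (simp add: nn_integral_cmult_indicator emeasure_lborel_Icc_eq ennreal_mult'[symmetric])
  finally show ?thesis .
qed

text \<open>The squared increment minus its mean is orthogonal to the past; this replaces (dW)^2 by
  d dt in Ito's formula.\<close>

lemma DS_compensated:
  assumes ab: "0 \<le> a" "a < b" "b \<le> T"
  defines "q \<equiv> \<lambda>\<omega>. (DS a b \<omega>)\<^sup>2 - d * (b - a)"
  shows "square_integrable M q" and "expectation (\<lambda>\<omega>. (q \<omega>)\<^sup>2) = 2 * (d * (b - a))\<^sup>2"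
    and "\<And>\<eta>. \<eta> \<in> borel_measurable (F a) \<Longrightarrow> square_integrable M \<eta> \<Longrightarrow> expectation (\<lambda>\<omega>. \<eta> \<omega> * q \<omega>) = 0"
proof -
  have [measurable]: "DS a b \<in> borel_measurable M" using DS_M[of a b] ab by auto
  note mom = DS_moments[OF ab]
  have q2: "(q \<omega>)\<^sup>2 = DS a b \<omega> ^ 4 - 2 * (d * (b - a)) * (DS a b \<omega>)\<^sup>2 + (d * (b - a))\<^sup>2" for \<omega>
  proof -
    have "(x\<^sup>2 - c)\<^sup>2 = x ^ 4 - 2 * c * x\<^sup>2 + c\<^sup>2" for x c :: real
      by (simp add: power2_eq_square power4_eq_xxxx algebra_simps)
    then show ?thesis unfolding q_def .
  qed
  show q: "square_integrable M q"
    unfolding square_integrable_def q2 using mom(1) by (auto simp: q_def)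
  show "expectation (\<lambda>\<omega>. (q \<omega>)\<^sup>2) = 2 * (d * (b - a))\<^sup>2"
  proof -
    have "expectation (\<lambda>\<omega>. (q \<omega>)\<^sup>2) = expectation (\<lambda>\<omega>. DS a b \<omega> ^ 4) - 2 * (d * (b - a)) * expectation (\<lambda>\<omega>. (DS a b \<omega>)\<^sup>2) + (d * (b - a))\<^sup>2"
      unfolding q2 using mom(1) prob_space
      by (subst Bochner_Integration.integral_add | subst Bochner_Integration.integral_diff | simp)+
    then show ?thesis unfolding mom(2,3) by (simp add: power2_eq_square)
  qed
  fix \<eta> assume \<eta>: "\<eta> \<in> borel_measurable (F a)" "square_integrable M \<eta>"
  have e: "q \<omega> = (\<lambda>z. (\<Sum>l\<in>UNIV. z $ l)\<^sup>2 - d * (b - a)) (W b \<omega> - W a \<omega>)" for \<omega>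
    by (simp add: q_def DS_def Dl_def)
  have "expectation (\<lambda>\<omega>. \<eta> \<omega> * q \<omega>) = expectation \<eta> * expectation q"
    using expectation_mult_incr[OF ab \<eta>(1), of "\<lambda>z. (\<Sum>l\<in>UNIV. z $ l)\<^sup>2 - d * (b - a)"] square_integrable_times[OF \<eta>(2) q]
    unfolding e by simp
  also have "expectation q = 0" unfolding q_def using mom(1)[of 2] mom(2) prob_space by simp
  finally show "expectation (\<lambda>\<omega>. \<eta> \<omega> * q \<omega>) = 0" by simp
qed

text \<open>Compared with the orthogonal case this loses a factor N. The Taylor remainders can
  afford it: their second moments are of order N^(-3).\<close>

lemma expectation_sum_sq_le:
  fixes X :: "nat \<Rightarrow> 'w \<Rightarrow> real"
  assumes X: "\<And>k. k < N \<Longrightarrow> square_integrable M (X k)" and B: "\<And>k. k < N \<Longrightarrow> expectation (\<lambda>\<omega>. (X k \<omega>)\<^sup>2) \<le> B"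
  shows "expectation (\<lambda>\<omega>. (\<Sum>k<N. X k \<omega>)\<^sup>2) \<le> real N * (real N * B)"
proof -
  have "expectation (\<lambda>\<omega>. (\<Sum>k<N. X k \<omega>)\<^sup>2) \<le> expectation (\<lambda>\<omega>. real N * (\<Sum>k<N. (X k \<omega>)\<^sup>2))"
  proof (rule integral_mono)
    have "square_integrable M (\<lambda>\<omega>. \<Sum>k<N. X k \<omega>)" using X by (intro square_integrable_sum) auto
    then show "integrable M (\<lambda>\<omega>. (\<Sum>k<N. X k \<omega>)\<^sup>2)" by (simp add: square_integrable_def)
    show "integrable M (\<lambda>\<omega>. real N * (\<Sum>k<N. (X k \<omega>)\<^sup>2))"
      using X by (intro integrable_mult_right Bochner_Integration.integrable_sum) (auto simp: square_integrable_def)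
    show "(\<Sum>k<N. X k \<omega>)\<^sup>2 \<le> real N * (\<Sum>k<N. (X k \<omega>)\<^sup>2)" for \<omega>
      using Cauchy_Schwarz_ineq_sum[of "\<lambda>_. 1" "\<lambda>k. X k \<omega>" "{..<N}"] by simp
  qed
  also have "\<dots> = real N * (\<Sum>k<N. expectation (\<lambda>\<omega>. (X k \<omega>)\<^sup>2))"
    using X by (subst integral_mult_right_zero, subst Bochner_Integration.integral_sum) (auto simp: square_integrable_def)
  also have "\<dots> \<le> real N * (\<Sum>k<N. B)" using B by (intro mult_left_mono sum_mono) auto
  finally show ?thesis by simp
qed

text \<open>The compensated squares have second moments of order N^(-2), for which the cruder bound
  would not tend to zero; orthogonality leaves a sum of order 1 / N.\<close>

lemma expectation_sum_sq_orth:
  fixes X :: "nat \<Rightarrow> 'w \<Rightarrow> real"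
  assumes X: "\<And>k. k < N \<Longrightarrow> square_integrable M (X k)" and orth: "\<And>j k. j < k \<Longrightarrow> k < N \<Longrightarrow> expectation (\<lambda>\<omega>. X j \<omega> * X k \<omega>) = 0"
  shows "expectation (\<lambda>\<omega>. (\<Sum>k<N. X k \<omega>)\<^sup>2) = (\<Sum>k<N. expectation (\<lambda>\<omega>. (X k \<omega>)\<^sup>2))"
proof -
  have "expectation (\<lambda>\<omega>. (\<Sum>k<N. X k \<omega>)\<^sup>2) = expectation (\<lambda>\<omega>. \<Sum>j<N. \<Sum>k<N. X j \<omega> * X k \<omega>)"
    by (simp add: power2_eq_square sum_product)
  also have "\<dots> = (\<Sum>j<N. \<Sum>k<N. expectation (\<lambda>\<omega>. X j \<omega> * X k \<omega>))"
    by (rule integral_sum2) (auto intro!: square_integrable_times X)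
  also have "\<dots> = (\<Sum>j<N. \<Sum>k<N. if k = j then expectation (\<lambda>\<omega>. (X j \<omega>)\<^sup>2) else 0)"
  proof (intro sum.cong refl)
    fix j k assume jk: "j \<in> {..<N}" "k \<in> {..<N}"
    consider "j < k" | "k < j" | "k = j" by linarith
    then show "expectation (\<lambda>\<omega>. X j \<omega> * X k \<omega>) = (if k = j then expectation (\<lambda>\<omega>. (X j \<omega>)\<^sup>2) else 0)"
      using jk orth[of j k] orth[of k j] by cases (auto simp: power2_eq_square mult.commute)
  qed
  finally show ?thesis by simp
qed

text \<open>On a uniform grid the claimed integral differs from the simple integral by three sums:
  third-order Taylor remainders \<open>R\<close>, compensated squared increments \<open>Q\<close>,
  and the error \<open>C\<close> of a left Riemann sum for the drift. Each tends to zero in L^2. All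
  derivatives in play are bounded, so no localisation occurs.\<close>

lemma ito_formula:
  fixes G z z1 z2 :: "real \<Rightarrow> real"
  assumes G: "\<And>x. (G has_real_derivative z x) (at x)" and z: "\<And>x. (z has_real_derivative z1 x) (at x)"
    and z1: "\<And>x. (z1 has_real_derivative z2 x) (at x)"
    and K: "\<And>x. \<bar>z x\<bar> \<le> K" "\<And>x. \<bar>z1 x\<bar> \<le> K" "\<And>x. \<bar>z2 x\<bar> \<le> K"
    and u: "0 \<le> u" "u \<le> w" "w \<le> T"
  shows "has_ito_integral M F W (\<lambda>r \<omega>. \<chi> l. z (S r \<omega>)) u w
    (\<lambda>\<omega>. G (S w \<omega>) - G (S u \<omega>) - d / 2 * (LINT r:{u..w}|lborel. z1 (S r \<omega>)))"
    (is "has_ito_integral M F W ?\<Phi> u w ?I")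
proof -
  have cont: "continuous_on UNIV G" "continuous_on UNIV z" "continuous_on UNIV z1"
    using G z z1 by (auto intro!: continuous_at_imp_continuous_on DERIV_isCont)
  then have [measurable]: "G \<in> borel_measurable borel" "z \<in> borel_measurable borel" "z1 \<in> borel_measurable borel"
    by (auto intro: borel_measurable_continuous_onI)
  have K0: "K \<ge> 0" using K(1)[of 0] by linarith
  let ?c = "\<lambda>r. max u (min w r)"
  have Sj: "(\<lambda>x. S (?c (snd x)) (fst x)) \<in> borel_measurable (M \<Otimes>\<^sub>M borel)"
    using S_joint_measurable[OF u] by (simp add: case_prod_unfold)
  have [measurable]: "S u \<in> borel_measurable M" "S w \<in> borel_measurable M" using S_M u by auto
  have Ieq: "(LINT r:{u..w}|lborel. z1 (S r \<omega>)) = (LINT r|lborel. indicator {u..w} r * z1 (S (?c r) \<omega>))" for \<omega>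
    unfolding set_lebesgue_integral_def by (intro Bochner_Integration.integral_cong) (auto simp: indicator_def)
  have Im: "?I \<in> borel_measurable M"
  proof -
    have [measurable]: "(\<lambda>x. S (?c (snd x)) (fst x)) \<in> borel_measurable (M \<Otimes>\<^sub>M lborel)" using Sj by simp
    have "(\<lambda>\<omega>. LINT r|lborel. indicator {u..w} r * z1 (S (?c r) \<omega>)) \<in> borel_measurable M" by measurable
    then show ?thesis unfolding Ieq by measurable
  qed
  have \<Phi>m: "(\<lambda>(r, \<omega>). ?\<Phi> r \<omega>) \<in> borel_measurable (restrict_space borel {u..w} \<Otimes>\<^sub>M M)"
  proof -
    have idm: "(\<lambda>r. r) \<in> measurable (restrict_space borel {u..w}) borel" by (rule measurable_restrict_space1) simp
    have "(\<lambda>x. (snd x, fst x)) \<in> measurable (restrict_space borel {u..w} \<Otimes>\<^sub>M M) (M \<Otimes>\<^sub>M borel)"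
      by (intro measurable_Pair measurable_snd measurable_compose[OF measurable_fst idm])
    from measurable_compose[OF this Sj] have "(\<lambda>x. S (?c (fst x)) (snd x)) \<in> borel_measurable (restrict_space borel {u..w} \<Otimes>\<^sub>M M)" by simp
    then have "(\<lambda>x. S (fst x) (snd x)) \<in> borel_measurable (restrict_space borel {u..w} \<Otimes>\<^sub>M M)"
      by (rule measurable_cong[THEN iffD1, rotated]) (auto simp: space_pair_measure space_restrict_space max_def min_def)
    then have "(\<lambda>x. z (S (fst x) (snd x)) *\<^sub>R ((\<chi> l. 1) :: real^'d)) \<in> borel_measurable (restrict_space borel {u..w} \<Otimes>\<^sub>M M)" by measurable
    moreover have "z y *\<^sub>R ((\<chi> l. 1) :: real^'d) = (\<chi> l. z y)" for y by (simp add: vec_eq_iff)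
    ultimately show ?thesis by (simp add: case_prod_unfold)
  qed
  show ?thesis
  \<comment> \<open>The degenerate interval occurs in the BSDE at t = T; there the empty sum with
    zero cells is an exact approximation.\<close>
  proof (cases "u = w")
    case True
    have sm: "simple_integrand M F u w 0 (\<lambda>_. u) (\<lambda>_ _. 0 :: real^'d)" using u by (simp add: simple_integrand_def)
    have null: "(\<integral>\<^sup>+r\<in>{w..w}. f r \<partial>lborel) = 0" for f :: "real \<Rightarrow> ennreal"
      using AE_lborel_singleton[of w] by (intro nn_integral_zero' ) (auto elim!: eventually_mono simp: indicator_def)
    have null2: "(LINT r:{w..w}|lborel. z1 (S r \<omega>)) = 0" for \<omega>
    proof -
      have "AE r in lborel. indicator {w..w} r *\<^sub>R z1 (S r \<omega>) = 0"
        using AE_lborel_singleton[of w] by eventually_elim (simp add: indicator_def)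
      then show ?thesis unfolding set_lebesgue_integral_def by (rule integral_eq_zero_AE)
    qed
    have "(\<lambda>p::nat. L2sq M (\<lambda>\<omega>. ?I \<omega> - simple_ito W 0 (\<lambda>_. u) (\<lambda>_ _. 0) \<omega>)) \<longlonglongrightarrow> 0"
      unfolding True null2 by (simp add: simple_ito_def L2sq_def)
    moreover have "(\<lambda>p::nat. \<integral>\<^sup>+\<omega>. (\<integral>\<^sup>+r\<in>{u..w}. ennreal ((norm (?\<Phi> r \<omega> - simple_process 0 (\<lambda>_. u) (\<lambda>_ _. 0) r \<omega>))\<^sup>2) \<partial>lborel) \<partial>M) \<longlonglongrightarrow> 0"
      unfolding True null by simp
    ultimately show ?thesis
      unfolding has_ito_integral_def using Im \<Phi>m sm
      by (intro conjI exI[of _ "\<lambda>_. 0"] exI[of _ "\<lambda>_ _. u"] exI[of _ "\<lambda>_ _ _. 0"]) auto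
  next
    case False
    then have uw: "u < w" using u by simp
    define \<xi> where "\<xi> N k \<omega> = (\<chi> l::'d. z (S (grid u w N k) \<omega>))" for N k \<omega>
    have gT: "grid u w N k \<in> {0..T}" if "k \<le> N" "N > 0" for k N using grid_bounds[of u w k N] that u by auto
    have s: "simple_integrand M F u w N (grid u w N) (\<xi> N)" if N: "N > 0" for N
    proof -
      have m: "\<xi> N k \<in> borel_measurable (F (grid u w N k))" if "k < N" for k
      proof -
        have "S (grid u w N k) \<in> borel_measurable (F (grid u w N k))" by (rule S_F) (use gT that N in auto)
        then have "(\<lambda>\<omega>. z (S (grid u w N k) \<omega>) *\<^sub>R ((\<chi> l. 1) :: real^'d)) \<in> borel_measurable (F (grid u w N k))" by measurable
        moreover have "z y *\<^sub>R ((\<chi> l. 1) :: real^'d) = (\<chi> l. z y)" for y by (simp add: vec_eq_iff)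
        ultimately show ?thesis by (simp add: \<xi>_def[abs_def])
      qed
      have b: "bounded (\<xi> N k ` space M)" for k
      proof -
        have "norm (\<xi> N k \<omega>) \<le> (\<Sum>l\<in>(UNIV::'d set). K)" for \<omega>
          unfolding \<xi>_def by (rule order_trans[OF norm_le_l1_cart]) (auto intro!: sum_mono K)
        then show ?thesis unfolding bounded_iff by blast
      qed
      show ?thesis using m b grid_bounds[of u w _ N] grid_mono[of u w _ _ N] u N
        by (auto simp: simple_integrand_def)
    qed
    have sp: "simple_process N (grid u w N) (\<xi> N) r \<omega> = (\<chi> l. left_step z u w N r \<omega>)" for N r \<omega>
      by (auto simp: simple_process_def left_step_def step_fun_def \<xi>_def vec_eq_iff mult.commute)
    have nrm: "(norm ((\<chi> l::'d. x) - (\<chi> l. y)))\<^sup>2 = d * (x - y)\<^sup>2" for x y :: real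
      by (simp add: norm_vec_def L2_set_def d_def)
    have si: "simple_ito W N (grid u w N) (\<xi> N) \<omega> = (\<Sum>k<N. z (S (grid u w N k) \<omega>) * DS (grid u w N k) (grid u w N (Suc k)) \<omega>)" for N \<omega>
      by (simp add: simple_ito_Dl \<xi>_def DS_def sum_distrib_left)
    have Klip: "\<bar>z x - z y\<bar> \<le> K * \<bar>x - y\<bar>" "\<bar>z1 x - z1 y\<bar> \<le> K * \<bar>x - y\<bar>" for x y
      using lipschitz_from_deriv[OF z K(2)] lipschitz_from_deriv[OF z1 K(3)] by blast+
    have conv1: "(\<lambda>p. \<integral>\<^sup>+\<omega>. (\<integral>\<^sup>+r\<in>{u..w}. ennreal ((norm (?\<Phi> r \<omega> - simple_process (Suc p) (grid u w (Suc p)) (\<xi> (Suc p)) r \<omega>))\<^sup>2) \<partial>lborel) \<partial>M) \<longlonglongrightarrow> 0"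
    proof (rule tendsto_sandwich[OF _ _ tendsto_const])
      let ?B = "\<lambda>p. d * (K\<^sup>2 * (d * ((w - u) / real (Suc p))) * (w - u))"
      have "?B \<longlonglongrightarrow> d * (K\<^sup>2 * (d * 0) * (w - u))"
        by (intro tendsto_intros lim_const_over_n[THEN LIMSEQ_Suc])
      then show "(\<lambda>p. ennreal (?B p)) \<longlonglongrightarrow> 0" using tendsto_ennrealI[of ?B 0] by simp
      show "\<forall>\<^sub>F p in sequentially. (\<integral>\<^sup>+\<omega>. (\<integral>\<^sup>+r\<in>{u..w}. ennreal ((norm (?\<Phi> r \<omega> - simple_process (Suc p) (grid u w (Suc p)) (\<xi> (Suc p)) r \<omega>))\<^sup>2) \<partial>lborel) \<partial>M) \<le> ennreal (?B p)"
      proof (rule always_eventually, rule allI)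
        fix p
        \<comment> \<open>All d components coincide, so the squared norm is d times a scalar square;
          sqrt d is moved into the scalar function to which \<open>left_step_dist\<close> is
          applied.\<close>
        have "ennreal ((norm (?\<Phi> r \<omega> - simple_process (Suc p) (grid u w (Suc p)) (\<xi> (Suc p)) r \<omega>))\<^sup>2)
          = ennreal ((sqrt d * z (S r \<omega>) - left_step (\<lambda>x. sqrt d * z x) u w (Suc p) r \<omega>)\<^sup>2)" for r \<omega>
          unfolding sp nrm left_step_mult right_diff_distrib[symmetric] using d_pos by (simp add: power_mult_distrib)
        then have "(\<integral>\<^sup>+\<omega>. (\<integral>\<^sup>+r\<in>{u..w}. ennreal ((norm (?\<Phi> r \<omega> - simple_process (Suc p) (grid u w (Suc p)) (\<xi> (Suc p)) r \<omega>))\<^sup>2) \<partial>lborel) \<partial>M)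
          \<le> ennreal ((sqrt d * K)\<^sup>2 * (d * ((w - u) / real (Suc p))) * (w - u))"
          using Klip(1) d_pos
          by (simp only:) (intro left_step_dist[OF u(1) uw u(3)], auto simp: right_diff_distrib[symmetric] abs_mult mult.assoc intro!: mult_left_mono)
        also have "(sqrt d * K)\<^sup>2 * (d * ((w - u) / real (Suc p))) * (w - u) = ?B p"
          using d_pos by (simp add: power_mult_distrib)
        finally show "(\<integral>\<^sup>+\<omega>. (\<integral>\<^sup>+r\<in>{u..w}. ennreal ((norm (?\<Phi> r \<omega> - simple_process (Suc p) (grid u w (Suc p)) (\<xi> (Suc p)) r \<omega>))\<^sup>2) \<partial>lborel) \<partial>M) \<le> ennreal (?B p)" .
      qed
    qed simp
    have conv2: "(\<lambda>p. L2sq M (\<lambda>\<omega>. ?I \<omega> - simple_ito W (Suc p) (grid u w (Suc p)) (\<xi> (Suc p)) \<omega>)) \<longlonglongrightarrow> 0"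
    proof (rule tendsto_sandwich[OF _ _ tendsto_const])
      let ?\<delta> = "\<lambda>p. (w - u) / real (Suc p)"
      \<comment> \<open>The three terms bound \<open>R\<close>, \<open>Q\<close> and
        \<open>C\<close>, in that order, with N times the cell length replaced by w - u. In 60 = 2 *
        2 * 15 the 15 is the sixth Gaussian moment; the powers of 2 come from two applications of
        \<open>L2sq_add_le\<close>.\<close>
      define B where "B p = 60 * K\<^sup>2 * d ^ 3 * (w - u)\<^sup>2 * ?\<delta> p + 2 * K\<^sup>2 * d\<^sup>2 * (w - u) * ?\<delta> p
        + 2 * ((sqrt (w - u) * (d / 2) * K)\<^sup>2 * (d * ?\<delta> p) * (w - u))" for p
      have "B \<longlonglongrightarrow> 60 * K\<^sup>2 * d ^ 3 * (w - u)\<^sup>2 * 0 + 2 * K\<^sup>2 * d\<^sup>2 * (w - u) * 0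
        + 2 * ((sqrt (w - u) * (d / 2) * K)\<^sup>2 * (d * 0) * (w - u))"
        unfolding B_def[abs_def] by (intro tendsto_intros lim_const_over_n[THEN LIMSEQ_Suc])
      then show "(\<lambda>p. ennreal (B p)) \<longlonglongrightarrow> 0" using tendsto_ennrealI[of B 0] by simp
      show "\<forall>\<^sub>F p in sequentially. L2sq M (\<lambda>\<omega>. ?I \<omega> - simple_ito W (Suc p) (grid u w (Suc p)) (\<xi> (Suc p)) \<omega>) \<le> ennreal (B p)"
      proof (rule always_eventually, rule allI)
        fix p
        define N where "N = Suc p"
        define \<delta> where "\<delta> = (w - u) / real N"
        have N: "N > 0" and \<delta>: "\<delta> > 0" "real N * \<delta> = w - u" using uw by (auto simp: N_def \<delta>_def)
        let ?g = "grid u w N"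
        let ?D = "\<lambda>k. DS (?g k) (?g (Suc k))"
        have gk: "0 \<le> ?g k" "?g k < ?g (Suc k)" "?g (Suc k) \<le> T" "?g (Suc k) - ?g k = \<delta>" "?g k \<in> {0..T}" "?g (Suc k) \<in> {0..T}"
          if "k < N" for k
          using gT[of k N] gT[of "Suc k" N] that N grid_Suc[of u w N k] \<delta>(1) unfolding \<delta>_def by auto
        have Sm[measurable]: "S (?g k) \<in> borel_measurable M" if "k \<le> N" for k using gT[OF that N] by (rule S_M)
        define R where "R k \<omega> = G (S (?g (Suc k)) \<omega>) - G (S (?g k) \<omega>) - z (S (?g k) \<omega>) * ?D k \<omega> - 1/2 * z1 (S (?g k) \<omega>) * (?D k \<omega>)\<^sup>2" for k \<omega>
        define Q where "Q k \<omega> = 1/2 * z1 (S (?g k) \<omega>) * ((?D k \<omega>)\<^sup>2 - d * \<delta>)" for k \<omega>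
        define C where "C \<omega> = d / 2 * (LINT r:{u..w}|lborel. left_step z1 u w N r \<omega> - z1 (S r \<omega>))" for \<omega>
        have Dm[measurable]: "?D k \<in> borel_measurable M" if "k < N" for k using gk[OF that] by (intro DS_M)
        have Rsq: "square_integrable M (R k)" and ER: "expectation (\<lambda>\<omega>. (R k \<omega>)\<^sup>2) \<le> K\<^sup>2 * (15 * (d * \<delta>) ^ 3)" if k: "k < N" for k
        proof -
          have Rb: "\<bar>R k \<omega>\<bar> \<le> K * \<bar>?D k \<omega>\<bar> ^ 3" for \<omega>
            using taylor3[OF G z z1 K(3), of "S (?g k) \<omega>" "?D k \<omega>"] S_DS[of "?g (Suc k)" \<omega> "?g k"] unfolding R_def by simp
          note mom = DS_moments[OF gk(1-3)[OF k]]
          have R2: "(R k \<omega>)\<^sup>2 \<le> K\<^sup>2 * ?D k \<omega> ^ 6" for \<omega>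
          proof -
            have "\<bar>R k \<omega>\<bar>\<^sup>2 \<le> (K * \<bar>?D k \<omega>\<bar> ^ 3)\<^sup>2" using Rb by (intro power_mono) auto
            also have "\<dots> = K\<^sup>2 * \<bar>?D k \<omega>\<bar> ^ 6" by (simp add: power_mult_distrib flip: power_mult)
            finally show ?thesis by (simp add: power_even_abs)
          qed
          have Rm: "R k \<in> borel_measurable M"
          proof -
            have [measurable]: "S (?g k) \<in> borel_measurable M" "S (?g (Suc k)) \<in> borel_measurable M" "?D k \<in> borel_measurable M"
              using Sm Dm k by auto
            show ?thesis unfolding R_def[abs_def] by measurable
          qed
          have i: "integrable M (\<lambda>\<omega>. (R k \<omega>)\<^sup>2)"
          proof (rule Bochner_Integration.integrable_bound)
            show "integrable M (\<lambda>\<omega>. K\<^sup>2 * ?D k \<omega> ^ 6)" using mom(1) by simp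
            show "AE \<omega> in M. norm ((R k \<omega>)\<^sup>2) \<le> norm (K\<^sup>2 * ?D k \<omega> ^ 6)" using R2 by (intro AE_I2) (simp add: abs_mult power_even_abs)
          qed (use Rm in measurable)
          with Rm show "square_integrable M (R k)" by (simp add: square_integrable_def)
          have "expectation (\<lambda>\<omega>. (R k \<omega>)\<^sup>2) \<le> expectation (\<lambda>\<omega>. K\<^sup>2 * ?D k \<omega> ^ 6)"
            using i mom(1) R2 by (intro integral_mono) auto
          then show "expectation (\<lambda>\<omega>. (R k \<omega>)\<^sup>2) \<le> K\<^sup>2 * (15 * (d * \<delta>) ^ 3)" using mom(4) gk(4)[OF k] by simp
        qed
        have Qsq: "square_integrable M (Q k)" and EQ: "expectation (\<lambda>\<omega>. (Q k \<omega>)\<^sup>2) \<le> K\<^sup>2 / 2 * (d * \<delta>)\<^sup>2"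
          and Qorth: "\<And>j. j < k \<Longrightarrow> expectation (\<lambda>\<omega>. Q j \<omega> * Q k \<omega>) = 0" if k: "k < N" for k
        proof -
          note q = DS_compensated[OF gk(1-3)[OF k], unfolded gk(4)[OF k]]
          have [measurable]: "S (?g k) \<in> borel_measurable M" using Sm k by auto
          have zb: "\<bar>1/2 * z1 x\<bar> \<le> K / 2" for x using K(2)[of x] by simp
          show Qk: "square_integrable M (Q k)" unfolding Q_def[abs_def]
            by (rule square_integrable_bounded_mult[OF q(1) _ zb]) measurable
          have "expectation (\<lambda>\<omega>. (Q k \<omega>)\<^sup>2) \<le> expectation (\<lambda>\<omega>. (K / 2)\<^sup>2 * ((?D k \<omega>)\<^sup>2 - d * \<delta>)\<^sup>2)"
          proof (rule integral_mono)
            fix \<omega>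
            have "\<bar>1/2 * z1 (S (?g k) \<omega>)\<bar>\<^sup>2 \<le> (K / 2)\<^sup>2" using zb by (intro power_mono) auto
            then have "(1/2 * z1 (S (?g k) \<omega>))\<^sup>2 \<le> (K / 2)\<^sup>2" by (simp only: power2_abs)
            then show "(Q k \<omega>)\<^sup>2 \<le> (K / 2)\<^sup>2 * ((?D k \<omega>)\<^sup>2 - d * \<delta>)\<^sup>2"
              unfolding Q_def power_mult_distrib[of "1/2 * z1 (S (?g k) \<omega>)"] by (intro mult_right_mono) auto
          qed (use Qk q(1) in \<open>auto simp: square_integrable_def\<close>)
          then show "expectation (\<lambda>\<omega>. (Q k \<omega>)\<^sup>2) \<le> K\<^sup>2 / 2 * (d * \<delta>)\<^sup>2"
            using q(2) by (simp add: power_divide)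
          fix j assume j: "j < k"
          then have jN: "j < N" using k by simp
          have le: "?g (Suc j) \<le> ?g k" "?g j \<le> ?g k" using grid_mono[of u w _ k N] j u by auto
          let ?\<eta> = "\<lambda>\<omega>. (1/2 * z1 (S (?g k) \<omega>)) * Q j \<omega>"
          have "?\<eta> \<in> borel_measurable (F (?g k))"
          proof -
            have [measurable]: "S (?g k) \<in> borel_measurable (F (?g k))" "S (?g j) \<in> borel_measurable (F (?g k))" "?D j \<in> borel_measurable (F (?g k))"
              using gk[OF k] gk[OF jN] le by (auto intro!: S_F DS_F)
            show ?thesis unfolding Q_def by measurable
          qed
          moreover have "square_integrable M ?\<eta>"
          proof (rule square_integrable_bounded_mult[OF _ _ zb])
            note qj = DS_compensated[OF gk(1-3)[OF jN], unfolded gk(4)[OF jN]]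
            have [measurable]: "S (?g j) \<in> borel_measurable M" using Sm jN by auto
            show "square_integrable M (Q j)" unfolding Q_def[abs_def]
              by (rule square_integrable_bounded_mult[OF qj(1) _ zb]) measurable
          qed measurable
          ultimately have "expectation (\<lambda>\<omega>. ?\<eta> \<omega> * ((?D k \<omega>)\<^sup>2 - d * \<delta>)) = 0" by (rule q(3))
          then show "expectation (\<lambda>\<omega>. Q j \<omega> * Q k \<omega>) = 0" unfolding Q_def[of k] by (simp add: mult_ac)
        qed
        have iz: "integrable lborel (\<lambda>r. indicator {u..w} r * z1 (S r \<omega>))"
          and iz2: "integrable lborel (\<lambda>r. indicator {u..w} r * (z1 (S r \<omega>))\<^sup>2)" if \<omega>: "\<omega> \<in> space M" for \<omega>
        proof -
          have "continuous_on {u..w} (\<lambda>r. S r \<omega>)" by (rule continuous_on_subset[OF S_continuous[OF \<omega>]]) (use u in auto)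
          then have c: "continuous_on {u..w} (\<lambda>r. z1 (S r \<omega>))"
            by (rule continuous_on_compose2[OF cont(3)]) auto
          show "integrable lborel (\<lambda>r. indicator {u..w} r * z1 (S r \<omega>))"
            using borel_integrable_atLeastAtMost'[OF c] by (simp add: set_integrable_def)
          have c2: "continuous_on {u..w} (\<lambda>r. (z1 (S r \<omega>))\<^sup>2)" by (intro continuous_intros c)
          show "integrable lborel (\<lambda>r. indicator {u..w} r * (z1 (S r \<omega>))\<^sup>2)"
            using borel_integrable_atLeastAtMost'[OF c2] by (simp add: set_integrable_def)
        qed
        have il: "integrable lborel (\<lambda>r. indicator {u..w} r * left_step z1 u w N r \<omega>)"
          and vl: "(LINT r|lborel. indicator {u..w} r * left_step z1 u w N r \<omega>) = (\<Sum>k<N. z1 (S (?g k) \<omega>) * \<delta>)" for \<omega>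
        proof -
          show "integrable lborel (\<lambda>r. indicator {u..w} r * left_step z1 u w N r \<omega>)"
            unfolding left_step_def by (rule step_fun_integral[OF u(2) N])
          show "(LINT r|lborel. indicator {u..w} r * left_step z1 u w N r \<omega>) = (\<Sum>k<N. z1 (S (?g k) \<omega>) * \<delta>)"
            unfolding left_step_def step_fun_integral(2)[OF u(2) N] using gk(4) by (intro sum.cong) auto
        qed
        have Ceq: "C \<omega> = d / 2 * ((\<Sum>k<N. z1 (S (?g k) \<omega>) * \<delta>) - (LINT r:{u..w}|lborel. z1 (S r \<omega>)))" if \<omega>: "\<omega> \<in> space M" for \<omega>
        proof -
          have "(LINT r:{u..w}|lborel. left_step z1 u w N r \<omega> - z1 (S r \<omega>))
            = (LINT r|lborel. indicator {u..w} r * left_step z1 u w N r \<omega> - indicator {u..w} r * z1 (S r \<omega>))"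
            by (simp add: set_lebesgue_integral_def right_diff_distrib)
          also have "\<dots> = (\<Sum>k<N. z1 (S (?g k) \<omega>) * \<delta>) - (LINT r|lborel. indicator {u..w} r * z1 (S r \<omega>))"
            unfolding Bochner_Integration.integral_diff[OF il iz[OF \<omega>]] vl ..
          finally show ?thesis by (simp add: C_def set_lebesgue_integral_def)
        qed
        \<comment> \<open>The increments of G telescope, and the second-order terms of
          \<open>R\<close> and the compensators in \<open>Q\<close> combine to the Riemann sum that
          \<open>C\<close> compares with the integral.\<close>
        have eq: "?I \<omega> - simple_ito W N ?g (\<xi> N) \<omega> = (\<Sum>k<N. R k \<omega>) + (\<Sum>k<N. Q k \<omega>) + C \<omega>" if \<omega>: "\<omega> \<in> space M" for \<omega>
        proof -
          have tel: "(\<Sum>k<N. G (S (?g (Suc k)) \<omega>) - G (S (?g k) \<omega>)) = G (S w \<omega>) - G (S u \<omega>)"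
            using sum_lessThan_telescope[of "\<lambda>k. G (S (?g k) \<omega>)" N] N by simp
          have RQ: "R k \<omega> + Q k \<omega> = (G (S (?g (Suc k)) \<omega>) - G (S (?g k) \<omega>)) - z (S (?g k) \<omega>) * ?D k \<omega> - d / 2 * (z1 (S (?g k) \<omega>) * \<delta>)" for k
            unfolding R_def Q_def by (simp add: algebra_simps)
          have "(\<Sum>k<N. R k \<omega>) + (\<Sum>k<N. Q k \<omega>) = (\<Sum>k<N. R k \<omega> + Q k \<omega>)" by (simp add: sum.distrib)
          also have "\<dots> = G (S w \<omega>) - G (S u \<omega>) - (\<Sum>k<N. z (S (?g k) \<omega>) * ?D k \<omega>) - d / 2 * (\<Sum>k<N. z1 (S (?g k) \<omega>) * \<delta>)"
            unfolding RQ tel[symmetric] sum_subtractf sum_distrib_left ..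
          finally show ?thesis unfolding Ceq[OF \<omega>] si by (simp add: algebra_simps)
        qed
        have LC: "L2sq M C \<le> ennreal ((sqrt (w - u) * (d / 2) * K)\<^sup>2 * (d * \<delta>) * (w - u))"
        proof -
          \<comment> \<open>The constant collects the factor d / 2 of the drift and the factor sqrt
            (w - u) from Cauchy-Schwarz in time.\<close>
          let ?\<rho> = "\<lambda>x. (sqrt (w - u) * (d / 2)) * z1 x"
          have "L2sq M C \<le> (\<integral>\<^sup>+\<omega>. (\<integral>\<^sup>+r\<in>{u..w}. ennreal ((?\<rho> (S r \<omega>) - left_step ?\<rho> u w N r \<omega>)\<^sup>2) \<partial>lborel) \<partial>M)"
            unfolding L2sq_def
          proof (rule nn_integral_mono)
            fix \<omega> assume \<omega>: "\<omega> \<in> space M"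
            let ?f = "\<lambda>r. left_step z1 u w N r \<omega> - z1 (S r \<omega>)"
            have if1: "integrable lborel (\<lambda>r. indicator {u..w} r * ?f r)"
              using Bochner_Integration.integrable_diff[OF il iz[OF \<omega>]] by (simp add: right_diff_distrib)
            have fb: "\<bar>?f r\<bar> \<le> 2 * K" if r: "u < r" "r \<le> w" for r
            proof -
              obtain k where k: "k < N" "?g k < r" "r \<le> ?g (Suc k)" using grid_cell[OF r N] by blast
              have "left_step z1 u w N r \<omega> = z1 (S (?g k) \<omega>)"
                unfolding left_step_def using step_fun_grid[of u w k N r] k u by simp
              then show ?thesis using K(2)[of "S (?g k) \<omega>"] K(2)[of "S r \<omega>"] by linarith
            qed
            have if2: "integrable lborel (\<lambda>r. indicator {u..w} r * (?f r)\<^sup>2)"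
            proof (rule Bochner_Integration.integrable_bound)
              show "integrable lborel (\<lambda>r. indicator {u..w} r * (2 * K)\<^sup>2)" by (intro integrable_mult_left integrable_indicator_Icc)
              have "(\<lambda>r. (indicator {u..w} r * ?f r)\<^sup>2) \<in> borel_measurable lborel" using if1 by measurable
              moreover have "(indicator {u..w} r * ?f r)\<^sup>2 = indicator {u..w} r * (?f r)\<^sup>2" for r by (auto simp: indicator_def)
              ultimately show "(\<lambda>r. indicator {u..w} r * (?f r)\<^sup>2) \<in> borel_measurable lborel" by (simp only:)
              show "AE r in lborel. norm (indicator {u..w} r * (?f r)\<^sup>2) \<le> norm (indicator {u..w} r * (2 * K)\<^sup>2)"
                using AE_lborel_singleton[of u]
              proof eventually_elim
                case (elim r)
                show ?case
                proof (cases "r \<in> {u..w}")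
                  case True
                  then have "\<bar>?f r\<bar>\<^sup>2 \<le> (2 * K)\<^sup>2" using fb[of r] elim by (intro power_mono) auto
                  then show ?thesis using True by simp
                qed simp
              qed
            qed
            have "(C \<omega>)\<^sup>2 = (d / 2)\<^sup>2 * (LINT r:{u..w}|lborel. ?f r)\<^sup>2" unfolding C_def by (rule power_mult_distrib)
            also have "\<dots> \<le> (d / 2)\<^sup>2 * ((w - u) * (LINT r:{u..w}|lborel. (?f r)\<^sup>2))"
              by (intro mult_left_mono square_integral_Icc_le[OF if1 if2 uw]) auto
            also have "\<dots> = (LINT r|lborel. ((w - u) * (d / 2)\<^sup>2) * (indicator {u..w} r * (?f r)\<^sup>2))"
              unfolding set_lebesgue_integral_def integral_mult_right_zero by (simp add: mult_ac)
            finally have "ennreal ((norm (C \<omega>))\<^sup>2) \<le> ennreal (LINT r|lborel. ((w - u) * (d / 2)\<^sup>2) * (indicator {u..w} r * (?f r)\<^sup>2))"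
              by (intro ennreal_leI) simp
            also have "\<dots> = (\<integral>\<^sup>+r. ennreal (((w - u) * (d / 2)\<^sup>2) * (indicator {u..w} r * (?f r)\<^sup>2)) \<partial>lborel)"
              using uw by (intro nn_integral_eq_integral[symmetric] integrable_mult_right if2) auto
            also have "\<dots> = (\<integral>\<^sup>+r\<in>{u..w}. ennreal ((?\<rho> (S r \<omega>) - left_step ?\<rho> u w N r \<omega>)\<^sup>2) \<partial>lborel)"
            proof (rule nn_integral_cong)
              fix r
              have "(?\<rho> (S r \<omega>) - left_step ?\<rho> u w N r \<omega>)\<^sup>2 = (sqrt (w - u) * (d / 2))\<^sup>2 * (z1 (S r \<omega>) - left_step z1 u w N r \<omega>)\<^sup>2"
                unfolding left_step_mult right_diff_distrib[symmetric] by (rule power_mult_distrib)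
              also have "\<dots> = ((w - u) * (d / 2)\<^sup>2) * (?f r)\<^sup>2"
                using uw unfolding power_mult_distrib by (simp add: power2_commute)
              finally show "ennreal (((w - u) * (d / 2)\<^sup>2) * (indicator {u..w} r * (?f r)\<^sup>2))
                = ennreal ((?\<rho> (S r \<omega>) - left_step ?\<rho> u w N r \<omega>)\<^sup>2) * indicator {u..w} r"
                by (auto simp: indicator_def)
            qed
            finally show "ennreal ((norm (C \<omega>))\<^sup>2) \<le> (\<integral>\<^sup>+r\<in>{u..w}. ennreal ((?\<rho> (S r \<omega>) - left_step ?\<rho> u w N r \<omega>)\<^sup>2) \<partial>lborel)" .
          qed
          also have "\<dots> \<le> ennreal ((sqrt (w - u) * (d / 2) * K)\<^sup>2 * (d * ((w - u) / real N)) * (w - u))"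
          proof (rule left_step_dist[OF u(1) uw u(3) N])
            show "\<bar>?\<rho> x - ?\<rho> y\<bar> \<le> sqrt (w - u) * (d / 2) * K * \<bar>x - y\<bar>" for x y
            proof -
              have "\<bar>?\<rho> x - ?\<rho> y\<bar> = (sqrt (w - u) * (d / 2)) * \<bar>z1 x - z1 y\<bar>"
                unfolding right_diff_distrib[symmetric] abs_mult using uw d_pos by simp
              also have "\<dots> \<le> (sqrt (w - u) * (d / 2)) * (K * \<bar>x - y\<bar>)"
                using uw d_pos by (intro mult_left_mono Klip) auto
              finally show ?thesis by (simp add: mult.assoc)
            qed
          qed measurable
          finally show ?thesis unfolding \<delta>_def .
        qed
        have sm: "simple_ito W N ?g (\<xi> N) \<in> borel_measurable M"
          using simple_cross(1)[OF u(1,3) s[OF N] s[OF N]] by (simp add: square_integrable_def)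
        have Rsum: "square_integrable M (\<lambda>\<omega>. \<Sum>k<N. R k \<omega>)" and Qsum: "square_integrable M (\<lambda>\<omega>. \<Sum>k<N. Q k \<omega>)"
          using Rsq Qsq by (auto intro!: square_integrable_sum)
        then have [measurable]: "(\<lambda>\<omega>. \<Sum>k<N. R k \<omega>) \<in> borel_measurable M" "(\<lambda>\<omega>. \<Sum>k<N. Q k \<omega>) \<in> borel_measurable M"
          by (auto simp: square_integrable_def)
        \<comment> \<open>Measurability of \<open>C\<close> is read off from the decomposition,
          where all other terms are known to be measurable.\<close>
        have Cm[measurable]: "C \<in> borel_measurable M"
        proof -
          have "(\<lambda>\<omega>. ?I \<omega> - simple_ito W N ?g (\<xi> N) \<omega> - (\<Sum>k<N. R k \<omega>) - (\<Sum>k<N. Q k \<omega>)) \<in> borel_measurable M"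
            by (intro borel_measurable_diff[OF borel_measurable_diff[OF borel_measurable_diff[OF Im sm]]]) measurable
          then show ?thesis by (rule measurable_cong[THEN iffD1, rotated]) (use eq in simp)
        qed
        have "L2sq M (\<lambda>\<omega>. ?I \<omega> - simple_ito W N ?g (\<xi> N) \<omega>) = L2sq M (\<lambda>\<omega>. ((\<Sum>k<N. R k \<omega>) + (\<Sum>k<N. Q k \<omega>)) + C \<omega>)"
          unfolding L2sq_def using eq by (intro nn_integral_cong) simp
        also have "\<dots> \<le> 2 * L2sq M (\<lambda>\<omega>. (\<Sum>k<N. R k \<omega>) + (\<Sum>k<N. Q k \<omega>)) + 2 * L2sq M C"
          by (rule L2sq_add_le) measurable
        also have "\<dots> \<le> 2 * (2 * L2sq M (\<lambda>\<omega>. \<Sum>k<N. R k \<omega>) + 2 * L2sq M (\<lambda>\<omega>. \<Sum>k<N. Q k \<omega>)) + 2 * L2sq M C"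
          by (intro add_right_mono mult_left_mono L2sq_add_le) measurable
        also have "\<dots> \<le> 2 * (2 * ennreal (real N * (real N * (K\<^sup>2 * (15 * (d * \<delta>) ^ 3)))) + 2 * ennreal (\<Sum>k<N. K\<^sup>2 / 2 * (d * \<delta>)\<^sup>2))
            + 2 * ennreal ((sqrt (w - u) * (d / 2) * K)\<^sup>2 * (d * \<delta>) * (w - u))"
        proof (intro add_mono mult_left_mono LC)
          show "L2sq M (\<lambda>\<omega>. \<Sum>k<N. R k \<omega>) \<le> ennreal (real N * (real N * (K\<^sup>2 * (15 * (d * \<delta>) ^ 3))))"
            unfolding L2sq_eq[OF Rsum] by (intro ennreal_leI expectation_sum_sq_le Rsq ER)
          show "L2sq M (\<lambda>\<omega>. \<Sum>k<N. Q k \<omega>) \<le> ennreal (\<Sum>k<N. K\<^sup>2 / 2 * (d * \<delta>)\<^sup>2)"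
          proof -
            have "expectation (\<lambda>\<omega>. (\<Sum>k<N. Q k \<omega>)\<^sup>2) = (\<Sum>k<N. expectation (\<lambda>\<omega>. (Q k \<omega>)\<^sup>2))"
              by (rule expectation_sum_sq_orth) (auto intro: Qsq Qorth)
            also have "\<dots> \<le> (\<Sum>k<N. K\<^sup>2 / 2 * (d * \<delta>)\<^sup>2)" by (rule sum_mono, rule EQ) simp
            finally show ?thesis unfolding L2sq_eq[OF Qsum] by (rule ennreal_leI)
          qed
        qed auto
        also have "\<dots> = ennreal (2 * (2 * (real N * (real N * (K\<^sup>2 * (15 * (d * \<delta>) ^ 3)))) + 2 * (\<Sum>k<N. K\<^sup>2 / 2 * (d * \<delta>)\<^sup>2))
            + 2 * ((sqrt (w - u) * (d / 2) * K)\<^sup>2 * (d * \<delta>) * (w - u)))"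
          using \<delta>(1) d_pos uw by (intro ennreal_combination) (auto intro!: sum_nonneg)
        also have "\<dots> = ennreal (B p)"
        proof -
          have "2 * (2 * (real N * (real N * (K\<^sup>2 * (15 * (d * \<delta>) ^ 3)))) + 2 * (\<Sum>k<N. K\<^sup>2 / 2 * (d * \<delta>)\<^sup>2))
            = 60 * K\<^sup>2 * d ^ 3 * (real N * \<delta>)\<^sup>2 * \<delta> + 2 * K\<^sup>2 * d\<^sup>2 * (real N * \<delta>) * \<delta>"
            by (simp add: power2_eq_square power3_eq_cube algebra_simps)
          then show ?thesis unfolding B_def \<delta>(2) \<delta>_def[symmetric] N_def[symmetric] by simp
        qed
        finally show "L2sq M (\<lambda>\<omega>. ?I \<omega> - simple_ito W (Suc p) (grid u w (Suc p)) (\<xi> (Suc p)) \<omega>) \<le> ennreal (B p)"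
          unfolding N_def .
      qed
    qed simp
    show ?thesis
      unfolding has_ito_integral_def using Im \<Phi>m s conv1 conv2
      by (intro conjI exI[of _ Suc] exI[of _ "\<lambda>p. grid u w (Suc p)"] exI[of _ "\<lambda>p. \<xi> (Suc p)"]) auto
  qed
qed

end

section \<open>The Gudermannian function and its derivatives\<close>

definition gd :: "real \<Rightarrow> real" where "gd x = arctan (sinh x)"

definition sech :: "real \<Rightarrow> real" where "sech x = 1 / cosh x"

text \<open>The antiderivative is fixed up to an additive constant; what enters is its derivative
  and the linear growth that follows from it.\<close>

definition gdint :: "real \<Rightarrow> real" where
  "gdint = (SOME G. \<forall>x. (G has_real_derivative gd x) (at x))"

lemma tanh_sech: "(tanh x)\<^sup>2 = 1 - (sech x)\<^sup>2"
proof -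
  have c: "(cosh x)\<^sup>2 \<noteq> 0" by simp
  have "(tanh x)\<^sup>2 = (sinh x)\<^sup>2 / (cosh x)\<^sup>2" by (simp add: tanh_def power_divide)
  also have "(sinh x)\<^sup>2 = (cosh x)\<^sup>2 - 1" using hyperbolic_pythagoras[of x] by linarith
  also have "((cosh x)\<^sup>2 - 1) / (cosh x)\<^sup>2 = 1 - (sech x)\<^sup>2"
    using c by (simp only: diff_divide_distrib divide_self sech_def power_divide power_one if_False simp_thms)
  finally show ?thesis .
qed

lemma sech_bounds: "0 < sech x" "sech x \<le> 1" "\<bar>tanh x :: real\<bar> \<le> 1"
proof -
  show "0 < sech x" "sech x \<le> 1" by (auto simp: sech_def cosh_real_ge_1)
  have "(tanh x)\<^sup>2 \<le> (1::real)\<^sup>2" by (simp add: tanh_sech)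
  then show "\<bar>tanh x :: real\<bar> \<le> 1" by (simp add: abs_square_le_1)
qed

lemma sqrt_sinh: "sqrt (1 + (sinh x)\<^sup>2) = cosh (x::real)"
  using hyperbolic_pythagoras[of x] by (intro real_sqrt_unique) auto

text \<open>Together with \<open>gd_deriv\<close> this is the differential equation gd' = cos gd, by
  which the test function solves (P). The sine determines the derivative of the driver along the
  solution.\<close>

lemma cos_gd: "cos (gd x) = sech x" and sin_gd: "sin (gd x) = tanh x"
  by (simp_all add: gd_def cos_arctan sin_arctan sqrt_sinh sech_def tanh_def)

lemma gd_deriv: "(gd has_real_derivative sech x) (at x)"
proof -
  have "(gd has_real_derivative (inverse (1 + (sinh x)\<^sup>2) * cosh x)) (at x)"
    unfolding gd_def[abs_def] by (auto intro!: derivative_eq_intros)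
  moreover have "inverse (1 + (sinh x)\<^sup>2) * cosh x = sech x"
  proof -
    have "1 + (sinh x)\<^sup>2 = (cosh x)\<^sup>2" using hyperbolic_pythagoras[of x] by simp
    then show ?thesis by (simp add: sech_def power2_eq_square field_simps)
  qed
  ultimately show ?thesis by simp
qed

lemma gdint_deriv: "(gdint has_real_derivative gd x) (at x)"
proof -
  have cont: "isCont gd x" for x using gd_deriv by (rule DERIV_isCont)
  have "\<exists>G. \<forall>x. - \<infinity> < ereal x \<longrightarrow> ereal x < \<infinity> \<longrightarrow> (G has_vector_derivative gd x) (at x)"
    by (rule einterval_antiderivative) (auto intro: cont)
  then have "\<exists>G. \<forall>x. (G has_real_derivative gd x) (at x)"
    by (simp add: has_real_derivative_iff_has_vector_derivative)
  from someI_ex[OF this] show ?thesis unfolding gdint_def by blast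
qed

lemma sech_deriv: "(sech has_real_derivative - sech x * tanh x) (at x)"
  unfolding sech_def[abs_def] by (auto intro!: derivative_eq_intros simp: tanh_def field_simps power2_eq_square)

lemma tanh_deriv: "(tanh has_real_derivative (sech x)\<^sup>2) (at x)"
proof -
  have "(tanh has_real_derivative 1 - (tanh x)\<^sup>2) (at x)" by (auto intro!: derivative_eq_intros)
  then show ?thesis by (simp add: tanh_sech)
qed

text \<open>Functions \<open>p (sech x) + tanh x * q (sech x)\<close> with polynomials \<open>p\<close>, \<open>q\<close> are closed under
  differentiation.\<close>

type_synonym hpoly = "real poly \<times> real poly"

definition hev :: "hpoly \<Rightarrow> real \<Rightarrow> real" where
  "hev P x = poly (fst P) (sech x) + tanh x * poly (snd P) (sech x)"

text \<open>With s = sech, the chain rule uses s' = - s tanh and tanh' = s^2; the square of tanh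
  that appears is eliminated by tanh^2 = 1 - s^2. This gives the pair (s^2 q - (s - s^3) q', - s
  p').\<close>

definition hderiv :: "hpoly \<Rightarrow> hpoly" where
  "hderiv P = ([:0, 0, 1:] * snd P - [:0, 1, 0, -1:] * pderiv (snd P), - ([:0, 1:] * pderiv (fst P)))"

lemma hev_deriv: "(hev P has_real_derivative hev (hderiv P) x) (at x)"
proof -
  obtain p q where P: "P = (p, q)" by (cases P)
  have d: "((\<lambda>x. poly r (sech x)) has_real_derivative poly (pderiv r) (sech x) * (- sech x * tanh x)) (at x)" for r
    by (rule DERIV_chain2[OF poly_DERIV sech_deriv])
  have "(hev P has_real_derivative
      poly (pderiv p) (sech x) * (- sech x * tanh x)
      + ((sech x)\<^sup>2 * poly q (sech x) + poly (pderiv q) (sech x) * (- sech x * tanh x) * tanh x)) (at x)"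
    unfolding hev_def[abs_def] P fst_conv snd_conv by (rule DERIV_add[OF d DERIV_mult[OF tanh_deriv d]])
  moreover have "poly (pderiv p) (sech x) * (- sech x * tanh x)
      + ((sech x)\<^sup>2 * poly q (sech x) + poly (pderiv q) (sech x) * (- sech x * tanh x) * tanh x) = hev (hderiv P) x"
  proof -
    have "poly (pderiv q) (sech x) * (- sech x * tanh x) * tanh x = - (tanh x)\<^sup>2 * sech x * poly (pderiv q) (sech x)"
      by (simp add: power2_eq_square)
    then show ?thesis unfolding tanh_sech
      by (simp add: P hev_def hderiv_def algebra_simps power2_eq_square)
  qed
  ultimately show ?thesis by simp
qed

lemma hev_continuous: "continuous_on UNIV (hev P)"
  by (intro continuous_at_imp_continuous_on ballI DERIV_isCont[OF hev_deriv])

lemma hev_measurable [measurable]: "hev P \<in> borel_measurable borel"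
  by (rule borel_measurable_continuous_onI[OF hev_continuous])

lemma hev_bounded: obtains C where "\<And>x. \<bar>hev P x\<bar> \<le> C"
proof -
  have "\<exists>B. \<forall>x\<in>{0..1}. \<bar>poly p x\<bar> \<le> B" for p :: "real poly"
  proof -
    have "compact (poly p ` {0..1})" by (intro compact_continuous_image continuous_intros) simp
    then have "bounded (poly p ` {0..1})" by (rule compact_imp_bounded)
    then show ?thesis unfolding bounded_iff by simp
  qed
  note bd = this
  obtain B1 where B1: "\<forall>x\<in>{0..1}. \<bar>poly (fst P) x\<bar> \<le> B1" using bd by blast
  obtain B2 where B2: "\<forall>x\<in>{0..1}. \<bar>poly (snd P) x\<bar> \<le> B2" using bd by blast
  have "\<bar>hev P x\<bar> \<le> B1 + B2" for x
  proof -
    have s: "sech x \<in> {0..1}" using sech_bounds[of x] by auto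
    have "\<bar>hev P x\<bar> \<le> \<bar>poly (fst P) (sech x)\<bar> + \<bar>tanh x\<bar> * \<bar>poly (snd P) (sech x)\<bar>"
      unfolding hev_def using abs_triangle_ineq[of "poly (fst P) (sech x)" "tanh x * poly (snd P) (sech x)"] by (simp add: abs_mult)
    also have "\<dots> \<le> B1 + 1 * B2"
      using sech_bounds(3)[of x] B1 B2 s by (intro add_mono mult_mono) auto
    finally show ?thesis by simp
  qed
  then show ?thesis by (rule that)
qed

text \<open>sech is even and tanh is odd, so both summands vanish separately. As sech takes every
  value in (0, 1), each polynomial has infinitely many zeros.\<close>

lemma hev_zero:
  assumes "\<And>x. hev (p, q) x = 0"
  shows "p = 0" "q = 0"
proof -
  have sm: "sech (- x) = sech x" for x by (simp add: sech_def)
  have p0: "poly p (sech x) = 0" for x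
  proof -
    have "poly p (sech x) + tanh x * poly q (sech x) = 0" "poly p (sech x) - tanh x * poly q (sech x) = 0"
      using assms[of x] assms[of "- x"] unfolding hev_def sm fst_conv snd_conv tanh_minus by simp_all
    then show ?thesis by linarith
  qed
  have q0: "tanh x * poly q (sech x) = 0" for x
    using assms[of x] p0[of x] by (simp add: hev_def)
  \<comment> \<open>The preimage must differ from 0, so that tanh can be divided out.\<close>
  have surj: "\<exists>x. x \<noteq> 0 \<and> sech x = y" if y: "0 < y" "y < 1" for y
  proof -
    have "cosh (arcosh (1 / y)) = 1 / y" using y by (intro cosh_arcosh_real) (auto simp: field_simps)
    then have 1: "sech (arcosh (1 / y)) = y" by (simp add: sech_def)
    have 0: "sech 0 = 1" by (simp add: sech_def)
    have "arcosh (1 / y) \<noteq> 0"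
    proof
      assume "arcosh (1 / y) = 0"
      with 0 1 y show False by simp
    qed
    with 1 show ?thesis by blast
  qed
  have inf: "infinite {0<..<1::real}" by simp
  have "poly p y = 0" "poly q y = 0" if y: "y \<in> {0<..<1}" for y
  proof -
    from y have "0 < y" "y < 1" by auto
    from surj[OF this] obtain x where x: "x \<noteq> 0" "sech x = y" by blast
    show "poly p y = 0" using p0[of x] x by simp
    have "tanh x \<noteq> 0" using x(1) by simp
    then show "poly q y = 0" using q0[of x] x by simp
  qed
  then have "{0<..<1::real} \<subseteq> {y. poly p y = 0}" "{0<..<1::real} \<subseteq> {y. poly q y = 0}" by auto
  then have "infinite {y. poly p y = 0}" "infinite {y. poly q y = 0}" using inf finite_subset by blast+
  then show "p = 0" "q = 0" using poly_roots_finite by blast+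
qed

lemma hev_smult: "c * hev P x = hev (smult c (fst P), smult c (snd P)) x"
  by (simp add: hev_def algebra_simps)

text \<open>The successive derivatives of the test function. From order 2 on, starting with sech,
  they lie in the polynomial algebra; orders 0 and 1 do not.\<close>

definition gdD :: "nat \<Rightarrow> real \<Rightarrow> real" where
  "gdD m = (if m = 0 then gdint else if m = 1 then gd else hev ((hderiv ^^ (m - 2)) ([:0, 1:], 0)))"

lemma gdD_deriv: "(gdD m has_real_derivative gdD (Suc m) x) (at x)"
proof -
  consider "m = 0" | "m = 1" | k where "m = Suc (Suc k)" by (metis One_nat_def not0_implies_Suc)
  then show ?thesis
  proof cases
    case 1 then show ?thesis using gdint_deriv by (simp add: gdD_def)
  next
    case 2 then show ?thesis using gd_deriv by (simp add: gdD_def hev_def)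
  next
    case 3 then show ?thesis using hev_deriv by (simp add: gdD_def)
  qed
qed

lemma gdD_continuous: "continuous_on UNIV (gdD m)"
  by (intro continuous_at_imp_continuous_on ballI DERIV_isCont[OF gdD_deriv])

lemma gdD_measurable [measurable]: "gdD m \<in> borel_measurable borel"
  by (rule borel_measurable_continuous_onI[OF gdD_continuous])

lemma gd_bound: "\<bar>gd x\<bar> \<le> 2"
  using arctan_bounded[of "sinh x"] pi_less_4 unfolding gd_def abs_le_iff by linarith

lemma gdD_bounded: assumes "m \<ge> 1" obtains C where "\<And>x. \<bar>gdD m x\<bar> \<le> C"
proof (cases "m = 1")
  case True
  then have "\<And>x. \<bar>gdD m x\<bar> \<le> 2" using gd_bound by (simp add: gdD_def)
  then show ?thesis by (rule that)
next
  case False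
  obtain C where "\<And>x. \<bar>hev ((hderiv ^^ (m - 2)) ([:0, 1:], 0)) x\<bar> \<le> C" using hev_bounded by blast
  then show ?thesis using False assms that[of C] by (simp add: gdD_def)
qed

lemma gdint_lin_growth: "lin_growth gdint"
proof -
  have m: "gdint \<in> borel_measurable borel" using gdD_measurable[of 0] by (simp add: gdD_def)
  have "\<bar>gdint x\<bar> \<le> (\<bar>gdint 0\<bar> + 2) * (1 + \<bar>x\<bar>)" for x
  proof -
    have "\<bar>gdint x - gdint 0\<bar> \<le> 2 * \<bar>x - 0\<bar>" by (rule lipschitz_from_deriv[OF gdint_deriv gd_bound])
    then have "\<bar>gdint x\<bar> \<le> \<bar>gdint 0\<bar> + 2 * \<bar>x\<bar>" by simp
    also have "\<dots> \<le> (\<bar>gdint 0\<bar> + 2) * (1 + \<bar>x\<bar>)" by (simp add: algebra_simps)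
    finally show ?thesis .
  qed
  with m show ?thesis unfolding lin_growth_def by blast
qed

text \<open>Even orders are polynomials in sech alone, odd orders are tanh times such a polynomial.
  Hence the error coefficients of Y will live in the first component and those of Z in the
  second.\<close>

lemma gdD_values:
  "gdD 2 = hev ([:0, 1:], 0)"
  "gdD 3 = hev (0, [:0, -1:])"
  "gdD 4 = hev ([:0, 1, 0, -2:], 0)"
  "gdD 5 = hev (0, [:0, -1, 0, 6:])"
  "gdD 6 = hev ([:0, 1, 0, -20, 0, 24:], 0)"
  "gdD 7 = hev (0, [:0, -1, 0, 60, 0, -120:])"
  "gdD 8 = hev ([:0, 1, 0, -182, 0, 840, 0, -720:], 0)"
  by (simp_all add: gdD_def eval_nat_numeral hderiv_def pderiv_pCons)

section \<open>Functions of the coordinate sum\<close>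

definition csum :: "real^'d \<Rightarrow> real" where "csum x = (\<Sum>l\<in>UNIV. x $ l)"

lemma csum_axis: "csum (x + s *\<^sub>R axis i 1) = csum x + s"
  by (simp add: csum_def sum.distrib axis_def if_distrib[of "\<lambda>x. s * x"] cong: if_cong)

lemma continuous_csum [continuous_intros]: "continuous_on A f \<Longrightarrow> continuous_on A (\<lambda>x. csum (f x))"
  unfolding csum_def by (intro continuous_intros)

lemma partial_derivI:
  assumes "((\<lambda>s. \<phi> (x + s *\<^sub>R e)) has_real_derivative c) (at 0)"
  shows "partial_deriv e \<phi> x = c" "has_partial e \<phi> x"
  using assms by (auto simp: partial_deriv_def has_partial_def field_differentiable_def DERIV_imp_deriv)

lemma ridge_partial:
  assumes "\<And>x. (g has_real_derivative g' x) (at x)"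
  shows "partial_deriv (axis i 1) (\<lambda>x. g (csum x)) = (\<lambda>x. g' (csum x))"
    and "has_partial (axis i 1) (\<lambda>x. g (csum x)) x"
proof -
  have "((\<lambda>s. g (csum (x + s *\<^sub>R axis i 1))) has_real_derivative g' (csum x)) (at 0)" for x :: "real^'a"
    using assms[of "csum x"] DERIV_shift[of g "g' (csum x)" 0 "csum x"] by (simp add: csum_axis add.commute)
  from partial_derivI[OF this]
  show "partial_deriv (axis i 1) (\<lambda>x. g (csum x)) = (\<lambda>x. g' (csum x))" "has_partial (axis i 1) (\<lambda>x. g (csum x)) x"
    by auto
qed

section \<open>The operators on functions of the coordinate sum\<close>

definition b0 :: "real^'d \<Rightarrow> real^'d" where "b0 x = 0"

definition \<sigma>0 :: "real^'d \<Rightarrow> real^'d^'d" where "\<sigma>0 x = mat 1"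

lemma has_vector_derivative_const_within:
  assumes "\<And>s. s \<in> {0..T} \<Longrightarrow> f s = c" "t \<in> {0..T}"
  shows "(f has_vector_derivative (0::real)) (at t within {0..T})"
  using has_vector_derivative_transform[of t "{0..T}" f "\<lambda>_. c" 0] assms by (auto intro: has_vector_derivative_const)

lemma dt_const:
  assumes "T > 0" "\<And>s. s \<in> {0..T} \<Longrightarrow> v s = v0" "t \<in> {0..T}"
  shows "dt T v t x = 0" "(\<lambda>s. v s x) differentiable (at t within {0..T})"
proof -
  have d: "((\<lambda>s. v s x) has_vector_derivative 0) (at t within {0..T})"
    by (rule has_vector_derivative_const_within[where c="v0 x"]) (use assms in auto)
  show "dt T v t x = 0" unfolding dt_def
    by (rule vector_derivative_within_closed_interval[OF assms(1,3) d])
  show "(\<lambda>s. v s x) differentiable (at t within {0..T})"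
    using d by (rule differentiableI_vector)
qed

text \<open>With identity diffusion the second-order sum reduces to its diagonal of d equal terms.
  The form of v is prescribed on [0, T] only, because iterated operators are not controlled at other
  times.\<close>

lemma Lop_ridge:
  fixes v :: "real \<Rightarrow> real^'d \<Rightarrow> real"
  assumes T: "T > 0" and t: "t \<in> {0..T}" and v: "\<And>s. s \<in> {0..T} \<Longrightarrow> v s = (\<lambda>x. g (csum x))"
    and g: "\<And>x. (g has_real_derivative g' x) (at x)" and g': "\<And>x. (g' has_real_derivative g'' x) (at x)"
  shows "Lop T b0 \<sigma>0 None v t = (\<lambda>x. real CARD('d) / 2 * g'' (csum x))"
    and "Lop T b0 \<sigma>0 (Some j) v t = (\<lambda>x. g' (csum x))"
    and "Lop_defined_at T m v t x"
proof -
  note pd = ridge_partial[OF g] ridge_partial[OF g']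
  show "Lop T b0 \<sigma>0 None v t = (\<lambda>x. real CARD('d) / 2 * g'' (csum x))"
  proof
    fix x
    have dt: "dt T v t x = 0" by (rule dt_const(1)[where ?v0.0="\<lambda>x. g (csum x)"]) (use T v t in auto)
    have "\<sigma>0 x ** transpose (\<sigma>0 x) = mat 1" for x :: "real^'d" by (simp add: \<sigma>0_def transpose_mat)
    then show "Lop T b0 \<sigma>0 None v t x = real CARD('d) / 2 * g'' (csum x)"
      by (simp add: Lop_def dt v[OF t] pd b0_def mat_def if_distrib[of "\<lambda>x. x * _"] cong: if_cong)
  qed
  show "Lop T b0 \<sigma>0 (Some j) v t = (\<lambda>x. g' (csum x))"
    by (auto simp: Lop_def fun_eq_iff v[OF t] pd \<sigma>0_def mat_def if_distrib[of "\<lambda>x. x * _"] cong: if_cong)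
  show "Lop_defined_at T m v t x"
    unfolding Lop_defined_at_def v[OF t] pd(1) using pd(2,4) dt_const(2)[of T v "\<lambda>x. g (csum x)" t x] T t v by auto
qed

text \<open>On a function of the coordinate sum an operator with multi-index \<alpha> acts as
  (d/2)^zeros D^weight: an index 0 contributes d/2 and two derivatives, any other index one
  derivative.\<close>

primrec zeros :: "'d option list \<Rightarrow> nat" where
  "zeros [] = 0"
| "zeros (m # \<alpha>) = (if m = None then 1 else 0) + zeros \<alpha>"

primrec weight :: "'d option list \<Rightarrow> nat" where
  "weight [] = 0"
| "weight (m # \<alpha>) = (if m = None then 2 else 1) + weight \<alpha>"

lemma Lmulti_ridge:
  fixes v :: "real \<Rightarrow> real^'d \<Rightarrow> real" and D :: "nat \<Rightarrow> real \<Rightarrow> real"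
  assumes T: "T > 0" and v: "\<And>s. s \<in> {0..T} \<Longrightarrow> v s = (\<lambda>x. D 0 (csum x))"
    and D: "\<And>m x. (D m has_real_derivative D (Suc m) x) (at x)" and t: "t \<in> {0..T}"
  shows "Lmulti T b0 \<sigma>0 \<alpha> v t = (\<lambda>x. (real CARD('d) / 2) ^ zeros \<alpha> * D (weight \<alpha>) (csum x))"
    and "Lmulti_defined T b0 \<sigma>0 \<alpha> v"
proof -
  let ?c = "real CARD('d) / 2"
  have "(\<forall>t\<in>{0..T}. Lmulti T b0 \<sigma>0 \<alpha> v t = (\<lambda>x. ?c ^ zeros \<alpha> * D (weight \<alpha>) (csum x))) \<and> Lmulti_defined T b0 \<sigma>0 \<alpha> v"
  proof (induction \<alpha>)
    case Nil then show ?case using v by simp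
  next
    case (Cons m \<alpha>)
    let ?g = "\<lambda>k y. ?c ^ zeros \<alpha> * D (weight \<alpha> + k) y"
    have IH: "\<And>s. s \<in> {0..T} \<Longrightarrow> Lmulti T b0 \<sigma>0 \<alpha> v s = (\<lambda>x. ?g 0 (csum x))" using Cons.IH by simp
    have d: "(?g k has_real_derivative ?g (Suc k) y) (at y)" for k y
      using DERIV_cmult[OF D[of "weight \<alpha> + k" y]] by simp
    note L = Lop_ridge[OF T _ IH d[of 0] d[of "Suc 0"]]
    have "Lmulti T b0 \<sigma>0 (m # \<alpha>) v t = (\<lambda>x. ?c ^ zeros (m # \<alpha>) * D (weight (m # \<alpha>)) (csum x))" if t: "t \<in> {0..T}" for t
      using L(1)[OF t] L(2)[OF t] by (cases m) (auto simp: mult.assoc add.commute)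
    then show ?case using L(3) Cons.IH by auto
  qed
  then show "Lmulti T b0 \<sigma>0 \<alpha> v t = (\<lambda>x. ?c ^ zeros \<alpha> * D (weight \<alpha>) (csum x))" "Lmulti_defined T b0 \<sigma>0 \<alpha> v"
    using t by auto
qed

lemma weight_pos: "\<alpha> \<noteq> [] \<Longrightarrow> weight \<alpha> \<ge> 1"
  by (cases \<alpha>) auto

text \<open>A nonempty multi-index has positive weight, so the unbounded function D 0 never occurs
  among the required bounds.\<close>

lemma ridge_Gb:
  fixes D :: "nat \<Rightarrow> real \<Rightarrow> real"
  assumes T: "T > 0" and D: "\<And>m x. (D m has_real_derivative D (Suc m) x) (at x)"
    and B: "\<And>m. m \<ge> 1 \<Longrightarrow> \<exists>C. \<forall>x. \<bar>D m x\<bar> \<le> C"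
  shows "(\<lambda>_ (x::real^'d). D 0 (csum x)) \<in> Gb T b0 \<sigma>0 n"
proof -
  let ?v = "\<lambda>_ (x::real^'d). D 0 (csum x)"
  let ?c = "real CARD('d) / 2"
  have "?v \<in> Gb_index T b0 \<sigma>0 \<alpha>" if \<alpha>: "1 \<le> length \<alpha>" for \<alpha>
  proof -
    have L: "Lmulti T b0 \<sigma>0 \<alpha> ?v t x = ?c ^ zeros \<alpha> * D (weight \<alpha>) (csum x)" if "t \<in> {0..T}" for t and x :: "real^'d"
      using Lmulti_ridge(1)[where v="?v" and D=D and \<alpha>=\<alpha>, OF T _ D that] by simp
    have contD: "continuous_on UNIV (D m)" for m
      by (intro continuous_at_imp_continuous_on ballI DERIV_isCont[OF D])
    have cont: "continuous_on ({0..T} \<times> UNIV) (\<lambda>(t, x). Lmulti T b0 \<sigma>0 \<alpha> ?v t x)"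
    proof (rule continuous_on_eq)
      show "continuous_on ({0..T} \<times> UNIV) (\<lambda>p. ?c ^ zeros \<alpha> * D (weight \<alpha>) (csum (snd p :: real^'d)))"
        by (intro continuous_intros continuous_on_compose2[OF contD]) auto
    qed (use L in auto)
    have "1 \<le> weight \<alpha>" using \<alpha> by (intro weight_pos) auto
    then obtain C where C: "\<And>x. \<bar>D (weight \<alpha>) x\<bar> \<le> C" using B by blast
    have "bounded ((\<lambda>(t, x). Lmulti T b0 \<sigma>0 \<alpha> ?v t x) ` ({0..T} \<times> UNIV))"
      unfolding bounded_iff
    proof (intro exI[of _ "?c ^ zeros \<alpha> * C"] ballI)
      fix y assume "y \<in> (\<lambda>(t, x). Lmulti T b0 \<sigma>0 \<alpha> ?v t x) ` ({0..T} \<times> UNIV)"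
      then obtain t x where "t \<in> {0..T}" "y = Lmulti T b0 \<sigma>0 \<alpha> ?v t x" by auto
      then have "y = ?c ^ zeros \<alpha> * D (weight \<alpha>) (csum x)" using L by simp
      then show "norm y \<le> ?c ^ zeros \<alpha> * C" using C[of "csum x"] by (simp add: abs_mult mult_left_mono)
    qed
    then show ?thesis using cont Lmulti_ridge(2)[where v="?v" and D=D and \<alpha>=\<alpha> and t=0, OF T _ D] T by (simp add: Gb_index_def)
  qed
  then show ?thesis by (simp add: Gb_def)
qed

lemma ridge_Cb1:
  assumes g: "\<And>x. (g has_real_derivative g' x) (at x)" and c: "continuous_on UNIV g'" and B: "\<And>x. \<bar>g' x\<bar> \<le> C"
  shows "Cb 1 (\<lambda>x::real^'d. g (csum x))"
proof -
  have cg: "continuous_on UNIV g" by (intro continuous_at_imp_continuous_on ballI DERIV_isCont[OF g])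
  show ?thesis
    unfolding Cb_def
  proof (intro allI impI)
    fix es :: "(real^'d) list" assume es: "set es \<subseteq> Basis \<and> length es \<le> 1"
    have Bas: "e \<in> Basis \<Longrightarrow> \<exists>i. e = axis i 1" for e :: "real^'d" by (auto simp: Basis_vec_def)
    consider "es = []" | i where "es = [axis i 1]"
      using es Bas by (cases es) (auto)
    then show "continuous_on UNIV (partials es (\<lambda>x. g (csum x))) \<and>
         (length es < 1 \<longrightarrow> (\<forall>e\<in>Basis. \<forall>x. has_partial e (partials es (\<lambda>x. g (csum x))) x)) \<and>
         (es \<noteq> [] \<longrightarrow> bounded (range (partials es (\<lambda>x. g (csum x)))))"
    proof cases
      case 1
      have "continuous_on UNIV (\<lambda>x::real^'d. g (csum x))"
        by (intro continuous_on_compose2[OF cg] continuous_intros) auto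
      moreover have "has_partial e (\<lambda>x. g (csum x)) x" if e: "e \<in> Basis" for e x :: "real^'d"
      proof -
        from Bas[OF e] obtain i where "e = axis i 1" by blast
        then show ?thesis using ridge_partial(2)[OF g] by simp
      qed
      ultimately show ?thesis using 1 by simp
    next
      case 2
      have "continuous_on UNIV (\<lambda>x::real^'d. g' (csum x))"
        by (intro continuous_on_compose2[OF c] continuous_intros) auto
      moreover have "bounded (range (\<lambda>x::real^'d. g' (csum x)))" using B by (auto simp: bounded_iff)
      ultimately show ?thesis using 2 by (simp add: ridge_partial(1)[OF g])
    qed
  qed
qed

section \<open>The driver\<close>

definition f0 :: "real \<times> (real^'d) \<Rightarrow> real" where
  "f0 p = - 1/2 * (\<Sum>l\<in>UNIV. cos (snd p $ l))"

text \<open>This space contains the driver and is closed under all partial derivatives, and its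
  members are bounded and continuous. The smoothness class then follows for every order by
  induction.\<close>

definition trig :: "(real \<times> (real^'d) \<Rightarrow> real) \<Rightarrow> bool" where
  "trig \<phi> \<longleftrightarrow> (\<exists>a b. \<phi> = (\<lambda>p. \<Sum>l\<in>UNIV. a l * cos (snd p $ l) + b l * sin (snd p $ l)))"

lemma trig_partial:
  fixes a b :: "'d::finite \<Rightarrow> real"
  defines "\<phi> \<equiv> \<lambda>p::real \<times> (real^'d). \<Sum>l\<in>UNIV. a l * cos (snd p $ l) + b l * sin (snd p $ l)"
  shows "partial_deriv (0, axis j 1) \<phi> = (\<lambda>p. - a j * sin (snd p $ j) + b j * cos (snd p $ j))"
    and "has_partial (0, axis j 1) \<phi> p"
    and "partial_deriv (1, 0) \<phi> = (\<lambda>p. 0)"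
    and "has_partial (1, 0) \<phi> p"
proof -
  have e: "snd (p + s *\<^sub>R (0, axis j 1)) $ l = snd p $ l + (if l = j then s else 0)" for p :: "real \<times> (real^'d)" and s l
    by (simp add: axis_def)
  have "((\<lambda>s. \<phi> (p + s *\<^sub>R (0, axis j 1))) has_real_derivative
      (\<Sum>l\<in>UNIV. if l = j then - a j * sin (snd p $ j) + b j * cos (snd p $ j) else 0)) (at 0)" for p
    unfolding \<phi>_def e
    by (rule DERIV_sum) (auto intro!: derivative_eq_intros)
  then have 1: "((\<lambda>s. \<phi> (p + s *\<^sub>R (0, axis j 1))) has_real_derivative - a j * sin (snd p $ j) + b j * cos (snd p $ j)) (at 0)" for p
    by simp
  have 2: "((\<lambda>s. \<phi> (p + s *\<^sub>R (1, 0))) has_real_derivative 0) (at 0)" for p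
    unfolding \<phi>_def by simp
  show "partial_deriv (0, axis j 1) \<phi> = (\<lambda>p. - a j * sin (snd p $ j) + b j * cos (snd p $ j))"
    "has_partial (0, axis j 1) \<phi> p" "partial_deriv (1, 0) \<phi> = (\<lambda>p. 0)" "has_partial (1, 0) \<phi> p"
    using partial_derivI[OF 1] partial_derivI[OF 2] by auto
qed

lemma prod_Basis: "e \<in> (Basis :: (real \<times> (real^'d)) set) \<Longrightarrow> e = (1, 0) \<or> (\<exists>j. e = (0, axis j 1))"
  by (auto simp: Basis_prod_def Basis_vec_def)

lemma trig_deriv:
  assumes "trig \<phi>" "e \<in> Basis"
  shows "trig (partial_deriv e \<phi>)" "has_partial e \<phi> p"
proof -
  obtain a b where \<phi>: "\<phi> = (\<lambda>p. \<Sum>l\<in>UNIV. a l * cos (snd p $ l) + b l * sin (snd p $ l))"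
    using assms(1) by (auto simp: trig_def)
  from prod_Basis[OF assms(2)] have "trig (partial_deriv e \<phi>) \<and> has_partial e \<phi> p"
  proof
    assume e: "e = (1, 0)"
    have "trig (\<lambda>p::real \<times> (real^'a). 0)" unfolding trig_def by (intro exI[of _ "\<lambda>_. 0"]) simp
    then show ?thesis unfolding \<phi> e trig_partial(3) using trig_partial(4) by blast
  next
    assume "\<exists>j. e = (0, axis j 1)"
    then obtain j where e: "e = (0, axis j 1)" by blast
    have eq: "- a j * sin (snd p $ j) + b j * cos (snd p $ j)
        = (\<Sum>l\<in>UNIV. (if l = j then b j else 0) * cos (snd p $ l) + (if l = j then - a j else 0) * sin (snd p $ l))"
      for p :: "real \<times> (real^'a)"
      by (simp add: sum.distrib if_distrib[of "\<lambda>x. x * _"] cong: if_cong)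
    show ?thesis unfolding \<phi> e trig_partial(1) trig_def eq
      by (intro conjI exI trig_partial(2)) (rule refl)
  qed
  then show "trig (partial_deriv e \<phi>)" "has_partial e \<phi> p" by auto
qed

lemma trig_Cb:
  fixes \<phi> :: "real \<times> (real^'d) \<Rightarrow> real"
  assumes "trig \<phi>" shows "Cb k \<phi>"
proof -
  have t: "trig (partials es \<phi>)" if "set es \<subseteq> Basis" for es
    using that by (induction es) (auto intro: assms trig_deriv)
  have cont: "continuous_on UNIV \<psi>" and bnd: "bounded (range \<psi>)" if \<psi>t: "trig \<psi>" for \<psi> :: "real \<times> (real^'d) \<Rightarrow> real"
  proof -
    obtain a b where \<psi>: "\<psi> = (\<lambda>p. \<Sum>l\<in>UNIV. a l * cos (snd p $ l) + b l * sin (snd p $ l))"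
      using \<psi>t by (auto simp: trig_def)
    show "continuous_on UNIV \<psi>" unfolding \<psi> by (intro continuous_intros)
    have "\<bar>\<psi> p\<bar> \<le> (\<Sum>l\<in>UNIV. \<bar>a l\<bar> + \<bar>b l\<bar>)" for p
      unfolding \<psi>
    proof (rule order_trans[OF sum_abs], rule sum_mono)
      fix l
      have "\<bar>a l * cos (snd p $ l) + b l * sin (snd p $ l)\<bar> \<le> \<bar>a l\<bar> * \<bar>cos (snd p $ l)\<bar> + \<bar>b l\<bar> * \<bar>sin (snd p $ l)\<bar>"
        using abs_triangle_ineq[of "a l * cos (snd p $ l)" "b l * sin (snd p $ l)"] by (simp add: abs_mult)
      also have "\<dots> \<le> \<bar>a l\<bar> * 1 + \<bar>b l\<bar> * 1" by (intro add_mono mult_left_mono) auto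
      finally show "\<bar>a l * cos (snd p $ l) + b l * sin (snd p $ l)\<bar> \<le> \<bar>a l\<bar> + \<bar>b l\<bar>" by simp
    qed
    then show "bounded (range \<psi>)" by (auto simp: bounded_iff)
  qed
  show ?thesis unfolding Cb_def using t cont bnd trig_deriv(2) by blast
qed

lemma f0_trig: "trig f0"
  unfolding trig_def
  by (intro exI[of _ "\<lambda>_. - 1/2"] exI[of _ "\<lambda>_. 0"]) (simp add: f0_def[abs_def] sum_distrib_left)

lemma fz_f0: "fz j f0 p = 1/2 * sin (snd p $ j)"
proof -
  have eq: "f0 = (\<lambda>p::real \<times> (real^'d). \<Sum>l\<in>UNIV. (- 1/2) * cos (snd p $ l) + 0 * sin (snd p $ l))"
    by (simp add: f0_def[abs_def] sum_distrib_left)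
  show ?thesis unfolding fz_def eq trig_partial(1)[of j "\<lambda>_. - 1/2" "\<lambda>_. 0"] by simp
qed

lemma f0_indep: "indep_of_y f0" by (simp add: indep_of_y_def f0_def)

lemma f0_fz_nonzero: "fz_nonzero (f0 :: real \<times> (real^'d) \<Rightarrow> real)"
proof -
  have "fz undefined f0 (0, \<chi> l::'d. pi / 2) = 1/2" by (simp add: fz_f0)
  then show ?thesis unfolding fz_nonzero_def by (intro exI[of _ undefined] exI[of _ "(0, \<chi> l. pi / 2)"]) simp
qed

lemma f0_lipschitz: "(real CARD('d))-lipschitz_on UNIV (f0 :: real \<times> (real^'d) \<Rightarrow> real)"
proof (rule lipschitz_onI)
  fix p q :: "real \<times> (real^'d)"
  have c: "\<bar>cos a - cos b\<bar> \<le> 1 * \<bar>a - b\<bar>" for a b :: real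
    by (rule lipschitz_from_deriv[where f'="\<lambda>x. - sin x"]) (auto intro!: derivative_eq_intros)
  have "dist (f0 p) (f0 q) = 1/2 * \<bar>\<Sum>l\<in>UNIV. cos (snd p $ l) - cos (snd q $ l)\<bar>"
    by (simp add: f0_def dist_real_def sum_subtractf abs_minus_commute flip: diff_divide_distrib)
  also have "\<dots> \<le> 1/2 * (\<Sum>l\<in>(UNIV::'d set). dist p q)"
  proof (intro mult_left_mono order_trans[OF sum_abs] sum_mono)
    fix l
    have "\<bar>cos (snd p $ l) - cos (snd q $ l)\<bar> \<le> \<bar>(snd p - snd q) $ l\<bar>" using c[of "snd p $ l" "snd q $ l"] by simp
    also have "\<dots> \<le> norm (snd p - snd q)" by (rule component_le_norm_cart)
    also have "\<dots> \<le> dist p q" using dist_snd_le[of p q] by (simp add: dist_norm)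
    finally show "\<bar>cos (snd p $ l) - cos (snd q $ l)\<bar> \<le> dist p q" .
  qed simp
  also have "\<dots> \<le> real CARD('d) * dist p q" by simp
  finally show "dist (f0 p) (f0 q) \<le> real CARD('d) * dist p q" .
qed simp

section \<open>The test problem\<close>

definition u0 :: "real \<Rightarrow> real^'d \<Rightarrow> real" where "u0 t x = gdint (csum x)"

lemma gdD_simps: "gdD 0 = gdint" "gdD (Suc 0) = gd" "gdD (Suc (Suc 0)) = sech"
  by (auto simp: gdD_def hev_def fun_eq_iff)

lemma u0_partial:
  "partial_deriv (axis i 1) (u0 t) = (\<lambda>x. gd (csum x))"
  "partial_deriv (axis i 1) (\<lambda>x. gd (csum x)) = (\<lambda>x. sech (csum x))"
  unfolding u0_def[abs_def] by (rule ridge_partial(1)[OF gdint_deriv] ridge_partial(1)[OF gd_deriv])+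

lemma grad_u0: "grad (u0 t) x v* \<sigma>0 x = (\<chi> l. gd (csum x))"
  by (simp add: grad_def u0_partial \<sigma>0_def)

text \<open>The multiplier tanh / 2 is the same for every coordinate; all quantities of (Ho)_4 that
  involve the driver are built from it.\<close>

lemma fz_at_u0: "fz_at \<sigma>0 f0 (\<lambda>x. gdint (csum x)) j x = 1/2 * tanh (csum x)"
  using grad_u0[of 0 x] by (simp add: fz_at_def fz_f0 sin_gd u0_def[abs_def])

lemma f0_u0: "f0 (y, (\<chi> l. gd s) :: real^'d) = - (real CARD('d) / 2) * sech s"
  by (simp add: f0_def cos_gd)

lemma gdD_bound_ex: "m \<ge> 1 \<Longrightarrow> \<exists>C. \<forall>x. \<bar>gdD m x\<bar> \<le> C"
  using gdD_bounded by blast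

lemma sech_continuous: "continuous_on UNIV sech"
  by (intro continuous_at_imp_continuous_on ballI DERIV_isCont[OF sech_deriv])

lemma gd_continuous: "continuous_on UNIV gd"
  by (intro continuous_at_imp_continuous_on ballI DERIV_isCont[OF gd_deriv])

lemma gdint_continuous: "continuous_on UNIV gdint"
  by (intro continuous_at_imp_continuous_on ballI DERIV_isCont[OF gdint_deriv])

lemma u0_solves:
  assumes T: "T > 0"
  shows "solves_P T b0 \<sigma>0 f0 (\<lambda>x::real^'d. gdint (csum x)) u0"
proof -
  have t: "t \<in> {0..<T} \<Longrightarrow> t \<in> {0..T}" for t by simp
  note L = Lop_ridge[OF T, of _ u0, OF _ _ gdint_deriv gd_deriv]
  have dt0: "dt T u0 t (x::real^'d) = 0" if "t \<in> {0..<T}" for t x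
    by (rule dt_const(1)[where ?v0.0="\<lambda>x. gdint (csum x)"]) (use T that in \<open>auto simp: u0_def\<close>)
  show ?thesis
    unfolding solves_P_def
  proof (intro conjI allI ballI)
    show "continuous_on ({0..T} \<times> UNIV) (\<lambda>(t, x::real^'d). u0 t x)"
      unfolding u0_def case_prod_unfold
      by (intro continuous_on_compose2[OF gdint_continuous] continuous_intros) auto
    show "Lop_defined_at T None u0 t (x::real^'d)" if "t \<in> {0..<T}" for t x
      using that by (intro L(3)) (auto simp: u0_def)
    show "continuous_on ({0..<T} \<times> UNIV) (\<lambda>(t, x::real^'d). dt T u0 t x)"
      by (rule continuous_on_eq[of _ "\<lambda>_. 0"]) (use dt0 in auto)
    show "continuous_on ({0..<T} \<times> UNIV) (\<lambda>(t, x::real^'d). partial_deriv (axis i 1) (u0 t) x)" for i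
      unfolding u0_partial case_prod_unfold
      by (intro continuous_on_compose2[OF gd_continuous] continuous_intros) auto
    show "continuous_on ({0..<T} \<times> UNIV) (\<lambda>(t, x::real^'d). partial_deriv (axis i 1) (partial_deriv (axis j 1) (u0 t)) x)" for i j
      unfolding u0_partial case_prod_unfold
      by (intro continuous_on_compose2[OF sech_continuous] continuous_intros) auto
    show "Lop T b0 \<sigma>0 None u0 t x = - f0 (u0 t x, grad (u0 t) x v* \<sigma>0 x)" if "t \<in> {0..<T}" for t and x :: "real^'d"
    proof -
      have "Lop T b0 \<sigma>0 None u0 t = (\<lambda>x::real^'d. real CARD('d) / 2 * sech (csum x))"
        using that by (intro L(1)) (auto simp: u0_def)
      then show ?thesis by (simp add: grad_u0 f0_u0)
    qed
  qed (simp add: u0_def)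
qed

lemma Hr4_u0: "T > 0 \<Longrightarrow> Hr4 T b0 \<sigma>0 f0 (u0 :: real \<Rightarrow> real^'d \<Rightarrow> real)"
  using ridge_Gb[of T gdD 5, OF _ gdD_deriv gdD_bound_ex] trig_Cb[OF f0_trig, of 5]
  by (simp add: Hr4_def u0_def[abs_def] gdD_simps)

text \<open>This is tanh / 2 times the fifth derivative of the test function: (1 - s^2)(- s + 6 s^3)
  / 2 with s = sech. Up to constants it is the function v_g of the nondegeneracy assumption.\<close>

definition Vp :: hpoly where "Vp = ([:0, -1/2, 0, 7/2, 0, -3:], 0)"

lemma tanh_hev: "1/2 * tanh x * hev (p, q) x = hev ([:1/2, 0, -1/2:] * q, smult (1/2) p) x"
proof -
  have "tanh x * (tanh x * poly q (sech x)) = (tanh x)\<^sup>2 * poly q (sech x)" by (simp add: power2_eq_square)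
  then show ?thesis unfolding tanh_sech by (simp add: hev_def algebra_simps power2_eq_square)
qed

lemma Vp_values:
  "hev ((hderiv ^^ 0) Vp) = hev ([:0, -1/2, 0, 7/2, 0, -3:], 0)"
  "hev ((hderiv ^^ 1) Vp) = hev (0, [:0, 1/2, 0, -21/2, 0, 15:])"
  "hev ((hderiv ^^ 2) Vp) = hev ([:0, -1/2, 0, 65/2, 0, -117, 0, 90:], 0)"
  by (simp_all add: Vp_def eval_nat_numeral hderiv_def pderiv_pCons)

section \<open>The test problem belongs to the class\<close>

context brownian_setup
begin

definition X :: "real \<Rightarrow> 'w \<Rightarrow> real^'d" where "X t \<omega> = X0 \<omega> + W t \<omega>"

lemma csum_X: "csum (X t \<omega>) = S t \<omega>"
  by (simp add: csum_def X_def S_def)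

text \<open>The expectation is that of a nonnegative Gaussian average at S 0, which must therefore
  vanish at some point. The Gaussian density is positive, so h vanishes Lebesgue almost everywhere,
  and continuity removes the exceptional set. Since t > 0, this works for every law of X0.\<close>

lemma full_support:
  fixes h :: "real \<Rightarrow> real"
  assumes t: "0 < t" "t \<le> T" and h: "continuous_on UNIV h" "\<And>x. 0 \<le> h x" "\<And>x. h x \<le> C"
    and E: "expectation (\<lambda>\<omega>. h (S t \<omega>)) = 0"
  shows "h x = 0"
proof -
  have hm[measurable]: "h \<in> borel_measurable borel" using h(1) by (rule borel_measurable_continuous_onI)
  have lg: "lin_growth h" by (rule bounded_lin_growth[OF hm, of C]) (use h in simp)
  let ?a = "d * t"
  have a: "?a > 0" using d_pos t by simp
  have i: "integrable M (\<lambda>\<omega>. h (S t \<omega>))"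
    using growth_S_square_integrable[OF lg, of t] t by (intro square_integrable_integrable) auto
  have "expectation (\<lambda>\<omega>. 1 * h (S t \<omega>)) = expectation (\<lambda>\<omega>. 1 * heat (d * (t - 0)) h (S 0 \<omega>))"
    using t i by (intro cond_heat[OF _ _ _ _ lg]) auto
  then have 0: "expectation (\<lambda>\<omega>. heat ?a h (S 0 \<omega>)) = 0" using E by simp
  have nn: "heat ?a h y \<ge> 0" for y unfolding heat_def using h(2) by (intro Bochner_Integration.integral_nonneg) auto
  have i0: "integrable M (\<lambda>\<omega>. heat ?a h (S 0 \<omega>))"
    using growth_S_square_integrable[OF lin_growth_heat[OF lg], of 0] T by (intro square_integrable_integrable) auto
  have "AE \<omega> in M. heat ?a h (S 0 \<omega>) = 0"
    using integral_nonneg_eq_0_iff_AE[OF i0] nn 0 by simp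
  note ae0 = this
  \<comment> \<open>One point y = S 0 \<omega> with vanishing average is enough; it exists because
    the space has mass one.\<close>
  have "\<exists>\<omega>. heat ?a h (S 0 \<omega>) = 0"
  proof (rule ccontr)
    assume "\<not> (\<exists>\<omega>. heat ?a h (S 0 \<omega>) = 0)"
    with ae0 have "AE \<omega> in M. False" by simp
    then show False by simp
  qed
  then obtain y where y: "heat ?a h y = 0" by blast
  have "integrable gauss (\<lambda>z. h (y + sqrt ?a * z))" by (rule growth_integrable0[OF lg])
  then have "AE z in gauss. h (y + sqrt ?a * z) = 0"
    using integral_nonneg_eq_0_iff_AE[of gauss "\<lambda>z. h (y + sqrt ?a * z)"] y h(2) by (simp add: heat_def)
  then have ae: "AE z in lborel. h (y + sqrt ?a * z) = 0"
    by (simp add: AE_density normal_density_pos)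
  have "\<forall>z. h (y + sqrt ?a * z) = 0"
  proof (rule ccontr)
    let ?U = "{z. h (y + sqrt ?a * z) \<noteq> 0}"
    assume "\<not> ?thesis"
    then have ne: "?U \<noteq> {}" by auto
    have "continuous_on UNIV (\<lambda>z. h (y + sqrt ?a * z))"
      by (intro continuous_on_compose2[OF h(1)] continuous_intros) auto
    then have "open ((\<lambda>z. h (y + sqrt ?a * z)) -` (- {0}))" by (intro open_vimage) auto
    moreover have "(\<lambda>z. h (y + sqrt ?a * z)) -` (- {0}) = ?U" by auto
    ultimately have op: "open ?U" by simp
    have "?U \<in> null_sets lborel" using ae op by (subst AE_iff_null_sets) auto
    then have "negligible ?U" by (simp add: negligible_iff_null_sets null_sets_completionI)
    with op ne open_not_negligible show False by blast
  qed
  then have "h (y + sqrt ?a * ((x - y) / sqrt ?a)) = 0" by blast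
  moreover have "r * ((x - y) / r) = x - y" if "r > 0" for r :: real using that by simp
  from this[OF real_sqrt_gt_zero[OF a]] have "y + sqrt ?a * ((x - y) / sqrt ?a) = x" by linarith
  ultimately show ?thesis by (simp only:)
qed

text \<open>Full support of the law of S at T reduces each nondegeneracy clause to the statement
  that a pair of polynomials is not zero.\<close>

lemma nonvanishing_hev:
  assumes "\<And>x. \<phi> x = hev P (csum x)" "P \<noteq> (0, 0)"
  shows "nonvanishing M (X T) \<phi>"
proof (rule ccontr)
  assume n: "\<not> nonvanishing M (X T) \<phi>"
  have [measurable]: "S T \<in> borel_measurable M" using S_M[of T] T by simp
  have e: "{\<omega> \<in> space M. \<phi> (X T \<omega>) \<noteq> 0} = {\<omega> \<in> space M. hev P (S T \<omega>) \<noteq> 0}" by (simp add: assms(1) csum_X)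
  have s: "{\<omega> \<in> space M. hev P (S T \<omega>) \<noteq> 0} \<in> sets M" by measurable
  from n have "prob {\<omega> \<in> space M. hev P (S T \<omega>) \<noteq> 0} = 0" by (simp add: nonvanishing_def e)
  then have "AE \<omega> in M. hev P (S T \<omega>) = 0"
    using s by (intro AE_I[of _ _ "{\<omega> \<in> space M. hev P (S T \<omega>) \<noteq> 0}"]) (auto simp: emeasure_eq_measure)
  then have E: "expectation (\<lambda>\<omega>. (hev P (S T \<omega>))\<^sup>2) = 0"
    by (intro integral_eq_zero_AE) (auto elim!: eventually_mono)
  obtain C where C: "\<And>x. \<bar>hev P x\<bar> \<le> C" using hev_bounded by blast
  have "(hev P x)\<^sup>2 = 0" for x
  proof (rule full_support[where h="\<lambda>x. (hev P x)\<^sup>2" and t=T and C="C\<^sup>2"])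
    show "continuous_on UNIV (\<lambda>x. (hev P x)\<^sup>2)" by (intro continuous_intros hev_continuous)
    show "(hev P x)\<^sup>2 \<le> C\<^sup>2" for x using power_mono[OF C[of x], of 2] by simp
  qed (use T E in auto)
  then have "hev (fst P, snd P) x = 0" for x by simp
  from hev_zero[OF this] have "P = (0, 0)" by (simp add: prod_eq_iff)
  with assms(2) show False by simp
qed

text \<open>The derivatives, as a function of the coordinate sum, of v_g when g is the terminal
  function of the test problem.\<close>

definition VD :: "nat \<Rightarrow> real \<Rightarrow> real" where "VD m x = (d / 2)\<^sup>2 * hev ((hderiv ^^ m) Vp) x"

lemma VD_deriv: "(VD m has_real_derivative VD (Suc m) x) (at x)"
  unfolding VD_def[abs_def] using DERIV_cmult[OF hev_deriv[of "(hderiv ^^ m) Vp" x], of "(d / 2)\<^sup>2"] by simp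

lemma Lu0: "t \<in> {0..T} \<Longrightarrow> Lmulti T b0 \<sigma>0 \<alpha> (\<lambda>_ x::real^'d. gdint (csum x)) t x = (d / 2) ^ zeros \<alpha> * gdD (weight \<alpha>) (csum x)"
  using Lmulti_ridge(1)[of T "\<lambda>_ x::real^'d. gdint (csum x)" gdD t \<alpha>, OF T _ gdD_deriv] by (simp add: gdD_simps d_def)

lemma vg_u0: "t \<in> {0..T} \<Longrightarrow> vg T b0 \<sigma>0 f0 (\<lambda>x::real^'d. gdint (csum x)) j t = (\<lambda>x. VD 0 (csum x))"
proof
  assume t: "t \<in> {0..T}"
  fix x :: "real^'d"
  have w: "zeros [Some j, None, None] = 2" "weight [Some j, None, None] = 5" by simp_all
  show "vg T b0 \<sigma>0 f0 (\<lambda>x::real^'d. gdint (csum x)) j t x = VD 0 (csum x)"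
    unfolding vg_def fz_at_u0 Lu0[OF t] w gdD_values mult.left_commute[of "1/2 * tanh _"] tanh_hev
    by (simp add: VD_def Vp_def)
qed

lemma Lop_vg:
  "Lop T b0 \<sigma>0 None (vg T b0 \<sigma>0 f0 (\<lambda>x::real^'d. gdint (csum x)) j) T x = d / 2 * VD 2 (csum x)"
  "Lop T b0 \<sigma>0 (Some l) (vg T b0 \<sigma>0 f0 (\<lambda>x::real^'d. gdint (csum x)) j) T x = VD 1 (csum x)"
  using Lop_ridge(1,2)[OF T _ vg_u0 VD_deriv[of 0] VD_deriv[of 1, simplified]] T
  by (simp_all add: d_def numeral_2_eq_2)

lemma wg_u0: "wg T b0 \<sigma>0 f0 (\<lambda>x::real^'d. gdint (csum x)) j T x = (d / 2) ^ 3 * (1/2 * tanh (csum x) * gdD 7 (csum x))"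
proof -
  have w: "zeros [Some j, None, None, None] = 3" "weight [Some j, None, None, None] = 7" "T \<in> {0..T}" using T by simp_all
  show ?thesis unfolding wg_def fz_at_u0 Lu0[OF w(3)] w by simp
qed

text \<open>The terminal function itself serves as g in every clause and for every choice of the
  \<nu>'s, and an arbitrary coordinate serves as j1 and j2. Each clause then expresses linear
  independence of explicit polynomials in sech.\<close>

lemma Ho4_u0: "Ho4 M T b0 \<sigma>0 f0 X"
proof -
  let ?g = "\<lambda>x::real^'d. gdint (csum x)"
  let ?c = "d / 2"
  have c: "?c > 0" using d_pos by simp
  have gG: "?g \<in> {g. (\<lambda>_. g) \<in> Gb T b0 \<sigma>0 4}"
    using ridge_Gb[of T gdD 4, OF T gdD_deriv gdD_bound_ex] by (simp add: gdD_simps)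
  have TT: "T \<in> {0..T}" using T by simp
  note L = Lu0[OF TT]
  \<comment> \<open>The summands do not depend on the coordinate; each sum contributes a factor d =
    2 (d/2), which explains the powers of 2 in the polynomials below.\<close>
  have sumd: "(\<Sum>j\<in>(UNIV::'d set). y) = 2 * ?c * y" for y :: real by (simp add: d_def)
  note nv = nonvanishing_hev
  have n1: "nonvanishing M (X T) (\<lambda>x. Lmulti T b0 \<sigma>0 [None] (\<lambda>_. ?g) T x)"
    unfolding L by (rule nv[where P="(smult ?c [:0, 1:], 0)"]) (use c in \<open>simp_all add: gdD_values hev_def\<close>)
  have w2: "zeros [None, None :: 'd option] = 2" "weight [None, None :: 'd option] = 4"
    "\<And>j::'d. zeros [Some j, None, None] = 2" "\<And>j::'d. weight [Some j, None, None] = 5"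
    "\<And>j::'d. zeros [Some j, None] = 1" "\<And>j::'d. weight [Some j, None] = 3" by simp_all
  have n2: "nonvanishing M (X T) (\<lambda>x. Lmulti T b0 \<sigma>0 [None, None] (\<lambda>_. ?g) T x)"
    unfolding L w2 gdD_values by (rule nv[where P="(smult (?c ^ 2) [:0, 1, 0, -2:], 0)"])
      (use c in \<open>simp_all add: gdD_values hev_def power2_eq_square algebra_simps\<close>)
  have n3: "nonvanishing M (X T) (\<lambda>x. Lmulti T b0 \<sigma>0 [Some undefined, None] (\<lambda>_. ?g) T x)"
    unfolding L w2 gdD_values by (rule nv[where P="(0, smult ?c [:0, -1:])"]) (use c in \<open>simp_all add: gdD_values hev_def\<close>)
  have n4: "nonvanishing M (X T) (\<lambda>x. Lmulti T b0 \<sigma>0 [Some undefined, None, None] (\<lambda>_. ?g) T x)"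
    unfolding L w2 gdD_values by (rule nv[where P="(0, smult (?c ^ 2) [:0, -1, 0, 6:])"])
      (use c in \<open>simp_all add: gdD_values hev_def power2_eq_square algebra_simps\<close>)
  have n5: "nonvanishing M (X T) (\<lambda>x. \<nu>1 * Lmulti T b0 \<sigma>0 [None, None, None] (\<lambda>_. ?g) T x + \<nu>3 * (\<Sum>j\<in>UNIV. vg T b0 \<sigma>0 f0 ?g j T x))"
    if \<nu>: "(\<nu>1, \<nu>3) \<noteq> (0, 0)" for \<nu>1 \<nu>3
    unfolding L vg_u0[OF TT] sumd
  proof (rule nv[where P="(smult (?c ^ 3) (smult \<nu>1 [:0, 1, 0, -20, 0, 24:] + smult (2 * \<nu>3) [:0, -1/2, 0, 7/2, 0, -3:]), 0)"])
    fix x :: "real^'d"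
    show "\<nu>1 * (?c ^ zeros [None, None, None] * gdD (weight [None, None, None]) (csum x)) + \<nu>3 * (2 * ?c * VD 0 (csum x))
      = hev (smult (?c ^ 3) (smult \<nu>1 [:0, 1, 0, -20, 0, 24:] + smult (2 * \<nu>3) [:0, -1/2, 0, 7/2, 0, -3:]), 0) (csum x)"
    proof -
      have w: "zeros [None, None, None] = 3" "weight [None, None, None] = 6" by simp_all
      show ?thesis unfolding w gdD_values VD_def Vp_values
        by (simp add: hev_def power2_eq_square power3_eq_cube field_simps)
    qed
    have "\<nu>1 = 0 \<and> \<nu>3 = 0" if "smult \<nu>1 [:0, 1, 0, -20, 0, 24:] + smult (2 * \<nu>3) [:0, -1/2, 0, 7/2, 0, -3:] = (0 :: real poly)"
      using that by simp
    then show "(smult (?c ^ 3) (smult \<nu>1 [:0, 1, 0, -20, 0, 24:] + smult (2 * \<nu>3) [:0, -1/2, 0, 7/2, 0, -3:]), 0) \<noteq> (0, 0 :: real poly)"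
      using \<nu> c by auto
  qed
  have n6: "nonvanishing M (X T) (\<lambda>x. \<nu>2 * Lmulti T b0 \<sigma>0 [Some l, None, None, None] (\<lambda>_. ?g) T x
      + \<nu>4 * fz_at \<sigma>0 f0 ?g l x * (\<Sum>j\<in>UNIV. Lmulti T b0 \<sigma>0 [Some j, None, None] (\<lambda>_. ?g) T x))"
    if \<nu>: "(\<nu>2, \<nu>4) \<noteq> (0, 0)" for \<nu>2 \<nu>4 l
    unfolding L fz_at_u0
  \<comment> \<open>The seventh derivative is odd, whereas tanh times the fifth is even, so the two
    coefficients sit in different components and cannot cancel.\<close>
  proof (rule nv[where P="(smult (?c ^ 3 * 2 * \<nu>4) [:0, -1/2, 0, 7/2, 0, -3:], smult (?c ^ 3 * \<nu>2) [:0, -1, 0, 60, 0, -120:])"])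
    fix x :: "real^'d"
    have w: "zeros [Some l, None, None, None] = 3" "weight [Some l, None, None, None] = 7"
      "\<And>j. zeros [Some j, None, None] = 2" "\<And>j. weight [Some j, None, None] = 5" for l :: 'd by simp_all
    have "\<nu>4 * (1/2 * tanh (csum x)) * (2 * ?c * (?c ^ 2 * gdD 5 (csum x)))
      = ?c ^ 3 * 2 * \<nu>4 * (1/2 * tanh (csum x) * gdD 5 (csum x))" by (simp add: power2_eq_square power3_eq_cube)
    also have "1/2 * tanh (csum x) * gdD 5 (csum x) = hev ([:0, -1/2, 0, 7/2, 0, -3:], 0) (csum x)"
      unfolding gdD_values tanh_hev by simp
    finally have e: "\<nu>4 * (1/2 * tanh (csum x)) * (2 * ?c * (?c ^ 2 * gdD 5 (csum x)))
      = ?c ^ 3 * 2 * \<nu>4 * hev ([:0, -1/2, 0, 7/2, 0, -3:], 0) (csum x)" .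
    show "\<nu>2 * (?c ^ zeros [Some l, None, None, None] * gdD (weight [Some l, None, None, None]) (csum x))
       + \<nu>4 * (1/2 * tanh (csum x)) * (\<Sum>j\<in>(UNIV::'d set). ?c ^ zeros [Some j, None, None] * gdD (weight [Some j, None, None]) (csum x))
      = hev (smult (?c ^ 3 * 2 * \<nu>4) [:0, -1/2, 0, 7/2, 0, -3:], smult (?c ^ 3 * \<nu>2) [:0, -1, 0, 60, 0, -120:]) (csum x)"
      unfolding w sumd e unfolding gdD_values by (simp add: hev_def algebra_simps)
    show "(smult (?c ^ 3 * 2 * \<nu>4) [:0, -1/2, 0, 7/2, 0, -3:], smult (?c ^ 3 * \<nu>2) [:0, -1, 0, 60, 0, -120:]) \<noteq> (0, 0 :: real poly)"
      using \<nu> c by auto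
  qed
  have n7: "nonvanishing M (X T) (\<lambda>x. \<nu>1 * Lmulti T b0 \<sigma>0 [None, None, None, None] (\<lambda>_. ?g) T x
      + \<nu>2 * (\<Sum>j\<in>UNIV. Lop T b0 \<sigma>0 None (vg T b0 \<sigma>0 f0 ?g j) T x)
      + \<nu>3 * (\<Sum>j\<in>UNIV. wg T b0 \<sigma>0 f0 ?g j T x)
      + \<nu>4 * (\<Sum>l\<in>UNIV. \<Sum>j\<in>UNIV. fz_at \<sigma>0 f0 ?g l x * Lop T b0 \<sigma>0 (Some l) (vg T b0 \<sigma>0 f0 ?g j) T x))"
    if \<nu>: "(\<nu>1, \<nu>2, \<nu>3, \<nu>4) \<noteq> (0, 0, 0, 0)" for \<nu>1 \<nu>2 \<nu>3 \<nu>4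
    unfolding L fz_at_u0 Lop_vg wg_u0 sumd
  proof -
    let ?p = "smult \<nu>1 [:0, 1, 0, -182, 0, 840, 0, -720:] + smult (2 * \<nu>2) [:0, -1/2, 0, 65/2, 0, -117, 0, 90:]
        + smult (2 * \<nu>3) [:0, -1/2, 0, 61/2, 0, -90, 0, 60:] + smult (4 * \<nu>4) [:0, 1/4, 0, -11/2, 0, 51/4, 0, -15/2:]"
    show "nonvanishing M (X T) (\<lambda>x. \<nu>1 * (?c ^ zeros [None, None, None, None] * gdD (weight [None, None, None, None]) (csum x))
      + \<nu>2 * (2 * ?c * (?c * VD 2 (csum x))) + \<nu>3 * (2 * ?c * (?c ^ 3 * (1/2 * tanh (csum x) * gdD 7 (csum x))))
      + \<nu>4 * (2 * ?c * (2 * ?c * (1/2 * tanh (csum x) * VD 1 (csum x)))))"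
    proof (rule nv[where P="(smult (?c ^ 4) ?p, 0)"])
      fix x :: "real^'d"
      have w: "zeros [None, None, None, None] = 4" "weight [None, None, None, None] = 8" by simp_all
      have a: "1/2 * tanh y * gdD 7 y = hev ([:0, -1/2, 0, 61/2, 0, -90, 0, 60:], 0) y" for y
        unfolding gdD_values tanh_hev by simp
      have b: "1/2 * tanh y * VD 1 y = ?c\<^sup>2 * hev ([:0, 1/4, 0, -11/2, 0, 51/4, 0, -15/2:], 0) y" for y
      proof -
        have "1/2 * tanh y * VD 1 y = ?c\<^sup>2 * (1/2 * tanh y * hev (0, [:0, 1/2, 0, -21/2, 0, 15:]) y)"
          unfolding VD_def Vp_values by simp
        then show ?thesis unfolding tanh_hev by simp
      qed
      show "\<nu>1 * (?c ^ zeros [None, None, None, None] * gdD (weight [None, None, None, None]) (csum x))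
      + \<nu>2 * (2 * ?c * (?c * VD 2 (csum x))) + \<nu>3 * (2 * ?c * (?c ^ 3 * (1/2 * tanh (csum x) * gdD 7 (csum x))))
      + \<nu>4 * (2 * ?c * (2 * ?c * (1/2 * tanh (csum x) * VD 1 (csum x)))) = hev (smult (?c ^ 4) ?p, 0) (csum x)"
        unfolding w a b unfolding gdD_values VD_def Vp_values
        by (simp add: hev_def power2_eq_square power3_eq_cube power4_eq_xxxx field_simps)
      show "(smult (?c ^ 4) ?p, 0) \<noteq> (0, 0 :: real poly)"
      proof
        assume "(smult (?c ^ 4) ?p, 0) = (0, 0 :: real poly)"
        then have "smult (?c ^ 4) ?p = 0" by (simp only: prod.inject)
        then have p0: "?p = 0" using c by (simp only: smult_eq_0_iff) (simp add: power_eq_0_iff)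
        \<comment> \<open>The four functions are odd polynomials in sech of degree at most 7.
          Comparing the four odd coefficients gives a nonsingular linear system for the
          \<nu>'s.\<close>
        have "coeff ?p 1 = 0" "coeff ?p 3 = 0" "coeff ?p 5 = 0" "coeff ?p 7 = 0" unfolding p0 by simp_all
        then have "\<nu>1 - \<nu>2 - \<nu>3 + \<nu>4 = 0" "- 182 * \<nu>1 + 65 * \<nu>2 + 61 * \<nu>3 - 22 * \<nu>4 = 0"
          "840 * \<nu>1 - 234 * \<nu>2 - 180 * \<nu>3 + 51 * \<nu>4 = 0" "- 720 * \<nu>1 + 180 * \<nu>2 + 120 * \<nu>3 - 30 * \<nu>4 = 0"
          by (simp_all add: coeff_pCons eval_nat_numeral)
        then have "\<nu>1 = 0" "\<nu>2 = 0" "\<nu>3 = 0" "\<nu>4 = 0" by linarith+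
        with \<nu> show False by simp
      qed
    qed
  qed
  show ?thesis
    unfolding Ho4_def Let_def
    by (intro conjI allI impI exI; rule bexI[OF _ gG])
      (rule n1 n2 n3 n4 | (rule n5, assumption) | (rule n7, assumption) | (rule allI, rule n6, assumption))+
qed

text \<open>Drift zero and constant diffusion make the stochastic integral a Brownian coordinate:
  one cell (0, t] represents the integrand exactly except at r = 0.\<close>

lemma X_sde: "sde_solution M F W T X0 b0 \<sigma>0 X"
  unfolding sde_solution_def
proof (intro conjI ballI allI)
  fix \<omega> assume "\<omega> \<in> space M"
  then have "continuous_on {0..T} (\<lambda>t. W t \<omega>)" using bm unfolding brownian_motion_def by blast
  then show "continuous_on {0..T} (\<lambda>t. X t \<omega>)" unfolding X_def by (intro continuous_intros)
next
  fix t assume t: "t \<in> {0..T}"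
  have "X0 \<in> borel_measurable (F t)" "W t \<in> borel_measurable (F t)" using F_mono[OF _ X0F, of t] W_F[OF t] t by auto
  then show "X t \<in> borel_measurable (F t)" unfolding X_def[abs_def] by measurable
next
  fix t k assume t: "t \<in> {0..T}"
  let ?s = "\<lambda>i::nat. if i = 0 then 0 else t"
  let ?\<xi> = "\<lambda>(_::nat) (_::'w). axis k 1 :: real^'d"
  let ?I = "\<lambda>\<omega>. X t \<omega> $ k - X0 \<omega> $ k - (LINT s:{0..t}|lborel. b0 (X s \<omega>) $ k)"
  have I: "?I \<omega> = W t \<omega> $ k" for \<omega> by (simp add: X_def b0_def set_lebesgue_integral_def)
  have row: "row k (\<sigma>0 x) = axis k 1" for x :: "real^'d" by (simp add: row_def \<sigma>0_def mat_def axis_def vec_eq_iff eq_commute)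
  have simple: "simple_integrand M F 0 t 1 ?s ?\<xi>"
  proof -
    have "bounded (?\<xi> 0 ` space M)" by (rule bounded_subset[of "{axis k 1}"]) auto
    then show ?thesis using t by (auto simp: simple_integrand_def)
  qed
  have W0: "W 0 \<omega> = 0" if "\<omega> \<in> space M" for \<omega> using bm that unfolding brownian_motion_def by blast
  have "L2sq M (\<lambda>\<omega>. W t \<omega> $ k - simple_ito W 1 ?s ?\<xi> \<omega>) = (\<integral>\<^sup>+\<omega>. 0 \<partial>M)"
    unfolding L2sq_def by (intro nn_integral_cong) (simp add: simple_ito_def inner_axis' W0)
  then have l2: "L2sq M (\<lambda>\<omega>. W t \<omega> $ k - simple_ito W 1 ?s ?\<xi> \<omega>) = 0" by simp
  have l1: "(\<integral>\<^sup>+r\<in>{0..t}. ennreal ((norm ((axis k 1 :: real^'d) - simple_process 1 ?s ?\<xi> r \<omega>))\<^sup>2) \<partial>lborel) = 0" for \<omega>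
  proof -
    have "(\<integral>\<^sup>+r\<in>{0..t}. ennreal ((norm ((axis k 1 :: real^'d) - simple_process 1 ?s ?\<xi> r \<omega>))\<^sup>2) \<partial>lborel) = (\<integral>\<^sup>+(r::real). 0 \<partial>lborel)"
    proof (rule nn_integral_cong_AE)
      show "AE r in lborel. ennreal ((norm ((axis k 1 :: real^'d) - simple_process 1 ?s ?\<xi> r \<omega>))\<^sup>2) * indicator {0..t} r = 0"
        using AE_lborel_singleton[of 0] by eventually_elim (auto simp: simple_process_def indicator_def)
    qed
    then show ?thesis by simp
  qed
  have m: "(\<lambda>\<omega>. W t \<omega> $ k) \<in> borel_measurable M" using W_M[OF t] by measurable
  show "has_ito_integral M F W (\<lambda>s \<omega>. row k (\<sigma>0 (X s \<omega>))) 0 t ?I"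
    unfolding has_ito_integral_def I row
    by (intro conjI m exI[of _ "\<lambda>_. 1"] exI[of _ "\<lambda>_. ?s"] exI[of _ "\<lambda>_. ?\<xi>"])
      (use simple l1 l2 in \<open>auto simp: case_prod_unfold\<close>)
qed

definition Y :: "real \<Rightarrow> 'w \<Rightarrow> real" where "Y t \<omega> = gdint (S t \<omega>)"

definition Z :: "real \<Rightarrow> 'w \<Rightarrow> real^'d" where "Z t \<omega> = (\<chi> l. gd (S t \<omega>))"

text \<open>Ito's formula for G(S): its drift (d/2) sech(S) is minus the driver along the
  solution.\<close>

lemma YZ_bsde: "bsde_solution M F W T f0 (\<lambda>x. gdint (csum x)) X Y Z"
  unfolding bsde_solution_def
proof (intro conjI ballI)
  have f: "f0 (Y s \<omega>, Z s \<omega>) = - (d / 2) * sech (S s \<omega>)" for s \<omega> unfolding Z_def f0_u0 by (simp add: d_def)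
  fix t assume t: "t \<in> {0..T}"
  have [measurable]: "gdint \<in> borel_measurable borel" "gd \<in> borel_measurable borel"
    using gdint_continuous gd_continuous by (auto intro: borel_measurable_continuous_onI)
  have S[measurable]: "S t \<in> borel_measurable (F t)" by (rule S_F[OF t]) simp
  show "Y t \<in> borel_measurable (F t)" unfolding Y_def[abs_def] by measurable
  have "Z t = (\<lambda>\<omega>. gd (S t \<omega>) *\<^sub>R ((\<chi> l. 1) :: real^'d))" by (auto simp: Z_def vec_eq_iff)
  then show "Z t \<in> borel_measurable (F t)" by simp
  have "has_ito_integral M F W (\<lambda>r \<omega>. \<chi> l. gd (S r \<omega>)) t T
    (\<lambda>\<omega>. gdint (S T \<omega>) - gdint (S t \<omega>) - d / 2 * (LINT r:{t..T}|lborel. sech (S r \<omega>)))"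
  proof (rule ito_formula[OF gdint_deriv gd_deriv sech_deriv])
    show "\<bar>gd x\<bar> \<le> 2" for x by (rule gd_bound)
    show "\<bar>sech x\<bar> \<le> 2" for x using sech_bounds[of x] by simp
    have "\<bar>sech x * tanh x\<bar> \<le> 1 * 1" for x unfolding abs_mult using sech_bounds[of x] by (intro mult_mono) auto
    then show "\<bar>- sech x * tanh x\<bar> \<le> 2" for x by (smt (verit) abs_minus_cancel mult_minus_left mult_1)
  qed (use t in auto)
  moreover have "(LINT s:{t..T}|lborel. f0 (Y s \<omega>, Z s \<omega>)) = - (d / 2) * (LINT r:{t..T}|lborel. sech (S r \<omega>))" for \<omega>
    unfolding f by (rule set_integral_mult_right)
  ultimately show "has_ito_integral M F W Z t T
        (\<lambda>\<omega>. gdint (csum (X T \<omega>)) + (LINT s:{t..T}|lborel. f0 (Y s \<omega>, Z s \<omega>)) - Y t \<omega>)"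
    unfolding csum_X Z_def[abs_def] Y_def by (simp add: algebra_simps)
next
  fix \<omega> assume \<omega>: "\<omega> \<in> space M"
  show "continuous_on {0..T} (\<lambda>t. Y t \<omega>)"
    unfolding Y_def by (rule continuous_on_compose2[OF gdint_continuous S_continuous[OF \<omega>]]) auto
next
  have f: "f0 (Y s \<omega>, Z s \<omega>) = - (d / 2) * sech (S s \<omega>)" for s \<omega> unfolding Z_def f0_u0 by (simp add: d_def)
  show "AE \<omega> in M. set_integrable lborel {0..T} (\<lambda>s. f0 (Y s \<omega>, Z s \<omega>))"
  proof (rule AE_I2)
    fix \<omega> assume \<omega>: "\<omega> \<in> space M"
    have "continuous_on {0..T} (\<lambda>s. - (d / 2) * sech (S s \<omega>))"
      by (intro continuous_intros continuous_on_compose2[OF sech_continuous S_continuous[OF \<omega>]]) auto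
    then show "set_integrable lborel {0..T} (\<lambda>s. f0 (Y s \<omega>, Z s \<omega>))"
      unfolding f by (rule borel_integrable_atLeastAtMost')
  qed
qed

lemma problem: "fbsde_problem M F W T X0 b0 \<sigma>0 f0 (\<lambda>x. gdint (csum x)) X Y Z u0"
  unfolding fbsde_problem_def
proof (intro conjI)
  show "\<exists>K. K-lipschitz_on UNIV (b0 :: real^'d \<Rightarrow> _)"
    by (intro exI[of _ 0] lipschitz_onI) (auto simp: b0_def)
  show "\<exists>K. K-lipschitz_on UNIV (\<sigma>0 :: real^'d \<Rightarrow> _)"
    by (intro exI[of _ 0] lipschitz_onI) (auto simp: \<sigma>0_def)
  show "\<exists>K. K-lipschitz_on UNIV (f0 :: real \<times> (real^'d) \<Rightarrow> real)" using f0_lipschitz by blast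
  show "Cb 1 (\<lambda>x::real^'d. gdint (csum x))" by (rule ridge_Cb1[OF gdint_deriv gd_continuous gd_bound])
  show "AE \<omega> in M. \<forall>t\<in>{0..T}. Y t \<omega> = u0 t (X t \<omega>) \<and> Z t \<omega> = grad (u0 t) (X t \<omega>) v* \<sigma>0 (X t \<omega>)"
    by (simp add: Y_def Z_def u0_def[of _ "X _ _"] csum_X grad_u0)
qed (use X_sde YZ_bsde u0_solves[OF T] in auto)

end

section \<open>Expansion of the one-step errors\<close>

text \<open>A bound of order \<eta>^r on (0, 1], uniform in x. Uniformity lets the bound pass
  through Gaussian averages, and the exponent is real to accommodate the half powers lost by
  \<open>heatd\<close>.\<close>

definition ubig :: "real \<Rightarrow> (real \<Rightarrow> real \<Rightarrow> real) \<Rightarrow> bool" where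
  "ubig r E \<longleftrightarrow> (\<exists>C. \<forall>\<eta> x. 0 < \<eta> \<longrightarrow> \<eta> \<le> 1 \<longrightarrow> \<bar>E \<eta> x\<bar> \<le> C * \<eta> powr r)"

lemma ubigE:
  assumes "ubig r E"
  obtains C where "C \<ge> 0" "\<forall>\<eta> x. 0 < \<eta> \<longrightarrow> \<eta> \<le> 1 \<longrightarrow> \<bar>E \<eta> x\<bar> \<le> C * \<eta> powr r"
proof -
  obtain C where C: "\<And>\<eta> x. 0 < \<eta> \<Longrightarrow> \<eta> \<le> 1 \<Longrightarrow> \<bar>E \<eta> x\<bar> \<le> C * \<eta> powr r" using assms by (auto simp: ubig_def)
  have "\<bar>E 1 0\<bar> \<le> C" using C[of 1 0] by simp
  then have "C \<ge> 0" by linarith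
  then show ?thesis by (rule that) (use C in simp)
qed

lemma ubigI: "(\<And>\<eta> x. 0 < \<eta> \<Longrightarrow> \<eta> \<le> 1 \<Longrightarrow> \<bar>E \<eta> x\<bar> \<le> C * \<eta> powr r) \<Longrightarrow> ubig r E"
  by (auto simp: ubig_def)

lemma ubig_zero: "ubig r (\<lambda>\<eta> x. 0)"
  by (rule ubigI[of _ 0]) simp

lemma ubig_add: assumes "ubig r E" "ubig r E'" shows "ubig r (\<lambda>\<eta> x. E \<eta> x + E' \<eta> x)"
proof -
  obtain C where AC: "C \<ge> 0" "\<forall>\<eta> x. 0 < \<eta> \<longrightarrow> \<eta> \<le> 1 \<longrightarrow> \<bar>E \<eta> x\<bar> \<le> C * \<eta> powr r"
    by (rule ubigE[OF assms(1)]) (rule that)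
  note C = AC(2)[rule_format]
  obtain C' where AC': "C' \<ge> 0" "\<forall>\<eta> x. 0 < \<eta> \<longrightarrow> \<eta> \<le> 1 \<longrightarrow> \<bar>E' \<eta> x\<bar> \<le> C' * \<eta> powr r"
    by (rule ubigE[OF assms(2)]) (rule that)
  note C' = AC'(2)[rule_format]
  show ?thesis
  proof (rule ubigI[of _ "C + C'"])
    fix \<eta> x :: real assume h: "0 < \<eta>" "\<eta> \<le> 1"
    show "\<bar>E \<eta> x + E' \<eta> x\<bar> \<le> (C + C') * \<eta> powr r" using C[OF h, of x] C'[OF h, of x] by (simp add: distrib_right)
  qed
qed

lemma ubig_mult: assumes "ubig r E" "ubig s E'" shows "ubig (r + s) (\<lambda>\<eta> x. E \<eta> x * E' \<eta> x)"
proof -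
  obtain C where AC: "C \<ge> 0" "\<forall>\<eta> x. 0 < \<eta> \<longrightarrow> \<eta> \<le> 1 \<longrightarrow> \<bar>E \<eta> x\<bar> \<le> C * \<eta> powr r"
    by (rule ubigE[OF assms(1)]) (rule that)
  note C = AC(1) AC(2)[rule_format]
  obtain C' where AC': "C' \<ge> 0" "\<forall>\<eta> x. 0 < \<eta> \<longrightarrow> \<eta> \<le> 1 \<longrightarrow> \<bar>E' \<eta> x\<bar> \<le> C' * \<eta> powr s"
    by (rule ubigE[OF assms(2)]) (rule that)
  note C' = AC'(2)[rule_format]
  show ?thesis
  proof (rule ubigI[of _ "C * C'"])
    fix \<eta> x :: real assume h: "0 < \<eta>" "\<eta> \<le> 1"
    have "\<bar>E \<eta> x * E' \<eta> x\<bar> \<le> (C * \<eta> powr r) * (C' * \<eta> powr s)"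
      unfolding abs_mult using C(1) by (intro mult_mono C(2)[OF h] C'[OF h]) auto
    then show "\<bar>E \<eta> x * E' \<eta> x\<bar> \<le> C * C' * \<eta> powr (r + s)" by (simp add: powr_add mult_ac)
  qed
qed

lemma ubig_bounded: assumes "\<And>x. \<bar>g x\<bar> \<le> K" shows "ubig 0 (\<lambda>\<eta> x. g x)"
  by (rule ubigI[of _ K]) (use assms in simp)

lemma ubig_cmult: "ubig r E \<Longrightarrow> ubig r (\<lambda>\<eta> x. c * E \<eta> x)"
  using ubig_mult[OF ubig_bounded[of "\<lambda>_. c" "\<bar>c\<bar>"]] by simp

lemma ubig_bmult: "(\<And>x. \<bar>g x\<bar> \<le> K) \<Longrightarrow> ubig r E \<Longrightarrow> ubig r (\<lambda>\<eta> x. g x * E \<eta> x)"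
  using ubig_mult[OF ubig_bounded[of g K]] by simp

lemma ubig_diff: "ubig r E \<Longrightarrow> ubig r E' \<Longrightarrow> ubig r (\<lambda>\<eta> x. E \<eta> x - E' \<eta> x)"
  using ubig_add[of r E "\<lambda>\<eta> x. (-1) * E' \<eta> x"] ubig_cmult[of r E' "-1"] by simp

lemma ubig_sum: "(\<And>i. i \<in> I \<Longrightarrow> ubig r (E i)) \<Longrightarrow> ubig r (\<lambda>\<eta> x. \<Sum>i\<in>I. E i \<eta> x)"
  by (induction I rule: infinite_finite_induct) (auto intro: ubig_add ubig_zero)

lemma ubig_power: "ubig (real n) (\<lambda>\<eta> x. \<eta> ^ n)"
  by (rule ubigI[of _ 1]) (simp add: powr_realpow)

lemma ubig_pmult: "ubig r E \<Longrightarrow> ubig (r + real n) (\<lambda>\<eta> x. \<eta> ^ n * E \<eta> x)"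
  using ubig_mult[OF ubig_power[of n], of r E] by (simp add: add.commute)

lemma ubig_mono: assumes "ubig r E" "s \<le> r" shows "ubig s E"
proof -
  obtain C where AC: "C \<ge> 0" "\<forall>\<eta> x. 0 < \<eta> \<longrightarrow> \<eta> \<le> 1 \<longrightarrow> \<bar>E \<eta> x\<bar> \<le> C * \<eta> powr r"
    by (rule ubigE[OF assms(1)]) (rule that)
  note C = AC(1) AC(2)[rule_format]
  show ?thesis
  proof (rule ubigI[of _ C])
    fix \<eta> x :: real assume h: "0 < \<eta>" "\<eta> \<le> 1"
    have "\<eta> powr r \<le> \<eta> powr s" using h assms(2) by (intro powr_mono') auto
    then show "\<bar>E \<eta> x\<bar> \<le> C * \<eta> powr s" using C(2)[OF h, of x] mult_left_mono[OF _ C(1)] by (meson order_trans)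
  qed
qed

lemma ubig_cong: "ubig r E \<Longrightarrow> (\<And>\<eta> x. 0 < \<eta> \<Longrightarrow> \<eta> \<le> 1 \<Longrightarrow> E' \<eta> x = E \<eta> x) \<Longrightarrow> ubig r E'"
  unfolding ubig_def by auto

lemma ubig_heat:
  assumes "ubig r E" "\<And>\<eta>. E \<eta> \<in> borel_measurable borel"
  shows "ubig r (\<lambda>\<eta>. heat (k * \<eta>) (E \<eta>))"
proof -
  obtain C where AC: "C \<ge> 0" "\<forall>\<eta> x. 0 < \<eta> \<longrightarrow> \<eta> \<le> 1 \<longrightarrow> \<bar>E \<eta> x\<bar> \<le> C * \<eta> powr r"
    by (rule ubigE[OF assms(1)]) (rule that)
  note C = AC(1) AC(2)[rule_format]
  show ?thesis by (rule ubigI[of _ C]) (intro heat_bound assms(2) C(2))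
qed

text \<open>Half a power is lost in general. It is regained where an explicit expansion is
  available, so only remainders pay for it.\<close>

lemma ubig_heatd:
  assumes "ubig r E" "\<And>\<eta>. E \<eta> \<in> borel_measurable borel" "k \<ge> 0"
  shows "ubig (r - 1/2) (\<lambda>\<eta>. heatd (k * \<eta>) (E \<eta>))"
proof (cases "k = 0")
  case True then show ?thesis using ubig_zero by simp
next
  case False
  obtain C where AC: "C \<ge> 0" "\<forall>\<eta> x. 0 < \<eta> \<longrightarrow> \<eta> \<le> 1 \<longrightarrow> \<bar>E \<eta> x\<bar> \<le> C * \<eta> powr r"
    by (rule ubigE[OF assms(1)]) (rule that)
  note C = AC(1) AC(2)[rule_format]
  show ?thesis
  proof (rule ubigI[of _ "C / sqrt k"])
    fix \<eta> x :: real assume h: "0 < \<eta>" "\<eta> \<le> 1"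
    have "\<bar>heatd (k * \<eta>) (E \<eta>) x\<bar> \<le> (C * \<eta> powr r) / sqrt (k * \<eta>)"
      using h assms(3) by (intro heatd_bound assms(2) C(2)) auto
    also have "\<dots> = C / sqrt k * \<eta> powr (r - 1/2)"
      using h by (simp add: powr_diff powr_half_sqrt real_sqrt_mult)
    finally show "\<bar>heatd (k * \<eta>) (E \<eta>) x\<bar> \<le> C / sqrt k * \<eta> powr (r - 1/2)" .
  qed
qed

lemma lin_growth_add: "lin_growth u \<Longrightarrow> lin_growth v \<Longrightarrow> lin_growth (\<lambda>x. u x + v x)"
proof -
  assume u: "lin_growth u" and v: "lin_growth v"
  obtain C where C: "\<forall>x. \<bar>u x\<bar> \<le> C * (1 + \<bar>x\<bar>)" using u unfolding lin_growth_def by blast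
  obtain C' where C': "\<forall>x. \<bar>v x\<bar> \<le> C' * (1 + \<bar>x\<bar>)" using v unfolding lin_growth_def by blast
  have "\<bar>u x + v x\<bar> \<le> (C + C') * (1 + \<bar>x\<bar>)" for x using C[rule_format, of x] C'[rule_format, of x] by (simp add: distrib_right)
  then show ?thesis using u v unfolding lin_growth_def by (auto intro!: borel_measurable_add)
qed

lemma lin_growth_cmult: "lin_growth u \<Longrightarrow> lin_growth (\<lambda>x. c * u x)"
proof -
  assume u: "lin_growth u"
  obtain C where C: "\<forall>x. \<bar>u x\<bar> \<le> C * (1 + \<bar>x\<bar>)" using u unfolding lin_growth_def by blast
  have "\<bar>c * u x\<bar> \<le> (\<bar>c\<bar> * C) * (1 + \<bar>x\<bar>)" for x using mult_left_mono[OF C[rule_format, of x], of "\<bar>c\<bar>"] by (simp add: abs_mult mult.assoc)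
  then show ?thesis using u unfolding lin_growth_def by (auto intro!: borel_measurable_times)
qed

lemma lin_growth_sum: "(\<And>i. i \<in> I \<Longrightarrow> lin_growth (v i)) \<Longrightarrow> lin_growth (\<lambda>x. \<Sum>i\<in>I. v i x)"
  by (induction I rule: infinite_finite_induct) (auto intro: lin_growth_add bounded_lin_growth[of _ 0])

lemma heat_add: "lin_growth u \<Longrightarrow> lin_growth v \<Longrightarrow> heat a (\<lambda>x. u x + v x) x = heat a u x + heat a v x"
  unfolding heat_def by (rule Bochner_Integration.integral_add) (auto intro: growth_integrable0)

lemma heat_cmult: "heat a (\<lambda>x. c * v x) x = c * heat a v x"
  unfolding heat_def by simp

lemma heatd_add: "lin_growth u \<Longrightarrow> lin_growth v \<Longrightarrow> heatd a (\<lambda>x. u x + v x) x = heatd a u x + heatd a v x"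
  unfolding heatd_def add_divide_distrib[symmetric] distrib_left
  by (subst Bochner_Integration.integral_add) (auto intro: growth_integrable1)

lemma heatd_cmult: "heatd a (\<lambda>x. c * v x) x = c * heatd a v x"
  unfolding heatd_def by (simp add: mult.left_commute[of _ c])

section \<open>Expansions of the building blocks\<close>

lemma ubig_heat_taylor:
  fixes D :: "nat \<Rightarrow> real \<Rightarrow> real"
  assumes der: "\<And>m x. (D m has_real_derivative D (Suc m) x) (at x)"
    and K: "\<And>x. \<bar>D (2 * n) x\<bar> \<le> K" and v: "lin_growth (D 0)" and k: "k \<ge> 0"
  shows "ubig (real n) (\<lambda>\<eta> x. heat (k * \<eta>) (D 0) x - (\<Sum>p<n. (k * \<eta>) ^ p / fact p * (D (2 * p) x / 2 ^ p)))"
proof (rule ubigI[of _ "K * k ^ n"])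
  fix \<eta> x :: real assume h: "0 < \<eta>" "\<eta> \<le> 1"
  have "(\<Sum>p<n. (k * \<eta>) ^ p / fact p * (D (2 * p) x / 2 ^ p)) = (\<Sum>p<n. (k * \<eta>) ^ p / (2 ^ p * fact p) * D (2 * p) x)"
    by (simp add: mult_ac)
  then show "\<bar>heat (k * \<eta>) (D 0) x - (\<Sum>p<n. (k * \<eta>) ^ p / fact p * (D (2 * p) x / 2 ^ p))\<bar> \<le> K * k ^ n * \<eta> powr real n"
    using heat_taylor[OF der K v, of "k * \<eta>" x] h k by (simp add: powr_realpow power_mult_distrib mult.assoc)
qed

text \<open>For k = 0 the expansion is zero and not the derivative. This convention is what later
  masks stages that coincide in time.\<close>

lemma ubig_heatd_taylor:
  fixes D :: "nat \<Rightarrow> real \<Rightarrow> real"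
  assumes der: "\<And>m x. (D m has_real_derivative D (Suc m) x) (at x)"
    and K: "\<And>x. \<bar>D (2 * n + 1) x\<bar> \<le> K" and v: "lin_growth (D 0)" and k: "k \<ge> 0"
  shows "ubig (real n) (\<lambda>\<eta> x. heatd (k * \<eta>) (D 0) x
    - (if k = 0 then 0 else \<Sum>p<n. (k * \<eta>) ^ p / fact p * (D (2 * p + 1) x / 2 ^ p)))"
proof (cases "k = 0")
  case True then show ?thesis using ubig_zero by simp
next
  case False
  show ?thesis
  proof (rule ubigI[of _ "K * k ^ n"])
    fix \<eta> x :: real assume h: "0 < \<eta>" "\<eta> \<le> 1"
    have "(\<Sum>p<n. (k * \<eta>) ^ p / fact p * (D (2 * p + 1) x / 2 ^ p)) = (\<Sum>p<n. (k * \<eta>) ^ p / (2 ^ p * fact p) * D (2 * p + 1) x)"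
      by (simp add: mult_ac)
    moreover have "k * \<eta> > 0" using h k False by simp
    ultimately show "\<bar>heatd (k * \<eta>) (D 0) x - (if k = 0 then 0 else \<Sum>p<n. (k * \<eta>) ^ p / fact p * (D (2 * p + 1) x / 2 ^ p))\<bar>
        \<le> K * k ^ n * \<eta> powr real n"
      using heatd_taylor[OF der K v, of "k * \<eta>" x] h False by (simp add: powr_realpow power_mult_distrib mult.assoc)
  qed
qed

text \<open>\<open>UG p\<close> is \<open>A\<^sup>p G\<close> for \<open>A = D\<^sup>2 / 2\<close>, \<open>DG p\<close> its derivative, and \<open>VG m\<close> the \<open>m\<close>-th derivative of
  \<open>tanh x / 2 * DG 2 x\<close>.\<close>

definition UG :: "nat \<Rightarrow> real \<Rightarrow> real" where "UG p x = gdD (2 * p) x / 2 ^ p"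
definition DG :: "nat \<Rightarrow> real \<Rightarrow> real" where "DG p x = gdD (2 * p + 1) x / 2 ^ p"
definition VG :: "nat \<Rightarrow> real \<Rightarrow> real" where "VG m x = hev ((hderiv ^^ m) Vp) x / 4"

text \<open>The driver on vectors with equal components, per coordinate: at (z, ..., z) the driver
  is d times \<open>phi z\<close>. The factor d joins h to form \<eta>.\<close>

definition phi :: "real \<Rightarrow> real" where "phi y = - 1/2 * cos y"

lemma phi_gd: "phi (gd x) = - UG 1 x"
  by (simp add: phi_def cos_gd UG_def gdD_values hev_def)

text \<open>A first-order expansion is enough: stage errors in Z are of order \<eta>^2, so the
  quadratic remainder is of order \<eta>^4 and, after the further factor \<eta> of the scheme, of
  order \<eta>^5.\<close>

lemma phi_taylor: "\<bar>phi (gd x + \<delta>) - phi (gd x) - 1/2 * tanh x * \<delta>\<bar> \<le> \<delta>\<^sup>2"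
proof -
  have d: "(phi has_real_derivative 1/2 * sin y) (at y)" "((\<lambda>y. 1/2 * sin y) has_real_derivative 1/2 * cos y) (at y)" for y
    unfolding phi_def[abs_def] by (auto intro!: derivative_eq_intros)
  define D where "D m = (if m = 0 then phi else if m = 1 then (\<lambda>y. 1/2 * sin y) else (\<lambda>y. 1/2 * cos y))" for m :: nat
  show ?thesis
  proof (cases "\<delta> = 0")
    case False
    have "\<exists>t. (if \<delta> + gd x < gd x then \<delta> + gd x < t \<and> t < gd x else gd x < t \<and> t < \<delta> + gd x) \<and>
      phi (\<delta> + gd x) = (\<Sum>m<2. D m (gd x) / fact m * (\<delta> + gd x - gd x) ^ m) + D 2 t / fact 2 * (\<delta> + gd x - gd x) ^ 2"
    proof (rule Taylor[of 2 D phi "min (gd x) (\<delta> + gd x)" "max (gd x) (\<delta> + gd x)"])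
      show "\<forall>m t. m < 2 \<and> min (gd x) (\<delta> + gd x) \<le> t \<and> t \<le> max (gd x) (\<delta> + gd x) \<longrightarrow> (D m has_real_derivative D (Suc m) t) (at t)"
        using d by (auto simp: D_def less_2_cases_iff)
    qed (use False in \<open>auto simp: D_def\<close>)
    then obtain t where "phi (\<delta> + gd x) = (\<Sum>m<2. D m (gd x) / fact m * \<delta> ^ m) + D 2 t / fact 2 * \<delta>\<^sup>2" by auto
    then have "phi (gd x + \<delta>) - phi (gd x) - 1/2 * tanh x * \<delta> = cos t / 4 * \<delta>\<^sup>2"
      by (simp add: numeral_2_eq_2 D_def sin_gd add.commute)
    moreover have "\<bar>cos t / 4\<bar> \<le> 1" using cos_le_one[of t] cos_ge_minus_one[of t] by linarith
    from mult_right_mono[OF this, of "\<delta>\<^sup>2"] have "\<bar>cos t / 4 * \<delta>\<^sup>2\<bar> \<le> 1 * \<delta>\<^sup>2" by (simp only: abs_mult abs_power2 zero_le_power2)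
    ultimately show ?thesis by (simp only: mult_1)
  qed simp
qed

lemma UG_bounded: "p \<ge> 1 \<Longrightarrow> \<exists>K. \<forall>x. \<bar>UG p x\<bar> \<le> K"
proof -
  assume "p \<ge> 1"
  then obtain K where "\<And>x. \<bar>gdD (2 * p) x\<bar> \<le> K" using gdD_bounded[of "2 * p"] by auto
  then show ?thesis by (intro exI[of _ "K / 2 ^ p"]) (auto simp: UG_def abs_divide divide_right_mono)
qed

lemma DG_bounded: "\<exists>K. \<forall>x. \<bar>DG p x\<bar> \<le> K"
proof -
  obtain K where "\<And>x. \<bar>gdD (2 * p + 1) x\<bar> \<le> K" using gdD_bounded[of "2 * p + 1"] by auto
  then show ?thesis by (intro exI[of _ "K / 2 ^ p"]) (auto simp: DG_def abs_divide divide_right_mono)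
qed

lemma VG_bounded: "\<exists>K. \<forall>x. \<bar>VG m x\<bar> \<le> K"
proof -
  obtain K where "\<And>x. \<bar>hev ((hderiv ^^ m) Vp) x\<bar> \<le> K" using hev_bounded by blast
  then show ?thesis by (intro exI[of _ "K / 4"]) (auto simp: VG_def)
qed

lemma UG_meas [measurable]: "UG p \<in> borel_measurable borel" unfolding UG_def[abs_def] by measurable
lemma VG_meas [measurable]: "VG p \<in> borel_measurable borel" unfolding VG_def[abs_def] by measurable

lemma lin_growth_UG1: "lin_growth (UG 1)"
proof -
  obtain K where "\<And>x. \<bar>UG 1 x\<bar> \<le> K" using UG_bounded[of 1] by auto
  then show ?thesis by (rule bounded_lin_growth[OF UG_meas])
qed

lemma lin_growth_VG: "lin_growth (VG p)"
proof -
  obtain K where "\<And>x. \<bar>VG p x\<bar> \<le> K" using VG_bounded by blast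
  then show ?thesis by (rule bounded_lin_growth[OF VG_meas])
qed

lemma VG_deriv: "(VG m has_real_derivative VG (Suc m) x) (at x)"
  unfolding VG_def[abs_def] using DERIV_cdivide[OF hev_deriv[of "(hderiv ^^ m) Vp" x], of 4] by simp

lemma tanh_DG2: "1/2 * tanh x * DG 2 x = VG 0 x"
proof -
  have "1/2 * tanh x * gdD 5 x = hev Vp x" unfolding gdD_values tanh_hev by (simp add: Vp_def)
  then show ?thesis by (simp add: DG_def VG_def)
qed

lemma UG1_seq: "((\<lambda>x. gdD (m + 2) x / 2) has_real_derivative gdD (Suc m + 2) x / 2) (at x)"
  using DERIV_cdivide[OF gdD_deriv[of "m + 2" x], of 2] by simp


lemma ubig_heat_hev: "k \<ge> 0 \<Longrightarrow> ubig 1 (\<lambda>\<eta> x. heat (k * \<eta>) (hev P) x - hev P x)"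
proof -
  assume k: "k \<ge> 0"
  obtain K where K: "\<And>x. \<bar>hev ((hderiv ^^ 2) P) x\<bar> \<le> K" using hev_bounded by blast
  obtain K' where K': "\<And>x. \<bar>hev P x\<bar> \<le> K'" using hev_bounded by blast
  have "ubig (real 1) (\<lambda>\<eta> x. heat (k * \<eta>) (hev ((hderiv ^^ 0) P)) x
    - (\<Sum>p<1. (k * \<eta>) ^ p / fact p * (hev ((hderiv ^^ (2 * p)) P) x / 2 ^ p)))"
    by (rule ubig_heat_taylor[where D="\<lambda>m. hev ((hderiv ^^ m) P)" and K=K])
      (use hev_deriv K k bounded_lin_growth[OF hev_measurable K'] in \<open>simp_all\<close>)
  then show ?thesis by simp
qed

lemma gdint_gdD: "gdint = gdD 0" and gd_gdD: "gd = gdD 1"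
  by (simp_all add: gdD_simps)

lemma ubig_heat_gdint: "ubig 5 (\<lambda>\<eta> x. heat \<eta> gdint x - (gdint x + \<eta> * UG 1 x + \<eta>\<^sup>2 / 2 * UG 2 x + \<eta> ^ 3 / 6 * UG 3 x + \<eta> ^ 4 / 24 * UG 4 x))"
proof -
  obtain K where K: "\<And>x. \<bar>gdD (2 * 5) x\<bar> \<le> K" using gdD_bounded[of "2 * 5"] by auto
  have "ubig (real 5) (\<lambda>\<eta> x. heat (1 * \<eta>) (gdD 0) x - (\<Sum>p<5. (1 * \<eta>) ^ p / fact p * (gdD (2 * p) x / 2 ^ p)))"
    by (rule ubig_heat_taylor[OF gdD_deriv K]) (use gdint_lin_growth in \<open>simp_all add: gdint_gdD\<close>)
  moreover have "(\<Sum>p<5. \<eta> ^ p / fact p * (gdD (2 * p) x / 2 ^ p))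
      = gdint x + \<eta> * UG 1 x + \<eta>\<^sup>2 / 2 * UG 2 x + \<eta> ^ 3 / 6 * UG 3 x + \<eta> ^ 4 / 24 * UG 4 x" for \<eta> x
    by (simp add: eval_nat_numeral UG_def gdint_gdD)
  ultimately show ?thesis by (simp add: gdint_gdD)
qed

lemma ubig_heatd_gdint: "c > 0 \<Longrightarrow> ubig 4 (\<lambda>\<eta> x. heatd (c * \<eta>) gdint x
    - (gd x + (c * \<eta>) * DG 1 x + (c * \<eta>)\<^sup>2 / 2 * DG 2 x + (c * \<eta>) ^ 3 / 6 * DG 3 x))"
proof -
  assume c: "c > 0"
  obtain K where K: "\<And>x. \<bar>gdD (2 * 4 + 1) x\<bar> \<le> K" using gdD_bounded[of "2 * 4 + 1"] by auto
  have "ubig (real 4) (\<lambda>\<eta> x. heatd (c * \<eta>) (gdD 0) x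
      - (if c = 0 then 0 else \<Sum>p<4. (c * \<eta>) ^ p / fact p * (gdD (2 * p + 1) x / 2 ^ p)))"
    by (rule ubig_heatd_taylor[OF gdD_deriv K]) (use c gdint_lin_growth in \<open>simp_all add: gdint_gdD\<close>)
  moreover have "(\<Sum>p<4. (c * \<eta>) ^ p / fact p * (gdD (2 * p + 1) x / 2 ^ p))
      = gd x + (c * \<eta>) * DG 1 x + (c * \<eta>)\<^sup>2 / 2 * DG 2 x + (c * \<eta>) ^ 3 / 6 * DG 3 x" for \<eta> x
    by (simp add: eval_nat_numeral DG_def gd_gdD)
  ultimately show ?thesis using c by (simp add: gdint_gdD)
qed

lemma ubig_heat_UG1: "k \<ge> 0 \<Longrightarrow> ubig 4 (\<lambda>\<eta> x. heat (k * \<eta>) (UG 1) x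
    - (UG 1 x + (k * \<eta>) * UG 2 x + (k * \<eta>)\<^sup>2 / 2 * UG 3 x + (k * \<eta>) ^ 3 / 6 * UG 4 x))"
proof -
  assume k: "k \<ge> 0"
  obtain K where K: "\<And>x. \<bar>gdD (2 * 4 + 2) x\<bar> \<le> K" using gdD_bounded[of "2 * 4 + 2"] by auto
  have g: "(\<lambda>x. gdD (0 + 2) x / 2) = UG 1" by (simp add: UG_def[abs_def] numeral_2_eq_2)
  have lg: "lin_growth (\<lambda>x. gdD (0 + 2) x / 2)" unfolding g by (rule lin_growth_UG1)
  have "ubig (real 4) (\<lambda>\<eta> x. heat (k * \<eta>) (\<lambda>x. gdD (0 + 2) x / 2) x - (\<Sum>p<4. (k * \<eta>) ^ p / fact p * (gdD (2 * p + 2) x / 2 / 2 ^ p)))"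
    by (rule ubig_heat_taylor[where D="\<lambda>m x. gdD (m + 2) x / 2", OF UG1_seq, of _ "K / 2"])
      (use K k lg in \<open>simp_all\<close>)
  moreover have "(\<Sum>p<4. (k * \<eta>) ^ p / fact p * (gdD (2 * p + 2) x / 2 / 2 ^ p))
      = UG 1 x + (k * \<eta>) * UG 2 x + (k * \<eta>)\<^sup>2 / 2 * UG 3 x + (k * \<eta>) ^ 3 / 6 * UG 4 x" for \<eta> x
    by (simp add: eval_nat_numeral UG_def)
  moreover note g
  ultimately show ?thesis by simp
qed

lemma ubig_heatd_UG1: "k > 0 \<Longrightarrow> ubig 3 (\<lambda>\<eta> x. heatd (k * \<eta>) (UG 1) x
    - (DG 1 x + (k * \<eta>) * DG 2 x + (k * \<eta>)\<^sup>2 / 2 * DG 3 x))"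
proof -
  assume k: "k > 0"
  obtain K where K: "\<And>x. \<bar>gdD (2 * 3 + 1 + 2) x\<bar> \<le> K" using gdD_bounded[of "2 * 3 + 1 + 2"] by auto
  have g: "(\<lambda>x. gdD (0 + 2) x / 2) = UG 1" by (simp add: UG_def[abs_def] numeral_2_eq_2)
  have lg: "lin_growth (\<lambda>x. gdD (0 + 2) x / 2)" unfolding g by (rule lin_growth_UG1)
  have "ubig (real 3) (\<lambda>\<eta> x. heatd (k * \<eta>) (\<lambda>x. gdD (0 + 2) x / 2) x
      - (if k = 0 then 0 else \<Sum>p<3. (k * \<eta>) ^ p / fact p * (gdD (2 * p + 1 + 2) x / 2 / 2 ^ p)))"
    by (rule ubig_heatd_taylor[where D="\<lambda>m x. gdD (m + 2) x / 2", OF UG1_seq, of _ "K / 2"])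
      (use K k lg in \<open>simp_all\<close>)
  moreover have "(\<Sum>p<3. (k * \<eta>) ^ p / fact p * (gdD (2 * p + 1 + 2) x / 2 / 2 ^ p))
      = DG 1 x + (k * \<eta>) * DG 2 x + (k * \<eta>)\<^sup>2 / 2 * DG 3 x" for \<eta> x
    by (simp add: eval_nat_numeral DG_def)
  moreover note g
  ultimately show ?thesis using k by simp
qed

lemma ubig_heatd_VG0: "k > 0 \<Longrightarrow> ubig 1 (\<lambda>\<eta> x. heatd (k * \<eta>) (VG 0) x - VG 1 x)"
proof -
  assume k: "k > 0"
  obtain K where K: "\<And>x. \<bar>VG (2 * 1 + 1) x\<bar> \<le> K" using VG_bounded by blast
  have "ubig (real 1) (\<lambda>\<eta> x. heatd (k * \<eta>) (VG 0) x
      - (if k = 0 then 0 else \<Sum>p<1. (k * \<eta>) ^ p / fact p * (VG (2 * p + 1) x / 2 ^ p)))"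
    by (rule ubig_heatd_taylor[OF VG_deriv K]) (use k lin_growth_VG in simp_all)
  then show ?thesis using k by simp
qed

lemma ubig_heat_VG0: "k \<ge> 0 \<Longrightarrow> ubig 2 (\<lambda>\<eta> x. heat (k * \<eta>) (VG 0) x - (VG 0 x + (k * \<eta>) * (VG 2 x / 2)))"
proof -
  assume k: "k \<ge> 0"
  obtain K where K: "\<And>x. \<bar>VG (2 * 2) x\<bar> \<le> K" using VG_bounded by blast
  have "ubig (real 2) (\<lambda>\<eta> x. heat (k * \<eta>) (VG 0) x
      - (\<Sum>p<2. (k * \<eta>) ^ p / fact p * (VG (2 * p) x / 2 ^ p)))"
    by (rule ubig_heat_taylor[OF VG_deriv K]) (use k lin_growth_VG in simp_all)
  then show ?thesis by (simp add: numeral_2_eq_2)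
qed

text \<open>The driver at a stage is -UG 1 at leading order, with \<open>e\<close> measuring the
  second-order error of that stage. The remainder drops from exponent 3 to 5/2; coinciding times
  give the factor 0.\<close>

lemma ubig_heatd_driver:
  assumes k: "k \<ge> 0" and m: "\<And>\<eta>. \<psi> \<eta> \<in> borel_measurable borel"
    and \<psi>: "ubig 3 (\<lambda>\<eta> x. \<psi> \<eta> x - (\<eta>\<^sup>2 * e * VG 0 x - UG 1 x))"
  shows "ubig (5/2) (\<lambda>\<eta> x. heatd (k * \<eta>) (\<psi> \<eta>) x - (if k > 0 then 1 else 0) *
    (\<eta>\<^sup>2 * e * VG 1 x - (DG 1 x + (k * \<eta>) * DG 2 x + (k * \<eta>)\<^sup>2 / 2 * DG 3 x)))"
proof (cases "k = 0")
  case True then show ?thesis using ubig_zero by simp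
next
  case False
  with k have k: "k > 0" by simp
  define R where "R \<eta> x = \<psi> \<eta> x - (\<eta>\<^sup>2 * e * VG 0 x - UG 1 x)" for \<eta> x
  have Rm: "R \<eta> \<in> borel_measurable borel" for \<eta> unfolding R_def[abs_def] using m by measurable
  have R: "ubig 3 R" using \<psi> unfolding R_def[abs_def] .
  have 1: "ubig (5/2) (\<lambda>\<eta>. heatd (k * \<eta>) (R \<eta>))" using ubig_heatd[OF R Rm, of k] k by simp
  have 2: "ubig (1 + real 2) (\<lambda>\<eta> x. \<eta>\<^sup>2 * (e * (heatd (k * \<eta>) (VG 0) x - VG 1 x)))"
    by (intro ubig_pmult ubig_cmult ubig_heatd_VG0 k)
  note 3 = ubig_heatd_UG1[OF k]
  have "ubig (5/2) (\<lambda>\<eta> x. heatd (k * \<eta>) (R \<eta>) x + \<eta>\<^sup>2 * (e * (heatd (k * \<eta>) (VG 0) x - VG 1 x))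
      - (heatd (k * \<eta>) (UG 1) x - (DG 1 x + (k * \<eta>) * DG 2 x + (k * \<eta>)\<^sup>2 / 2 * DG 3 x)))"
    by (intro ubig_add ubig_diff 1 ubig_mono[OF 2] ubig_mono[OF 3]) auto
  then show ?thesis
  proof (rule ubig_cong)
    fix \<eta> x :: real assume h: "0 < \<eta>" "\<eta> \<le> 1"
    obtain C where AC: "C \<ge> 0" "\<forall>\<eta> x. 0 < \<eta> \<longrightarrow> \<eta> \<le> 1 \<longrightarrow> \<bar>R \<eta> x\<bar> \<le> C * \<eta> powr 3"
      by (rule ubigE[OF R]) (rule that)
    note C = AC(2)[rule_format]
    have lgR: "lin_growth (R \<eta>)" by (rule bounded_lin_growth[OF Rm C[OF h]])
    have "\<psi> \<eta> = (\<lambda>x. R \<eta> x + (\<eta>\<^sup>2 * e * VG 0 x + (-1) * UG 1 x))" by (auto simp: R_def)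
    then have "heatd (k * \<eta>) (\<psi> \<eta>) x = heatd (k * \<eta>) (R \<eta>) x + (\<eta>\<^sup>2 * e * heatd (k * \<eta>) (VG 0) x + (-1) * heatd (k * \<eta>) (UG 1) x)"
      by (simp only: heatd_add heatd_cmult lin_growth_add lin_growth_cmult lgR lin_growth_UG1 lin_growth_VG)
    then show "heatd (k * \<eta>) (\<psi> \<eta>) x - (if k > 0 then 1 else 0) *
    (\<eta>\<^sup>2 * e * VG 1 x - (DG 1 x + (k * \<eta>) * DG 2 x + (k * \<eta>)\<^sup>2 / 2 * DG 3 x)) = heatd (k * \<eta>) (R \<eta>) x + \<eta>\<^sup>2 * (e * (heatd (k * \<eta>) (VG 0) x - VG 1 x))
      - (heatd (k * \<eta>) (UG 1) x - (DG 1 x + (k * \<eta>) * DG 2 x + (k * \<eta>)\<^sup>2 / 2 * DG 3 x))"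
      using k by (simp add: algebra_simps)
  qed
qed

text \<open>A common form for intermediate Z-stages and the Z-output. The expansion of the weighted
  terminal value is balanced against the driver terms, which enter with the opposite sign; w' are
  the weights that survive coinciding times. The factor \<eta> lifts the remainder 5/2 to 7/2,
  beyond \<eta>^3.\<close>

lemma ubig_heatd_stage:
  assumes c: "c > 0" and I: "finite I" and k: "\<And>i. i \<in> I \<Longrightarrow> k i \<ge> 0"
    and m: "\<And>i \<eta>. i \<in> I \<Longrightarrow> \<psi> i \<eta> \<in> borel_measurable borel"
    and \<psi>: "\<And>i. i \<in> I \<Longrightarrow> ubig 3 (\<lambda>\<eta> x. \<psi> i \<eta> x - (\<eta>\<^sup>2 * e i * VG 0 x - UG 1 x))"
    and w': "\<And>i. i \<in> I \<Longrightarrow> w' i = w i * (if k i > 0 then 1 else 0)"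
  shows "ubig (7/2) (\<lambda>\<eta> x. heatd (c * \<eta>) gdint x + \<eta> * (\<Sum>i\<in>I. w i * heatd (k i * \<eta>) (\<psi> i \<eta>) x)
    - (gd x + \<eta> * ((c - (\<Sum>i\<in>I. w' i)) * DG 1 x) + \<eta>\<^sup>2 * ((c\<^sup>2 / 2 - (\<Sum>i\<in>I. w' i * k i)) * DG 2 x)
       + \<eta> ^ 3 * ((c ^ 3 / 6 - 1/2 * (\<Sum>i\<in>I. w' i * (k i)\<^sup>2)) * DG 3 x + (\<Sum>i\<in>I. w' i * e i) * VG 1 x)))"
proof -
  have 1: "ubig (5/2 + real 1) (\<lambda>\<eta> x. \<eta> ^ 1 * (\<Sum>i\<in>I. w i * (heatd (k i * \<eta>) (\<psi> i \<eta>) x - (if k i > 0 then 1 else 0) *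
    (\<eta>\<^sup>2 * e i * VG 1 x - (DG 1 x + (k i * \<eta>) * DG 2 x + (k i * \<eta>)\<^sup>2 / 2 * DG 3 x)))))"
    by (intro ubig_pmult ubig_sum ubig_cmult ubig_heatd_driver k m \<psi>)
  have "ubig (7/2) (\<lambda>\<eta> x. (heatd (c * \<eta>) gdint x
    - (gd x + (c * \<eta>) * DG 1 x + (c * \<eta>)\<^sup>2 / 2 * DG 2 x + (c * \<eta>) ^ 3 / 6 * DG 3 x)) + \<eta> ^ 1 * (\<Sum>i\<in>I. w i * (heatd (k i * \<eta>) (\<psi> i \<eta>) x - (if k i > 0 then 1 else 0) *
    (\<eta>\<^sup>2 * e i * VG 1 x - (DG 1 x + (k i * \<eta>) * DG 2 x + (k i * \<eta>)\<^sup>2 / 2 * DG 3 x)))))"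
    by (intro ubig_add ubig_mono[OF ubig_heatd_gdint[OF c]] ubig_mono[OF 1]) auto
  then show ?thesis
  proof (rule ubig_cong)
    fix \<eta> x :: real
    have "(\<Sum>i\<in>I. w i * (heatd (k i * \<eta>) (\<psi> i \<eta>) x - (if k i > 0 then 1 else 0) *
        (\<eta>\<^sup>2 * e i * VG 1 x - (DG 1 x + (k i * \<eta>) * DG 2 x + (k i * \<eta>)\<^sup>2 / 2 * DG 3 x))))
      = (\<Sum>i\<in>I. w i * heatd (k i * \<eta>) (\<psi> i \<eta>) x - \<eta>\<^sup>2 * VG 1 x * (w' i * e i) + DG 1 x * w' i
          + \<eta> * DG 2 x * (w' i * k i) + \<eta>\<^sup>2 / 2 * DG 3 x * (w' i * (k i)\<^sup>2))"
      by (intro sum.cong refl) (simp add: w' algebra_simps power_mult_distrib)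
    also have "\<dots> = (\<Sum>i\<in>I. w i * heatd (k i * \<eta>) (\<psi> i \<eta>) x) - \<eta>\<^sup>2 * VG 1 x * (\<Sum>i\<in>I. w' i * e i)
        + DG 1 x * (\<Sum>i\<in>I. w' i) + \<eta> * DG 2 x * (\<Sum>i\<in>I. w' i * k i) + \<eta>\<^sup>2 / 2 * DG 3 x * (\<Sum>i\<in>I. w' i * (k i)\<^sup>2)"
      by (simp add: sum.distrib sum_subtractf sum_distrib_left)
    finally have s: "(\<Sum>i\<in>I. w i * (heatd (k i * \<eta>) (\<psi> i \<eta>) x - (if k i > 0 then 1 else 0) *
        (\<eta>\<^sup>2 * e i * VG 1 x - (DG 1 x + (k i * \<eta>) * DG 2 x + (k i * \<eta>)\<^sup>2 / 2 * DG 3 x)))) = \<dots>" .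
    show "heatd (c * \<eta>) gdint x + \<eta> * (\<Sum>i\<in>I. w i * heatd (k i * \<eta>) (\<psi> i \<eta>) x)
    - (gd x + \<eta> * ((c - (\<Sum>i\<in>I. w' i)) * DG 1 x) + \<eta>\<^sup>2 * ((c\<^sup>2 / 2 - (\<Sum>i\<in>I. w' i * k i)) * DG 2 x)
       + \<eta> ^ 3 * ((c ^ 3 / 6 - 1/2 * (\<Sum>i\<in>I. w' i * (k i)\<^sup>2)) * DG 3 x + (\<Sum>i\<in>I. w' i * e i) * VG 1 x))
      = (heatd (c * \<eta>) gdint x
    - (gd x + (c * \<eta>) * DG 1 x + (c * \<eta>)\<^sup>2 / 2 * DG 2 x + (c * \<eta>) ^ 3 / 6 * DG 3 x)) + \<eta> ^ 1 * (\<Sum>i\<in>I. w i * (heatd (k i * \<eta>) (\<psi> i \<eta>) x - (if k i > 0 then 1 else 0) *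
    (\<eta>\<^sup>2 * e i * VG 1 x - (DG 1 x + (k i * \<eta>) * DG 2 x + (k i * \<eta>)\<^sup>2 / 2 * DG 3 x))))"
      unfolding s by (simp add: algebra_simps power2_eq_square power3_eq_cube add_divide_distrib diff_divide_distrib)
  qed
qed


section \<open>Expansion of the stages\<close>

text \<open>The effective weight: an H-coefficient over an interval of length zero is zero, so
  stages at equal times do not act on each other. The row-sum condition of the class is stated with
  the same indicator.\<close>

definition smask :: "rk_coeffs \<Rightarrow> nat \<Rightarrow> nat \<Rightarrow> real" where
  "smask S j k = rk_alpha S j k * (if rk_c S k < rk_c S j then 1 else 0)"

text \<open>Coefficients of \<open>\<eta>\<^sup>2 DG 2\<close>, \<open>\<eta>\<^sup>3 DG 3\<close> and \<open>\<eta>\<^sup>3 VG 1\<close> in the error of stage \<open>j\<close>.\<close>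

definition e2 :: "rk_coeffs \<Rightarrow> nat \<Rightarrow> real" where
  "e2 S j = (rk_c S j)\<^sup>2 / 2 - (\<Sum>k=1..<j. smask S j k * (rk_c S j - rk_c S k))"

definition e3 :: "rk_coeffs \<Rightarrow> nat \<Rightarrow> real" where
  "e3 S j = rk_c S j ^ 3 / 6 - 1/2 * (\<Sum>k=1..<j. smask S j k * (rk_c S j - rk_c S k)\<^sup>2)"

definition er :: "rk_coeffs \<Rightarrow> nat \<Rightarrow> real" where
  "er S j = (\<Sum>k=1..<j. smask S j k * e2 S k)"

text \<open>The \<open>Z\<close>-component of stage \<open>j\<close> at time \<open>\<tau>\<close> is \<open>zeta S (d h) j (S \<tau>)\<close>.\<close>

fun zeta :: "rk_coeffs \<Rightarrow> real \<Rightarrow> nat \<Rightarrow> real \<Rightarrow> real" where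
  "zeta S \<eta> j = (if j \<le> 1 then gd else (\<lambda>x. heatd (rk_c S j * \<eta>) gdint x
     + \<eta> * (\<Sum>k=1..<j. rk_alpha S j k * heatd ((rk_c S j - rk_c S k) * \<eta>) (\<lambda>y. phi (zeta S \<eta> k y)) x)))"

declare zeta.simps [simp del]

lemma phi_bound: "\<bar>phi y\<bar> \<le> 1"
  using abs_cos_le_one[of y] by (simp add: phi_def abs_mult del: abs_cos_le_one)

lemma phi_meas [measurable]: "phi \<in> borel_measurable borel"
  unfolding phi_def[abs_def] by measurable

lemma zeta_meas [measurable]: "zeta S \<eta> j \<in> borel_measurable borel"
proof (induction j rule: less_induct)
  case (less j)
  show ?case
  proof (cases "j \<le> 1")
    case True
    then show ?thesis using gdD_measurable[of 1] by (simp add: zeta.simps[of S \<eta> j] gd_gdD)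
  next
    case False
    have "heatd a (\<lambda>y. phi (zeta S \<eta> k y)) \<in> borel_measurable borel" if "k \<in> {1..<j}" for k a
    proof -
      have [measurable]: "zeta S \<eta> k \<in> borel_measurable borel" using less that by simp
      have "lin_growth (\<lambda>y. phi (zeta S \<eta> k y))" by (rule bounded_lin_growth[of _ 1]) (use phi_bound in simp_all)
      then show ?thesis by (rule lin_growth_measurable[OF lin_growth_heatd])
    qed
    note [measurable] = this lin_growth_measurable[OF lin_growth_heatd[OF gdint_lin_growth]]
    show ?thesis using False by (subst zeta.simps) simp
  qed
qed

lemma ubig_VG: "ubig 0 (\<lambda>\<eta>. VG p)"
proof -
  obtain K where "\<And>x. \<bar>VG p x\<bar> \<le> K" using VG_bounded by blast
  then show ?thesis by (rule ubig_bounded)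
qed

lemma ubig_DG: "ubig 0 (\<lambda>\<eta>. DG p)"
proof -
  obtain K where "\<And>x. \<bar>DG p x\<bar> \<le> K" using DG_bounded by blast
  then show ?thesis by (rule ubig_bounded)
qed

text \<open>Two precisions are needed. Exponent 3 is enough inside a \<open>heatd\<close> average,
  where the outcome is required up to \<eta>^3 after a factor \<eta>; the Y-output needs the driver
  itself up to \<eta>^3.\<close>

lemma phi_expand:
  assumes z: "ubig (7/2) (\<lambda>\<eta> x. z \<eta> x - (gd x + \<eta>\<^sup>2 * (a * DG 2 x) + \<eta> ^ 3 * (b * DG 3 x + c * VG 1 x)))"
  shows "ubig (7/2) (\<lambda>\<eta> x. phi (z \<eta> x) - (\<eta>\<^sup>2 * a * VG 0 x - UG 1 x
      + \<eta> ^ 3 * (b * (1/2 * tanh x * DG 3 x) + c * (1/2 * tanh x * VG 1 x))))"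
    and "ubig 3 (\<lambda>\<eta> x. phi (z \<eta> x) - (\<eta>\<^sup>2 * a * VG 0 x - UG 1 x))"
proof -
  define R where "R \<eta> x = z \<eta> x - (gd x + \<eta>\<^sup>2 * (a * DG 2 x) + \<eta> ^ 3 * (b * DG 3 x + c * VG 1 x))" for \<eta> x
  define \<delta> where "\<delta> \<eta> x = z \<eta> x - gd x" for \<eta> x
  have R: "ubig (7/2) R" using z unfolding R_def[abs_def] .
  have 1: "ubig (0 + real 2) (\<lambda>\<eta> x. \<eta> ^ 2 * (a * DG 2 x))" by (intro ubig_pmult ubig_cmult ubig_DG)
  have 2: "ubig (0 + real 3) (\<lambda>\<eta> x. \<eta> ^ 3 * (b * DG 3 x + c * VG 1 x))"
    by (intro ubig_pmult ubig_add ubig_cmult ubig_DG ubig_VG)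
  have "ubig 2 (\<lambda>\<eta> x. R \<eta> x + (\<eta> ^ 2 * (a * DG 2 x) + \<eta> ^ 3 * (b * DG 3 x + c * VG 1 x)))"
    by (intro ubig_add ubig_mono[OF R] ubig_mono[OF 1] ubig_mono[OF 2]) auto
  then have \<delta>: "ubig 2 \<delta>" by (rule ubig_cong) (simp add: R_def \<delta>_def)
  \<comment> \<open>Quadratic in a deviation of order \<eta>^2.\<close>
  have q: "ubig (2 + 2) (\<lambda>\<eta> x. phi (gd x + \<delta> \<eta> x) - phi (gd x) - 1/2 * tanh x * \<delta> \<eta> x)"
  proof -
    obtain C where AC: "C \<ge> 0" "\<forall>\<eta> x. 0 < \<eta> \<longrightarrow> \<eta> \<le> 1 \<longrightarrow> \<bar>\<delta> \<eta> x * \<delta> \<eta> x\<bar> \<le> C * \<eta> powr (2 + 2)"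
      by (rule ubigE[OF ubig_mult[OF \<delta> \<delta>]]) (rule that)
    note C = AC(2)[rule_format]
    show ?thesis
    proof (rule ubigI[of _ C])
      fix \<eta> x :: real assume h: "0 < \<eta>" "\<eta> \<le> 1"
      show "\<bar>phi (gd x + \<delta> \<eta> x) - phi (gd x) - 1/2 * tanh x * \<delta> \<eta> x\<bar> \<le> C * \<eta> powr (2 + 2)"
        using phi_taylor[of x "\<delta> \<eta> x"] C[OF h, of x] by (simp add: power2_eq_square)
    qed
  qed
  have t: "\<bar>1/2 * tanh x\<bar> \<le> 1" for x :: real using sech_bounds(3)[of x] by (simp add: abs_mult)
  have "ubig (7/2) (\<lambda>\<eta> x. (phi (gd x + \<delta> \<eta> x) - phi (gd x) - 1/2 * tanh x * \<delta> \<eta> x) + 1/2 * tanh x * R \<eta> x)"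
    by (intro ubig_add ubig_mono[OF q] ubig_bmult[OF t] R) simp
  then show A: "ubig (7/2) (\<lambda>\<eta> x. phi (z \<eta> x) - (\<eta>\<^sup>2 * a * VG 0 x - UG 1 x
      + \<eta> ^ 3 * (b * (1/2 * tanh x * DG 3 x) + c * (1/2 * tanh x * VG 1 x))))"
    by (rule ubig_cong) (simp add: R_def \<delta>_def phi_gd tanh_DG2[symmetric] field_simps)
  have 3: "ubig (0 + real 3) (\<lambda>\<eta> x. \<eta> ^ 3 * (b * (1/2 * tanh x * DG 3 x) + c * (1/2 * tanh x * VG 1 x)))"
    by (intro ubig_pmult ubig_add ubig_cmult ubig_bmult[OF t] ubig_DG ubig_VG)
  have "ubig 3 (\<lambda>\<eta> x. (phi (z \<eta> x) - (\<eta>\<^sup>2 * a * VG 0 x - UG 1 x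
      + \<eta> ^ 3 * (b * (1/2 * tanh x * DG 3 x) + c * (1/2 * tanh x * VG 1 x))))
    + \<eta> ^ 3 * (b * (1/2 * tanh x * DG 3 x) + c * (1/2 * tanh x * VG 1 x)))"
    by (intro ubig_add ubig_mono[OF A] ubig_mono[OF 3]) auto
  then show "ubig 3 (\<lambda>\<eta> x. phi (z \<eta> x) - (\<eta>\<^sup>2 * a * VG 0 x - UG 1 x))"
    by (rule ubig_cong) simp
qed

lemma rk_c_mono:
  assumes S: "rk_class q S" and jk: "1 \<le> k" "k \<le> j" "j \<le> q + 1"
  shows "rk_c S k \<le> rk_c S j"
  using jk(2,3)
proof (induction j rule: dec_induct)
  case (step n)
  have "rk_c S n \<le> rk_c S (Suc n)"
    using S step jk(1) unfolding rk_class_def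
    by (cases "n = 1") (auto simp: numeral_2_eq_2 less_imp_le)
  then show ?case using step by simp
qed simp

text \<open>By strong induction on the stage. The row-sum condition cancels the term of order
  \<eta>, so the first error has order \<eta>^2. The error \<open>e2\<close> of an earlier stage
  enters a later one through the derivative of the driver, which produces the VG 1 term with
  coefficient \<open>er\<close>.\<close>

lemma zeta_expand:
  assumes S: "rk_class q S" and j: "1 \<le> j" "j \<le> q"
  shows "ubig (7/2) (\<lambda>\<eta> x. zeta S \<eta> j x - (gd x + \<eta>\<^sup>2 * (e2 S j * DG 2 x) + \<eta> ^ 3 * (e3 S j * DG 3 x + er S j * VG 1 x)))"
  using j
proof (induction j rule: less_induct)
  case (less j)
  show ?case
  proof (cases "j = 1")
    case True
    have "rk_c S 1 = 0" using S by (simp add: rk_class_def)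
    then show ?thesis using ubig_zero unfolding True by (simp add: zeta.simps e2_def e3_def er_def)
  next
    case False
    have c: "rk_c S j > 0"
    proof -
      have "rk_c S 2 \<le> rk_c S j" by (rule rk_c_mono[OF S]) (use False less.prems in auto)
      moreover have "rk_c S 2 > 0" using S by (auto simp: rk_class_def)
      ultimately show ?thesis by simp
    qed
    have row: "(\<Sum>k=1..<j. smask S j k) = rk_c S j"
      using S less.prems unfolding rk_class_def smask_def by auto
    have "ubig (7/2) (\<lambda>\<eta> x. heatd (rk_c S j * \<eta>) gdint x
        + \<eta> * (\<Sum>k\<in>{1..<j}. rk_alpha S j k * heatd ((rk_c S j - rk_c S k) * \<eta>) (\<lambda>y. phi (zeta S \<eta> k y)) x)
      - (gd x + \<eta> * ((rk_c S j - (\<Sum>k\<in>{1..<j}. smask S j k)) * DG 1 x)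
        + \<eta>\<^sup>2 * (((rk_c S j)\<^sup>2 / 2 - (\<Sum>k\<in>{1..<j}. smask S j k * (rk_c S j - rk_c S k))) * DG 2 x)
        + \<eta> ^ 3 * ((rk_c S j ^ 3 / 6 - 1/2 * (\<Sum>k\<in>{1..<j}. smask S j k * (rk_c S j - rk_c S k)\<^sup>2)) * DG 3 x
        + (\<Sum>k\<in>{1..<j}. smask S j k * e2 S k) * VG 1 x)))"
    proof (rule ubig_heatd_stage[OF c])
      fix k assume k: "k \<in> {1..<j}"
      show "0 \<le> rk_c S j - rk_c S k" using rk_c_mono[OF S, of k j] k less.prems by simp
      show "(\<lambda>y. phi (zeta S \<eta> k y)) \<in> borel_measurable borel" for \<eta> by measurable
      show "ubig 3 (\<lambda>\<eta> x. phi (zeta S \<eta> k x) - (\<eta>\<^sup>2 * e2 S k * VG 0 x - UG 1 x))"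
        by (rule phi_expand(2)[OF less.IH]) (use k less.prems in auto)
    qed (auto simp: smask_def)
    then show ?thesis
      unfolding row by (rule ubig_cong) (use False less.prems in \<open>simp add: zeta.simps[of S _ j] e2_def e3_def er_def\<close>)
  qed
qed

text \<open>\<open>tanh x / 2 * DG 3 x\<close> and \<open>tanh x / 2 * VG 1 x\<close>.\<close>

definition Wh :: hpoly where "Wh = ([:0, -1/16, 0, 61/16, 0, -45/4, 0, 15/2:], 0)"
definition Xh :: hpoly where "Xh = ([:0, 1/16, 0, -11/8, 0, 51/16, 0, -15/8:], 0)"

lemma tanh_DG3: "1/2 * tanh x * DG 3 x = hev Wh x"
proof -
  have "1/2 * tanh x * gdD 7 x = hev ([:0, -1/2, 0, 61/2, 0, -90, 0, 60:], 0) x"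
    unfolding gdD_values tanh_hev by simp
  also have "\<dots> = 8 * hev Wh x" unfolding hev_smult Wh_def by simp
  finally show ?thesis by (simp add: DG_def)
qed

lemma tanh_VG1: "1/2 * tanh x * VG 1 x = hev Xh x"
proof -
  have "1/2 * tanh x * hev ((hderiv ^^ 1) Vp) x = hev ([:0, 1/4, 0, -11/2, 0, 51/4, 0, -15/2:], 0) x"
    unfolding Vp_values tanh_hev by simp
  also have "\<dots> = 4 * hev Xh x" unfolding hev_smult Xh_def by simp
  finally show ?thesis by (simp add: VG_def)
qed

text \<open>An unweighted average loses no power, so the remainder keeps exponent 7/2. Terms already
  of order \<eta>^3 are taken at leading order, since averaging changes them by O(\<eta>^4)
  only.\<close>

lemma ubig_heat_driver:
  assumes k: "k \<ge> 0" and m: "\<And>\<eta>. \<psi> \<eta> \<in> borel_measurable borel"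
    and \<psi>: "ubig (7/2) (\<lambda>\<eta> x. \<psi> \<eta> x - (\<eta>\<^sup>2 * a * VG 0 x - UG 1 x + \<eta> ^ 3 * (b * hev Wh x + c * hev Xh x)))"
  shows "ubig (7/2) (\<lambda>\<eta> x. heat (k * \<eta>) (\<psi> \<eta>) x -
    (\<eta>\<^sup>2 * a * (VG 0 x + k * \<eta> * (VG 2 x / 2)) + \<eta> ^ 3 * (b * hev Wh x + c * hev Xh x)
      - (UG 1 x + (k * \<eta>) * UG 2 x + (k * \<eta>)\<^sup>2 / 2 * UG 3 x + (k * \<eta>) ^ 3 / 6 * UG 4 x)))"
proof -
  define R where "R \<eta> x = \<psi> \<eta> x - (\<eta>\<^sup>2 * a * VG 0 x - UG 1 x + \<eta> ^ 3 * (b * hev Wh x + c * hev Xh x))" for \<eta> x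
  have Rm: "R \<eta> \<in> borel_measurable borel" for \<eta> unfolding R_def[abs_def] using m by measurable
  have R: "ubig (7/2) R" using \<psi> unfolding R_def[abs_def] .
  have 1: "ubig (7/2) (\<lambda>\<eta>. heat (k * \<eta>) (R \<eta>))" by (rule ubig_heat[OF R Rm])
  have 2: "ubig (2 + real 2) (\<lambda>\<eta> x. \<eta>\<^sup>2 * (a * (heat (k * \<eta>) (VG 0) x - (VG 0 x + k * \<eta> * (VG 2 x / 2)))))"
    by (intro ubig_pmult ubig_cmult ubig_heat_VG0 k)
  note 3 = ubig_heat_UG1[OF k]
  have 4: "ubig (1 + real 3) (\<lambda>\<eta> x. \<eta> ^ 3 * (b * (heat (k * \<eta>) (hev Wh) x - hev Wh x) + c * (heat (k * \<eta>) (hev Xh) x - hev Xh x)))"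
    by (intro ubig_pmult ubig_add ubig_cmult ubig_heat_hev k)
  have "ubig (7/2) (\<lambda>\<eta> x. (heat (k * \<eta>) (R \<eta>) x + \<eta>\<^sup>2 * (a * (heat (k * \<eta>) (VG 0) x - (VG 0 x + k * \<eta> * (VG 2 x / 2))))
     + \<eta> ^ 3 * (b * (heat (k * \<eta>) (hev Wh) x - hev Wh x) + c * (heat (k * \<eta>) (hev Xh) x - hev Xh x)))
      - (heat (k * \<eta>) (UG 1) x - (UG 1 x + (k * \<eta>) * UG 2 x + (k * \<eta>)\<^sup>2 / 2 * UG 3 x + (k * \<eta>) ^ 3 / 6 * UG 4 x)))"
    by (intro ubig_diff ubig_add 1 ubig_mono[OF 2] ubig_mono[OF 3] ubig_mono[OF 4]) auto
  then show ?thesis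
  proof (rule ubig_cong)
    fix \<eta> x :: real assume h: "0 < \<eta>" "\<eta> \<le> 1"
    obtain C where AC: "C \<ge> 0" "\<forall>\<eta> x. 0 < \<eta> \<longrightarrow> \<eta> \<le> 1 \<longrightarrow> \<bar>R \<eta> x\<bar> \<le> C * \<eta> powr (7/2)"
      by (rule ubigE[OF R]) (rule that)
    note C = AC(2)[rule_format]
    have lgR: "lin_growth (R \<eta>)" by (rule bounded_lin_growth[OF Rm C[OF h]])
    have lgh: "lin_growth (hev P)" for P
    proof -
      obtain B where "\<And>x. \<bar>hev P x\<bar> \<le> B" using hev_bounded by blast
      then show ?thesis by (rule bounded_lin_growth[OF hev_measurable])
    qed
    have "\<psi> \<eta> = (\<lambda>x. R \<eta> x + ((\<eta>\<^sup>2 * a * VG 0 x + (-1) * UG 1 x) + ((\<eta> ^ 3 * b) * hev Wh x + (\<eta> ^ 3 * c) * hev Xh x)))"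
      by (auto simp: R_def algebra_simps)
    then have "heat (k * \<eta>) (\<psi> \<eta>) x = heat (k * \<eta>) (R \<eta>) x + ((\<eta>\<^sup>2 * a * heat (k * \<eta>) (VG 0) x + (-1) * heat (k * \<eta>) (UG 1) x)
        + ((\<eta> ^ 3 * b) * heat (k * \<eta>) (hev Wh) x + (\<eta> ^ 3 * c) * heat (k * \<eta>) (hev Xh) x))"
      by (simp only: heat_add heat_cmult lin_growth_add lin_growth_cmult lgR lin_growth_UG1 lin_growth_VG lgh)
    then show "heat (k * \<eta>) (\<psi> \<eta>) x -
    (\<eta>\<^sup>2 * a * (VG 0 x + k * \<eta> * (VG 2 x / 2)) + \<eta> ^ 3 * (b * hev Wh x + c * hev Xh x)
      - (UG 1 x + (k * \<eta>) * UG 2 x + (k * \<eta>)\<^sup>2 / 2 * UG 3 x + (k * \<eta>) ^ 3 / 6 * UG 4 x)) = (heat (k * \<eta>) (R \<eta>) x + \<eta>\<^sup>2 * (a * (heat (k * \<eta>) (VG 0) x - (VG 0 x + k * \<eta> * (VG 2 x / 2))))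
     + \<eta> ^ 3 * (b * (heat (k * \<eta>) (hev Wh) x - hev Wh x) + c * (heat (k * \<eta>) (hev Xh) x - hev Xh x)))
      - (heat (k * \<eta>) (UG 1) x - (UG 1 x + (k * \<eta>) * UG 2 x + (k * \<eta>)\<^sup>2 / 2 * UG 3 x + (k * \<eta>) ^ 3 / 6 * UG 4 x))"
      by (simp add: algebra_simps)
  qed
qed

section \<open>Expansion of the outputs\<close>

text \<open>The Y-output as a function of S at the start of the step, when the scheme is started
  from exact values. The sum ends at q because an explicit scheme has output weight zero at stage q
  + 1.\<close>

definition Yhat :: "nat \<Rightarrow> rk_coeffs \<Rightarrow> real \<Rightarrow> real \<Rightarrow> real" where
  "Yhat q S \<eta> x = heat \<eta> gdint x
    + \<eta> * (\<Sum>j=1..q. rk_b S j * heat ((1 - rk_c S j) * \<eta>) (\<lambda>y. phi (zeta S \<eta> j y)) x)"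

definition Zhat :: "nat \<Rightarrow> rk_coeffs \<Rightarrow> real \<Rightarrow> real \<Rightarrow> real" where
  "Zhat q S \<eta> x = heatd \<eta> gdint x
    + \<eta> * (\<Sum>j=1..q. rk_beta S j * heatd ((1 - rk_c S j) * \<eta>) (\<lambda>y. phi (zeta S \<eta> j y)) x)"

definition bmask :: "rk_coeffs \<Rightarrow> nat \<Rightarrow> real" where
  "bmask S j = rk_beta S j * (if rk_c S j < 1 then 1 else 0)"

lemma Zhat_expand:
  assumes S: "rk_class q S"
  shows "ubig (7/2) (\<lambda>\<eta> x. Zhat q S \<eta> x - (gd x + \<eta> * ((1 - (\<Sum>j=1..q. bmask S j)) * DG 1 x)
     + \<eta>\<^sup>2 * ((1/2 - (\<Sum>j=1..q. bmask S j * (1 - rk_c S j))) * DG 2 x)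
     + \<eta> ^ 3 * ((1/6 - 1/2 * (\<Sum>j=1..q. bmask S j * (1 - rk_c S j)\<^sup>2)) * DG 3 x + (\<Sum>j=1..q. bmask S j * e2 S j) * VG 1 x)))"
proof -
  have c1: "rk_c S (q + 1) = 1" using S by (simp add: rk_class_def)
  have "ubig (7/2) (\<lambda>\<eta> x. heatd (1 * \<eta>) gdint x
        + \<eta> * (\<Sum>j\<in>{1..q}. rk_beta S j * heatd ((1 - rk_c S j) * \<eta>) (\<lambda>y. phi (zeta S \<eta> j y)) x)
     - (gd x + \<eta> * ((1 - (\<Sum>j\<in>{1..q}. bmask S j)) * DG 1 x)
       + \<eta>\<^sup>2 * ((1\<^sup>2/2 - (\<Sum>j\<in>{1..q}. bmask S j * (1 - rk_c S j))) * DG 2 x)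
       + \<eta> ^ 3 * ((1^3/6 - 1/2 * (\<Sum>j\<in>{1..q}. bmask S j * (1 - rk_c S j)\<^sup>2)) * DG 3 x + (\<Sum>j\<in>{1..q}. bmask S j * e2 S j) * VG 1 x)))"
  proof (rule ubig_heatd_stage)
    fix k assume k: "k \<in> {1..q}"
    show "0 \<le> 1 - rk_c S k" using rk_c_mono[OF S, of k "q + 1"] k c1 by simp
    show "(\<lambda>y. phi (zeta S \<eta> k y)) \<in> borel_measurable borel" for \<eta> by measurable
    show "ubig 3 (\<lambda>\<eta> x. phi (zeta S \<eta> k x) - (\<eta>\<^sup>2 * e2 S k * VG 0 x - UG 1 x))"
      by (rule phi_expand(2)[OF zeta_expand[OF S]]) (use k in auto)
  qed (auto simp: bmask_def)
  then show ?thesis by (rule ubig_cong) (simp add: Zhat_def)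
qed

text \<open>The exact value is G, so the eight bracketed coefficients are the errors themselves.
  Their numbers 1, 1, 2, 4 at the successive orders match the conditions of a classical method of
  order 4, one for each rooted tree.\<close>

lemma Yhat_expand:
  assumes S: "rk_class q S"
  shows "ubig (9/2) (\<lambda>\<eta> x. Yhat q S \<eta> x - (gdint x + \<eta> * ((1 - (\<Sum>j=1..q. rk_b S j)) * UG 1 x)
     + \<eta>\<^sup>2 * ((1/2 - (\<Sum>j=1..q. rk_b S j * (1 - rk_c S j))) * UG 2 x)
     + \<eta> ^ 3 * ((1/6 - 1/2 * (\<Sum>j=1..q. rk_b S j * (1 - rk_c S j)\<^sup>2)) * UG 3 x + (\<Sum>j=1..q. rk_b S j * e2 S j) * VG 0 x)
     + \<eta> ^ 4 * ((1/24 - 1/6 * (\<Sum>j=1..q. rk_b S j * (1 - rk_c S j) ^ 3)) * UG 4 x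
        + (\<Sum>j=1..q. rk_b S j * (1 - rk_c S j) * e2 S j) * (VG 2 x / 2)
        + (\<Sum>j=1..q. rk_b S j * e3 S j) * hev Wh x + (\<Sum>j=1..q. rk_b S j * er S j) * hev Xh x)))"
proof -
  have c1: "rk_c S (q + 1) = 1" using S by (simp add: rk_class_def)
  let ?s = "\<lambda>j. 1 - rk_c S j"
  let ?E = "\<lambda>j \<eta> x. \<eta>\<^sup>2 * e2 S j * (VG 0 x + ?s j * \<eta> * (VG 2 x / 2)) + \<eta> ^ 3 * (e3 S j * hev Wh x + er S j * hev Xh x)
      - (UG 1 x + (?s j * \<eta>) * UG 2 x + (?s j * \<eta>)\<^sup>2 / 2 * UG 3 x + (?s j * \<eta>) ^ 3 / 6 * UG 4 x)"
  have 1: "ubig (7/2 + real 1) (\<lambda>\<eta> x. \<eta> ^ 1 * (\<Sum>j\<in>{1..q}. rk_b S j * (heat (?s j * \<eta>) (\<lambda>y. phi (zeta S \<eta> j y)) x - ?E j \<eta> x)))"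
  proof (intro ubig_pmult ubig_sum ubig_cmult ubig_heat_driver)
    fix k assume k: "k \<in> {1..q}"
    show "0 \<le> ?s k" using rk_c_mono[OF S, of k "q + 1"] k c1 by simp
    show "(\<lambda>y. phi (zeta S \<eta> k y)) \<in> borel_measurable borel" for \<eta> by measurable
    show "ubig (7/2) (\<lambda>\<eta> x. phi (zeta S \<eta> k x) - (\<eta>\<^sup>2 * e2 S k * VG 0 x - UG 1 x + \<eta> ^ 3 * (e3 S k * hev Wh x + er S k * hev Xh x)))"
      unfolding tanh_DG3[symmetric] tanh_VG1[symmetric]
      by (rule phi_expand(1)[OF zeta_expand[OF S]]) (use k in auto)
  qed
  have "ubig (9/2) (\<lambda>\<eta> x. (heat \<eta> gdint x - (gdint x + \<eta> * UG 1 x + \<eta>\<^sup>2 / 2 * UG 2 x + \<eta> ^ 3 / 6 * UG 3 x + \<eta> ^ 4 / 24 * UG 4 x))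
    + \<eta> ^ 1 * (\<Sum>j\<in>{1..q}. rk_b S j * (heat (?s j * \<eta>) (\<lambda>y. phi (zeta S \<eta> j y)) x - ?E j \<eta> x)))"
    by (intro ubig_add ubig_mono[OF ubig_heat_gdint] ubig_mono[OF 1]) auto
  then show ?thesis
  proof (rule ubig_cong)
    fix \<eta> x :: real
    have "(\<Sum>j\<in>{1..q}. rk_b S j * (heat (?s j * \<eta>) (\<lambda>y. phi (zeta S \<eta> j y)) x - ?E j \<eta> x))
      = (\<Sum>j\<in>{1..q}. rk_b S j * heat (?s j * \<eta>) (\<lambda>y. phi (zeta S \<eta> j y)) x - \<eta>\<^sup>2 * VG 0 x * (rk_b S j * e2 S j)
          - \<eta> ^ 3 * (VG 2 x / 2) * (rk_b S j * ?s j * e2 S j) - \<eta> ^ 3 * hev Wh x * (rk_b S j * e3 S j)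
          - \<eta> ^ 3 * hev Xh x * (rk_b S j * er S j) + UG 1 x * rk_b S j + \<eta> * UG 2 x * (rk_b S j * ?s j)
          + \<eta>\<^sup>2 / 2 * UG 3 x * (rk_b S j * (?s j)\<^sup>2) + \<eta> ^ 3 / 6 * UG 4 x * (rk_b S j * ?s j ^ 3))"
      unfolding power_mult_distrib
      by (intro sum.cong refl) (simp add: field_simps power2_eq_square power3_eq_cube)
    also have "\<dots> = (\<Sum>j\<in>{1..q}. rk_b S j * heat (?s j * \<eta>) (\<lambda>y. phi (zeta S \<eta> j y)) x) - \<eta>\<^sup>2 * VG 0 x * (\<Sum>j\<in>{1..q}. rk_b S j * e2 S j)
          - \<eta> ^ 3 * (VG 2 x / 2) * (\<Sum>j\<in>{1..q}. rk_b S j * ?s j * e2 S j) - \<eta> ^ 3 * hev Wh x * (\<Sum>j\<in>{1..q}. rk_b S j * e3 S j)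
          - \<eta> ^ 3 * hev Xh x * (\<Sum>j\<in>{1..q}. rk_b S j * er S j) + UG 1 x * (\<Sum>j\<in>{1..q}. rk_b S j) + \<eta> * UG 2 x * (\<Sum>j\<in>{1..q}. rk_b S j * ?s j)
          + \<eta>\<^sup>2 / 2 * UG 3 x * (\<Sum>j\<in>{1..q}. rk_b S j * (?s j)\<^sup>2) + \<eta> ^ 3 / 6 * UG 4 x * (\<Sum>j\<in>{1..q}. rk_b S j * ?s j ^ 3)"
      by (simp only: sum.distrib sum_subtractf sum_distrib_left)
    finally have s: "(\<Sum>j\<in>{1..q}. rk_b S j * (heat (?s j * \<eta>) (\<lambda>y. phi (zeta S \<eta> j y)) x - ?E j \<eta> x)) = \<dots>" .
    show "Yhat q S \<eta> x - (gdint x + \<eta> * ((1 - (\<Sum>j=1..q. rk_b S j)) * UG 1 x)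
     + \<eta>\<^sup>2 * ((1/2 - (\<Sum>j=1..q. rk_b S j * (1 - rk_c S j))) * UG 2 x)
     + \<eta> ^ 3 * ((1/6 - 1/2 * (\<Sum>j=1..q. rk_b S j * (1 - rk_c S j)\<^sup>2)) * UG 3 x + (\<Sum>j=1..q. rk_b S j * e2 S j) * VG 0 x)
     + \<eta> ^ 4 * ((1/24 - 1/6 * (\<Sum>j=1..q. rk_b S j * (1 - rk_c S j) ^ 3)) * UG 4 x
        + (\<Sum>j=1..q. rk_b S j * (1 - rk_c S j) * e2 S j) * (VG 2 x / 2)
        + (\<Sum>j=1..q. rk_b S j * e3 S j) * hev Wh x + (\<Sum>j=1..q. rk_b S j * er S j) * hev Xh x))
      = (heat \<eta> gdint x - (gdint x + \<eta> * UG 1 x + \<eta>\<^sup>2 / 2 * UG 2 x + \<eta> ^ 3 / 6 * UG 3 x + \<eta> ^ 4 / 24 * UG 4 x))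
    + \<eta> ^ 1 * (\<Sum>j\<in>{1..q}. rk_b S j * (heat (?s j * \<eta>) (\<lambda>y. phi (zeta S \<eta> j y)) x - ?E j \<eta> x))"
      unfolding s Yhat_def
      by (simp add: algebra_simps power2_eq_square power3_eq_cube power4_eq_xxxx add_divide_distrib diff_divide_distrib)
  qed
qed

section \<open>Order conditions\<close>

lemma cancel_diff:
  fixes x y z :: real
  assumes "x * z = y * z" "z \<noteq> 0" shows "x = y"
  using assms by simp

text \<open>The hypotheses on \<open>b\<close> are the order conditions of a classical explicit four-stage fourth order
  Runge--Kutta method, which force \<open>c4 = 1\<close>. The hypotheses on \<open>g\<close> are those of a third order
  quadrature that may use only the first three of these stages.\<close>

lemma rk4_order_conditions_False:
  fixes c2 c3 c4 :: real
  assumes c: "0 < c2" "c2 < c3"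
    and b1: "b2 * c2 + b3 * c3 + b4 * c4 = 1/2"
    and b2: "b2 * c2\<^sup>2 + b3 * c3\<^sup>2 + b4 * c4\<^sup>2 = 1/3"
    and b3: "b2 * c2 ^ 3 + b3 * c3 ^ 3 + b4 * c4 ^ 3 = 1/4"
    and b4: "b3 * (a32 * c2) + b4 * (a42 * c2 + a43 * c3) = 1/6"
    and b5: "b3 * c3 * (a32 * c2) + b4 * c4 * (a42 * c2 + a43 * c3) = 1/8"
    and b6: "b3 * (a32 * c2\<^sup>2) + b4 * (a42 * c2\<^sup>2 + a43 * c3\<^sup>2) = 1/12"
    and b7: "b4 * a43 * a32 * c2 = 1/24"
    and g: "c4 = 1 \<Longrightarrow> g2 * c2 + g3 * c3 = 1/2 \<and> g2 * c2\<^sup>2 + g3 * c3\<^sup>2 = 1/3 \<and> g3 * (a32 * c2) = 1/6"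
  shows False
proof -
  \<comment> \<open>Butcher's simplifying quantities: d_j = sum_i b_i a_ij - b_j (1 - c_j) measures
    the failure of the column condition, e_j = sum_k a_jk c_k - c_j^2 / 2 the failure of stage order
    two. The conditions make d orthogonal to the vectors (c_j), (c_j^2) and (e_j).\<close>
  define d2 d3 d4 where "d2 = b3 * a32 + b4 * a42 - b2 * (1 - c2)" and "d3 = b4 * a43 - b3 * (1 - c3)"
    and "d4 = - b4 * (1 - c4)"
  define e2 e3 e4 where "e2 = - c2\<^sup>2 / 2" and "e3 = a32 * c2 - c3\<^sup>2 / 2" and "e4 = a42 * c2 + a43 * c3 - c4\<^sup>2 / 2"
  note defs = d2_def d3_def d4_def e2_def e3_def e4_def
  have dc: "d2 * c2 + d3 * c3 + d4 * c4 = 0" and dc2: "d2 * c2\<^sup>2 + d3 * c3\<^sup>2 + d4 * c4\<^sup>2 = 0"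
    and de: "d2 * e2 + d3 * e3 + d4 * e4 = 0" and be: "b2 * e2 + b3 * e3 + b4 * e4 = 0"
    and bce: "b2 * c2 * e2 + b3 * c3 * e3 + b4 * c4 * e4 = 0"
    using b1 b2 b3 b4 b5 b6 b7 unfolding defs by (simp_all add: field_simps power2_eq_square power3_eq_cube)
  have b4n: "b4 \<noteq> 0" using b7 by auto
  \<comment> \<open>Since 0 < c2 < c3, the first two entries of e are matched by a combination of c
    and c^2. If d4 were not zero, orthogonality would force the third entry to match as
    well.\<close>
  obtain x y where xy: "e2 = x * c2 + y * c2\<^sup>2" "e3 = x * c3 + y * c3\<^sup>2"
  proof -
    define y where "y = (e3 * c2 - e2 * c3) / (c2 * c3 * (c3 - c2))"
    have n: "c2 * c3 * (c3 - c2) \<noteq> 0" using c by simp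
    have div_cancel: "z \<noteq> 0 \<Longrightarrow> w / z * z = w" for w z :: real by simp
    have y: "y * (c2 * c3 * (c3 - c2)) = e3 * c2 - e2 * c3" unfolding y_def by (rule div_cancel[OF n])
    define x where "x = e2 / c2 - y * c2"
    have x: "x * c2 = e2 - y * c2\<^sup>2" unfolding x_def using c by (simp add: field_simps power2_eq_square)
    have "e3 * c2 = (x * c3 + y * c3\<^sup>2) * c2"
      using x y by (simp add: power2_eq_square) algebra
    then have "e3 = x * c3 + y * c3\<^sup>2" by (rule cancel_diff) (use c in simp)
    with x show ?thesis by (intro that[of x y]) simp_all
  qed
  have "d4 * (e4 - (x * c4 + y * c4\<^sup>2)) = 0"
    using dc dc2 de unfolding xy by algebra
  moreover have "e4 \<noteq> x * c4 + y * c4\<^sup>2"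
  proof
    \<comment> \<open>If e = x c + y c^2 in all entries, pairing with b and with b c gives two
      independent equations for x and y. Both vanish, against e2 = - c2^2 / 2.\<close>
    assume e4: "e4 = x * c4 + y * c4\<^sup>2"
    have "b2 * e2 + b3 * e3 + b4 * e4 = x * (b2 * c2 + b3 * c3 + b4 * c4) + y * (b2 * c2\<^sup>2 + b3 * c3\<^sup>2 + b4 * c4\<^sup>2)"
      unfolding xy e4 by (simp add: algebra_simps)
    then have 1: "x * (1/2) + y * (1/3) = 0" unfolding be b1 b2 by simp
    have "b2 * c2 * e2 + b3 * c3 * e3 + b4 * c4 * e4 = x * (b2 * c2\<^sup>2 + b3 * c3\<^sup>2 + b4 * c4\<^sup>2) + y * (b2 * c2 ^ 3 + b3 * c3 ^ 3 + b4 * c4 ^ 3)"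
      unfolding xy e4 by (simp add: algebra_simps power2_eq_square power3_eq_cube)
    then have 2: "x * (1/3) + y * (1/4) = 0" unfolding bce b2 b3 by simp
    from 1 2 have "x = 0" "y = 0" by simp_all
    then have "e2 = 0" using xy by simp
    then show False using c by (simp add: e2_def)
  qed
  ultimately have "d4 = 0" by simp
  then have c4: "c4 = 1" using b4n by (simp add: d4_def)
  \<comment> \<open>With d4 = 0, elimination of d2 from the two orthogonality relations.\<close>
  have "d3 * (c3 * (c3 - c2)) = 0" using dc dc2 \<open>d4 = 0\<close> by (simp add: power2_eq_square) algebra
  then have "d3 = 0" using c by simp
  then have "b4 * a43 = b3 * (1 - c3)" by (simp add: d3_def)
  then have k: "b3 * (1 - c3) * (a32 * c2) = 1/24" using b7 by (simp add: mult.assoc)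
  \<comment> \<open>The quadrature with weights b applied to (1 - t) t (t - c2): the nodes c2 and c4
    = 1 drop out, and the exact integral is (1 - 2 c2) / 12.\<close>
  have m: "b3 * (1 - c3) * (c3 * (c3 - c2)) = (1 - 2 * c2) / 12"
    using b1 b2 b3 unfolding c4 by (simp add: field_simps power2_eq_square power3_eq_cube) algebra
  let ?p = "b3 * (1 - c3)"
  have 1: "2 * (a32 * c2) * (1 - 2 * c2) = c3 * (c3 - c2)"
  proof -
    have "?p * (2 * (a32 * c2) * (1 - 2 * c2)) = ?p * (c3 * (c3 - c2))" using k m by algebra
    moreover have "?p \<noteq> 0" using k by auto
    ultimately show ?thesis by simp
  qed
  from g[OF c4] have g1: "g2 * c2 + g3 * c3 = 1/2" "g2 * c2\<^sup>2 + g3 * c3\<^sup>2 = 1/3" "g3 * (a32 * c2) = 1/6" by auto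
  have 2: "(a32 * c2) * (2 - 3 * c2) = c3 * (c3 - c2)"
  proof -
    \<comment> \<open>The Z-quadrature applied to t (t - c2), with integral (2 - 3 c2) / 6; only the
      node c3 remains.\<close>
    have n: "g3 * (c3 * (c3 - c2)) = (2 - 3 * c2) / 6" using g1(1,2) by (simp add: field_simps power2_eq_square) algebra
    have "g3 * ((a32 * c2) * (2 - 3 * c2)) = g3 * (c3 * (c3 - c2))" using n g1(3) by algebra
    moreover have "g3 \<noteq> 0" using g1(3) by auto
    ultimately show ?thesis by simp
  qed
  \<comment> \<open>Both relations evaluate c3 (c3 - c2). Comparing 2 (1 - 2 c2) with 2 - 3 c2 would
    force c2 = 0.\<close>
  have "(a32 * c2) * c2 = 0" using 1 2 by algebra
  then show False using k c by auto
qed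

text \<open>A change of variables: moments in 1 - c_j become moments in c_j, and \<open>e2\<close>,
  \<open>e3\<close>, \<open>er\<close> are rewritten by the row sums, so that the conditions take
  the classical form for the masked coefficients.\<close>

lemma rk_order_conditions_False:
  assumes S: "rk_class 4 S"
    and y1: "(\<Sum>j=1..4. rk_b S j) = 1"
    and y2: "(\<Sum>j=1..4. rk_b S j * (1 - rk_c S j)) = 1/2"
    and y3: "(\<Sum>j=1..4. rk_b S j * (1 - rk_c S j)\<^sup>2) = 1/3"
    and y4: "(\<Sum>j=1..4. rk_b S j * e2 S j) = 0"
    and y5: "(\<Sum>j=1..4. rk_b S j * (1 - rk_c S j) ^ 3) = 1/4"
    and y6: "(\<Sum>j=1..4. rk_b S j * (1 - rk_c S j) * e2 S j) = 0"
    and y7: "(\<Sum>j=1..4. rk_b S j * e3 S j) = 0"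
    and y8: "(\<Sum>j=1..4. rk_b S j * er S j) = 0"
    and z1: "(\<Sum>j=1..4. bmask S j) = 1"
    and z2: "(\<Sum>j=1..4. bmask S j * (1 - rk_c S j)) = 1/2"
    and z3: "(\<Sum>j=1..4. bmask S j * (1 - rk_c S j)\<^sup>2) = 1/3"
    and z4: "(\<Sum>j=1..4. bmask S j * e2 S j) = 0"
  shows False
proof -
  define c2 c3 c4 where "c2 = rk_c S 2" and "c3 = rk_c S 3" and "c4 = rk_c S 4"
  define b1 b2 b3 b4 where "b1 = rk_b S 1" and "b2 = rk_b S 2" and "b3 = rk_b S 3" and "b4 = rk_b S 4"
  define g1 g2 g3 g4 where "g1 = bmask S 1" and "g2 = bmask S 2" and "g3 = bmask S 3" and "g4 = bmask S 4"
  define a21 a31 a32 a41 a42 a43 where "a21 = smask S 2 1" and "a31 = smask S 3 1" and "a32 = smask S 3 2"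
    and "a41 = smask S 4 1" and "a42 = smask S 4 2" and "a43 = smask S 4 3"
  have i4: "{1..4} = {1, 2, 3, 4 :: nat}" by auto
  have i: "{1..<1} = ({} :: nat set)" "{1..<2} = {1 :: nat}" "{1..<3} = {1, 2 :: nat}" "{1..<4} = {1, 2, 3 :: nat}" by auto
  note names = c2_def[symmetric] c3_def[symmetric] c4_def[symmetric] b1_def[symmetric] b2_def[symmetric] b3_def[symmetric] b4_def[symmetric]
    g1_def[symmetric] g2_def[symmetric] g3_def[symmetric] g4_def[symmetric] a21_def[symmetric] a31_def[symmetric] a32_def[symmetric]
    a41_def[symmetric] a42_def[symmetric] a43_def[symmetric]
  have c1: "rk_c S 1 = 0" and c2: "0 < c2" using S by (auto simp: rk_class_def c2_def)
  have rows: "a21 = c2" "a31 + a32 = c3" "a41 + a42 + a43 = c4"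
  proof -
    have r: "(\<Sum>k=1..<j. smask S j k) = rk_c S j" if "j \<in> {1..4}" for j
      using S that unfolding rk_class_def smask_def by auto
    show "a21 = c2" "a31 + a32 = c3" "a41 + a42 + a43 = c4"
      using r[of 2] r[of 3] r[of 4] unfolding i by (simp_all add: names[simplified] add.assoc[symmetric])
  qed
  have e2: "e2 S 1 = 0" "e2 S 2 = - c2\<^sup>2 / 2" "e2 S 3 = a32 * c2 - c3\<^sup>2 / 2" "e2 S 4 = a42 * c2 + a43 * c3 - c4\<^sup>2 / 2"
  proof -
    show "e2 S 1 = 0" unfolding e2_def i c1 by simp
    show "e2 S 2 = - c2\<^sup>2 / 2" unfolding e2_def i using rows(1) by (simp add: names[simplified] c1[simplified] power2_eq_square)
    have a31: "a31 = c3 - a32" and a41: "a41 = c4 - a42 - a43" using rows by simp_all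
    show "e2 S 3 = a32 * c2 - c3\<^sup>2 / 2" unfolding e2_def i by (simp add: names[simplified] c1[simplified] a31 power2_eq_square field_simps)
    show "e2 S 4 = a42 * c2 + a43 * c3 - c4\<^sup>2 / 2" unfolding e2_def i by (simp add: names[simplified] c1[simplified] a41 power2_eq_square field_simps)
  qed
  have e3: "e3 S 1 = 0" "e3 S 2 = - (c2 ^ 3) / 3" "e3 S 3 = c3 * (a32 * c2) - a32 * c2\<^sup>2 / 2 - c3 ^ 3 / 3"
    "e3 S 4 = c4 * (a42 * c2 + a43 * c3) - (a42 * c2\<^sup>2 + a43 * c3\<^sup>2) / 2 - c4 ^ 3 / 3"
  proof -
    show "e3 S 1 = 0" unfolding e3_def i c1 by simp
    show "e3 S 2 = - (c2 ^ 3) / 3" unfolding e3_def i using rows(1) by (simp add: names[simplified] c1[simplified] power2_eq_square power3_eq_cube)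
    have a31: "a31 = c3 - a32" and a41: "a41 = c4 - a42 - a43" using rows by simp_all
    show "e3 S 3 = c3 * (a32 * c2) - a32 * c2\<^sup>2 / 2 - c3 ^ 3 / 3"
      unfolding e3_def i by (simp add: names[simplified] c1[simplified] a31 power2_eq_square power3_eq_cube field_simps)
    show "e3 S 4 = c4 * (a42 * c2 + a43 * c3) - (a42 * c2\<^sup>2 + a43 * c3\<^sup>2) / 2 - c4 ^ 3 / 3"
      unfolding e3_def i by (simp add: names[simplified] c1[simplified] a41 power2_eq_square power3_eq_cube field_simps)
  qed
  have er: "er S 1 = 0" "er S 2 = 0" "er S 3 = - a32 * c2\<^sup>2 / 2"
    "er S 4 = - a42 * c2\<^sup>2 / 2 + a43 * (a32 * c2 - c3\<^sup>2 / 2)"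
    unfolding er_def i by (simp_all add: e2[simplified] names[simplified])
  have Y1: "b1 + (b2 + (b3 + b4)) = 1" using y1 unfolding i4 by (simp add: names[simplified])
  have Y2: "b1 + (b2 * (1 - c2) + (b3 * (1 - c3) + b4 * (1 - c4))) = 1/2" using y2 unfolding i4 by (simp add: names[simplified] c1[simplified])
  have Y3: "b1 + (b2 * (1 - c2)\<^sup>2 + (b3 * (1 - c3)\<^sup>2 + b4 * (1 - c4)\<^sup>2)) = 1/3" using y3 unfolding i4 by (simp add: names[simplified] c1[simplified])
  have Y5: "b1 + (b2 * (1 - c2) ^ 3 + (b3 * (1 - c3) ^ 3 + b4 * (1 - c4) ^ 3)) = 1/4" using y5 unfolding i4 by (simp add: names[simplified] c1[simplified])
  have Y4: "b2 * e2 S 2 + (b3 * e2 S 3 + b4 * e2 S 4) = 0" using y4 unfolding i4 by (simp add: names[simplified] e2(1)[simplified])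
  have Y6: "b2 * (1 - c2) * e2 S 2 + (b3 * (1 - c3) * e2 S 3 + b4 * (1 - c4) * e2 S 4) = 0"
    using y6 unfolding i4 by (simp add: names[simplified] e2(1)[simplified])
  have Y7: "b2 * e3 S 2 + (b3 * e3 S 3 + b4 * e3 S 4) = 0" using y7 unfolding i4 by (simp add: names[simplified] e3(1)[simplified])
  have Y8: "b3 * er S 3 + b4 * er S 4 = 0" using y8 unfolding i4 by (simp add: names[simplified] er(1)[simplified] er(2))
  have B1: "b2 * c2 + b3 * c3 + b4 * c4 = 1/2" using Y1 Y2 by (simp add: algebra_simps)
  have B2: "b2 * c2\<^sup>2 + b3 * c3\<^sup>2 + b4 * c4\<^sup>2 = 1/3" using Y1 Y3 B1 by (simp add: algebra_simps power2_eq_square)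
  have B3: "b2 * c2 ^ 3 + b3 * c3 ^ 3 + b4 * c4 ^ 3 = 1/4"
    using Y1 Y5 B1 B2 by (simp add: algebra_simps power2_eq_square power3_eq_cube)
  have B4: "b3 * (a32 * c2) + b4 * (a42 * c2 + a43 * c3) = 1/6"
    using Y4 B2 unfolding e2 by (simp add: field_simps)
  have B5: "b3 * c3 * (a32 * c2) + b4 * c4 * (a42 * c2 + a43 * c3) = 1/8"
    using Y6 B2 B3 B4 unfolding e2 by (simp add: field_simps power2_eq_square power3_eq_cube)
  have B6: "b3 * (a32 * c2\<^sup>2) + b4 * (a42 * c2\<^sup>2 + a43 * c3\<^sup>2) = 1/12"
    using Y7 B3 B5 unfolding e3 by (simp add: field_simps power2_eq_square power3_eq_cube)
  have B7: "b4 * a43 * a32 * c2 = 1/24"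
    using Y8 B6 unfolding er by (simp add: field_simps power2_eq_square)
  \<comment> \<open>The masked coefficient a32 is nonzero only if the stages 2 and 3 lie at
    different times.\<close>
  have c23: "c2 < c3"
  proof -
    have "a32 \<noteq> 0" using B7 by auto
    then show ?thesis by (auto simp: a32_def smask_def c2_def c3_def split: if_splits)
  qed
  have G: "g2 * c2 + g3 * c3 = 1/2 \<and> g2 * c2\<^sup>2 + g3 * c3\<^sup>2 = 1/3 \<and> g3 * (a32 * c2) = 1/6" if "c4 = 1"
  proof -
    \<comment> \<open>At c4 = 1 the fourth stage sits at the output time, where its H-coefficient
      has step 0.\<close>
    have g4: "g4 = 0" using that by (simp add: g4_def bmask_def c4_def)
    have Z1: "g1 + (g2 + g3) = 1" using z1 unfolding i4 by (simp add: names[simplified] g4)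
    have Z2: "g1 + (g2 * (1 - c2) + g3 * (1 - c3)) = 1/2" using z2 unfolding i4 by (simp add: names[simplified] c1[simplified] g4)
    have Z3: "g1 + (g2 * (1 - c2)\<^sup>2 + g3 * (1 - c3)\<^sup>2) = 1/3" using z3 unfolding i4 by (simp add: names[simplified] c1[simplified] g4)
    have Z4: "g2 * e2 S 2 + g3 * e2 S 3 = 0" using z4 unfolding i4 by (simp add: names[simplified] e2(1)[simplified] g4)
    have G1: "g2 * c2 + g3 * c3 = 1/2" using Z1 Z2 by (simp add: algebra_simps)
    have G2: "g2 * c2\<^sup>2 + g3 * c3\<^sup>2 = 1/3" using Z1 Z3 G1 by (simp add: algebra_simps power2_eq_square)
    have "g3 * (a32 * c2) = 1/6" using Z4 G2 unfolding e2 by (simp add: field_simps)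
    with G1 G2 show ?thesis by blast
  qed
  show False by (rule rk4_order_conditions_False[OF c2 c23 B1 B2 B3 B4 B5 B6 B7 G])
qed

section \<open>The scheme for the test problem\<close>

context brownian_setup
begin

text \<open>A conditional expectation given by an explicit function and tested on events. In
  contrast to \<open>real_cond_exp\<close>, sums and multiples of such pairs combine pointwise,
  without exceptional null sets.\<close>

definition cond_version :: "real \<Rightarrow> ('w \<Rightarrow> real) \<Rightarrow> ('w \<Rightarrow> real) \<Rightarrow> bool" where
  "cond_version t G g \<longleftrightarrow> integrable M G \<and> integrable M g \<and> g \<in> borel_measurable (F t) \<and>
    (\<forall>A\<in>sets (F t). expectation (\<lambda>\<omega>. indicator A \<omega> * G \<omega>) = expectation (\<lambda>\<omega>. indicator A \<omega> * g \<omega>))"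

lemma cond_version_AE:
  assumes "cond_version t G g" shows "AE \<omega> in M. g \<omega> = real_cond_exp M (F t) G \<omega>"
proof -
  interpret fs: finite_measure_subalgebra M "F t" by unfold_locales (rule sub)
  have "AE \<omega> in M. real_cond_exp M (F t) G \<omega> = g \<omega>"
    by (rule fs.real_cond_exp_charact) (use assms in \<open>simp_all add: cond_version_def set_lebesgue_integral_def\<close>)
  then show ?thesis by eventually_elim simp
qed

lemma integrable_indicator_times:
  assumes A: "A \<in> sets (F t)" and G: "integrable M G"
  shows "integrable M (\<lambda>\<omega>. indicator A \<omega> * G \<omega> :: real)"
  using integrable_mult_indicator[OF _ G, of A] sub[of t] A by (auto simp: subalgebra_def)

lemma cond_version_zero: "cond_version t (\<lambda>_. 0) (\<lambda>_. 0)"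
  by (simp add: cond_version_def)

lemma cond_version_add:
  assumes "cond_version t G g" "cond_version t G' g'"
  shows "cond_version t (\<lambda>\<omega>. G \<omega> + G' \<omega>) (\<lambda>\<omega>. g \<omega> + g' \<omega>)"
  using assms integrable_indicator_times unfolding cond_version_def
  by (auto simp: distrib_left)

lemma cond_version_cmult: "cond_version t G g \<Longrightarrow> cond_version t (\<lambda>\<omega>. c * G \<omega>) (\<lambda>\<omega>. c * g \<omega>)"
  unfolding cond_version_def by (auto simp: mult.left_commute[of _ c])

lemma cond_version_sum:
  "(\<And>i. i \<in> I \<Longrightarrow> cond_version t (G i) (g i)) \<Longrightarrow> cond_version t (\<lambda>\<omega>. \<Sum>i\<in>I. G i \<omega>) (\<lambda>\<omega>. \<Sum>i\<in>I. g i \<omega>)"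
  by (induction I rule: infinite_finite_induct) (auto intro: cond_version_zero cond_version_add)

lemma indicator_F:
  assumes "A \<in> sets (F t)"
  shows "(indicator A :: 'w \<Rightarrow> real) \<in> borel_measurable (F t)" "\<bar>indicator A \<omega> :: real\<bar> \<le> 1"
  using assms by (simp, simp add: indicator_def)

lemma cond_version_heat:
  assumes t: "0 \<le> t" "0 \<le> h" "t + h \<le> T" and v: "lin_growth v"
  shows "cond_version t (\<lambda>\<omega>. v (S (t + h) \<omega>)) (\<lambda>\<omega>. heat (d * h) v (S t \<omega>))"
  unfolding cond_version_def
proof (intro conjI ballI)
  have tT: "t \<in> {0..T}" "t + h \<in> {0..T}" using t by auto
  show i: "integrable M (\<lambda>\<omega>. v (S (t + h) \<omega>))"
    by (intro square_integrable_integrable growth_S_square_integrable v tT)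
  show "integrable M (\<lambda>\<omega>. heat (d * h) v (S t \<omega>))"
    by (intro square_integrable_integrable growth_S_square_integrable lin_growth_heat v tT)
  show "(\<lambda>\<omega>. heat (d * h) v (S t \<omega>)) \<in> borel_measurable (F t)"
    using lin_growth_measurable[OF lin_growth_heat[OF v]] S_F[OF tT(1) order_refl] by measurable
  fix A assume A: "A \<in> sets (F t)"
  show "expectation (\<lambda>\<omega>. indicator A \<omega> * v (S (t + h) \<omega>)) = expectation (\<lambda>\<omega>. indicator A \<omega> * heat (d * h) v (S t \<omega>))"
    using cond_heat[OF t(1) _ t(3) indicator_F(1)[OF A] v integrable_indicator_times[OF A i]] t by simp
qed

lemma cond_version_heatd:
  assumes t: "0 \<le> t" "0 \<le> h" "t + h \<le> T" and \<psi>: "\<psi> l \<in> moment_class m" and v: "lin_growth v"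
  shows "cond_version t (\<lambda>\<omega>. H_coeff M F W \<psi> t h \<omega> $ l * v (S (t + h) \<omega>)) (\<lambda>\<omega>. heatd (d * h) v (S t \<omega>))"
  unfolding cond_version_def
proof (intro conjI ballI)
  have tT: "t \<in> {0..T}" "t + h \<in> {0..T}" using t by auto
  have "square_integrable M (\<lambda>\<omega>. H_coeff M F W \<psi> t h \<omega> $ l)"
    by (rule H_coeff_moment(1)[where \<zeta>="\<lambda>_. 1" and C=1 and \<psi>=\<psi> and l=l, OF t \<psi> _ _ v]) auto
  then show "integrable M (\<lambda>\<omega>. H_coeff M F W \<psi> t h \<omega> $ l * v (S (t + h) \<omega>))"
    by (intro square_integrable_times growth_S_square_integrable v tT)
  show "integrable M (\<lambda>\<omega>. heatd (d * h) v (S t \<omega>))"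
    by (intro square_integrable_integrable growth_S_square_integrable lin_growth_heatd v tT)
  show "(\<lambda>\<omega>. heatd (d * h) v (S t \<omega>)) \<in> borel_measurable (F t)"
    using lin_growth_measurable[OF lin_growth_heatd[OF v]] S_F[OF tT(1) order_refl] by measurable
  fix A assume A: "A \<in> sets (F t)"
  show "expectation (\<lambda>\<omega>. indicator A \<omega> * (H_coeff M F W \<psi> t h \<omega> $ l * v (S (t + h) \<omega>)))
    = expectation (\<lambda>\<omega>. indicator A \<omega> * heatd (d * h) v (S t \<omega>))"
    by (rule H_coeff_moment(2)[where C=1 and \<psi>=\<psi> and l=l, OF t \<psi> indicator_F[OF A] v])
qed

section \<open>Explicit stages of one transition\<close>

definition stage_time :: "rk_coeffs \<Rightarrow> real \<Rightarrow> real \<Rightarrow> nat \<Rightarrow> real" where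
  "stage_time R t0 t1 j = t1 - rk_c R j * (t1 - t0)"

definition Zst :: "nat \<Rightarrow> rk_coeffs \<Rightarrow> real \<Rightarrow> real \<Rightarrow> nat \<Rightarrow> 'w \<Rightarrow> real^'d" where
  "Zst q R t0 t1 j \<omega> = (\<chi> l. if j \<le> q then zeta R (d * (t1 - t0)) j (S (stage_time R t0 t1 j) \<omega>)
     else Zhat q R (d * (t1 - t0)) (S t0 \<omega>))"

definition driver_stage :: "rk_coeffs \<Rightarrow> real \<Rightarrow> real \<Rightarrow> nat \<Rightarrow> 'w \<Rightarrow> real" where
  "driver_stage R t0 t1 k \<omega> = d * phi (zeta R (d * (t1 - t0)) k (S (stage_time R t0 t1 k) \<omega>))"

text \<open>The driver ignores y, so intermediate Y-stages feed nothing back and can be left as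
  conditional expectations; only the output is needed in closed form.\<close>

definition Yst :: "nat \<Rightarrow> rk_coeffs \<Rightarrow> real \<Rightarrow> real \<Rightarrow> nat \<Rightarrow> 'w \<Rightarrow> real" where
  "Yst q R t0 t1 j = (if j = 1 then Y t1 else if j \<le> q then real_cond_exp M (F (stage_time R t0 t1 j))
       (\<lambda>\<omega>. Y t1 \<omega> + (t1 - t0) * (\<Sum>k=1..j. rk_a R j k * driver_stage R t0 t1 k \<omega>))
     else (\<lambda>\<omega>. Yhat q R (d * (t1 - t0)) (S t0 \<omega>)))"

lemma f0_phi: "f0 (y, (\<chi> l. z) :: real^'d) = d * phi z"
  by (simp add: f0_def phi_def d_def)

lemma zeta_lin_growth: "lin_growth (\<lambda>y. phi (zeta R \<eta> k y))"
  by (rule bounded_lin_growth[of _ 1]) (use phi_bound in simp_all)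

lemma Yhat_measurable: "Yhat q R \<eta> \<in> borel_measurable borel"
  unfolding Yhat_def[abs_def]
  by (intro borel_measurable_add borel_measurable_times borel_measurable_const borel_measurable_sum
      lin_growth_measurable lin_growth_heat zeta_lin_growth gdint_lin_growth)

lemma Zhat_measurable: "Zhat q R \<eta> \<in> borel_measurable borel"
  unfolding Zhat_def[abs_def]
  by (intro borel_measurable_add borel_measurable_times borel_measurable_const borel_measurable_sum
      lin_growth_measurable lin_growth_heatd zeta_lin_growth gdint_lin_growth)

lemma vec_const_measurable:
  "g \<in> borel_measurable N \<Longrightarrow> (\<lambda>\<omega>. (\<chi> l. g \<omega>) :: real^'d) \<in> borel_measurable N"
proof -
  assume [measurable]: "g \<in> borel_measurable N"
  have "(\<lambda>\<omega>. (\<chi> l. g \<omega>) :: real^'d) = (\<lambda>\<omega>. g \<omega> *\<^sub>R ((\<chi> l. 1) :: real^'d))" by (auto simp: vec_eq_iff)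
  then show ?thesis by simp
qed

text \<open>The order bound quantifies over all stage families that satisfy the relation; it can be
  exploited once a family with known output is shown to satisfy it.\<close>

lemma rk_step_exact:
  assumes R: "rk_class q R" "rk_explicit q R" and q: "q \<ge> 1" and t: "0 \<le> t0" "t0 < t1" "t1 \<le> T"
    and mom: "\<And>j l. j \<in> {2..q+1} \<Longrightarrow> \<psi> j l \<in> moment_class m \<and> \<phi> j l \<in> moment_class m'"
  shows "rk_step M F W q R \<psi> \<phi> f0 t0 t1 (Y t1) (Z t1) (Yst q R t0 t1) (Zst q R t0 t1)"
proof -
  define h where "h = t1 - t0"
  let ?\<tau> = "\<lambda>j. t1 - rk_c R j * h"
  have st: "stage_time R t0 t1 j = ?\<tau> j" for j by (simp add: stage_time_def h_def)
  have hp: "h > 0" using t by (simp add: h_def)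
  have c1: "rk_c R 1 = 0" and cq: "rk_c R (q + 1) = 1" using R by (auto simp: rk_class_def)
  have c0: "0 \<le> rk_c R j" "rk_c R j \<le> 1" if "j \<in> {1..q+1}" for j
    using rk_c_mono[OF R(1), of 1 j] rk_c_mono[OF R(1), of j "q + 1"] that c1 cq by auto
  have \<tau>: "?\<tau> j \<in> {0..T}" "t0 \<le> ?\<tau> j" "?\<tau> j \<le> t1" if "j \<in> {1..q+1}" for j
  proof -
    have "rk_c R j * h \<le> 1 * h" using c0[OF that] hp by (intro mult_right_mono) auto
    moreover have "0 \<le> rk_c R j * h" using c0[OF that] hp by simp
    moreover have "t1 = t0 + h" by (simp add: h_def)
    ultimately show "?\<tau> j \<in> {0..T}" "t0 \<le> ?\<tau> j" "?\<tau> j \<le> t1" using t unfolding atLeastAtMost_iff by linarith+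
  qed
  have \<tau>q: "?\<tau> (q + 1) = t0" using cq by (simp add: h_def)
  have \<tau>1: "?\<tau> 1 = t1" using c1 by simp
  have fv: "f0 (Ys, Zst q R t0 t1 k \<omega>) = driver_stage R t0 t1 k \<omega>" if "k \<le> q" for k Ys \<omega>
    using that by (simp add: Zst_def f0_phi driver_stage_def)
  have meas: "zeta R \<eta> k \<in> borel_measurable borel" for \<eta> k by measurable
  have Y1: "Y t1 = (\<lambda>\<omega>. gdint (S t1 \<omega>))" by (auto simp: Y_def)
  \<comment> \<open>Weights and index set are left general, so that the same statement covers the
    intermediate stages and the output.\<close>
  have Z: "cond_version (?\<tau> j) (\<lambda>\<omega>. H_coeff M F W (\<psi> j) (?\<tau> j) (rk_c R j * h) \<omega> $ l * Y t1 \<omega>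
       + h * (\<Sum>k\<in>I. w k * H_coeff M F W (\<phi> j) (?\<tau> j) ((rk_c R j - rk_c R k) * h) \<omega> $ l * driver_stage R t0 t1 k \<omega>))
     (\<lambda>\<omega>. heatd (rk_c R j * (d * h)) gdint (S (?\<tau> j) \<omega>)
       + (d * h) * (\<Sum>k\<in>I. w k * heatd ((rk_c R j - rk_c R k) * (d * h)) (\<lambda>y. phi (zeta R (d * h) k y)) (S (?\<tau> j) \<omega>)))"
    if j: "j \<in> {2..q+1}" and I: "I \<subseteq> {1..<j}" for j I w l
  proof -
    have jj: "j \<in> {1..q+1}" using j by auto
    have 1: "cond_version (?\<tau> j) (\<lambda>\<omega>. H_coeff M F W (\<psi> j) (?\<tau> j) (rk_c R j * h) \<omega> $ l * gdint (S (?\<tau> j + rk_c R j * h) \<omega>))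
        (\<lambda>\<omega>. heatd (d * (rk_c R j * h)) gdint (S (?\<tau> j) \<omega>))"
      by (rule cond_version_heatd) (use \<tau>[OF jj] c0[OF jj] hp t mom[OF j] gdint_lin_growth in auto)
    have 2: "cond_version (?\<tau> j) (\<lambda>\<omega>. H_coeff M F W (\<phi> j) (?\<tau> j) ((rk_c R j - rk_c R k) * h) \<omega> $ l
          * phi (zeta R (d * h) k (S (?\<tau> j + (rk_c R j - rk_c R k) * h) \<omega>)))
        (\<lambda>\<omega>. heatd (d * ((rk_c R j - rk_c R k) * h)) (\<lambda>y. phi (zeta R (d * h) k y)) (S (?\<tau> j) \<omega>))" if k: "k \<in> I" for k
    proof (rule cond_version_heatd)
      have kk: "k \<in> {1..q+1}" "1 \<le> k" "k \<le> j" "j \<le> q + 1" using k I j by auto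
      show "0 \<le> ?\<tau> j" using \<tau>[OF jj] by simp
      show "0 \<le> (rk_c R j - rk_c R k) * h" using rk_c_mono[OF R(1) kk(2-4)] hp by simp
      have "?\<tau> j + (rk_c R j - rk_c R k) * h = ?\<tau> k" by (simp add: algebra_simps)
      then show "?\<tau> j + (rk_c R j - rk_c R k) * h \<le> T" using \<tau>[OF kk(1)] by simp
      show "\<phi> j l \<in> moment_class m'" using mom[OF j] by blast
      show "lin_growth (\<lambda>y. phi (zeta R (d * h) k y))" by (rule zeta_lin_growth)
    qed
    have e1: "S (?\<tau> j + rk_c R j * h) = S t1" by simp
    have e2: "?\<tau> j + (rk_c R j - rk_c R k) * h = ?\<tau> k" for k by (simp add: algebra_simps)
    have 3: "cond_version (?\<tau> j) (\<lambda>\<omega>. H_coeff M F W (\<psi> j) (?\<tau> j) (rk_c R j * h) \<omega> $ l * gdint (S t1 \<omega>)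
      + h * (\<Sum>k\<in>I. (w k * d) * (H_coeff M F W (\<phi> j) (?\<tau> j) ((rk_c R j - rk_c R k) * h) \<omega> $ l
          * phi (zeta R (d * h) k (S (?\<tau> k) \<omega>)))))
     (\<lambda>\<omega>. heatd (d * (rk_c R j * h)) gdint (S (?\<tau> j) \<omega>)
       + h * (\<Sum>k\<in>I. (w k * d) * heatd (d * ((rk_c R j - rk_c R k) * h)) (\<lambda>y. phi (zeta R (d * h) k y)) (S (?\<tau> j) \<omega>)))"
      by (intro cond_version_add cond_version_cmult cond_version_sum 1[unfolded e1] 2[unfolded e2])
    have a: "d * (x * h) = x * (d * h)" for x by simp
    have b: "h * (\<Sum>k\<in>I. (w k * d) * g k) = (d * h) * (\<Sum>k\<in>I. w k * g k)" for g
      unfolding sum_distrib_left by (intro sum.cong refl) simp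
    have c: "(w k * d) * (H * p) = w k * H * (d * p)" for k H p by simp
    show ?thesis using 3 unfolding a b driver_stage_def st h_def[symmetric] Y1 c[symmetric] .
  qed
  show ?thesis
    unfolding rk_step_def Let_def h_def[symmetric]
  proof (intro conjI ballI allI)
    show "Yst q R t0 t1 1 = Y t1" by (simp add: Yst_def)
    show "Zst q R t0 t1 1 = Z t1"
      using q by (auto simp: Zst_def Z_def st zeta.simps c1[simplified] fun_eq_iff)
  next
    fix j assume j: "j \<in> {2..q+1}"
    then have jj: "j \<in> {1..q+1}" by auto
    have Sm: "S (?\<tau> j) \<in> borel_measurable (F (?\<tau> j))" by (rule S_F[OF \<tau>(1)[OF jj] order_refl])
    show "Yst q R t0 t1 j \<in> borel_measurable (F (?\<tau> j))"
    proof (cases "j \<le> q")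
      case True then show ?thesis using j by (simp add: Yst_def st)
    next
      case False
      then have jq: "j = q + 1" using j by simp
      have [measurable]: "S t0 \<in> borel_measurable (F t0)" using Sm unfolding jq \<tau>q .
      show ?thesis using q Yhat_measurable unfolding jq \<tau>q by (simp add: Yst_def)
    qed
    show "Zst q R t0 t1 j \<in> borel_measurable (F (?\<tau> j))"
    proof (cases "j \<le> q")
      case True
      then have "Zst q R t0 t1 j = (\<lambda>\<omega>. \<chi> l. zeta R (d * h) j (S (?\<tau> j) \<omega>))" by (auto simp: Zst_def st h_def)
      then show ?thesis using measurable_compose[OF Sm meas] by (simp add: vec_const_measurable)
    next
      case False
      then have jq: "j = q + 1" using j by simp
      have "Zst q R t0 t1 j = (\<lambda>\<omega>. \<chi> l. Zhat q R (d * h) (S t0 \<omega>))" by (auto simp: Zst_def h_def jq)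
      then show ?thesis using measurable_compose[OF Sm[unfolded jq \<tau>q] Zhat_measurable] unfolding jq \<tau>q by (simp add: vec_const_measurable)
    qed
  next
    fix j assume j: "j \<in> {2..q}"
    have "(\<lambda>\<omega>. Y t1 \<omega> + h * (\<Sum>k=1..j. rk_a R j k * f0 (Yst q R t0 t1 k \<omega>, Zst q R t0 t1 k \<omega>)))
       = (\<lambda>\<omega>. Y t1 \<omega> + h * (\<Sum>k=1..j. rk_a R j k * driver_stage R t0 t1 k \<omega>))"
      using j by (intro ext arg_cong2[where f="(+)"] refl arg_cong2[where f="(*)"] sum.cong) (auto simp: fv)
    moreover have "Yst q R t0 t1 j = real_cond_exp M (F (?\<tau> j)) (\<lambda>\<omega>. Y t1 \<omega> + h * (\<Sum>k=1..j. rk_a R j k * driver_stage R t0 t1 k \<omega>))"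
      using j by (simp add: Yst_def st h_def)
    ultimately show "AE \<omega> in M. Yst q R t0 t1 j \<omega> = real_cond_exp M (F (?\<tau> j))
        (\<lambda>\<omega>. Y t1 \<omega> + h * (\<Sum>k=1..j. rk_a R j k * f0 (Yst q R t0 t1 k \<omega>, Zst q R t0 t1 k \<omega>))) \<omega>" by simp
    fix l
    have e: "(\<lambda>\<omega>. H_coeff M F W (\<psi> j) (?\<tau> j) (rk_c R j * h) \<omega> $ l * Y t1 \<omega>
       + h * (\<Sum>k=1..<j. rk_alpha R j k * H_coeff M F W (\<phi> j) (?\<tau> j) ((rk_c R j - rk_c R k) * h) \<omega> $ l * f0 (Yst q R t0 t1 k \<omega>, Zst q R t0 t1 k \<omega>)))
      = (\<lambda>\<omega>. H_coeff M F W (\<psi> j) (?\<tau> j) (rk_c R j * h) \<omega> $ l * Y t1 \<omega>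
       + h * (\<Sum>k=1..<j. rk_alpha R j k * H_coeff M F W (\<phi> j) (?\<tau> j) ((rk_c R j - rk_c R k) * h) \<omega> $ l * driver_stage R t0 t1 k \<omega>))"
      using j by (intro ext arg_cong2[where f="(+)"] refl arg_cong2[where f="(*)"] sum.cong) (auto simp: fv)
    have z: "Zst q R t0 t1 j \<omega> $ l = heatd (rk_c R j * (d * h)) gdint (S (?\<tau> j) \<omega>)
       + (d * h) * (\<Sum>k=1..<j. rk_alpha R j k * heatd ((rk_c R j - rk_c R k) * (d * h)) (\<lambda>y. phi (zeta R (d * h) k y)) (S (?\<tau> j) \<omega>))" for \<omega>
      using j by (simp add: Zst_def st h_def[symmetric] zeta.simps[of R _ j])
    show "AE \<omega> in M. Zst q R t0 t1 j \<omega> $ l = real_cond_exp M (F (?\<tau> j))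
        (\<lambda>\<omega>. H_coeff M F W (\<psi> j) (?\<tau> j) (rk_c R j * h) \<omega> $ l * Y t1 \<omega>
       + h * (\<Sum>k=1..<j. rk_alpha R j k * H_coeff M F W (\<phi> j) (?\<tau> j) ((rk_c R j - rk_c R k) * h) \<omega> $ l * f0 (Yst q R t0 t1 k \<omega>, Zst q R t0 t1 k \<omega>))) \<omega>"
      unfolding e z by (rule cond_version_AE[OF Z]) (use j in auto)
  next
    have b0: "rk_b R (q + 1) = 0" using R by (simp add: rk_explicit_def)
    have e: "(\<lambda>\<omega>. Y t1 \<omega> + h * (\<Sum>j=1..q+1. rk_b R j * f0 (Yst q R t0 t1 j \<omega>, Zst q R t0 t1 j \<omega>)))
      = (\<lambda>\<omega>. Y t1 \<omega> + h * (\<Sum>j=1..q. rk_b R j * driver_stage R t0 t1 j \<omega>))"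
      using b0 fv by simp
    have 1: "cond_version t0 (\<lambda>\<omega>. gdint (S (t0 + h) \<omega>)) (\<lambda>\<omega>. heat (d * h) gdint (S t0 \<omega>))"
      by (rule cond_version_heat) (use t in \<open>auto simp: h_def gdint_lin_growth\<close>)
    have 2: "cond_version t0 (\<lambda>\<omega>. phi (zeta R (d * h) k (S (t0 + (1 - rk_c R k) * h) \<omega>)))
        (\<lambda>\<omega>. heat (d * ((1 - rk_c R k) * h)) (\<lambda>y. phi (zeta R (d * h) k y)) (S t0 \<omega>))" if k: "k \<in> {1..q}" for k
    proof (rule cond_version_heat)
      have kk: "k \<in> {1..q+1}" using k by auto
      show "0 \<le> (1 - rk_c R k) * h" using c0[OF kk] hp by simp
      have "t0 + (1 - rk_c R k) * h = ?\<tau> k" by (simp add: h_def algebra_simps)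
      then show "t0 + (1 - rk_c R k) * h \<le> T" using \<tau>[OF kk] by simp
    qed (use t zeta_lin_growth in auto)
    have e1: "t0 + h = t1" by (simp add: h_def)
    have e2: "t0 + (1 - rk_c R k) * h = ?\<tau> k" for k by (simp add: h_def algebra_simps)
    have 3: "cond_version t0 (\<lambda>\<omega>. gdint (S t1 \<omega>) + h * (\<Sum>k=1..q. (rk_b R k * d) * phi (zeta R (d * h) k (S (?\<tau> k) \<omega>))))
      (\<lambda>\<omega>. heat (d * h) gdint (S t0 \<omega>) + h * (\<Sum>k=1..q. (rk_b R k * d) * heat (d * ((1 - rk_c R k) * h)) (\<lambda>y. phi (zeta R (d * h) k y)) (S t0 \<omega>)))"
      by (intro cond_version_add cond_version_cmult cond_version_sum 1[unfolded e1] 2[unfolded e2])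
    have a: "d * (x * h) = x * (d * h)" for x by simp
    have b: "h * (\<Sum>k=1..q. (rk_b R k * d) * g k) = (d * h) * (\<Sum>k=1..q. rk_b R k * g k)" for g
      unfolding sum_distrib_left by (intro sum.cong refl) simp
    have c: "(rk_b R k * d) * p = rk_b R k * (d * p)" for k p by simp
    have y: "Yst q R t0 t1 (q + 1) = (\<lambda>\<omega>. heat (d * h) gdint (S t0 \<omega>)
       + (d * h) * (\<Sum>k=1..q. rk_b R k * heat ((1 - rk_c R k) * (d * h)) (\<lambda>y. phi (zeta R (d * h) k y)) (S t0 \<omega>)))"
      using q by (auto simp: Yst_def Yhat_def h_def)
    have "cond_version t0 (\<lambda>\<omega>. Y t1 \<omega> + h * (\<Sum>j=1..q. rk_b R j * driver_stage R t0 t1 j \<omega>)) (Yst q R t0 t1 (q + 1))"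
      using 3 unfolding a b y driver_stage_def st h_def[symmetric] Y1 c[symmetric] .
    then show "AE \<omega> in M. Yst q R t0 t1 (q + 1) \<omega> = real_cond_exp M (F t0)
        (\<lambda>\<omega>. Y t1 \<omega> + h * (\<Sum>j=1..q+1. rk_b R j * f0 (Yst q R t0 t1 j \<omega>, Zst q R t0 t1 j \<omega>))) \<omega>"
      unfolding e by (rule cond_version_AE)
  next
    fix l
    have e: "(\<lambda>\<omega>. H_coeff M F W (\<psi> (q + 1)) (?\<tau> (q + 1)) (rk_c R (q + 1) * h) \<omega> $ l * Y t1 \<omega>
       + h * (\<Sum>k=1..q. rk_beta R k * H_coeff M F W (\<phi> (q + 1)) (?\<tau> (q + 1)) ((rk_c R (q + 1) - rk_c R k) * h) \<omega> $ l * f0 (Yst q R t0 t1 k \<omega>, Zst q R t0 t1 k \<omega>)))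
      = (\<lambda>\<omega>. H_coeff M F W (\<psi> (q + 1)) (?\<tau> (q + 1)) (rk_c R (q + 1) * h) \<omega> $ l * Y t1 \<omega>
       + h * (\<Sum>k=1..q. rk_beta R k * H_coeff M F W (\<phi> (q + 1)) (?\<tau> (q + 1)) ((rk_c R (q + 1) - rk_c R k) * h) \<omega> $ l * driver_stage R t0 t1 k \<omega>))"
      by (intro ext arg_cong2[where f="(+)"] refl arg_cong2[where f="(*)"] sum.cong) (auto simp: fv)
    have z: "Zst q R t0 t1 (q + 1) \<omega> $ l = heatd (rk_c R (q + 1) * (d * h)) gdint (S (?\<tau> (q + 1)) \<omega>)
       + (d * h) * (\<Sum>k=1..q. rk_beta R k * heatd ((rk_c R (q + 1) - rk_c R k) * (d * h)) (\<lambda>y. phi (zeta R (d * h) k y)) (S (?\<tau> (q + 1)) \<omega>))" for \<omega>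
      unfolding \<tau>q unfolding cq by (simp add: Zst_def Zhat_def h_def[symmetric])
    show "AE \<omega> in M. Zst q R t0 t1 (q + 1) \<omega> $ l = real_cond_exp M (F t0)
        (\<lambda>\<omega>. H_coeff M F W (\<psi> (q + 1)) (?\<tau> (q + 1)) (rk_c R (q + 1) * h) \<omega> $ l * Y t1 \<omega>
       + h * (\<Sum>k=1..q. rk_beta R k * H_coeff M F W (\<phi> (q + 1)) (?\<tau> (q + 1)) ((rk_c R (q + 1) - rk_c R k) * h) \<omega> $ l * f0 (Yst q R t0 t1 k \<omega>, Zst q R t0 t1 k \<omega>))) \<omega>"
      unfolding e z unfolding \<tau>q by (rule cond_version_AE[OF Z[of "q + 1" "{1..q}", unfolded \<tau>q]]) (use q in auto)
  qed
qed

section \<open>From the order bound to vanishing error coefficients\<close>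

text \<open>The truncation error is a sum of nonnegative terms, so each step obeys the bound for the
  whole sum. In a uniform partition with 2n steps the step number n starts at T/2 for every n, which
  gives second-moment bounds at a fixed time while h tends to zero. Clearing the weights 1 / h and h
  leaves the powers 2p + 1 for Y and 2p - 1 for Z.\<close>

lemma rk_order_one_step:
  assumes R: "rk_class q R" "rk_explicit q R" and q: "q \<ge> 1"
    and mom: "\<And>j l. j \<in> {2..q+1} \<Longrightarrow> \<psi> j l \<in> moment_class m \<and> \<phi> j l \<in> moment_class m'"
    and ord: "rk_order M F W T X0 P p q R \<psi> \<phi>" and P: "P b0 \<sigma>0 f0 X u0"
  shows "\<exists>C N. \<forall>n\<ge>N. n \<ge> 1 \<and>
      expectation (\<lambda>\<omega>. (Yhat q R (d * (T / (2 * real n))) (S (T / 2) \<omega>) - gdint (S (T / 2) \<omega>))\<^sup>2) \<le> C * (d * (T / (2 * real n))) ^ (2 * p + 1)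
    \<and> (p \<ge> 1 \<longrightarrow> expectation (\<lambda>\<omega>. (Zhat q R (d * (T / (2 * real n))) (S (T / 2) \<omega>) - gd (S (T / 2) \<omega>))\<^sup>2) \<le> C * (d * (T / (2 * real n))) ^ (2 * (p - 1) + 1))"
proof -
  from ord[unfolded rk_order_def, rule_format, OF conjI[OF problem P]]
  obtain C \<delta> where \<delta>: "\<delta> > 0" and C: "\<forall>n t Ys Zs. partition T n t \<and> mesh n t \<le> \<delta> \<and>
      (\<forall>i<n. rk_step M F W q R \<psi> \<phi> f0 (t i) (t (Suc i)) (Y (t (Suc i))) (Z (t (Suc i))) (Ys i) (Zs i)) \<longrightarrow>
      trunc_error M n t Y Z (\<lambda>i. Ys i (q + 1)) (\<lambda>i. Zs i (q + 1)) \<le> ennreal (C * mesh n t ^ (2 * p))"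
    by (elim exE conjE) (rule that)
  obtain N :: nat where N: "T / (2 * \<delta>) < real N" using reals_Archimedean2 by blast
  have dp: "d > 0" by (rule d_pos)
  \<comment> \<open>The powers of 1 / d convert powers of h into powers of \<eta> = d h; the two
    summands provide one constant for both estimates.\<close>
  let ?K = "\<bar>C\<bar> * (1 / d) ^ (2 * p + 1) + \<bar>C\<bar> * (1 / d) ^ (2 * (p - 1) + 1)"
  show ?thesis
  proof (intro exI[of _ ?K] exI[of _ "max N 1"] allI impI)
    fix n assume n: "n \<ge> max N 1"
    define h where "h = T / (2 * real n)"
    define t where "t i = h * real i" for i :: nat
    have n0: "real n \<ge> 1" "real n \<ge> real N" using n by auto
    have hp: "h > 0" using T n0 by (simp add: h_def)
    have h2n: "h * real (2 * n) = T" using n0 by (simp add: h_def)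
    have hn: "h * real n = T / 2" using n0 by (simp add: h_def)
    have dt: "t (Suc i) - t i = h" for i by (simp add: t_def algebra_simps)
    have part: "partition T (2 * n) t"
      unfolding partition_def using n n0 hp h2n by (auto simp: t_def)
    have mesh: "mesh (2 * n) t = h"
    proof -
      have "(\<lambda>i. t (Suc i) - t i) ` {..<2 * n} = {h}" using n by (auto simp: dt intro!: image_eqI[of _ _ 0])
      then show ?thesis by (simp add: mesh_def)
    qed
    have "T < real N * (2 * \<delta>)" using N \<delta> by (simp add: pos_divide_less_eq)
    also have "\<dots> \<le> real n * (2 * \<delta>)" using n0 \<delta> by (intro mult_right_mono) auto
    finally have h\<delta>: "h \<le> \<delta>" using n0 by (simp add: h_def field_simps)
    let ?Ys = "\<lambda>i. Yst q R (t i) (t (Suc i))" and ?Zs = "\<lambda>i. Zst q R (t i) (t (Suc i))"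
    have tb: "0 \<le> t i" "t i < t (Suc i)" "t (Suc i) \<le> T" if "i < 2 * n" for i
    proof -
      show "0 \<le> t i" "t i < t (Suc i)" using hp by (auto simp: t_def)
      have "real (Suc i) \<le> real (2 * n)" using that by (subst of_nat_le_iff) simp
      then have "h * real (Suc i) \<le> h * real (2 * n)" using hp by (intro mult_left_mono) auto
      then show "t (Suc i) \<le> T" unfolding h2n t_def .
    qed
    have "trunc_error M (2 * n) t Y Z (\<lambda>i. ?Ys i (q + 1)) (\<lambda>i. ?Zs i (q + 1)) \<le> ennreal (C * mesh (2 * n) t ^ (2 * p))"
      using h\<delta> by (intro C[rule_format] conjI part allI impI rk_step_exact[where m=m and m'=m'] R q tb mom) (simp_all add: mesh)
    also have "\<dots> \<le> ennreal (\<bar>C\<bar> * h ^ (2 * p))"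
      unfolding mesh using hp by (intro ennreal_leI mult_right_mono) auto
    finally have te: "trunc_error M (2 * n) t Y Z (\<lambda>i. ?Ys i (q + 1)) (\<lambda>i. ?Zs i (q + 1)) \<le> ennreal (\<bar>C\<bar> * h ^ (2 * p))" .
    have tn: "t n = T / 2" using hn by (simp add: t_def)
    have dtn: "t (Suc n) - T / 2 = h" using dt[of n] tn by simp
    have T2: "T / 2 \<in> {0..T}" using T by simp
    define EY where "EY = expectation (\<lambda>\<omega>. (Yhat q R (d * h) (S (T / 2) \<omega>) - gdint (S (T / 2) \<omega>))\<^sup>2)"
    define EZ where "EZ = expectation (\<lambda>\<omega>. (Zhat q R (d * h) (S (T / 2) \<omega>) - gd (S (T / 2) \<omega>))\<^sup>2)"
    have lgz: "lin_growth (\<lambda>x. gd x)" by (rule bounded_lin_growth[OF _ gd_bound]) (use gdD_measurable[of 1] in \<open>simp add: gd_gdD\<close>)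
    have lY: "lin_growth (Yhat q R (d * h))" and lZ: "lin_growth (Zhat q R (d * h))"
      unfolding Yhat_def[abs_def] Zhat_def[abs_def]
      by (intro lin_growth_add lin_growth_cmult lin_growth_sum lin_growth_heat lin_growth_heatd zeta_lin_growth gdint_lin_growth)+
    have sY: "square_integrable M (\<lambda>\<omega>. gdint (S (T / 2) \<omega>) - Yhat q R (d * h) (S (T / 2) \<omega>))"
      and sZ: "square_integrable M (\<lambda>\<omega>. gd (S (T / 2) \<omega>) - Zhat q R (d * h) (S (T / 2) \<omega>))"
      by (intro square_integrable_diff growth_S_square_integrable[OF _ T2] lY lZ lgz gdint_lin_growth)+
    have LY: "L2sq M (\<lambda>\<omega>. Y (t n) \<omega> - ?Ys n (q + 1) \<omega>) = ennreal EY"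
    proof -
      have "(\<lambda>\<omega>. Y (t n) \<omega> - ?Ys n (q + 1) \<omega>) = (\<lambda>\<omega>. gdint (S (T / 2) \<omega>) - Yhat q R (d * h) (S (T / 2) \<omega>))"
        using q by (auto simp: Y_def Yst_def dtn tn)
      then show ?thesis using L2sq_eq[OF sY] by (simp add: EY_def power2_commute)
    qed
    \<comment> \<open>All coordinates of the Z-error coincide, so a single one gives a lower bound
      for the norm.\<close>
    have LZ: "ennreal EZ \<le> L2sq M (\<lambda>\<omega>. Z (t n) \<omega> - ?Zs n (q + 1) \<omega>)"
    proof -
      have "ennreal EZ = L2sq M (\<lambda>\<omega>. gd (S (T / 2) \<omega>) - Zhat q R (d * h) (S (T / 2) \<omega>))"
        using L2sq_eq[OF sZ] by (simp add: EZ_def power2_commute)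
      also have "\<dots> \<le> L2sq M (\<lambda>\<omega>. Z (t n) \<omega> - ?Zs n (q + 1) \<omega>)"
        unfolding L2sq_def
      proof (intro nn_integral_mono ennreal_leI power_mono)
        fix \<omega>
        have "gd (S (T / 2) \<omega>) - Zhat q R (d * h) (S (T / 2) \<omega>) = (Z (t n) \<omega> - ?Zs n (q + 1) \<omega>) $ undefined"
          by (simp add: Z_def Zst_def dtn tn)
        then show "norm (gd (S (T / 2) \<omega>) - Zhat q R (d * h) (S (T / 2) \<omega>)) \<le> norm (Z (t n) \<omega> - ?Zs n (q + 1) \<omega>)"
          using component_le_norm_cart[of "Z (t n) \<omega> - ?Zs n (q + 1) \<omega>" undefined] by simp
      qed simp
      finally show ?thesis .
    qed
    have E0: "EY \<ge> 0" "EZ \<ge> 0" by (auto simp: EY_def EZ_def)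
    have "ennreal (h * (1 / h\<^sup>2 * EY + EZ)) = ennreal h * (ennreal (1 / h\<^sup>2) * ennreal EY + ennreal EZ)"
      using hp E0 by (simp add: ennreal_mult[symmetric] ennreal_plus[symmetric] del: ennreal_plus)
    also have "\<dots> \<le> ennreal (t (Suc n) - t n) * (ennreal (1 / (t (Suc n) - t n)\<^sup>2) * L2sq M (\<lambda>\<omega>. Y (t n) \<omega> - ?Ys n (q + 1) \<omega>)
         + L2sq M (\<lambda>\<omega>. Z (t n) \<omega> - ?Zs n (q + 1) \<omega>))"
      unfolding dt LY using LZ by (intro mult_left_mono add_left_mono) auto
    also have "\<dots> \<le> trunc_error M (2 * n) t Y Z (\<lambda>i. ?Ys i (q + 1)) (\<lambda>i. ?Zs i (q + 1))"
      unfolding trunc_error_def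
      by (rule member_le_sum[of n "{..<2 * n}" "\<lambda>i. ennreal (t (Suc i) - t i) * (ennreal (1 / (t (Suc i) - t i)\<^sup>2) * L2sq M (\<lambda>\<omega>. Y (t i) \<omega> - ?Ys i (q + 1) \<omega>)
         + L2sq M (\<lambda>\<omega>. Z (t i) \<omega> - ?Zs i (q + 1) \<omega>))"]) (use n in auto)
    also note te
    finally have "h * (1 / h\<^sup>2 * EY + EZ) \<le> \<bar>C\<bar> * h ^ (2 * p)" using hp by (subst (asm) ennreal_le_iff) auto
    then have "h * (h * (1 / h\<^sup>2 * EY + EZ)) \<le> h * (\<bar>C\<bar> * h ^ (2 * p))" using hp by (intro mult_left_mono) auto
    moreover have "h * (h * (1 / h\<^sup>2 * EY + EZ)) = EY + h\<^sup>2 * EZ" using hp by (simp add: power2_eq_square distrib_left)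
    ultimately have main: "EY + h\<^sup>2 * EZ \<le> \<bar>C\<bar> * h ^ (2 * p + 1)" by (simp add: mult_ac)
    have hd: "h ^ k = (1 / d) ^ k * (d * h) ^ k" for k using dp by (simp add: power_mult_distrib[symmetric])
    have dh: "0 \<le> (d * h) ^ k" for k using dp hp by simp
    have K: "\<bar>C\<bar> * (1 / d) ^ k \<ge> 0" for k using dp by simp
    have EY: "EY \<le> ?K * (d * h) ^ (2 * p + 1)"
    proof -
      have "EY \<le> \<bar>C\<bar> * h ^ (2 * p + 1)" using main E0 zero_le_power2[of h] mult_nonneg_nonneg[of "h\<^sup>2" EZ] by linarith
      also have "\<dots> = (\<bar>C\<bar> * (1 / d) ^ (2 * p + 1)) * (d * h) ^ (2 * p + 1)" by (subst hd) simp
      also have "\<dots> \<le> ?K * (d * h) ^ (2 * p + 1)" using K[of "2 * p + 1"] K[of "2 * (p - 1) + 1"] by (intro mult_right_mono dh) linarith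
      finally show ?thesis .
    qed
    have EZ: "EZ \<le> ?K * (d * h) ^ (2 * (p - 1) + 1)" if p1: "p \<ge> 1"
    proof -
      obtain p' where p': "p = Suc p'" using p1 by (cases p) auto
      have "h\<^sup>2 * EZ \<le> h\<^sup>2 * (\<bar>C\<bar> * h ^ (2 * (p - 1) + 1))" using main E0 by (simp add: p' power2_eq_square mult_ac)
      then have "EZ \<le> \<bar>C\<bar> * h ^ (2 * (p - 1) + 1)" using hp by (simp only: mult_le_cancel_left_pos zero_less_power)
      also have "\<dots> = (\<bar>C\<bar> * (1 / d) ^ (2 * (p - 1) + 1)) * (d * h) ^ (2 * (p - 1) + 1)" by (subst hd) simp
      also have "\<dots> \<le> ?K * (d * h) ^ (2 * (p - 1) + 1)" using K[of "2 * p + 1"] K[of "2 * (p - 1) + 1"] by (intro mult_right_mono dh) linarith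
      finally show ?thesis .
    qed
    show "n \<ge> 1 \<and>
      expectation (\<lambda>\<omega>. (Yhat q R (d * (T / (2 * real n))) (S (T / 2) \<omega>) - gdint (S (T / 2) \<omega>))\<^sup>2) \<le> ?K * (d * (T / (2 * real n))) ^ (2 * p + 1)
    \<and> (p \<ge> 1 \<longrightarrow> expectation (\<lambda>\<omega>. (Zhat q R (d * (T / (2 * real n))) (S (T / 2) \<omega>) - gd (S (T / 2) \<omega>))\<^sup>2) \<le> ?K * (d * (T / (2 * real n))) ^ (2 * (p - 1) + 1))"
      using n EY EZ unfolding h_def[symmetric] EY_def EZ_def by auto
  qed
qed

text \<open>The squared leading term has size \<eta>^(2p), while both the error bound and the
  squared remainder have size \<eta>^(2p + 1). Division by \<eta>^(2p) and \<eta> -> 0 leave a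
  vanishing second moment, and full support at time T/2 makes the coefficient function vanish
  everywhere.\<close>

lemma leading_term_zero:
  assumes E: "ubig (real p + 1/2) (\<lambda>\<eta> x. E \<eta> x - \<eta> ^ p * hev Q x)" and m: "\<And>\<eta>. E \<eta> \<in> borel_measurable borel"
    and e: "\<And>n. n \<ge> N \<Longrightarrow> n \<ge> 1 \<and> expectation (\<lambda>\<omega>. (E (d * (T / (2 * real n))) (S (T / 2) \<omega>))\<^sup>2) \<le> C * (d * (T / (2 * real n))) ^ (2 * p + 1)"
  shows "hev Q x = 0"
proof -
  obtain K where K: "K \<ge> 0" "\<forall>\<eta> x. 0 < \<eta> \<longrightarrow> \<eta> \<le> 1 \<longrightarrow> \<bar>E \<eta> x - \<eta> ^ p * hev Q x\<bar> \<le> K * \<eta> powr (real p + 1/2)"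
    by (rule ubigE[OF E]) (rule that)
  obtain B where B: "\<And>x. \<bar>hev Q x\<bar> \<le> B" using hev_bounded by blast
  have T2: "T / 2 \<in> {0..T}" using T by simp
  note [measurable] = S_M[OF T2] m
  define \<eta> where "\<eta> n = d * (T / (2 * real n))" for n
  define q where "q = expectation (\<lambda>\<omega>. (hev Q (S (T / 2) \<omega>))\<^sup>2)"
  have lim: "\<eta> \<longlonglongrightarrow> 0"
  proof -
    have "(\<lambda>n. d * T / 2 * (1 / real n)) \<longlonglongrightarrow> d * T / 2 * 0" by (intro tendsto_intros lim_1_over_n)
    then show ?thesis unfolding \<eta>_def[abs_def] by simp
  qed
  have ev: "eventually (\<lambda>n. q \<le> (2 * C + 2 * K\<^sup>2) * \<eta> n) sequentially"
  proof -
    have "eventually (\<lambda>n. \<eta> n < 1) sequentially" by (rule order_tendstoD(2)[OF lim]) simp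
    then show ?thesis using eventually_ge_at_top[of N]
    proof eventually_elim
      fix n assume n: "\<eta> n < 1" "N \<le> n"
      let ?h = "\<eta> n"
      have n1: "n \<ge> 1" and en: "expectation (\<lambda>\<omega>. (E ?h (S (T / 2) \<omega>))\<^sup>2) \<le> C * ?h ^ (2 * p + 1)"
        using e[OF n(2)] unfolding \<eta>_def by auto
      have hp: "?h > 0" using n1 d_pos T by (simp add: \<eta>_def)
      have pw: "(?h powr (real p + 1/2))\<^sup>2 = ?h ^ (2 * p + 1)"
      proof -
        have "(?h powr (real p + 1/2))\<^sup>2 = ?h powr (real (2 * p + 1))"
          using hp by (simp add: power2_eq_square powr_add[symmetric] add.commute)
        then show ?thesis using hp by (simp only: powr_realpow)
      qed
      have ptw: "?h ^ (2 * p) * (hev Q y)\<^sup>2 \<le> 2 * (E ?h y)\<^sup>2 + 2 * (K\<^sup>2 * ?h ^ (2 * p + 1))" for y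
      proof -
        let ?r = "E ?h y - ?h ^ p * hev Q y"
        have "\<bar>?r\<bar> \<le> K * ?h powr (real p + 1/2)" using K(2) hp n(1) by simp
        then have "?r\<^sup>2 \<le> (K * ?h powr (real p + 1/2))\<^sup>2" by (metis abs_ge_zero power2_abs power_mono)
        then have r: "?r\<^sup>2 \<le> K\<^sup>2 * ?h ^ (2 * p + 1)" unfolding power_mult_distrib pw .
        have "(a - b)\<^sup>2 \<le> 2 * a\<^sup>2 + 2 * b\<^sup>2" for a b :: real
          using zero_le_power2[of "a + b"] by (simp add: power2_eq_square algebra_simps)
        from this[of "E ?h y" ?r] have "(?h ^ p * hev Q y)\<^sup>2 \<le> 2 * (E ?h y)\<^sup>2 + 2 * ?r\<^sup>2" by simp
        then show ?thesis using r by (simp add: power_mult_distrib power_mult[symmetric] mult.commute[of p])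
      qed
      have Eb: "\<bar>E ?h y\<bar> \<le> \<bar>B\<bar> + K" for y
      proof -
        have "\<bar>E ?h y - ?h ^ p * hev Q y\<bar> \<le> K * ?h powr (real p + 1/2)" using K(2) hp n(1) by simp
        also have "\<dots> \<le> K * 1" using hp n(1) K(1) by (intro mult_left_mono powr_le1) auto
        finally have 1: "\<bar>E ?h y - ?h ^ p * hev Q y\<bar> \<le> K" by simp
        have "\<bar>?h ^ p * hev Q y\<bar> \<le> 1 * \<bar>B\<bar>"
          unfolding abs_mult using hp n(1) B[of y] by (intro mult_mono) (auto simp: power_le_one)
        with 1 show ?thesis by linarith
      qed
      have iE: "integrable M (\<lambda>\<omega>. (E ?h (S (T / 2) \<omega>))\<^sup>2)"
        using square_integrable_bounded[of "\<lambda>\<omega>. E ?h (S (T / 2) \<omega>)" "\<bar>B\<bar> + K"] Eb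
        by (auto simp: square_integrable_def)
      have iQ: "integrable M (\<lambda>\<omega>. (hev Q (S (T / 2) \<omega>))\<^sup>2)"
        using square_integrable_bounded[of "\<lambda>\<omega>. hev Q (S (T / 2) \<omega>)" B] B
        by (auto simp: square_integrable_def)
      have "expectation (\<lambda>\<omega>. ?h ^ (2 * p) * (hev Q (S (T / 2) \<omega>))\<^sup>2)
          \<le> expectation (\<lambda>\<omega>. 2 * (E ?h (S (T / 2) \<omega>))\<^sup>2 + 2 * (K\<^sup>2 * ?h ^ (2 * p + 1)))"
        using iE iQ ptw by (intro integral_mono) auto
      also have "\<dots> = 2 * expectation (\<lambda>\<omega>. (E ?h (S (T / 2) \<omega>))\<^sup>2) + 2 * (K\<^sup>2 * ?h ^ (2 * p + 1))"
        using iE by (simp add: prob_space)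
      also have "\<dots> \<le> 2 * (C * ?h ^ (2 * p + 1)) + 2 * (K\<^sup>2 * ?h ^ (2 * p + 1))" using en by simp
      finally have "?h ^ (2 * p) * q \<le> ?h ^ (2 * p) * ((2 * C + 2 * K\<^sup>2) * ?h)"
        unfolding q_def by (simp add: algebra_simps)
      then show "q \<le> (2 * C + 2 * K\<^sup>2) * ?h" using hp by (simp only: mult_le_cancel_left_pos zero_less_power)
    qed
  qed
  have "(\<lambda>n. (2 * C + 2 * K\<^sup>2) * \<eta> n) \<longlonglongrightarrow> (2 * C + 2 * K\<^sup>2) * 0" by (intro tendsto_intros lim)
  then have "q \<le> (2 * C + 2 * K\<^sup>2) * 0" using ev by (rule tendsto_lowerbound) simp
  moreover have "q \<ge> 0" unfolding q_def by simp
  ultimately have q0: "q = 0" by simp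
  have "(hev Q x)\<^sup>2 = 0"
  proof (rule full_support[where h="\<lambda>x. (hev Q x)\<^sup>2" and t="T / 2" and C="B\<^sup>2"])
    show "continuous_on UNIV (\<lambda>x. (hev Q x)\<^sup>2)" by (intro continuous_intros hev_continuous)
    show "(hev Q x)\<^sup>2 \<le> B\<^sup>2" for x using power_mono[OF B[of x], of 2] by simp
  qed (use T q0 in \<open>auto simp: q_def\<close>)
  then show ?thesis by simp
qed

text \<open>By strong induction the terms below p vanish identically, and those above p are absorbed
  into a remainder of exponent p + 1/2; then p is the leading power.\<close>

lemma all_terms_zero:
  assumes E: "ubig (real N + 1/2) (\<lambda>\<eta> x. E \<eta> x - (\<Sum>p=1..N. \<eta> ^ p * hev (Q p) x))" and m: "\<And>\<eta>. E \<eta> \<in> borel_measurable borel"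
    and e: "\<And>n. n \<ge> L \<Longrightarrow> n \<ge> 1 \<and> expectation (\<lambda>\<omega>. (E (d * (T / (2 * real n))) (S (T / 2) \<omega>))\<^sup>2) \<le> C * (d * (T / (2 * real n))) ^ (2 * N + 1)"
    and p: "p \<in> {1..N}"
  shows "hev (Q p) x = 0"
  using p
proof (induction p arbitrary: x rule: less_induct)
  case (less p)
  have z: "hev (Q j) y = 0" if "j \<in> {1..<p}" for j y using less that by auto
  have qb: "ubig 0 (\<lambda>\<eta>. hev P)" for P
  proof -
    obtain B where "\<And>x. \<bar>hev P x\<bar> \<le> B" using hev_bounded by blast
    then show ?thesis by (rule ubig_bounded)
  qed
  have sp: "(\<Sum>j=1..N. \<eta> ^ j * hev (Q j) y) = \<eta> ^ p * hev (Q p) y + (\<Sum>j=Suc p..N. \<eta> ^ j * hev (Q j) y)" for \<eta> y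
  proof -
    have "{1..N} = {1..<p} \<union> insert p {Suc p..N}" using less.prems by auto
    then have "(\<Sum>j=1..N. \<eta> ^ j * hev (Q j) y) = (\<Sum>j\<in>{1..<p}. \<eta> ^ j * hev (Q j) y) + (\<Sum>j\<in>insert p {Suc p..N}. \<eta> ^ j * hev (Q j) y)"
      by (simp only:) (intro sum.union_disjoint; auto)
    then show ?thesis using z by simp
  qed
  have t: "ubig (real p + 1/2) (\<lambda>\<eta> x. \<Sum>j\<in>{Suc p..N}. \<eta> ^ j * hev (Q j) x)"
  proof (rule ubig_sum)
    fix j assume j: "j \<in> {Suc p..N}"
    show "ubig (real p + 1/2) (\<lambda>\<eta> x. \<eta> ^ j * hev (Q j) x)"
      by (rule ubig_mono[OF ubig_pmult[OF qb]]) (use j in auto)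
  qed
  have "ubig (real p + 1/2) (\<lambda>\<eta> x. (E \<eta> x - (\<Sum>p=1..N. \<eta> ^ p * hev (Q p) x)) + (\<Sum>j\<in>{Suc p..N}. \<eta> ^ j * hev (Q j) x))"
    by (intro ubig_add t ubig_mono[OF E]) (use less.prems in auto)
  then have 1: "ubig (real p + 1/2) (\<lambda>\<eta> x. E \<eta> x - \<eta> ^ p * hev (Q p) x)"
  proof (rule ubig_cong)
    fix \<eta> x
    show "E \<eta> x - \<eta> ^ p * hev (Q p) x = (E \<eta> x - (\<Sum>p=1..N. \<eta> ^ p * hev (Q p) x)) + (\<Sum>j\<in>{Suc p..N}. \<eta> ^ j * hev (Q j) x)"
      using sp[of \<eta> x] by linarith
  qed
  \<comment> \<open>From N1 on, \<eta> is at most 1, so that the bound with exponent 2N + 1 implies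
    the one with exponent 2p + 1.\<close>
  obtain N1 :: nat where N1: "d * T < real N1" using reals_Archimedean2 by blast
  show ?case
  proof (rule leading_term_zero[OF 1 m])
    fix n assume n: "n \<ge> max L N1"
    let ?h = "d * (T / (2 * real n))"
    have a: "n \<ge> 1" "expectation (\<lambda>\<omega>. (E ?h (S (T / 2) \<omega>))\<^sup>2) \<le> C * ?h ^ (2 * N + 1)" using e[of n] n by auto
    have hp: "?h \<ge> 0" using d_pos T a(1) by simp
    have "real N1 \<le> real n" using n by simp
    then have "d * T \<le> 2 * real n" using N1 by linarith
    then have h1: "?h \<le> 1" using a(1) by (simp add: field_simps)
    have "C * ?h ^ (2 * N + 1) \<le> \<bar>C\<bar> * ?h ^ (2 * N + 1)" by (intro mult_right_mono zero_le_power hp abs_ge_self)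
    also have "\<dots> \<le> \<bar>C\<bar> * ?h ^ (2 * p + 1)" using hp h1 less.prems by (intro mult_left_mono power_decreasing) auto
    finally show "n \<ge> 1 \<and> expectation (\<lambda>\<omega>. (E ?h (S (T / 2) \<omega>))\<^sup>2) \<le> \<bar>C\<bar> * ?h ^ (2 * p + 1)" using a by auto
  qed
qed

text \<open>Order 4 bounds the second moments by \<eta>^9 for Y and \<eta>^7 for Z, so the
  coefficient functions up to \<eta>^4 and \<eta>^3 vanish. Separating them by independent
  polynomials gives eight conditions for Y and four for Z.\<close>

lemma no_order_4:
  assumes R: "rk_class 4 R" "rk_explicit 4 R"
    and mom: "\<And>j l. j \<in> {2..5} \<Longrightarrow> \<psi> j l \<in> moment_class m \<and> \<phi> j l \<in> moment_class m'"
    and ord: "rk_order M F W T X0 P 4 4 R \<psi> \<phi>" and P: "P b0 \<sigma>0 f0 X u0"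
  shows False
proof -
  have mom': "\<psi> j l \<in> moment_class m \<and> \<phi> j l \<in> moment_class m'" if "j \<in> {2..4+1}" for j l using mom[of j l] that by simp
  obtain C N where CN: "\<forall>n\<ge>N. n \<ge> 1 \<and>
      expectation (\<lambda>\<omega>. (Yhat 4 R (d * (T / (2 * real n))) (S (T / 2) \<omega>) - gdint (S (T / 2) \<omega>))\<^sup>2) \<le> C * (d * (T / (2 * real n))) ^ (2 * 4 + 1)
    \<and> ((4::nat) \<ge> 1 \<longrightarrow> expectation (\<lambda>\<omega>. (Zhat 4 R (d * (T / (2 * real n))) (S (T / 2) \<omega>) - gd (S (T / 2) \<omega>))\<^sup>2) \<le> C * (d * (T / (2 * real n))) ^ (2 * (4 - 1) + 1))"
    using rk_order_one_step[OF R _ mom' ord P] by auto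
  define y1 y2 y3 y4 y5 y6 y7 y8 where "y1 = 1 - (\<Sum>j=1..4. rk_b R j)" and "y2 = 1/2 - (\<Sum>j=1..4. rk_b R j * (1 - rk_c R j))"
    and "y3 = 1/6 - 1/2 * (\<Sum>j=1..4. rk_b R j * (1 - rk_c R j)\<^sup>2)" and "y4 = (\<Sum>j=1..4. rk_b R j * e2 R j)"
    and "y5 = 1/24 - 1/6 * (\<Sum>j=1..4. rk_b R j * (1 - rk_c R j) ^ 3)" and "y6 = (\<Sum>j=1..4. rk_b R j * (1 - rk_c R j) * e2 R j)"
    and "y7 = (\<Sum>j=1..4. rk_b R j * e3 R j)" and "y8 = (\<Sum>j=1..4. rk_b R j * er R j)"
  define z1 z2 z3 z4 where "z1 = 1 - (\<Sum>j=1..4. bmask R j)" and "z2 = 1/2 - (\<Sum>j=1..4. bmask R j * (1 - rk_c R j))"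
    and "z3 = 1/6 - 1/2 * (\<Sum>j=1..4. bmask R j * (1 - rk_c R j)\<^sup>2)" and "z4 = (\<Sum>j=1..4. bmask R j * e2 R j)"
  \<comment> \<open>The denominators 2, 4, 8, 16 are the powers of 2 in \<open>UG\<close>; the 4 and
    8 at \<open>y4\<close> and \<open>y6\<close> come from the factor 1/4 in \<open>VG\<close> and
    from the half in front of VG 2.\<close>
  define QY :: "nat \<Rightarrow> hpoly" where "QY p = (if p = 1 then (smult (y1 / 2) [:0, 1:], 0) else if p = 2 then (smult (y2 / 4) [:0, 1, 0, -2:], 0)
      else if p = 3 then (smult (y3 / 8) [:0, 1, 0, -20, 0, 24:] + smult (y4 / 4) [:0, -1/2, 0, 7/2, 0, -3:], 0)
      else (smult (y5 / 16) [:0, 1, 0, -182, 0, 840, 0, -720:] + smult (y6 / 8) [:0, -1/2, 0, 65/2, 0, -117, 0, 90:]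
        + smult y7 [:0, -1/16, 0, 61/16, 0, -45/4, 0, 15/2:] + smult y8 [:0, 1/16, 0, -11/8, 0, 51/16, 0, -15/8:], 0))" for p
  define QZ :: "nat \<Rightarrow> hpoly" where "QZ p = (if p = 1 then (0, smult (z1 / 2) [:0, -1:]) else if p = 2 then (0, smult (z2 / 4) [:0, -1, 0, 6:])
      else (0, smult (z3 / 8) [:0, -1, 0, 60, 0, -120:] + smult (z4 / 4) [:0, 1/2, 0, -21/2, 0, 15:]))" for p
  have i4: "{1..4} = {1, 2, 3, 4 :: nat}" and i3: "{1..3} = {1, 2, 3 :: nat}" by auto
  have UGv: "UG 1 x = hev ([:0, 1:], 0) x / 2" "UG 2 x = hev ([:0, 1, 0, -2:], 0) x / 4"
    "UG 3 x = hev ([:0, 1, 0, -20, 0, 24:], 0) x / 8" "UG 4 x = hev ([:0, 1, 0, -182, 0, 840, 0, -720:], 0) x / 16"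
    "DG 1 x = hev (0, [:0, -1:]) x / 2" "DG 2 x = hev (0, [:0, -1, 0, 6:]) x / 4" "DG 3 x = hev (0, [:0, -1, 0, 60, 0, -120:]) x / 8"
    "VG 0 x = hev ([:0, -1/2, 0, 7/2, 0, -3:], 0) x / 4" "VG 1 x = hev (0, [:0, 1/2, 0, -21/2, 0, 15:]) x / 4"
    "VG 2 x = hev ([:0, -1/2, 0, 65/2, 0, -117, 0, 90:], 0) x / 4" for x
    by (simp_all only: UG_def DG_def VG_def Vp_values) (simp_all add: gdD_values)
  have sY: "(\<Sum>p=1..4. \<eta> ^ p * hev (QY p) x) = \<eta> * (y1 * UG 1 x) + \<eta>\<^sup>2 * (y2 * UG 2 x) + \<eta> ^ 3 * (y3 * UG 3 x + y4 * VG 0 x)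
     + \<eta> ^ 4 * (y5 * UG 4 x + y6 * (VG 2 x / 2) + y7 * hev Wh x + y8 * hev Xh x)" for \<eta> x
  proof -
    have "hev (QY 1) x = y1 * UG 1 x" "hev (QY 2) x = y2 * UG 2 x" "hev (QY 3) x = y3 * UG 3 x + y4 * VG 0 x"
      "hev (QY 4) x = y5 * UG 4 x + y6 * (VG 2 x / 2) + y7 * hev Wh x + y8 * hev Xh x"
      unfolding QY_def UGv Wh_def Xh_def hev_def by (simp_all add: field_simps)
    then show ?thesis unfolding i4 by simp
  qed
  have sZ: "(\<Sum>p=1..3. \<eta> ^ p * hev (QZ p) x) = \<eta> * (z1 * DG 1 x) + \<eta>\<^sup>2 * (z2 * DG 2 x) + \<eta> ^ 3 * (z3 * DG 3 x + z4 * VG 1 x)" for \<eta> x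
  proof -
    have "hev (QZ 1) x = z1 * DG 1 x" "hev (QZ 2) x = z2 * DG 2 x" "hev (QZ 3) x = z3 * DG 3 x + z4 * VG 1 x"
      unfolding QZ_def UGv hev_def by (simp_all add: field_simps)
    then show ?thesis unfolding i3 by simp
  qed
  have gm: "gdint \<in> borel_measurable borel" "gd \<in> borel_measurable borel"
    using gdD_measurable[of 0] gdD_measurable[of 1] by (simp_all add: gdint_gdD gd_gdD)
  have Yz: "hev (QY p) x = 0" if "p \<in> {1..4}" for p x
  proof (rule all_terms_zero[where N=4 and L=N and C=C and E="\<lambda>\<eta> x. Yhat 4 R \<eta> x - gdint x", OF _ _ _ that])
    have "ubig (9/2) (\<lambda>\<eta> x. Yhat 4 R \<eta> x - gdint x - (\<Sum>p=1..4. \<eta> ^ p * hev (QY p) x))"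
      by (rule ubig_cong[OF Yhat_expand[OF R(1)]]) (simp only: sY y1_def y2_def y3_def y4_def y5_def y6_def y7_def y8_def diff_diff_eq add.assoc)
    then show "ubig (real 4 + 1/2) (\<lambda>\<eta> x. Yhat 4 R \<eta> x - gdint x - (\<Sum>p=1..4. \<eta> ^ p * hev (QY p) x))" by simp
    show "(\<lambda>x. Yhat 4 R \<eta> x - gdint x) \<in> borel_measurable borel" for \<eta> using Yhat_measurable gm by measurable
  qed (use CN in auto)
  have Zz: "hev (QZ p) x = 0" if "p \<in> {1..3}" for p x
  proof (rule all_terms_zero[where N=3 and L=N and C=C and E="\<lambda>\<eta> x. Zhat 4 R \<eta> x - gd x", OF _ _ _ that])
    have "ubig (7/2) (\<lambda>\<eta> x. Zhat 4 R \<eta> x - gd x - (\<Sum>p=1..3. \<eta> ^ p * hev (QZ p) x))"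
      by (rule ubig_cong[OF Zhat_expand[OF R(1)]]) (simp only: sZ z1_def z2_def z3_def z4_def diff_diff_eq add.assoc)
    then show "ubig (real 3 + 1/2) (\<lambda>\<eta> x. Zhat 4 R \<eta> x - gd x - (\<Sum>p=1..3. \<eta> ^ p * hev (QZ p) x))" by simp
    show "(\<lambda>x. Zhat 4 R \<eta> x - gd x) \<in> borel_measurable borel" for \<eta> using Zhat_measurable gm by measurable
    show "n \<ge> 1 \<and> expectation (\<lambda>\<omega>. (Zhat 4 R (d * (T / (2 * real n))) (S (T / 2) \<omega>) - gd (S (T / 2) \<omega>))\<^sup>2) \<le> C * (d * (T / (2 * real n))) ^ (2 * 3 + 1)"
      if "n \<ge> N" for n using CN that by simp
  qed
  \<comment> \<open>Even derivatives occupy the first component and odd ones the second, so the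
    Y-conditions are read off from \<open>fst\<close> and the Z-conditions from
    \<open>snd\<close>.\<close>
  have Y0: "fst (QY p) = 0" if "p \<in> {1..4}" for p
    using hev_zero(1)[of "fst (QY p)" "snd (QY p)"] Yz[OF that] by simp
  have Z0: "snd (QZ p) = 0" if "p \<in> {1..3}" for p
    using hev_zero(2)[of "fst (QZ p)" "snd (QZ p)"] Zz[OF that] by simp
  have "y1 = 0" "y2 = 0" using Y0[of 1] Y0[of 2] by (simp_all add: QY_def)
  moreover have "y3 = 0 \<and> y4 = 0"
  proof -
    have "smult (y3 / 8) [:0, 1, 0, -20, 0, 24:] + smult (y4 / 4) [:0, -1/2, 0, 7/2, 0, -3:] = 0" using Y0[of 3] by (simp add: QY_def)
    then show ?thesis by simp
  qed
  \<comment> \<open>At order \<eta>^4 four polynomials supported on s, s^3, s^5, s^7 compete; the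
    coefficient equations have only the trivial solution, so four separate conditions
    result.\<close>
  moreover have "y5 = 0 \<and> y6 = 0 \<and> y7 = 0 \<and> y8 = 0"
  proof -
    have "smult (y5 / 16) [:0, 1, 0, -182, 0, 840, 0, -720:] + smult (y6 / 8) [:0, -1/2, 0, 65/2, 0, -117, 0, 90:]
        + smult y7 [:0, -1/16, 0, 61/16, 0, -45/4, 0, 15/2:] + smult y8 [:0, 1/16, 0, -11/8, 0, 51/16, 0, -15/8:] = 0"
      using Y0[of 4] by (simp add: QY_def)
    then show ?thesis by simp
  qed
  moreover have "z1 = 0" "z2 = 0" using Z0[of 1] Z0[of 2] by (simp_all add: QZ_def)
  moreover have "z3 = 0 \<and> z4 = 0"
  proof -
    have "smult (z3 / 8) [:0, -1, 0, 60, 0, -120:] + smult (z4 / 4) [:0, 1/2, 0, -21/2, 0, 15:] = 0" using Z0[of 3] by (simp add: QZ_def)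
    then show ?thesis by simp
  qed
  ultimately show False
    by (intro rk_order_conditions_False[OF R(1)])
      (simp_all add: y1_def y2_def y3_def y4_def y5_def y6_def y7_def y8_def z1_def z2_def z3_def z4_def)
qed

end

theorem theorem1p7:
  fixes M :: "'w measure" and F :: "real \<Rightarrow> 'w measure" and T :: real
    and W :: "real \<Rightarrow> 'w \<Rightarrow> real^'d" and X0 :: "'w \<Rightarrow> real^'d"
  assumes "T > 0"
    and "prob_space M"
    and "filtration (space M) F"
    and "\<And>t. subalgebra M (F t)"
    and "brownian_motion M F T W"
    and "X0 \<in> borel_measurable (F 0)"
    and "integrable M (\<lambda>\<omega>. (norm (X0 \<omega>))\<^sup>2)"
  shows "\<not> (\<exists>S \<psi> \<phi>. rk_class 4 S \<and> rk_explicit 4 S \<and>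
              (\<forall>j\<in>{2..5}. \<forall>l. \<psi> j l \<in> moment_class 3 \<and> \<phi> j l \<in> moment_class 2) \<and>
              rk_order M F W T X0
                (\<lambda>b \<sigma> f X u. indep_of_y f \<and> fz_nonzero f \<and> Hr4 T b \<sigma> f u \<and> Ho4 M T b \<sigma> f X)
                4 4 S \<psi> \<phi>)"
proof -
  interpret brownian_setup M F T W X0
    by (rule brownian_setup.intro[OF assms(2) brownian_setup_axioms.intro]) (rule assms)+
  show ?thesis
  proof
    assume "\<exists>S \<psi> \<phi>. rk_class 4 S \<and> rk_explicit 4 S \<and>
              (\<forall>j\<in>{2..5}. \<forall>l. \<psi> j l \<in> moment_class 3 \<and> \<phi> j l \<in> moment_class 2) \<and>
              rk_order M F W T X0
                (\<lambda>b \<sigma> f X u. indep_of_y f \<and> fz_nonzero f \<and> Hr4 T b \<sigma> f u \<and> Ho4 M T b \<sigma> f X)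
                4 4 S \<psi> \<phi>"
    then obtain R \<psi> \<phi> where R: "rk_class 4 R" "rk_explicit 4 R"
      and mom: "\<forall>j\<in>{2..5}. \<forall>l. \<psi> j l \<in> moment_class 3 \<and> \<phi> j l \<in> moment_class 2"
      and ord: "rk_order M F W T X0
                (\<lambda>b \<sigma> f X u. indep_of_y f \<and> fz_nonzero f \<and> Hr4 T b \<sigma> f u \<and> Ho4 M T b \<sigma> f X) 4 4 R \<psi> \<phi>"
      by blast
    show False
    proof (rule no_order_4[OF R _ ord])
      show "\<psi> j l \<in> moment_class 3 \<and> \<phi> j l \<in> moment_class 2" if "j \<in> {2..5}" for j l using mom that by blast
      show "indep_of_y f0 \<and> fz_nonzero f0 \<and> Hr4 T b0 \<sigma>0 f0 u0 \<and> Ho4 M T b0 \<sigma>0 f0 X"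
        by (intro conjI f0_indep f0_fz_nonzero Hr4_u0 Ho4_u0 assms(1))
    qed
  qed
qed

end
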